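(* The $r$-pseudoforest Deletion problem admits a kernel with $O(k^2r^2)$ vertices and $O(k^2r^2)$ edges: there is a polynomial-time algorithm that, given an instance $(G,k)$ (with $r$ fixed as part of the problem), outputs an equivalent instance $(G',k')$ with $k' \le k$ such that $G'$ has $O(k^2r^2)$ vertices and $O(k^2r^2)$ edges.
   Context: Graphs may have parallel edges and loops. An $r$-pseudoforest is a graph in which each connected component can be made into a forest by deleting at most $r$ edges. $r$-pseudoforest Deletion: given a graph $G$ and integer $k$, decide whether there is $X \subseteq V(G)$ with $|X| \le k$ such that $G - X$ is an $r$-pseudoforest. Two instances are equivalent if both are yes-instances or both are no-instances. *)

theory Defs
  imports Main "HOL-Computational_Algebra.Polynomial"
begin

section \<open>Multigraphs\<close>

text \<open>Edges are objects in their own right, so distinct edges may have the same ends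
  (parallel edges), and an edge whose set of ends is a singleton is a loop.\<close>

record ('v, 'e) mgraph =
  verts :: "'v set"
  edges :: "'e set"
  ends :: "'e \<Rightarrow> 'v set"

definition finite_mgraph :: "('v, 'e) mgraph \<Rightarrow> bool" where
  "finite_mgraph G \<longleftrightarrow> finite (verts G) \<and> finite (edges G) \<and>
     (\<forall>e \<in> edges G. \<exists>u \<in> verts G. \<exists>v \<in> verts G. ends G e = {u, v})"

definition induced_subgraph :: "('v, 'e) mgraph \<Rightarrow> 'v set \<Rightarrow> ('v, 'e) mgraph" where
  "induced_subgraph G S =
     \<lparr>verts = verts G \<inter> S, edges = {e \<in> edges G. ends G e \<subseteq> S}, ends = ends G\<rparr>"

definition delete_verts :: "('v, 'e) mgraph \<Rightarrow> 'v set \<Rightarrow> ('v, 'e) mgraph" where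
  "delete_verts G X = induced_subgraph G (verts G - X)"

definition delete_edges :: "('v, 'e) mgraph \<Rightarrow> 'e set \<Rightarrow> ('v, 'e) mgraph" where
  "delete_edges G F = \<lparr>verts = verts G, edges = edges G - F, ends = ends G\<rparr>"

definition adjacency :: "('v, 'e) mgraph \<Rightarrow> ('v \<times> 'v) set" where
  "adjacency G = {(u, v). \<exists>e \<in> edges G. ends G e = {u, v}}"

definition connectedness :: "('v, 'e) mgraph \<Rightarrow> ('v \<times> 'v) set" where
  "connectedness G = {(u, v). u \<in> verts G \<and> v \<in> verts G \<and> (u, v) \<in> (adjacency G)\<^sup>*}"

definition components :: "('v, 'e) mgraph \<Rightarrow> ('v, 'e) mgraph set" where
  "components G = induced_subgraph G ` (verts G // connectedness G)"

text \<open>Cycles of length 1 are loops, and cycles of length 2 are pairs of parallel edges.\<close>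

definition is_cycle :: "('v, 'e) mgraph \<Rightarrow> 'v list \<Rightarrow> 'e list \<Rightarrow> bool" where
  "is_cycle G vs es \<longleftrightarrow> es \<noteq> [] \<and> length vs = length es \<and>
     distinct vs \<and> distinct es \<and> set vs \<subseteq> verts G \<and> set es \<subseteq> edges G \<and>
     (\<forall>i < length es. ends G (es ! i) = {vs ! i, vs ! ((i + 1) mod length es)})"

definition forest :: "('v, 'e) mgraph \<Rightarrow> bool" where
  "forest G \<longleftrightarrow> (\<nexists>vs es. is_cycle G vs es)"

definition pseudoforest :: "nat \<Rightarrow> ('v, 'e) mgraph \<Rightarrow> bool" where
  "pseudoforest r G \<longleftrightarrow>
     (\<forall>H \<in> components G. \<exists>F \<subseteq> edges H. finite F \<and> card F \<le> r \<and> forest (delete_edges H F))"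

definition pseudoforest_deletion :: "nat \<Rightarrow> ('v, 'e) mgraph \<Rightarrow> int \<Rightarrow> bool" where
  "pseudoforest_deletion r G k \<longleftrightarrow>
     (\<exists>X \<subseteq> verts G. finite X \<and> int (card X) \<le> k \<and> pseudoforest r (delete_verts G X))"

section \<open>Polynomial time\<close>

text \<open>The model of computation is the WHILE language of Jones (Computability and Complexity from
  a Programming Perspective): imperative programs over binary trees.  Evaluating an expression
  costs, for every node of the expression, one plus the size of the tree computed there.
  No step can therefore manipulate more data than it is charged for, and polynomial time in
  this model coincides with polynomial time on Turing machines.\<close>

datatype tree = Leaf | Node tree tree

datatype expr =
    Var nat
  | LeafE
  | NodeE expr expr
  | LeftE expr
  | RightE expr
  | EqE expr expr

datatype com =
    Skip
  | Assign nat expr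
  | Seq com com
  | If expr com com
  | While expr com

type_synonym store = "nat \<Rightarrow> tree"

fun left :: "tree \<Rightarrow> tree" where
  "left Leaf = Leaf"
| "left (Node a b) = a"

fun right :: "tree \<Rightarrow> tree" where
  "right Leaf = Leaf"
| "right (Node a b) = b"

text \<open>As truth values, \<open>Leaf\<close> is false and every other tree is true.\<close>

definition enc_bool :: "bool \<Rightarrow> tree" where
  "enc_bool b = (if b then Node Leaf Leaf else Leaf)"

fun val :: "expr \<Rightarrow> store \<Rightarrow> tree" where
  "val (Var x) s = s x"
| "val LeafE s = Leaf"
| "val (NodeE a b) s = Node (val a s) (val b s)"
| "val (LeftE a) s = left (val a s)"
| "val (RightE a) s = right (val a s)"
| "val (EqE a b) s = enc_bool (val a s = val b s)"

fun cost :: "expr \<Rightarrow> store \<Rightarrow> nat" where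
  "cost (Var x) s = 1 + size (s x)"
| "cost LeafE s = 1"
| "cost (NodeE a b) s = cost a s + cost b s + 1 + size (val (NodeE a b) s)"
| "cost (LeftE a) s = cost a s + 1 + size (val (LeftE a) s)"
| "cost (RightE a) s = cost a s + 1 + size (val (RightE a) s)"
| "cost (EqE a b) s = cost a s + cost b s + 1 + size (val (EqE a b) s)"

text \<open>\<open>exec c s t s'\<close>: started in store \<open>s\<close>, the command \<open>c\<close> terminates in
  store \<open>s'\<close> after time \<open>t\<close>.\<close>

inductive exec :: "com \<Rightarrow> store \<Rightarrow> nat \<Rightarrow> store \<Rightarrow> bool" where
  Skip: "exec Skip s 1 s"
| Assign: "exec (Assign x a) s (1 + cost a s) (s(x := val a s))"
| Seq: "exec c s t s' \<Longrightarrow> exec d s' t' s'' \<Longrightarrow> exec (Seq c d) s (1 + t + t') s''"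
| IfTrue: "val a s \<noteq> Leaf \<Longrightarrow> exec c s t s' \<Longrightarrow> exec (If a c d) s (1 + cost a s + t) s'"
| IfFalse: "val a s = Leaf \<Longrightarrow> exec d s t s' \<Longrightarrow> exec (If a c d) s (1 + cost a s + t) s'"
| WhileTrue: "val a s \<noteq> Leaf \<Longrightarrow> exec c s t s' \<Longrightarrow> exec (While a c) s' t' s'' \<Longrightarrow>
    exec (While a c) s (1 + cost a s + t + t') s''"
| WhileFalse: "val a s = Leaf \<Longrightarrow> exec (While a c) s (1 + cost a s) s"

inductive_cases exec_cases:
  "exec Skip s t s'" "exec (Assign x a) s t s'" "exec (Seq c d) s t s'"
  "exec (If a c d) s t s'" "exec (While a c) s t s'"

lemma exec_deterministic:
  "exec c s t s' \<Longrightarrow> exec c s u s'' \<Longrightarrow> t = u \<and> s' = s''"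
proof (induction arbitrary: u s'' rule: exec.induct)
  case (Skip s)
  then show ?case by (auto elim: exec_cases(1))
next
  case (Assign x a s)
  then show ?case by (auto elim: exec_cases(2))
next
  case (Seq c s t s' d t' s2)
  from Seq.prems show ?case by (rule exec_cases(3)) (auto dest!: Seq.IH)
next
  case (IfTrue a s c t s' d)
  from IfTrue.prems show ?case
    by (rule exec_cases(4)) (use IfTrue.hyps in \<open>auto dest!: IfTrue.IH\<close>)
next
  case (IfFalse a s d t s' c)
  from IfFalse.prems show ?case
    by (rule exec_cases(4)) (use IfFalse.hyps in \<open>auto dest!: IfFalse.IH\<close>)
next
  case (WhileTrue a s c t s' t' s2)
  from WhileTrue.prems show ?case
    by (rule exec_cases(5)) (use WhileTrue.hyps in \<open>auto dest!: WhileTrue.IH\<close>)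
next
  case (WhileFalse a s c)
  from WhileFalse.prems show ?case
    by (rule exec_cases(5)) (use WhileFalse.hyps in \<open>auto\<close>)
qed

text \<open>Input and output are passed in variable 0; all other variables are initially \<open>Leaf\<close>.\<close>

definition computes_in :: "com \<Rightarrow> tree \<Rightarrow> nat \<Rightarrow> tree \<Rightarrow> bool" where
  "computes_in c x t y \<longleftrightarrow> (\<exists>s. exec c ((\<lambda>_. Leaf)(0 := x)) t s \<and> s 0 = y)"

definition poly_time ::
  "('a \<Rightarrow> tree) \<Rightarrow> ('b \<Rightarrow> tree) \<Rightarrow> 'a set \<Rightarrow> ('a \<Rightarrow> 'b) \<Rightarrow> bool" where
  "poly_time enc_in enc_out A f \<longleftrightarrow>
     (\<exists>(c :: com) (p :: nat poly). \<forall>x \<in> A.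
        \<exists>t \<le> poly p (size (enc_in x)). computes_in c (enc_in x) t (enc_out (f x)))"

section \<open>Instances and their encodings\<close>

text \<open>A concrete instance consists of a list of vertices, a list containing a pair of ends for
  every edge, and the budget.  The edges of the graph are the positions in the second list.\<close>

type_synonym pd_instance = "nat list \<times> (nat \<times> nat) list \<times> int"

definition pd_instances :: "pd_instance set" where
  "pd_instances = {(vs, es, k). distinct vs \<and> set es \<subseteq> set vs \<times> set vs}"

fun graph_of :: "pd_instance \<Rightarrow> (nat, nat) mgraph" where
  "graph_of (vs, es, k) =
     \<lparr>verts = set vs, edges = {..<length es}, ends = (\<lambda>i. {fst (es ! i), snd (es ! i)})\<rparr>"

fun budget :: "pd_instance \<Rightarrow> int" where
  "budget (vs, es, k) = k"

lemma finite_mgraph_graph_of: "I \<in> pd_instances \<Longrightarrow> finite_mgraph (graph_of I)"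
proof -
  assume I: "I \<in> pd_instances"
  obtain vs es k where "I = (vs, es, k)" by (cases I)
  moreover have "fst (es ! i) \<in> set vs \<and> snd (es ! i) \<in> set vs" if "i < length es" for i
    using I calculation nth_mem[OF that] by (auto simp: pd_instances_def mem_Times_iff)
  ultimately show ?thesis by (auto simp: finite_mgraph_def)
qed

text \<open>Numbers are encoded in binary, least significant bit first.\<close>

fun enc_nat :: "nat \<Rightarrow> tree" where
  "enc_nat n = (if n = 0 then Leaf else Node (enc_bool (odd n)) (enc_nat (n div 2)))"

declare enc_nat.simps [simp del]

definition enc_int :: "int \<Rightarrow> tree" where
  "enc_int k = Node (enc_bool (k < 0)) (enc_nat (nat \<bar>k\<bar>))"

definition enc_list :: "('a \<Rightarrow> tree) \<Rightarrow> 'a list \<Rightarrow> tree" where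
  "enc_list enc xs = foldr (\<lambda>x. Node (enc x)) xs Leaf"

definition enc_pair :: "('a \<Rightarrow> tree) \<Rightarrow> ('b \<Rightarrow> tree) \<Rightarrow> 'a \<times> 'b \<Rightarrow> tree" where
  "enc_pair enc enc' p = Node (enc (fst p)) (enc' (snd p))"

definition enc_instance :: "pd_instance \<Rightarrow> tree" where
  "enc_instance =
     enc_pair (enc_list enc_nat) (enc_pair (enc_list (enc_pair enc_nat enc_nat)) enc_int)"

end

(* A graph is an r-pseudoforest iff every nonempty connected vertex set S spans at most
   |S| + r - 1 edges.  In this form the usual rules are easily justified: delete components that
   satisfy the bound and vertices of degree at most 1, contract vertices of degree 2, reduce
   multiplicities to r + 2, and delete a vertex (with k decremented) that lies in every solution,
   for instance because of r + 1 loops.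

   The degree of a vertex v is bounded by greedily collecting ears, that is, internally fresh
   paths from v back to v or to earlier ears.  With 2k + r + 1 ears v lies in every solution.
   Otherwise the 2m ends of the m ears form a set of O(k) hubs, and every component of the graph
   without v and the hubs is joined to v by at most one edge.  Too many such components with a
   cycle again force v.  Those that are trees ("lobes") are assigned to adjacent hubs by
   push-relabel with capacity r + 3.  If they cannot all be placed, a Hall violator consists of
   hubs of which each may be joined to v by r + 2 parallel edges, in exchange for the edges
   between v and the lobes; this removes more edges than it adds.

   So if k > r, every degree in an irreducible instance is O(kr), and a solution X meets O(k^2 r)
   edges.  Every component of G - X is joined to X and has excess at most r, and the other
   vertices have degree at least 3; hence the size is O(k^2 r^2).  For k <= r the reduced instance
   is solved by brute force with search depth r, which is a constant. *)
theory Submission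
  imports Defs
begin

section \<open>Typed polynomial-time functions\<close>

text \<open>The working quantity is the excess, edges minus vertices, of a connected set. A
  connected set has at least the excess of each of its nonempty subsets, so components and arbitrary
  connected subsets can be exchanged freely, and every rule is justified by following the excess.
  Exact min-max theorems on disjoint cycles through a vertex and on matchings are replaced by greedy
  or locally stable structures, which costs constant factors only. For ears it costs the 2 in
  \<open>2k + r + 1\<close>: a vertex other than \<open>v\<close> has degree at most 3 in the union
  of the ears, so deleting it removes up to three edges and one vertex and lowers the excess by at
  most 2. Since the running time refers to a concrete machine, every loop is a fold over a
  precomputed list, with a size bound for all intermediate values. The rules merely propose
  candidates; one is accepted only after a test that it is well-formed, has no new vertices and is
  smaller. So termination and sizes need no analysis of the rules; that a rule shrinks the instance
  matters only for irreducible ones. The constant 230 is independent of \<open>r\<close>. Only the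
  exponent of the running time depends on it, through the brute-force search.\<close>

class enc =
  fixes encode :: "'a \<Rightarrow> tree"
  assumes inj_encode: "encode x = encode y \<Longrightarrow> x = y"

instantiation bool :: enc begin
definition "encode_bool = enc_bool"
instance by standard (simp add: encode_bool_def enc_bool_def split: if_splits)
end

lemma enc_nat_inj: "enc_nat m = enc_nat n \<Longrightarrow> m = n"
proof (induction m arbitrary: n rule: less_induct)
  case (less m)
  note eqs = enc_nat.simps[of m] enc_nat.simps[of n]
  show ?case
  proof (cases "m = 0 \<or> n = 0")
    case True
    then show ?thesis using less.prems eqs by (auto split: if_splits)
  next
    case False
    then have "enc_bool (odd m) = enc_bool (odd n)" and "enc_nat (m div 2) = enc_nat (n div 2)"
      using less.prems eqs by auto
    then have "odd m = odd n" "m div 2 = n div 2"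
      using less.IH[of "m div 2" "n div 2"] False by (auto simp: enc_bool_def split: if_splits)
    then show ?thesis by (metis bit_eq_rec)
  qed
qed

instantiation nat :: enc begin
definition "encode_nat = enc_nat"
instance by standard (simp add: encode_nat_def enc_nat_inj)
end

instantiation unit :: enc begin
definition "encode_unit (u :: unit) = Leaf"
instance by standard simp
end

instantiation prod :: (enc, enc) enc begin
definition "encode_prod = enc_pair encode encode"
instance by standard (auto simp: encode_prod_def enc_pair_def prod_eq_iff dest: inj_encode)
end

instantiation list :: (enc) enc begin
definition "encode_list = enc_list encode"
instance
proof
  fix xs ys :: "'a list"
  show "encode xs = encode ys \<Longrightarrow> xs = ys"
  proof (induction xs arbitrary: ys)
    case Nil
    then show ?case by (cases ys) (auto simp: encode_list_def enc_list_def)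
  next
    case (Cons x xs)
    then show ?case by (cases ys) (auto simp: encode_list_def enc_list_def dest: inj_encode)
  qed
qed
end

instantiation int :: enc begin
definition "encode_int = enc_int"
instance
  by standard (auto simp: encode_int_def enc_int_def enc_bool_def split: if_splits dest!: enc_nat_inj)
end

lemma encode_simps [simp]:
  "encode True = Node Leaf Leaf" "encode False = Leaf"
  "encode (x, y) = Node (encode x) (encode y)"
  "encode [] = Leaf" "encode (z # zs) = Node (encode z) (encode zs)"
  by (simp_all add: encode_bool_def enc_bool_def encode_prod_def enc_pair_def encode_list_def enc_list_def)

lemma encode_Leaf_iff: "encode xs = Leaf \<longleftrightarrow> xs = []" for xs :: "'a::enc list"
  by (cases xs) auto

lemma encode_pair: "encode p = Node (encode (fst p)) (encode (snd p))"
  by (cases p) simp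

lemma encode_eq_iff [simp]: "encode x = encode y \<longleftrightarrow> x = y"
  by (auto dest: inj_encode)

lemma encode_bool_Leaf [simp]: "encode b = Leaf \<longleftrightarrow> \<not> b" for b :: bool
  by (cases b) auto

section \<open>Sizes of encodings and polynomial bounds\<close>

abbreviation esize :: "'a::enc \<Rightarrow> nat" where
  "esize x \<equiv> size (encode x)"

text \<open>Explicit bounds are written as plain functions built from sums, products and
  compositions; an actual polynomial is extracted only when \<open>ptI\<close> is applied.\<close>

definition pbd :: "(nat \<Rightarrow> nat) \<Rightarrow> bool" where
  "pbd g \<longleftrightarrow> (\<exists>p :: nat poly. \<forall>n. g n \<le> poly p n)"

text \<open>All coefficients are natural numbers. This is what allows an input size to be replaced
  by an upper bound inside a running time.\<close>

lemma poly_nat_mono: "m \<le> n \<Longrightarrow> poly p m \<le> poly (p :: nat poly) n"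
  by (induction p) (auto intro!: add_mono mult_mono)

lemma pbd_const [intro!, simp]: "pbd (\<lambda>_. c)"
  unfolding pbd_def by (rule exI[of _ "[:c:]"]) simp

lemma pbd_id [intro!, simp]: "pbd (\<lambda>n. n)"
  unfolding pbd_def by (rule exI[of _ "[:0, 1:]"]) simp

lemma pbdE:
  assumes "pbd g"
  obtains p :: "nat poly" where "\<And>n. g n \<le> poly p n"
  using assms by (auto simp: pbd_def)

lemma pbdI: "(\<And>n. g n \<le> poly p n) \<Longrightarrow> pbd g" for p :: "nat poly"
  by (auto simp: pbd_def)

lemma pbd_add [intro!, simp]:
  assumes "pbd f" "pbd g"
  shows "pbd (\<lambda>n. f n + g n)"
proof -
  obtain p q :: "nat poly" where "\<And>n. f n \<le> poly p n" "\<And>n. g n \<le> poly q n"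
    using assms by (auto elim!: pbdE)
  then show ?thesis by (intro pbdI[where p = "p + q"]) (simp add: add_mono)
qed

lemma pbd_mult [intro!, simp]:
  assumes "pbd f" "pbd g"
  shows "pbd (\<lambda>n. f n * g n)"
proof -
  obtain p q :: "nat poly" where "\<And>n. f n \<le> poly p n" "\<And>n. g n \<le> poly q n"
    using assms by (auto elim!: pbdE)
  then show ?thesis by (intro pbdI[where p = "p * q"]) (simp add: mult_le_mono)
qed

lemma pbd_Suc [intro!, simp]: "pbd f \<Longrightarrow> pbd (\<lambda>n. Suc (f n))"
  using pbd_add[of f "\<lambda>_. 1"] by simp

lemma pbd_comp:
  assumes "pbd g" "pbd f"
  shows "pbd (\<lambda>n. g (f n))"
proof -
  obtain p q :: "nat poly" where p: "\<And>n. g n \<le> poly p n" and q: "\<And>n. f n \<le> poly q n"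
    using assms by (auto elim!: pbdE)
  have "g (f n) \<le> poly (pcompose p q) n" for n
    using p[of "f n"] poly_nat_mono[OF q, of p n] by (simp add: poly_pcompose)
  then show ?thesis by (rule pbdI)
qed

lemma pbd_poly [intro!, simp]: "pbd f \<Longrightarrow> pbd (\<lambda>n. poly p (f n))"
  by (rule pbd_comp[of "poly p"]) (auto intro: pbdI)

text \<open>The input and the output of a program are in variable \<open>n\<close>; it may use all variables
  above \<open>n\<close> but must preserve those below, so that programs can be composed.\<close>

definition pt :: "('a::enc \<Rightarrow> 'b::enc) \<Rightarrow> bool" where
  "pt f \<longleftrightarrow> (\<exists>p :: nat poly. (\<forall>x. esize (f x) \<le> poly p (esize x)) \<and>
     (\<forall>n. \<exists>c. \<forall>x s. s n = encode x \<longrightarrow>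
       (\<exists>t s'. exec c s t s' \<and> t \<le> poly p (esize x) \<and> s' n = encode (f x) \<and> (\<forall>i<n. s' i = s i))))"

named_theorems pt_intros

lemma ptI:
  fixes f :: "'a::enc \<Rightarrow> 'b::enc"
  assumes "pbd g" and "\<And>x. esize (f x) \<le> g (esize x)"
    and "\<And>n. \<exists>c. \<forall>x s. s n = encode x \<longrightarrow>
       (\<exists>t s'. exec c s t s' \<and> t \<le> g (esize x) \<and> s' n = encode (f x) \<and> (\<forall>i<n. s' i = s i))"
  shows "pt f"
proof -
  from assms(1) obtain p :: "nat poly" where p: "g n \<le> poly p n" for n
    by (auto simp: pbd_def)
  show ?thesis
    unfolding pt_def
  proof (intro exI[of _ p] conjI allI)
    show "esize (f x) \<le> poly p (esize x)" for x
      using assms(2) p le_trans by blast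
    show "\<exists>c. \<forall>x s. s n = encode x \<longrightarrow>
       (\<exists>t s'. exec c s t s' \<and> t \<le> poly p (esize x) \<and> s' n = encode (f x) \<and> (\<forall>i<n. s' i = s i))" for n
      using assms(3)[of n] p by (meson le_trans)
  qed
qed

text \<open>Skolemised form: \<open>C n\<close> is the copy of the program with register base
  \<open>n\<close>, so compound programs can run their parts at different offsets, while one
  polynomial serves all of them.\<close>

lemma ptE:
  fixes f :: "'a::enc \<Rightarrow> 'b::enc"
  assumes "pt f"
  obtains p :: "nat poly" and C where "\<And>x. esize (f x) \<le> poly p (esize x)"
    and "\<And>n x s. s n = encode x \<Longrightarrow>
       \<exists>t s'. exec (C n) s t s' \<and> t \<le> poly p (esize x) \<and> s' n = encode (f x) \<and> (\<forall>i<n. s' i = s i)"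
proof -
  obtain p :: "nat poly" where 1: "\<forall>x. esize (f x) \<le> poly p (esize x)"
    and 2: "\<forall>n. \<exists>c. \<forall>x s. s n = encode x \<longrightarrow>
       (\<exists>t s'. exec c s t s' \<and> t \<le> poly p (esize x) \<and> s' n = encode (f x) \<and> (\<forall>i<n. s' i = s i))"
    using assms unfolding pt_def by blast
  from choice[OF 2] obtain C where "\<forall>n x s. s n = encode x \<longrightarrow>
       (\<exists>t s'. exec (C n) s t s' \<and> t \<le> poly p (esize x) \<and> s' n = encode (f x) \<and> (\<forall>i<n. s' i = s i))" ..
  with 1 that show ?thesis by blast
qed

section \<open>Programs without loops\<close>

lemma size_val_le_cost: "size (val e s) \<le> cost e s"
  by (induction e s rule: val.induct) (auto simp: enc_bool_def)

text \<open>One assignment suffices when the result is given by an expression in the input register.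
  Its cost also bounds the size of the result, because evaluation is charged for the tree that it
  produces.\<close>

lemma pt_expr:
  fixes f :: "'a::enc \<Rightarrow> 'b::enc"
  assumes "pbd g"
    and e: "\<And>n x s. s n = encode x \<Longrightarrow> val (e n) s = encode (f x) \<and> cost (e n) s \<le> g (esize x)"
  shows "pt f"
proof (rule ptI[where g = "\<lambda>n. 1 + g n"])
  show "pbd (\<lambda>n. 1 + g n)" using assms(1) by (intro pbd_add pbd_const)
  show "esize (f x) \<le> 1 + g (esize x)" for x
    using e[of "\<lambda>_. encode x" 0 x] size_val_le_cost[of "e 0" "\<lambda>_. encode x"] by auto
next
  fix n
  show "\<exists>c. \<forall>x s. s n = encode x \<longrightarrow>
       (\<exists>t s'. exec c s t s' \<and> t \<le> 1 + g (esize x) \<and> s' n = encode (f x) \<and> (\<forall>i<n. s' i = s i))"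
  proof (rule exI[of _ "Assign n (e n)"], intro allI impI)
    fix x :: 'a and s assume "s n = encode x"
    with e[of s n x] exec.Assign[of n "e n" s]
    show "\<exists>t s'. exec (Assign n (e n)) s t s' \<and> t \<le> 1 + g (esize x) \<and> s' n = encode (f x) \<and> (\<forall>i<n. s' i = s i)"
      by (metis add_left_mono fun_upd_other fun_upd_same nat_neq_iff)
  qed
qed

text \<open>Different types share trees: a pair and a nonempty list, a number and its list of bits,
  an integer and a pair of sign and modulus. Passing between them is the identity program.\<close>

lemma pt_coerce: "(\<And>x. encode (f x) = encode x) \<Longrightarrow> pt f"
  by (rule pt_expr[where g = "\<lambda>n. 1 + n" and e = Var]) auto

lemma pt_id [pt_intros]: "pt (\<lambda>x. x)"
  by (rule pt_coerce) simp

lemma ex_expr_const: "\<exists>e. \<forall>s s'. val e s = x \<and> cost e s = cost e s'"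
proof (induction x)
  case Leaf
  show ?case by (rule exI[of _ LeafE]) simp
next
  case (Node a b)
  then obtain e f where "\<forall>s s'. val e s = a \<and> cost e s = cost e s'" "\<forall>s s'. val f s = b \<and> cost f s = cost f s'"
    by blast
  then show ?case by (intro exI[of _ "NodeE e f"]) (metis cost.simps(3) val.simps(3))
qed

lemma pt_const [pt_intros]: "pt (\<lambda>_. c)"
proof -
  obtain e where e: "\<forall>s s'. val e s = encode c \<and> cost e s = cost e s'"
    using ex_expr_const by blast
  show ?thesis
    by (rule pt_expr[where g = "\<lambda>_. cost e (\<lambda>_. Leaf)" and e = "\<lambda>_. e"], simp) (use e in \<open>metis order_refl\<close>)
qed

lemma pt_comp:
  fixes f :: "'a::enc \<Rightarrow> 'b::enc" and g :: "'b \<Rightarrow> 'c::enc"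
  assumes "pt g" and "pt f"
  shows "pt (\<lambda>x. g (f x))"
proof -
  obtain p C where p: "\<And>x. esize (f x) \<le> poly p (esize x)"
    "\<And>n x s. s n = encode x \<Longrightarrow>
       \<exists>t s'. exec (C n) s t s' \<and> t \<le> poly p (esize x) \<and> s' n = encode (f x) \<and> (\<forall>i<n. s' i = s i)"
    using assms(2) by (elim ptE) blast
  obtain q D where q: "\<And>x. esize (g x) \<le> poly q (esize x)"
    "\<And>n x s. s n = encode x \<Longrightarrow>
       \<exists>t s'. exec (D n) s t s' \<and> t \<le> poly q (esize x) \<and> s' n = encode (g x) \<and> (\<forall>i<n. s' i = s i)"
    using assms(1) by (elim ptE) blast
  have qp: "poly q (esize (f x)) \<le> poly q (poly p (esize x))" for x
    by (intro poly_nat_mono p)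
  show ?thesis
  proof (rule ptI[where g = "\<lambda>n. 1 + poly p n + poly q (poly p n)"])
    show "esize (g (f x)) \<le> 1 + poly p (esize x) + poly q (poly p (esize x))" for x
      using q(1)[of "f x"] qp[of x] by linarith
    fix n
    define c where "c = C n"
    have c: "\<And>x s. s n = encode x \<Longrightarrow>
       (\<exists>t s'. exec c s t s' \<and> t \<le> poly p (esize x) \<and> s' n = encode (f x) \<and> (\<forall>i<n. s' i = s i))"
      unfolding c_def by (rule p(2))
    define d where "d = D n"
    have d: "\<And>x s. s n = encode x \<Longrightarrow>
       (\<exists>t s'. exec d s t s' \<and> t \<le> poly q (esize x) \<and> s' n = encode (g x) \<and> (\<forall>i<n. s' i = s i))"
      unfolding d_def by (rule q(2))
    show "\<exists>c. \<forall>x s. s n = encode x \<longrightarrow> (\<exists>t s'. exec c s t s' \<and>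
        t \<le> 1 + poly p (esize x) + poly q (poly p (esize x)) \<and> s' n = encode (g (f x)) \<and> (\<forall>i<n. s' i = s i))"
    proof (rule exI[of _ "Seq c d"], intro allI impI)
      fix x :: 'a and s assume "s n = encode x"
      from c[of s x, OF this] obtain t s1 where 1: "exec c s t s1" "t \<le> poly p (esize x)" "s1 n = encode (f x)"
        "\<forall>i<n. s1 i = s i" by blast
      from d[of s1 "f x", OF 1(3)] obtain u s2 where 2: "exec d s1 u s2" "u \<le> poly q (esize (f x))" "s2 n = encode (g (f x))"
        "\<forall>i<n. s2 i = s1 i" by blast
      have "1 + t + u \<le> 1 + poly p (esize x) + poly q (poly p (esize x))"
        using 1(2) 2(2) qp[of x] by linarith
      moreover have "\<forall>i<n. s2 i = s i" using 1(4) 2(4) by simp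
      ultimately show "\<exists>t s'. exec (Seq c d) s t s' \<and>
        t \<le> 1 + poly p (esize x) + poly q (poly p (esize x)) \<and> s' n = encode (g (f x)) \<and> (\<forall>i<n. s' i = s i)"
        using exec.Seq[OF 1(1) 2(1)] 2(3) by blast
    qed
  qed auto
qed

text \<open>The registers above \<open>n\<close> act as a stack. The input is copied to
  \<open>n + 1\<close> and then to \<open>n + 2\<close>; the second program, based at
  \<open>n + 2\<close>, preserves both the input in \<open>n\<close> and the first result in
  \<open>n + 1\<close>.\<close>

lemma pt_pair [pt_intros]:
  fixes f :: "'a::enc \<Rightarrow> 'b::enc" and g :: "'a \<Rightarrow> 'c::enc"
  assumes "pt f" and "pt g"
  shows "pt (\<lambda>x. (f x, g x))"
proof -
  obtain p C where p: "\<And>x. esize (f x) \<le> poly p (esize x)"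
    "\<And>n x s. s n = encode x \<Longrightarrow>
       \<exists>t s'. exec (C n) s t s' \<and> t \<le> poly p (esize x) \<and> s' n = encode (f x) \<and> (\<forall>i<n. s' i = s i)"
    using assms(1) by (elim ptE) blast
  obtain q D where q: "\<And>x. esize (g x) \<le> poly q (esize x)"
    "\<And>n x s. s n = encode x \<Longrightarrow>
       \<exists>t s'. exec (D n) s t s' \<and> t \<le> poly q (esize x) \<and> s' n = encode (g x) \<and> (\<forall>i<n. s' i = s i)"
    using assms(2) by (elim ptE) blast
  define B where "B n = 20 + 4 * n + 4 * poly p n + 4 * poly q n" for n
  show ?thesis
  proof (rule ptI[where g = B])
    show "pbd B" unfolding B_def by auto
    show "esize (f x, g x) \<le> B (esize x)" for x
      using p(1)[of x] q(1)[of x] by (simp add: B_def)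
    fix n
    define c where "c = C (n + 1)"
    have c: "\<And>x s. s (n + 1) = encode x \<Longrightarrow>
       (\<exists>t s'. exec c s t s' \<and> t \<le> poly p (esize x) \<and> s' (n + 1) = encode (f x) \<and> (\<forall>i<n + 1. s' i = s i))"
      unfolding c_def by (rule p(2))
    define d where "d = D (n + 2)"
    have d: "\<And>x s. s (n + 2) = encode x \<Longrightarrow>
       (\<exists>t s'. exec d s t s' \<and> t \<le> poly q (esize x) \<and> s' (n + 2) = encode (g x) \<and> (\<forall>i<n + 2. s' i = s i))"
      unfolding d_def by (rule q(2))
    let ?c = "Seq (Assign (n + 1) (Var n)) (Seq c (Seq (Assign (n + 2) (Var n)) (Seq d
       (Assign n (NodeE (Var (n + 1)) (Var (n + 2)))))))"
    show "\<exists>c. \<forall>x s. s n = encode x \<longrightarrow> (\<exists>t s'. exec c s t s' \<and>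
        t \<le> B (esize x) \<and> s' n = encode (f x, g x) \<and> (\<forall>i<n. s' i = s i))"
    proof (rule exI[of _ ?c], intro allI impI)
      fix x :: 'a and s assume s: "s n = encode x"
      let ?s1 = "s(n + 1 := encode x)"
      have "?s1 (n + 1) = encode x" by simp
      from c[of ?s1 x, OF this] obtain t s2 where 1: "exec c ?s1 t s2" "t \<le> poly p (esize x)" "s2 (n + 1) = encode (f x)"
        "\<forall>i<n + 1. s2 i = ?s1 i" by blast
      let ?s3 = "s2(n + 2 := encode x)"
      have "?s3 (n + 2) = encode x" by simp
      from d[of ?s3 x, OF this] obtain u s4 where 2: "exec d ?s3 u s4" "u \<le> poly q (esize x)" "s4 (n + 2) = encode (g x)"
        "\<forall>i<n + 2. s4 i = ?s3 i" by blast
      have s2n: "s2 n = encode x" using 1(4) s by auto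
      have s4: "s4 (n + 1) = encode (f x)" using 2(4) 1(3) by auto
      have a1: "exec (Assign (n + 1) (Var n)) s (2 + esize x) ?s1"
        using exec.Assign[of "n + 1" "Var n" s] s by simp
      have a2: "exec (Assign (n + 2) (Var n)) s2 (2 + esize x) ?s3"
        using exec.Assign[of "n + 2" "Var n" s2] s2n by simp
      let ?s5 = "s4(n := encode (f x, g x))"
      have a3: "exec (Assign n (NodeE (Var (n + 1)) (Var (n + 2)))) s4 (5 + 2 * esize (f x) + 2 * esize (g x)) ?s5"
        using exec.Assign[of n "NodeE (Var (n + 1)) (Var (n + 2))" s4] s4 2(3) by (simp add: numeral_eq_Suc mult_2 ac_simps)
      show "\<exists>t s'. exec ?c s t s' \<and>
        t \<le> B (esize x) \<and> s' n = encode (f x, g x) \<and> (\<forall>i<n. s' i = s i)"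
      proof (intro exI conjI)
        show "exec ?c s (1 + (2 + esize x) + (1 + t + (1 + (2 + esize x) + (1 + u + (5 + 2 * esize (f x) + 2 * esize (g x)))))) ?s5"
          by (intro exec.Seq) (rule a1 1(1) a2 2(1) a3)+
        show "1 + (2 + esize x) + (1 + t + (1 + (2 + esize x) + (1 + u + (5 + 2 * esize (f x) + 2 * esize (g x))))) \<le> B (esize x)"
          using 1(2) 2(2) p(1)[of x] q(1)[of x] by (simp add: B_def)
        show "?s5 n = encode (f x, g x)" by simp
        show "\<forall>i<n. ?s5 i = s i" using 1(4) 2(4) by auto
      qed
    qed
  qed
qed

lemma pt_fst [pt_intros]: "pt f \<Longrightarrow> pt (\<lambda>x. fst (f x))"
proof (rule pt_comp[of fst])
  show "pt fst"
    by (rule pt_expr[where g = "\<lambda>n. 2 + 2 * n" and e = "\<lambda>n. LeftE (Var n)"])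
      (auto simp: encode_pair)
qed

lemma pt_snd [pt_intros]: "pt f \<Longrightarrow> pt (\<lambda>x. snd (f x))"
proof (rule pt_comp[of snd])
  show "pt snd"
    by (rule pt_expr[where g = "\<lambda>n. 2 + 2 * n" and e = "\<lambda>n. RightE (Var n)"])
      (auto simp: encode_pair)
qed

lemma pt_case_prod [pt_intros]:
  "pt (\<lambda>x. f x (fst (g x)) (snd (g x))) \<Longrightarrow> pt (\<lambda>x. case g x of (a, b) \<Rightarrow> f x a b)"
  by (simp add: case_prod_unfold)

lemma pt_Cons [pt_intros]: "pt f \<Longrightarrow> pt g \<Longrightarrow> pt (\<lambda>x. f x # g x)"
  using pt_comp[of "\<lambda>p. fst p # snd p" "\<lambda>x. (f x, g x)"] pt_coerce[of "\<lambda>p. fst p # snd p"]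
  by (auto simp: pt_pair encode_pair)

text \<open>Comparing trees compares values because encodings are injective; this is why
  \<open>enc\<close> demands injectivity.\<close>

lemma pt_eq [pt_intros]: "pt f \<Longrightarrow> pt g \<Longrightarrow> pt (\<lambda>x. f x = g x)"
proof -
  have "pt (\<lambda>p :: 'b \<times> 'b. fst p = snd p)"
    by (rule pt_expr[where g = "\<lambda>n. 7 + 4 * n" and e = "\<lambda>n. EqE (LeftE (Var n)) (RightE (Var n))"])
      (auto simp: encode_pair enc_bool_def)
  then show "pt f \<Longrightarrow> pt g \<Longrightarrow> pt (\<lambda>x. f x = g x)"
    using pt_comp[of "\<lambda>p. fst p = snd p" "\<lambda>x. (f x, g x)"] by (auto simp: pt_pair)
qed

text \<open>Both the test and the argument of the positive branch are single expressions. With a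
  flag paired to the input this gives the ordinary conditional; with a list paired to the input it
  gives case distinction on the list.\<close>

lemma pt_if_expr:
  fixes f :: "'d::enc \<Rightarrow> 'c::enc" and g :: "'a::enc \<Rightarrow> 'c"
  assumes f: "pt f" and g: "pt g" and h: "pbd h"
    and t: "\<And>n x s. s n = encode x \<Longrightarrow> (val (t n) s \<noteq> Leaf \<longleftrightarrow> b x) \<and> cost (t n) s \<le> h (esize x)"
    and e: "\<And>n x s. s n = encode x \<Longrightarrow> b x \<Longrightarrow> val (e n) s = encode (m x) \<and> cost (e n) s \<le> h (esize x)"
  shows "pt (\<lambda>x. if b x then f (m x) else g x)"
proof -
  obtain p C where p: "\<And>x. esize (f x) \<le> poly p (esize x)"
    "\<And>n x s. s n = encode x \<Longrightarrow>
       \<exists>t s'. exec (C n) s t s' \<and> t \<le> poly p (esize x) \<and> s' n = encode (f x) \<and> (\<forall>i<n. s' i = s i)"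
    using f by (elim ptE) blast
  obtain q D where q: "\<And>x. esize (g x) \<le> poly q (esize x)"
    "\<And>n x s. s n = encode x \<Longrightarrow>
       \<exists>t s'. exec (D n) s t s' \<and> t \<le> poly q (esize x) \<and> s' n = encode (g x) \<and> (\<forall>i<n. s' i = s i)"
    using g by (elim ptE) blast
  define B where "B n = 20 + 6 * n + 2 * h n + poly p (h n) + poly q n" for n
  have m: "poly p (esize (m x)) \<le> poly p (h (esize x))" if "b x" for x
    using e[of "\<lambda>_. encode x" 0 x] size_val_le_cost[of "e 0" "\<lambda>_. encode x"] that
    by (intro poly_nat_mono) auto
  show ?thesis
  proof (rule ptI[where g = B])
    show "pbd B" unfolding B_def using h by auto
    show "esize (if b x then f (m x) else g x) \<le> B (esize x)" for x
      using p(1)[of "m x"] q(1)[of x] m[of x] by (cases "b x") (simp_all add: B_def)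
    fix n
    define c where "c = C n"
    have c: "\<And>x s. s n = encode x \<Longrightarrow>
       (\<exists>t s'. exec c s t s' \<and> t \<le> poly p (esize x) \<and> s' n = encode (f x) \<and> (\<forall>i<n. s' i = s i))"
      unfolding c_def by (rule p(2))
    define d where "d = D n"
    have d: "\<And>x s. s n = encode x \<Longrightarrow>
       (\<exists>t s'. exec d s t s' \<and> t \<le> poly q (esize x) \<and> s' n = encode (g x) \<and> (\<forall>i<n. s' i = s i))"
      unfolding d_def by (rule q(2))
    let ?R = "Assign n (e n)"
    let ?c = "If (t n) (Seq ?R c) d"
    show "\<exists>c. \<forall>x s. s n = encode x \<longrightarrow> (\<exists>t s'. exec c s t s' \<and>
        t \<le> B (esize x) \<and> s' n = encode (if b x then f (m x) else g x) \<and> (\<forall>i<n. s' i = s i))"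
    proof (rule exI[of _ ?c], intro allI impI)
      fix x :: 'a and s assume s: "s n = encode x"
      show "\<exists>t s'. exec ?c s t s' \<and>
        t \<le> B (esize x) \<and> s' n = encode (if b x then f (m x) else g x) \<and> (\<forall>i<n. s' i = s i)"
      proof (cases "b x")
        case True
        let ?s1 = "s(n := encode (m x))"
        have R: "exec ?R s (1 + cost (e n) s) ?s1"
          using exec.Assign[of n "e n" s] e[of s n x, OF s True] by simp
        have x1: "?s1 n = encode (m x)" by simp
        from c[of ?s1 "m x", OF x1] obtain u s2 where 1: "exec c ?s1 u s2" "u \<le> poly p (esize (m x))" "s2 n = encode (f (m x))"
          "\<forall>i<n. s2 i = ?s1 i" by blast
        have "val (t n) s \<noteq> Leaf" using t[of s n x, OF s] True by simp
        from exec.IfTrue[OF this exec.Seq[OF R 1(1)]] have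
          "exec ?c s (1 + cost (t n) s + (1 + (1 + cost (e n) s) + u)) s2" .
        moreover have "1 + cost (t n) s + (1 + (1 + cost (e n) s) + u) \<le> B (esize x)"
          using t[of s n x, OF s] e[of s n x, OF s True] 1(2) m[OF True] by (simp add: B_def)
        moreover have "\<forall>i<n. s2 i = s i" using 1(4) by simp
        ultimately show ?thesis using 1(3) True by auto
      next
        case False
        from d[of s x, OF s] obtain u s2 where 1: "exec d s u s2" "u \<le> poly q (esize x)" "s2 n = encode (g x)"
          "\<forall>i<n. s2 i = s i" by blast
        have "val (t n) s = Leaf" using t[of s n x, OF s] False by simp
        from exec.IfFalse[OF this 1(1)] have "exec ?c s (1 + cost (t n) s + u) s2" .
        moreover have "1 + cost (t n) s + u \<le> B (esize x)"
          using t[of s n x, OF s] 1(2) by (simp add: B_def)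
        ultimately show ?thesis using 1(3,4) False by auto
      qed
    qed
  qed
qed

lemma pt_if [pt_intros]:
  fixes f :: "'a::enc \<Rightarrow> 'b::enc"
  assumes "pt b" and "pt f" and "pt g"
  shows "pt (\<lambda>x. if b x then f x else g x)"
proof -
  have h: "pt (\<lambda>x. (b x, x))" using assms(1) by (intro pt_intros)
  have "pt (\<lambda>z :: bool \<times> 'a. g (snd z))" by (intro pt_comp[OF assms(3)] pt_snd pt_id)
  then have "pt (\<lambda>z. if fst z then f (snd z) else g (snd z))"
    by (intro pt_if_expr[where h = "\<lambda>n. 2 + 2 * n" and t = "\<lambda>n. LeftE (Var n)" and e = "\<lambda>n. RightE (Var n)"] assms(2))
      (auto simp: encode_pair)
  from pt_comp[OF this h] show ?thesis by (simp cong: if_cong)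
qed

lemma pt_conj [pt_intros]: "pt f \<Longrightarrow> pt g \<Longrightarrow> pt (\<lambda>x. f x \<and> g x)"
  using pt_if[of f g "\<lambda>_. False"] by (simp add: pt_const if_bool_eq_disj)

lemma pt_not [pt_intros]: "pt f \<Longrightarrow> pt (\<lambda>x. \<not> f x)"
  using pt_if[of f "\<lambda>_. False" "\<lambda>_. True"] by (simp add: pt_const if_bool_eq_conj)

lemma pt_disj [pt_intros]: "pt f \<Longrightarrow> pt g \<Longrightarrow> pt (\<lambda>x. f x \<or> g x)"
  using pt_if[of f "\<lambda>_. True" g] by (simp add: pt_const if_bool_eq_disj cong: disj_cong)

lemma pt_imp [pt_intros]: "pt f \<Longrightarrow> pt g \<Longrightarrow> pt (\<lambda>x. f x \<longrightarrow> g x)"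
  using pt_if[of f g "\<lambda>_. True"] by (simp add: pt_const if_bool_eq_conj)

lemma pt_case_list [pt_intros]:
  fixes xs :: "'a::enc \<Rightarrow> 'b::enc list" and g :: "'a \<Rightarrow> 'b \<Rightarrow> 'b list \<Rightarrow> 'c::enc"
  assumes "pt xs" and "pt d" and "pt (\<lambda>z. g (fst z) (fst (snd z)) (snd (snd z)))"
  shows "pt (\<lambda>x. case xs x of [] \<Rightarrow> d x | y # ys \<Rightarrow> g x y ys)"
proof -
  have h: "pt (\<lambda>x. (xs x, x))" using assms(1) by (intro pt_intros)
  \<comment> \<open>Head and tail as a pair have the same tree as the nonempty list, so
    \<open>?m\<close> only swaps the two halves of the tree.\<close>
  let ?m = "\<lambda>z :: 'b list \<times> 'a. (snd z, (hd (fst z), tl (fst z)))"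
  have "pt (\<lambda>z :: 'b list \<times> 'a. d (snd z))" by (intro pt_comp[OF assms(2)] pt_snd pt_id)
  then have "pt (\<lambda>z. if fst z \<noteq> [] then (\<lambda>z. g (fst z) (fst (snd z)) (snd (snd z))) (?m z) else d (snd z))"
    by (intro pt_if_expr[where h = "\<lambda>n. 9 + 4 * n" and t = "\<lambda>n. LeftE (Var n)"
          and e = "\<lambda>n. NodeE (RightE (Var n)) (LeftE (Var n))" and m = ?m] assms(3))
      (auto simp: encode_pair encode_Leaf_iff neq_Nil_conv)
  have eq: "(\<lambda>x. case xs x of [] \<Rightarrow> d x | y # ys \<Rightarrow> g x y ys)
      = (\<lambda>x. if xs x \<noteq> [] then g x (hd (xs x)) (tl (xs x)) else d x)"
    by (auto simp: fun_eq_iff split: list.split)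
  from pt_comp[OF \<open>pt (\<lambda>z. if fst z \<noteq> [] then _ z else _ z)\<close> h] show ?thesis
    unfolding eq by (simp only: fst_conv snd_conv cong: if_cong)
qed

section \<open>Loops over lists\<close>

lemma length_le_esize: "length xs \<le> esize xs"
  by (induction xs) auto

text \<open>Register \<open>n\<close> holds the accumulator, \<open>n + 1\<close> the rest of the
  list, and \<open>n + 2\<close> the pair on which the body works. The bound \<open>B\<close> on all
  accumulators makes the time of one round uniform, so the total is that time multiplied by the
  number of rounds.\<close>

lemma exec_fold:
  fixes g :: "'y::enc \<times> 's::enc \<Rightarrow> 's"
  assumes c: "\<And>x s. s (n + 2) = encode x \<Longrightarrow>
       (\<exists>t s'. exec c s t s' \<and> t \<le> poly p (esize x) \<and> s' (n + 2) = encode (g x) \<and> (\<forall>i<n + 2. s' i = s i))"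
    and "s (n + 1) = encode xs" "s n = encode st" "esize xs \<le> L"
    and "\<And>i. esize (fold (\<lambda>y s. g (y, s)) (take i xs) st) \<le> B"
  defines "W \<equiv> While (Var (n + 1)) (Seq (Assign (n + 2) (NodeE (LeftE (Var (n + 1))) (Var n)))
     (Seq c (Seq (Assign n (Var (n + 2))) (Assign (n + 1) (RightE (Var (n + 1)))))))"
  shows "\<exists>t s'. exec W s t s' \<and> t \<le> (length xs + 1) * (30 + 10 * L + 10 * B + poly p (L + B + 1)) \<and>
     s' n = encode (fold (\<lambda>y s. g (y, s)) xs st) \<and> (\<forall>i<n. s' i = s i)"
  using assms(2-5)
proof (induction xs arbitrary: s st)
  case Nil
  have "exec W s (1 + cost (Var (n + 1)) s) s"
    unfolding W_def by (rule exec.WhileFalse) (use Nil in simp)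
  then show ?case using Nil by (intro exI[of _ "1 + cost (Var (n + 1)) s"] exI[of _ s]) auto
next
  case (Cons y ys)
  let ?s1 = "s(n + 2 := encode (y, st))"
  have st: "esize st \<le> B" using Cons.prems(4)[of 0] by simp
  have st': "esize (g (y, st)) \<le> B" using Cons.prems(4)[of 1] by simp
  have ys: "esize y + esize ys + 1 \<le> L" using Cons.prems(3) by simp
  have a1: "exec (Assign (n + 2) (NodeE (LeftE (Var (n + 1))) (Var n))) s
      (6 + (1 + esize y + esize ys) + esize y + esize st + (esize y + esize st)) ?s1" (is "exec _ _ ?t1 _")
    using exec.Assign[of "n + 2" "NodeE (LeftE (Var (n + 1))) (Var n)" s] Cons.prems
    by (simp add: numeral_eq_Suc ac_simps)
  have "?s1 (n + 2) = encode (y, st)" by simp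
  from c[of ?s1 "(y, st)", OF this] obtain t s2 where 2: "exec c ?s1 t s2" "t \<le> poly p (esize (y, st))"
    "s2 (n + 2) = encode (g (y, st))" "\<forall>i<n + 2. s2 i = ?s1 i" by blast
  have t: "t \<le> poly p (L + B + 1)"
    by (rule le_trans[OF 2(2)], rule poly_nat_mono) (use st ys in auto)
  let ?s3 = "s2(n := encode (g (y, st)))"
  have a3: "exec (Assign n (Var (n + 2))) s2 (2 + esize (g (y, st))) ?s3" (is "exec _ _ ?t3 _")
    using exec.Assign[of n "Var (n + 2)" s2] 2(3) by simp
  have s3: "?s3 (n + 1) = Node (encode y) (encode ys)" using 2(4) Cons.prems(1) by simp
  let ?s4 = "?s3(n + 1 := encode ys)"
  have a4: "exec (Assign (n + 1) (RightE (Var (n + 1)))) ?s3 (4 + esize y + 2 * esize ys) ?s4" (is "exec _ _ ?t4 _")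
    using exec.Assign[of "n + 1" "RightE (Var (n + 1))" ?s3] s3 by (simp add: numeral_eq_Suc mult_2 ac_simps)
  have "\<exists>t s'. exec W ?s4 t s' \<and> t \<le> (length ys + 1) * (30 + 10 * L + 10 * B + poly p (L + B + 1)) \<and>
     s' n = encode (fold (\<lambda>y s. g (y, s)) ys (g (y, st))) \<and> (\<forall>i<n. s' i = ?s4 i)"
  proof (rule Cons.IH)
    show "esize (fold (\<lambda>y s. g (y, s)) (take i ys) (g (y, st))) \<le> B" for i
      using Cons.prems(4)[of "Suc i"] by simp
  qed (use ys in auto)
  then obtain u s5 where 5: "exec W ?s4 u s5" "u \<le> (length ys + 1) * (30 + 10 * L + 10 * B + poly p (L + B + 1))"
    "s5 n = encode (fold (\<lambda>y s. g (y, s)) ys (g (y, st)))" "\<forall>i<n. s5 i = ?s4 i" by blast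
  have nz: "val (Var (n + 1)) s \<noteq> Leaf" using Cons.prems(1) by simp
  note ex = exec.WhileTrue[OF nz exec.Seq[OF a1 exec.Seq[OF 2(1) exec.Seq[OF a3 a4]]] 5(1)[unfolded W_def], folded W_def]
  show ?case
  proof (intro exI conjI)
    show "exec W s (1 + cost (Var (n + 1)) s + (1 + ?t1 + (1 + t + (1 + ?t3 + ?t4))) + u) s5"
      by (rule ex)
    have "cost (Var (n + 1)) s = 2 + esize y + esize ys" using Cons.prems(1) by simp
    then have "1 + cost (Var (n + 1)) s + (1 + ?t1 + (1 + t + (1 + ?t3 + ?t4))) \<le> 30 + 10 * L + 10 * B + poly p (L + B + 1)"
      using t st st' ys by simp
    with 5(2) show "1 + cost (Var (n + 1)) s + (1 + ?t1 + (1 + t + (1 + ?t3 + ?t4))) + u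
      \<le> (length (y # ys) + 1) * (30 + 10 * L + 10 * B + poly p (L + B + 1))" by simp
    show "s5 n = encode (fold (\<lambda>y s. g (y, s)) (y # ys) st)" using 5(3) by simp
    show "\<forall>i<n. s5 i = s i" using 5(4) 2(4) by auto
  qed
qed

text \<open>A polynomial-time body could square the accumulator in each round, so a bound on all
  intermediate values has to be supplied. Every loop of the kernel is an instance of this
  rule.\<close>

lemma pt_fold:
  fixes xs :: "'a::enc \<Rightarrow> 'y::enc list" and init :: "'a \<Rightarrow> 's::enc"
  assumes xs: "pt xs" and init: "pt init" and f: "pt (\<lambda>z. f (fst z) (fst (snd z)) (snd (snd z)))"
    and b: "pbd b" "\<And>x i. esize (fold (f x) (take i (xs x)) (init x)) \<le> b (esize x)"
  shows "pt (\<lambda>x. fold (f x) (xs x) (init x))"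
proof -
  \<comment> \<open>The body sees a single register, so the environment \<open>x\<close> is carried
    along inside the accumulator.\<close>
  define g where "g = (\<lambda>z :: 'y \<times> 'a \<times> 's. (fst (snd z), f (fst (snd z)) (fst z) (snd (snd z))))"
  have fold_g: "fold (\<lambda>y s. g (y, s)) ys (x, s) = (x, fold (f x) ys s)" for ys x s
    by (induction ys arbitrary: s) (auto simp: g_def)
  have "pt (\<lambda>z :: 'y \<times> 'a \<times> 's. (fst (snd z), fst z, snd (snd z)))" by (intro pt_intros)
  from pt_comp[OF f this] have "pt (\<lambda>z :: 'y \<times> 'a \<times> 's. f (fst (snd z)) (fst z) (snd (snd z)))" by simp
  then have "pt g" unfolding g_def by (intro pt_intros)
  then obtain p C where p: "\<And>n x s. s n = encode x \<Longrightarrow>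
       \<exists>t s'. exec (C n) s t s' \<and> t \<le> poly p (esize x) \<and> s' n = encode (g x) \<and> (\<forall>i<n. s' i = s i)"
    by (elim ptE) blast
  have "pt (\<lambda>x. (xs x, (x, init x)))" using xs init by (intro pt_intros)
  then obtain q D where q: "\<And>x. esize (xs x, (x, init x)) \<le> poly q (esize x)"
    "\<And>n x s. s n = encode x \<Longrightarrow>
       \<exists>t s'. exec (D n) s t s' \<and> t \<le> poly q (esize x) \<and> s' n = encode (xs x, (x, init x)) \<and> (\<forall>i<n. s' i = s i)"
    by (elim ptE) blast
  define T where "T m = (poly q m + 1) * (30 + 10 * poly q m + 10 * (1 + m + b m) + poly p (poly q m + (1 + m + b m) + 1))" for m
  define B where "B m = 50 + 5 * poly q m + T m + 3 * m + 3 * b m" for m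
  show ?thesis
  proof (rule ptI[where g = B])
    show "pbd B" unfolding B_def T_def using b(1) by auto
    show "esize (fold (f x) (xs x) (init x)) \<le> B (esize x)" for x
      using b(2)[of x "length (xs x)"] by (simp add: B_def)
    fix n
    define c where "c = C (n + 2)"
    have c: "\<And>x s. s (n + 2) = encode x \<Longrightarrow>
       (\<exists>t s'. exec c s t s' \<and> t \<le> poly p (esize x) \<and> s' (n + 2) = encode (g x) \<and> (\<forall>i<n + 2. s' i = s i))"
      unfolding c_def by (rule p)
    define d where "d = D n"
    have d: "\<And>x s. s n = encode x \<Longrightarrow>
       (\<exists>t s'. exec d s t s' \<and> t \<le> poly q (esize x) \<and> s' n = encode (xs x, (x, init x)) \<and> (\<forall>i<n. s' i = s i))"
      unfolding d_def by (rule q(2))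
    let ?W = "While (Var (n + 1)) (Seq (Assign (n + 2) (NodeE (LeftE (Var (n + 1))) (Var n)))
     (Seq c (Seq (Assign n (Var (n + 2))) (Assign (n + 1) (RightE (Var (n + 1)))))))"
    let ?A1 = "Assign (n + 1) (LeftE (Var n))" and ?A2 = "Assign n (RightE (Var n))"
    let ?c = "Seq d (Seq ?A1 (Seq ?A2 (Seq ?W ?A2)))"
    show "\<exists>c. \<forall>x s. s n = encode x \<longrightarrow> (\<exists>t s'. exec c s t s' \<and>
        t \<le> B (esize x) \<and> s' n = encode (fold (f x) (xs x) (init x)) \<and> (\<forall>i<n. s' i = s i))"
    proof (rule exI[of _ ?c], intro allI impI)
      fix x :: 'a and s assume "s n = encode x"
      from d[of s x, OF this] obtain t s1 where 1: "exec d s t s1" "t \<le> poly q (esize x)"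
        "s1 n = encode (xs x, (x, init x))" "\<forall>i<n. s1 i = s i" by blast
      let ?s2 = "s1(n + 1 := encode (xs x))"
      have a2: "exec ?A1 s1 (1 + (1 + esize (xs x, (x, init x)) + 1 + esize (xs x))) ?s2" (is "exec _ _ ?t2 _")
        using exec.Assign[of "n + 1" "LeftE (Var n)" s1] 1(3) by simp
      let ?s3 = "?s2(n := encode (x, init x))"
      have a3: "exec ?A2 ?s2 (1 + (1 + esize (xs x, (x, init x)) + 1 + esize (x, init x))) ?s3" (is "exec _ _ ?t3 _")
        using exec.Assign[of n "RightE (Var n)" ?s2] 1(3) by simp
      have "\<exists>t s'. exec ?W ?s3 t s' \<and>
         t \<le> (length (xs x) + 1) * (30 + 10 * poly q (esize x) + 10 * (1 + esize x + b (esize x)) + poly p (poly q (esize x) + (1 + esize x + b (esize x)) + 1)) \<and>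
         s' n = encode (fold (\<lambda>y s. g (y, s)) (xs x) (x, init x)) \<and> (\<forall>i<n. s' i = ?s3 i)"
      proof (rule exec_fold[OF c])
        show "esize (xs x) \<le> poly q (esize x)" using q(1)[of x] by simp
        show "esize (fold (\<lambda>y s. g (y, s)) (take i (xs x)) (x, init x)) \<le> 1 + esize x + b (esize x)" for i
          using b(2)[of x i] by (simp add: fold_g)
      qed auto
      then obtain u s4 where 4: "exec ?W ?s3 u s4"
         "u \<le> (length (xs x) + 1) * (30 + 10 * poly q (esize x) + 10 * (1 + esize x + b (esize x)) + poly p (poly q (esize x) + (1 + esize x + b (esize x)) + 1))"
         "s4 n = encode (fold (\<lambda>y s. g (y, s)) (xs x) (x, init x))" "\<forall>i<n. s4 i = ?s3 i" by blast
      have u: "u \<le> T (esize x)"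
        unfolding T_def by (rule le_trans[OF 4(2)], rule mult_le_mono1)
          (use length_le_esize[of "xs x"] q(1)[of x] in simp)
      let ?r = "fold (f x) (xs x) (init x)"
      let ?s5 = "s4(n := encode ?r)"
      have a5: "exec ?A2 s4 (1 + (1 + esize (x, ?r) + 1 + esize ?r)) ?s5" (is "exec _ _ ?t5 _")
        using exec.Assign[of n "RightE (Var n)" s4] 4(3) by (simp add: fold_g)
      show "\<exists>t s'. exec ?c s t s' \<and> t \<le> B (esize x) \<and> s' n = encode ?r \<and> (\<forall>i<n. s' i = s i)"
      proof (intro exI conjI)
        show "exec ?c s (1 + t + (1 + ?t2 + (1 + ?t3 + (1 + u + ?t5)))) ?s5"
          by (rule exec.Seq[OF 1(1) exec.Seq[OF a2 exec.Seq[OF a3 exec.Seq[OF 4(1) a5]]]])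
        show "1 + t + (1 + ?t2 + (1 + ?t3 + (1 + u + ?t5))) \<le> B (esize x)"
          using 1(2) u q(1)[of x] b(2)[of x "length (xs x)"] by (simp add: B_def)
        show "?s5 n = encode ?r" by simp
        show "\<forall>i<n. ?s5 i = s i" using 1(4) 4(4) by auto
      qed
    qed
  qed
qed

lemma pt_encode_cong: "pt f \<Longrightarrow> (\<And>x. encode (h x) = encode (f x)) \<Longrightarrow> pt h"
  by (simp add: pt_def)

lemma pt_bound:
  assumes "pt f"
  obtains p :: "nat poly" where "\<And>x. esize (f x) \<le> poly p (esize x)"
  using assms by (elim ptE) blast

text \<open>The size bound of \<open>pt_fold\<close> is usually a consequence of an invariant, which
  may depend on the number of rounds done so far.\<close>

lemma pt_fold_inv:
  fixes xs :: "'a::enc \<Rightarrow> 'y::enc list" and init :: "'a \<Rightarrow> 's::enc"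
  assumes xs: "pt xs" and init: "pt init" and f: "pt (\<lambda>z. f (fst z) (fst (snd z)) (snd (snd z)))"
    and I0: "\<And>x. I x 0 (init x)"
    and IS: "\<And>x i s. i < length (xs x) \<Longrightarrow> I x i s \<Longrightarrow> I x (Suc i) (f x (xs x ! i) s)"
    and b: "pbd b" "\<And>x i s. i \<le> length (xs x) \<Longrightarrow> I x i s \<Longrightarrow> esize s \<le> b (esize x)"
  shows "pt (\<lambda>x. fold (f x) (xs x) (init x))"
proof (rule pt_fold[OF xs init f b(1)])
  fix x i
  have *: "i \<le> length (xs x) \<Longrightarrow> I x i (fold (f x) (take i (xs x)) (init x))" for i
  proof (induction i)
    case 0
    then show ?case using I0 by simp
  next
    case (Suc i)
    then show ?case using IS[of i x] by (simp add: take_Suc_conv_app_nth)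
  qed
  show "esize (fold (f x) (take i (xs x)) (init x)) \<le> b (esize x)"
  proof (cases "i \<le> length (xs x)")
    case True
    then show ?thesis using b(2) * by blast
  next
    case False
    then show ?thesis using b(2)[OF order_refl *[OF order_refl]] by simp
  qed
qed

section \<open>Sizes of lists and the standard list functions\<close>

lemma esize_append [simp]: "esize (xs @ ys) = esize xs + esize ys"
  by (induction xs) auto

lemma esize_rev [simp]: "esize (rev xs) = esize xs"
  by (induction xs) auto

lemma esize_take: "esize (take i xs) \<le> esize xs"
  by (metis append_take_drop_id esize_append le_add1)

lemma esize_filter: "esize (filter P xs) \<le> esize xs"
  by (induction xs) auto

lemma esize_list_le: "(\<And>y. y \<in> set ys \<Longrightarrow> esize y \<le> B) \<Longrightarrow> esize ys \<le> length ys * (B + 1)"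
  by (induction ys) (fastforce simp: algebra_simps)+

lemma esize_mem: "y \<in> set ys \<Longrightarrow> esize y < esize ys"
  by (induction ys) auto

text \<open>Used for accumulators whose entries come from a given list: their length then controls
  their size.\<close>

lemma esize_subset:
  assumes "set xs \<subseteq> set ys"
  shows "esize xs \<le> length xs * (esize ys + 1)"
proof (rule esize_list_le)
  show "esize y \<le> esize ys" if "y \<in> set xs" for y
    using that assms esize_mem[of y ys] by auto
qed

lemma esize_concat: "esize (concat xss) \<le> esize xss"
  by (induction xss) auto

lemma esize_unit_list [simp]: "esize (us :: unit list) = length us"
  by (induction us) (auto simp: encode_unit_def)

lemma fold_Cons_rev: "fold (\<lambda>y acc. g y # acc) xs acc = rev (map g xs) @ acc"
  by (induction xs arbitrary: acc) auto

lemma pt_rev [pt_intros]: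
  assumes "pt xs"
  shows "pt (\<lambda>x. rev (xs x))"
proof -
  obtain p where p: "\<And>x. esize (xs x) \<le> poly p (esize x)" using pt_bound[OF assms] by blast
  have "esize (take i (xs x)) \<le> poly p (esize x)" for i x
    using p[of x] esize_take[of i "xs x"] by linarith
  then have "pt (\<lambda>x. fold (\<lambda>y acc. y # acc) (xs x) [])"
    by (intro pt_fold[where f = "\<lambda>x y acc. y # acc" and b = "poly p"] pt_intros assms)
      (auto simp: fold_Cons_rev)
  then show ?thesis by (simp add: fold_Cons_rev)
qed

lemma pt_append [pt_intros]:
  assumes "pt xs" "pt ys"
  shows "pt (\<lambda>x. xs x @ ys x)"
proof -
  obtain p where p: "\<And>x. esize (xs x) \<le> poly p (esize x)" using pt_bound[OF assms(1)] by blast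
  obtain q where q: "\<And>x. esize (ys x) \<le> poly q (esize x)" using pt_bound[OF assms(2)] by blast
  have "esize (take i (rev (xs x))) + esize (ys x) \<le> poly p (esize x) + poly q (esize x)" for i x
    using p[of x] q[of x] esize_take[of i "rev (xs x)"] by simp
  then have "pt (\<lambda>x. fold (\<lambda>y acc. y # acc) (rev (xs x)) (ys x))"
    by (intro pt_fold[where f = "\<lambda>x y acc. y # acc" and b = "\<lambda>n. poly p n + poly q n"] pt_intros assms)
      (auto simp: fold_Cons_rev)
  then show ?thesis by (simp add: fold_Cons_rev)
qed

lemma pt_map [pt_intros]:
  assumes xs: "pt xs" and f: "pt (\<lambda>z. f (fst z) (snd z))"
  shows "pt (\<lambda>x. map (f x) (xs x))"
proof -
  obtain p where p: "\<And>x. esize (xs x) \<le> poly p (esize x)" using pt_bound[OF xs] by blast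
  obtain q where q: "\<And>x y. esize (f x y) \<le> poly q (esize (x, y))" using pt_bound[OF f] by (metis fst_conv snd_conv)
  have *: "esize (map (f x) (take i (rev (xs x)))) \<le> poly p (esize x) * (poly q (1 + esize x + poly p (esize x)) + 1)" for i x
  proof -
    have "esize (map (f x) (take i (rev (xs x)))) \<le> length (map (f x) (take i (rev (xs x)))) * (poly q (1 + esize x + poly p (esize x)) + 1)"
    proof (rule esize_list_le)
      fix y assume "y \<in> set (map (f x) (take i (rev (xs x))))"
      then obtain z where z: "z \<in> set (xs x)" "y = f x z"
        using in_set_takeD by fastforce
      have "esize (x, z) \<le> 1 + esize x + poly p (esize x)"
        using esize_mem[OF z(1)] p[of x] by simp
      then show "esize y \<le> poly q (1 + esize x + poly p (esize x))"
        using q[of x z] z(2) poly_nat_mono[of "esize (x, z)" _ q] by (metis le_trans)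
    qed
    moreover have "length (map (f x) (take i (rev (xs x)))) \<le> poly p (esize x)"
      using length_le_esize[of "xs x"] p[of x] by simp
    ultimately show ?thesis by (meson le_trans mult_le_mono1)
  qed
  have f': "pt (\<lambda>z. f (fst z) (fst (snd z)) # snd (snd z))"
    by (intro pt_intros pt_comp[OF f, of "\<lambda>z. (fst z, fst (snd z))", simplified])
  have "pt (\<lambda>x. fold (\<lambda>y acc. f x y # acc) (rev (xs x)) [])"
    by (rule pt_fold[where f = "\<lambda>x y acc. f x y # acc"
      and b = "\<lambda>n. poly p n * (poly q (1 + n + poly p n) + 1)"])
     (use * in \<open>auto simp: fold_Cons_rev intro!: pt_intros assms f'\<close>)
  then show ?thesis by (simp add: fold_Cons_rev rev_map)
qed

lemma pt_filter [pt_intros]: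
  assumes xs: "pt xs" and f: "pt (\<lambda>z. P (fst z) (snd z))"
  shows "pt (\<lambda>x. filter (P x) (xs x))"
proof -
  obtain p where p: "\<And>x. esize (xs x) \<le> poly p (esize x)" using pt_bound[OF xs] by blast
  have fold: "fold (\<lambda>y acc. if P x y then y # acc else acc) ys acc = rev (filter (P x) ys) @ acc" for x ys acc
    by (induction ys arbitrary: acc) auto
  have *: "esize (filter (P x) (take i (rev (xs x)))) \<le> poly p (esize x)" for x i
    using p[of x] esize_filter[of "P x" "take i (rev (xs x))"] esize_take[of i "rev (xs x)"] by simp
  have f': "pt (\<lambda>z. if P (fst z) (fst (snd z)) then fst (snd z) # snd (snd z) else snd (snd z))"
    by (intro pt_intros pt_comp[OF f, of "\<lambda>z. (fst z, fst (snd z))", simplified])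
  have "pt (\<lambda>x. fold (\<lambda>y acc. if P x y then y # acc else acc) (rev (xs x)) [])"
    by (rule pt_fold[where f = "\<lambda>x y acc. if P x y then y # acc else acc" and b = "\<lambda>n. poly p n"])
     (use * in \<open>auto simp: fold intro!: pt_intros assms f'\<close>)
  then show ?thesis by (simp add: fold rev_filter)
qed

lemma pt_Bex [pt_intros]:
  assumes "pt xs" and "pt (\<lambda>z. P (fst z) (snd z))"
  shows "pt (\<lambda>x. \<exists>y \<in> set (xs x). P x y)"
proof -
  have "pt (\<lambda>x. \<not> filter (P x) (xs x) = [])" by (intro pt_intros assms)
  then show ?thesis by (simp add: filter_empty_conv)
qed

lemma pt_Ball [pt_intros]:
  assumes "pt xs" and "pt (\<lambda>z. P (fst z) (snd z))"
  shows "pt (\<lambda>x. \<forall>y \<in> set (xs x). P x y)"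
proof -
  have "pt (\<lambda>x. filter (\<lambda>y. \<not> P x y) (xs x) = [])" by (intro pt_intros assms)
  then show ?thesis by (simp add: filter_empty_conv)
qed

lemma pt_mem [pt_intros]:
  assumes "pt y" and "pt xs"
  shows "pt (\<lambda>x. y x \<in> set (xs x))"
proof -
  have "pt (\<lambda>z. y (fst z))" by (intro pt_comp[OF assms(1)] pt_intros)
  then have "pt (\<lambda>x. \<exists>z \<in> set (xs x). z = y x)" by (intro pt_intros assms)
  then show ?thesis by simp
qed

lemma pt_concat [pt_intros]:
  assumes xs: "pt xs"
  shows "pt (\<lambda>x. concat (xs x))"
proof -
  obtain p where p: "\<And>x. esize (xs x) \<le> poly p (esize x)" using pt_bound[OF xs] by blast
  have fold: "fold (@) ys acc = concat (rev ys) @ acc" for ys :: "'b list list" and acc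
    by (induction ys arbitrary: acc) auto
  have *: "esize (concat (rev (take i (rev (xs x))))) \<le> poly p (esize x)" for x i
    using p[of x] esize_concat[of "rev (take i (rev (xs x)))"] esize_take[of i "rev (xs x)"] by simp
  have "pt (\<lambda>x. fold (@) (rev (xs x)) [])"
    by (rule pt_fold[where f = "\<lambda>x y acc. y @ acc" and b = "\<lambda>n. poly p n"])
     (use * in \<open>auto simp: fold intro!: pt_intros assms\<close>)
  then show ?thesis by (simp add: fold)
qed

lemma pt_tl [pt_intros]:
  assumes "pt xs"
  shows "pt (\<lambda>x. tl (xs x))"
proof -
  have "pt (\<lambda>x. case xs x of [] \<Rightarrow> [] | y # ys \<Rightarrow> ys)" by (intro pt_intros assms)
  moreover have "tl zs = (case zs of [] \<Rightarrow> [] | y # ys \<Rightarrow> ys)" for zs :: "'b list" by (cases zs) auto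
  ultimately show ?thesis by simp
qed

subsection \<open>Numbers in unary and in binary\<close>

text \<open>Unary numbers are lists over the type \<open>unit\<close>.\<close>

definition upt :: "('a::enc \<Rightarrow> nat) \<Rightarrow> bool" where
  "upt a \<longleftrightarrow> pt (\<lambda>x. replicate (a x) ())"

lemma unit_list_eq: "us = replicate (length us) ()"
  by (induction us) auto

lemma upt_comp: "upt g \<Longrightarrow> pt f \<Longrightarrow> upt (\<lambda>x. g (f x))"
  unfolding upt_def by (rule pt_comp)

lemma upt_length [pt_intros]:
  assumes "pt xs"
  shows "upt (\<lambda>x. length (xs x))"
proof -
  have "pt (\<lambda>x. map (\<lambda>_. ()) (xs x))" by (intro pt_intros assms)
  then show ?thesis by (simp add: upt_def map_replicate_const)
qed

lemma upt_const [pt_intros]: "upt (\<lambda>_. c)"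
  unfolding upt_def by (rule pt_const)

lemma upt_add [pt_intros]: "upt a \<Longrightarrow> upt b \<Longrightarrow> upt (\<lambda>x. a x + b x)"
  unfolding upt_def replicate_add by (rule pt_append)

lemma upt_mult [pt_intros]:
  assumes "upt a" "upt b"
  shows "upt (\<lambda>x. a x * b x)"
proof -
  have b: "pt (\<lambda>x. replicate (b (fst x)) ())"
    by (rule pt_comp[OF assms(2)[unfolded upt_def]]) (intro pt_intros)
  have "pt (\<lambda>x. concat (map (\<lambda>_. replicate (b x) ()) (replicate (a x) ())))"
    by (intro pt_intros assms[unfolded upt_def] b)
  then show ?thesis
    unfolding upt_def by (subst (asm) unit_list_eq) (simp add: length_concat sum_list_replicate comp_def)
qed

lemma upt_diff [pt_intros]:
  assumes "upt a" "upt b"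
  shows "upt (\<lambda>x. a x - b x)"
proof -
  obtain p where p: "\<And>x. esize (replicate (a x) ()) \<le> poly p (esize x)"
    using pt_bound[OF assms(1)[unfolded upt_def]] by blast
  have fold: "fold (\<lambda>_ acc. tl acc) us acc = drop (length us) acc" for us :: "unit list" and acc :: "unit list"
    by (induction us arbitrary: acc) (auto simp: drop_Suc)
  have tl_pow: "(tl ^^ n) us = drop n us" for n and us :: "unit list"
    by (induction n) (auto simp: drop_Suc tl_drop)
  have "a x - min i (b x) \<le> poly p (esize x)" for x i using p[of x] by simp
  then have "pt (\<lambda>x. fold (\<lambda>_ acc. tl acc) (replicate (b x) ()) (replicate (a x) ()))"
    by (intro pt_fold[where f = "\<lambda>x y acc. tl acc" and b = "poly p"])
     (auto simp: fold tl_pow intro!: pt_intros assms[unfolded upt_def])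
  then show ?thesis by (simp add: tl_pow upt_def)
qed

lemma pt_le [pt_intros]:
  fixes a b :: "'a::enc \<Rightarrow> nat"
  assumes "upt a" "upt b"
  shows "pt (\<lambda>x. a x \<le> b x)"
proof -
  have "pt (\<lambda>x. replicate (a x - b x) () = [])"
    using upt_diff[OF assms] unfolding upt_def by (intro pt_intros)
  then show ?thesis by simp
qed

lemma pt_less [pt_intros]:
  fixes a b :: "'a::enc \<Rightarrow> nat"
  assumes "upt a" "upt b"
  shows "pt (\<lambda>x. a x < b x)"
  using pt_not[OF pt_le[OF assms(2,1)]] by (simp add: not_le)

lemma upt_min [pt_intros]:
  assumes "upt a" "upt b"
  shows "upt (\<lambda>x. min (a x) (b x))"
proof -
  have "upt (\<lambda>x. a x - (a x - b x))" by (intro pt_intros assms)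
  moreover have "a x - (a x - b x) = min (a x) (b x)" for x by simp
  ultimately show ?thesis by simp
qed

lemma upt_of_bool [pt_intros]:
  assumes "pt b"
  shows "upt (\<lambda>x. of_bool (b x))"
proof -
  have "pt (\<lambda>x. if b x then [()] else [])" by (intro pt_intros assms)
  moreover have "replicate (of_bool c) () = (if c then [()] else [])" for c by simp
  ultimately show ?thesis by (simp add: upt_def)
qed

text \<open>The bit list has the same tree as the number, so a binary number can be traversed by
  list folds without any conversion.\<close>

fun bits :: "nat \<Rightarrow> bool list" where
  "bits n = (if n = 0 then [] else odd n # bits (n div 2))"

declare bits.simps [simp del]

lemma encode_bits: "encode (bits n) = encode n"
proof (induction n rule: bits.induct)
  case (1 n)
  then show ?case
    by (subst bits.simps) (auto simp: encode_nat_def enc_nat.simps[of n] enc_bool_def)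
qed

lemma pt_bits [pt_intros]: "pt f \<Longrightarrow> pt (\<lambda>x. bits (f x))"
  by (rule pt_comp[OF pt_coerce]) (rule encode_bits)

fun inc :: "bool list \<Rightarrow> bool list" where
  "inc [] = [True]"
| "inc (False # bs) = True # bs"
| "inc (True # bs) = False # inc bs"

lemma inc_bits: "inc (bits n) = bits (Suc n)"
proof (induction n rule: bits.induct)
  case (1 n)
  show ?case
  proof (cases "n = 0 \<or> even n")
    case True
    then show ?thesis by (subst (1 2) bits.simps) (auto simp: bits.simps[of "Suc 0"] bits.simps[of 0])
  next
    case False
    then have "Suc n div 2 = Suc (n div 2)" by presburger
    with False 1 show ?thesis by (subst (1 2) bits.simps) auto
  qed
qed

text \<open>A carry ripples through the bits, starting with the least significant one. The fold
  stores the carry together with the output bits in reverse order, and \<open>fin\<close> appends a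
  carry that is left over.\<close>

lemma pt_Suc:
  assumes "pt f"
  shows "pt (\<lambda>x. Suc (f x))"
proof -
  define st where "st b ca = (fst ca \<and> b, (if fst ca then \<not> b else b) # snd ca)" for b and ca :: "bool \<times> bool list"
  define fin where "fin ca = rev (if fst ca then True # snd ca else snd ca)" for ca :: "bool \<times> bool list"
  have st_simps: "st b (False, acc) = (False, b # acc)" "st False (True, acc) = (False, True # acc)"
    "st True (True, acc) = (True, False # acc)" for b acc
    by (auto simp: st_def)
  have fin_simps: "fin (False, acc) = rev acc" "fin (True, acc) = rev acc @ [True]" for acc
    by (auto simp: fin_def)
  have st_fin0: "fin (fold st bs (False, acc)) = rev acc @ bs" for bs acc
    by (induction bs arbitrary: acc) (auto simp: st_simps fin_simps)
  have st_fin: "fin (fold st bs (True, acc)) = rev acc @ inc bs" for bs acc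
    by (induction bs arbitrary: acc rule: inc.induct) (auto simp: st_simps fin_simps st_fin0)
  have sz: "esize b \<le> 1" for b :: bool by (cases b) auto
  have pst: "pt (\<lambda>z. st (fst (snd z)) (snd (snd z)))" unfolding st_def by (intro pt_intros)
  have "pt (\<lambda>n. fold st (bits n) (True, []))"
  proof (rule pt_fold_inv[where f = "\<lambda>n. st" and I = "\<lambda>n i ca. length (snd ca) \<le> i" and b = "\<lambda>n. 2 + 2 * n"])
    show "esize ca \<le> 2 + 2 * esize n" if "i \<le> length (bits n)" "length (snd ca) \<le> i" for n i and ca :: "bool \<times> bool list"
    proof -
      have "length (snd ca) \<le> esize n"
        using that length_le_esize[of "bits n"] by (simp add: encode_bits)
      moreover have "esize (snd ca) \<le> length (snd ca) * (1 + 1)"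
        by (rule esize_list_le) (rule sz)
      ultimately show ?thesis using sz[of "fst ca"] by (simp add: encode_pair)
    qed
  qed (use pst in \<open>auto intro!: pt_intros simp: st_def\<close>)
  then have "pt (\<lambda>n. fin (fold st (bits n) (True, [])))" unfolding fin_def by (intro pt_intros)
  then have "pt (\<lambda>n. bits (Suc n))" by (simp add: st_fin inc_bits)
  then have "pt Suc" by (rule pt_encode_cong) (simp add: encode_bits)
  then show ?thesis by (rule pt_comp[OF _ assms])
qed

lemma esize_nat: "esize n \<le> 2 * n" for n :: nat
proof (induction n rule: less_induct)
  case (less n)
  have le: "esize n \<le> 2 + esize (n div 2)"
    by (simp add: encode_nat_def enc_nat.simps[of n] enc_bool_def)
  consider "n = 0" | "n = 1" | "n \<ge> 2" by linarith
  then show ?case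
  proof cases
    case 3
    then have "esize (n div 2) \<le> 2 * (n div 2)" using less[of "n div 2"] by simp
    moreover have "2 * (n div 2) \<le> n" by simp
    ultimately show ?thesis using le 3 by linarith
  qed (auto simp: encode_nat_def enc_nat.simps[of 0] enc_nat.simps[of "Suc 0"] enc_bool_def)
qed

lemma pt_of_unary:
  assumes "upt a"
  shows "pt a"
proof -
  obtain p where p: "\<And>x. a x \<le> poly p (esize x)"
    using pt_bound[OF assms[unfolded upt_def]] by (auto simp: )
  have fold: "fold (\<lambda>_. Suc) us n = length us + n" for us :: "unit list" and n
    by (induction us arbitrary: n) auto
  have "pt (\<lambda>x. fold (\<lambda>_. Suc) (replicate (a x) ()) 0)"
  proof (rule pt_fold[where f = "\<lambda>_ _. Suc" and b = "\<lambda>n. 2 * poly p n"])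
    show "esize (fold (\<lambda>_. Suc) (take i (replicate (a x) ())) 0) \<le> 2 * poly p (esize x)" for x i
      using esize_nat[of "min i (a x)"] p[of x] by (simp add: Suc_funpow)
  qed (use assms[unfolded upt_def] in \<open>auto intro!: pt_intros pt_Suc\<close>)
  then show ?thesis by (simp add: Suc_funpow)
qed

lemma pt_enumerate [pt_intros]:
  assumes "pt xs"
  shows "pt (\<lambda>x. List.enumerate 0 (xs x))"
proof -
  define st where "st y na = (Suc (fst na), (fst na, y) # snd na)" for y :: 'b and na :: "nat \<times> (nat \<times> 'b) list"
  have fold: "snd (fold st ys (n, acc)) = rev (List.enumerate n ys) @ acc" for ys n acc
    by (induction ys arbitrary: n acc) (auto simp: st_def)
  obtain p where p: "\<And>x. esize (xs x) \<le> poly p (esize x)" using pt_bound[OF assms] by blast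
  have pst: "pt (\<lambda>z. st (fst (snd z)) (snd (snd z)))" unfolding st_def by (intro pt_intros pt_Suc)
  have "pt (\<lambda>x. fold st (xs x) (0, []))"
  proof (rule pt_fold_inv[where f = "\<lambda>_. st" and
        I = "\<lambda>x i na. fst na = i \<and> length (snd na) = i \<and> (\<forall>(m, y) \<in> set (snd na). m \<le> i \<and> y \<in> set (xs x))"
        and b = "\<lambda>n. 2 * poly p n + 1 + poly p n * (2 + 3 * poly p n)"])
    fix x i and na :: "nat \<times> (nat \<times> 'b) list"
    assume i: "i \<le> length (xs x)" and I: "fst na = i \<and> length (snd na) = i \<and> (\<forall>(m, y) \<in> set (snd na). m \<le> i \<and> y \<in> set (xs x))"
    have ip: "i \<le> poly p (esize x)" using i length_le_esize[of "xs x"] p[of x] by simp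
    have "esize (snd na) \<le> length (snd na) * (1 + 3 * poly p (esize x) + 1)"
    proof (rule esize_list_le)
      fix z assume "z \<in> set (snd na)"
      then have "fst z \<le> i" "snd z \<in> set (xs x)" using I by auto
      then show "esize z \<le> 1 + 3 * poly p (esize x)"
        using esize_nat[of "fst z"] ip esize_mem[of "snd z" "xs x"] p[of x] by (simp add: encode_pair)
    qed
    also have "\<dots> \<le> poly p (esize x) * (2 + 3 * poly p (esize x))"
      using I ip by (intro mult_le_mono) auto
    finally show "esize na \<le> 2 * poly p (esize x) + 1 + poly p (esize x) * (2 + 3 * poly p (esize x))"
      using I esize_nat[of "fst na"] ip by (simp add: encode_pair)
  qed (use assms pst in \<open>auto intro!: pt_intros simp: st_def\<close>)
  then have "pt (\<lambda>x. rev (snd (fold st (xs x) (0, []))))" by (intro pt_intros)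
  then show ?thesis by (simp add: fold)
qed

lemma pt_int_of_nat: "pt f \<Longrightarrow> pt (\<lambda>x. int (f x))"
proof -
  assume "pt f"
  then have "pt (\<lambda>x. (False, f x))" by (intro pt_intros)
  then show ?thesis
    by (rule pt_encode_cong) (simp add: encode_int_def enc_int_def encode_nat_def enc_bool_def)
qed

lemma pt_int_parts:
  assumes "pt f"
  shows "pt (\<lambda>x. f x < (0 :: int))" "pt (\<lambda>x. nat \<bar>f x\<bar>)"
proof -
  have "pt (\<lambda>k :: int. (k < 0, nat \<bar>k\<bar>))"
    by (rule pt_coerce) (simp add: encode_int_def enc_int_def encode_nat_def encode_bool_def)
  from pt_comp[OF this assms] have "pt (\<lambda>x. (f x < 0, nat \<bar>f x\<bar>))" .
  from pt_fst[OF this] pt_snd[OF this] show "pt (\<lambda>x. f x < 0)" "pt (\<lambda>x. nat \<bar>f x\<bar>)" by simp_all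
qed

text \<open>A number can be exponentially larger than its binary encoding, so its unary form is
  available only below a cap that is itself unary. Horner's scheme is run from the most significant
  bit, and the value is capped after every doubling.\<close>

lemma upt_min_binary:
  assumes a: "upt a" and f: "pt f"
  shows "upt (\<lambda>x. min (a x) (f x))"
proof -
  define st where "st x b us = replicate (min (a x) (2 * length us + of_bool b)) ()" for x b and us :: "unit list"
  have st_len: "length (st x b us) = min (a x) (2 * length us + of_bool b)" for x b us
    by (simp add: st_def)
  \<comment> \<open>Capping before doubling does not change the capped result, so the intermediate
    caps are harmless.\<close>
  have cap: "min m (2 * min m n + c) = min m (2 * n + c)" for m n c :: nat by auto
  have "length (fold (st x) (rev (bits n)) []) = min (a x) n" for x n
  proof (induction n rule: bits.induct)
    case (1 n)
    show ?case
    proof (cases "n = 0")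
      case False
      then have "length (fold (st x) (rev (bits n)) []) = min (a x) (2 * min (a x) (n div 2) + of_bool (odd n))"
        using 1 by (subst bits.simps) (simp add: st_len)
      also have "\<dots> = min (a x) n" by (simp add: cap)
      finally show ?thesis .
    qed (simp add: bits.simps)
  qed
  then have eq: "fold (st x) (rev (bits n)) [] = replicate (min (a x) n) ()" for x n
    by (subst unit_list_eq) simp
  obtain p where p: "\<And>x. a x \<le> poly p (esize x)"
    using pt_bound[OF a[unfolded upt_def]] by (auto simp: )
  have st: "pt (\<lambda>z. st (fst z) (fst (snd z)) (snd (snd z)))"
    unfolding st_def upt_def[symmetric] by (intro pt_intros upt_comp[OF a])
  have "pt (\<lambda>x. fold (st x) (rev (bits (f x))) [])"
    by (rule pt_fold_inv[where I = "\<lambda>x i us. length us \<le> a x" and b = "poly p", OF _ _ st])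
      (use p in \<open>auto intro!: pt_intros f simp: st_def intro: le_trans\<close>)
  then show ?thesis by (simp add: eq upt_def)
qed

section \<open>Reachability and edge counts\<close>

definition reach :: "(nat \<times> nat) set \<Rightarrow> nat set \<Rightarrow> nat set" where
  "reach A Z = (A \<union> A\<inverse>)\<^sup>* `` Z"

definition inside :: "nat set \<Rightarrow> nat \<times> nat \<Rightarrow> bool" where
  "inside S p \<longleftrightarrow> fst p \<in> S \<and> snd p \<in> S"

definition touch :: "nat set \<Rightarrow> nat \<times> nat \<Rightarrow> bool" where
  "touch S p \<longleftrightarrow> fst p \<in> S \<or> snd p \<in> S"

definition cnt :: "nat set \<Rightarrow> (nat \<times> nat) list \<Rightarrow> nat" where
  "cnt S es = length (filter (inside S) es)"

definition conn :: "(nat \<times> nat) set \<Rightarrow> nat set \<Rightarrow> bool" where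
  "conn A S \<longleftrightarrow> (\<forall>x\<in>S. S \<subseteq> reach {p \<in> A. inside S p} {x})"

text \<open>The condition is stated for all connected subsets instead of components. This makes it
  inherited by subsets of \<open>W\<close> and dependent on the edges inside \<open>W\<close> only.
  The summand \<open>1\<close> avoids a subtraction of natural numbers.\<close>

definition sol :: "nat \<Rightarrow> nat set \<Rightarrow> (nat \<times> nat) list \<Rightarrow> bool" where
  "sol r W es \<longleftrightarrow> (\<forall>S. S \<noteq> {} \<and> S \<subseteq> W \<and> conn (set es) S \<longrightarrow> cnt S es + 1 \<le> card S + r)"

section \<open>Reachability\<close>

lemma inside_mono: "inside S p \<Longrightarrow> S \<subseteq> T \<Longrightarrow> inside T p"
  by (auto simp: inside_def)

lemma reach_refl: "Z \<subseteq> reach A Z"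
  by (auto simp: reach_def)

lemma reach_start: "x \<in> Z \<Longrightarrow> x \<in> reach A Z"
  using reach_refl by blast

lemma reach_step: "x \<in> reach A Z \<Longrightarrow> (x, y) \<in> A \<or> (y, x) \<in> A \<Longrightarrow> y \<in> reach A Z"
  by (auto simp: reach_def intro: rtrancl_into_rtrancl)

text \<open>The induction principle for reachability: it suffices to exhibit a set that contains the
  start and is not crossed by any edge. Most arguments below use it in place of explicit
  paths.\<close>

lemma reach_least:
  assumes "Z \<subseteq> R" "\<And>x y. (x, y) \<in> A \<Longrightarrow> x \<in> R \<longleftrightarrow> y \<in> R"
  shows "reach A Z \<subseteq> R"
proof
  fix y assume "y \<in> reach A Z"
  then obtain x where "x \<in> Z" "(x, y) \<in> (A \<union> A\<inverse>)\<^sup>*" by (auto simp: reach_def)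
  from this(2) show "y \<in> R"
    by (induction rule: rtrancl_induct) (use \<open>x \<in> Z\<close> assms in auto)
qed

lemma reach_closed: "(x, y) \<in> A \<Longrightarrow> x \<in> reach A Z \<longleftrightarrow> y \<in> reach A Z"
  by (meson reach_step)

lemma reach_mono: "A \<subseteq> B \<Longrightarrow> Z \<subseteq> Y \<Longrightarrow> reach A Z \<subseteq> reach B Y"
  by (rule reach_least) (use reach_refl in blast, meson reach_step subsetD)

lemma reach_trans: "Y \<subseteq> reach A Z \<Longrightarrow> reach A Y \<subseteq> reach A Z"
  by (rule reach_least) (auto simp: reach_closed)

lemma reach_sym: "y \<in> reach A {x} \<Longrightarrow> x \<in> reach A {y}"
proof -
  have "(A \<union> A\<inverse>)\<inverse> = A \<union> A\<inverse>" by auto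
  then show "y \<in> reach A {x} \<Longrightarrow> x \<in> reach A {y}"
    unfolding reach_def by (metis Image_singleton_iff rtrancl_converseI)
qed

lemma reach_eq: "y \<in> reach A {x} \<Longrightarrow> reach A {y} = reach A {x}"
  by (meson empty_subsetI insert_subset reach_sym reach_trans subset_antisym)

lemma reach_ends: "reach A Z \<subseteq> Z \<union> fst ` A \<union> snd ` A"
proof
  fix y assume "y \<in> reach A Z"
  then obtain x where "x \<in> Z" "(x, y) \<in> (A \<union> A\<inverse>)\<^sup>*" by (auto simp: reach_def)
  from this(2) show "y \<in> Z \<union> fst ` A \<union> snd ` A"
    by (induction rule: rtrancl_induct) (use \<open>x \<in> Z\<close> in force)+
qed

text \<open>A new edge matters only if one end is already reachable, and then it adds no more than
  what is reachable from the other end, which is chosen as \<open>c\<close>.\<close>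

lemma reach_insert_edge: "\<exists>c. reach (insert e A) Z \<subseteq> reach A (insert c Z)"
proof -
  obtain a b where e: "e = (a, b)" by (cases e)
  define c where "c = (if a \<in> reach A Z then b else a)"
  have sub: "reach A Z \<subseteq> reach A (insert c Z)" by (rule reach_mono) auto
  show ?thesis
  proof (cases "a \<in> reach A Z \<or> b \<in> reach A Z")
    case True
    then have "a \<in> reach A (insert c Z) \<and> b \<in> reach A (insert c Z)"
      using sub reach_start[of c "insert c Z" A] by (auto simp: c_def split: if_splits)
    then have "reach (insert e A) Z \<subseteq> reach A (insert c Z)"
      by (intro reach_least) (use sub reach_refl[of Z A] e in \<open>auto simp: reach_closed\<close>)
    then show ?thesis ..
  next
    case False
    then have "reach (insert e A) Z \<subseteq> reach A Z"
      by (intro reach_least) (use reach_refl[of Z A] e in \<open>auto simp: reach_closed\<close>)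
    with sub show ?thesis by blast
  qed
qed

text \<open>By the previous lemma every edge can be traded for one additional start vertex. This is
  the source of all bounds of the form that connecting \<open>n\<close> further vertices takes
  \<open>n\<close> edges.\<close>

lemma card_reach_le: "finite (reach (set es) Z - Z) \<and> card (reach (set es) Z - Z) \<le> length es"
proof (induction es arbitrary: Z)
  case Nil
  have "reach {} Z = Z" by (auto simp: reach_def)
  then show ?case by simp
next
  case (Cons e es)
  obtain c where c: "reach (insert e (set es)) Z \<subseteq> reach (set es) (insert c Z)"
    using reach_insert_edge by blast
  let ?R = "reach (set es) (insert c Z)"
  have "reach (set (e # es)) Z - Z \<subseteq> insert c (?R - insert c Z)" using c by auto
  moreover have R: "finite (?R - insert c Z)" "card (?R - insert c Z) \<le> length es"
    using Cons[of "insert c Z"] by auto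
  ultimately have "finite (reach (set (e # es)) Z - Z)"
    "card (reach (set (e # es)) Z - Z) \<le> card (insert c (?R - insert c Z))"
    by (meson finite_insert finite_subset, meson card_mono finite_insert)
  moreover have "card (insert c (?R - insert c Z)) \<le> Suc (card (?R - insert c Z))"
    using R(1) by (simp add: card_insert_if)
  ultimately show ?case using R(2) by simp
qed

lemma card_reach_image_le:
  assumes "finite T"
  shows "card (reach (en ` T) Z - Z) \<le> card T"
proof -
  obtain es where "set es = en ` T" "distinct es"
    using finite_distinct_list[of "en ` T"] assms by auto
  then show ?thesis
    using card_reach_le[of es Z] distinct_card[of es] card_image_le[OF assms, of en] by auto
qed

section \<open>Edge counts of connected sets\<close>

lemma length_filter_disj:
  assumes "\<And>x. x \<in> set xs \<Longrightarrow> P x \<Longrightarrow> \<not> Q x" "\<And>x. x \<in> set xs \<Longrightarrow> P x \<or> Q x \<Longrightarrow> R x"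
  shows "length (filter P xs) + length (filter Q xs) \<le> length (filter R xs)"
  using assms
proof (induction xs)
  case (Cons x xs)
  then have "length (filter P xs) + length (filter Q xs) \<le> length (filter R xs)" by simp
  then show ?case using Cons.prems[of x] by auto
qed simp

lemma length_filter_le_add:
  assumes "\<And>x. x \<in> set xs \<Longrightarrow> R x \<Longrightarrow> P x \<or> Q x"
  shows "length (filter R xs) \<le> length (filter P xs) + length (filter Q xs)"
  using assms
proof (induction xs)
  case (Cons x xs)
  then have "length (filter R xs) \<le> length (filter P xs) + length (filter Q xs)" by simp
  then show ?case using Cons.prems[of x] by auto
qed simp

lemma length_filter_mono:
  assumes "\<And>x. x \<in> set xs \<Longrightarrow> P x \<Longrightarrow> Q x"
  shows "length (filter P xs) \<le> length (filter Q xs)"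
  using length_filter_le_add[of xs P Q "\<lambda>_. False"] assms by auto

text \<open>Starting from the whole complement of \<open>Y\<close>, the edges that miss
  \<open>Y\<close> are useless, so \<open>Y\<close> is already reached through the edges that touch
  it, and each of its vertices needs one.\<close>

lemma card_le_touch:
  assumes "Y \<subseteq> reach (set es) Z" "Y \<inter> Z = {}"
  shows "finite Y \<and> card Y \<le> length (filter (touch Y) es)"
proof -
  let ?es = "filter (touch Y) es"
  have "reach (set es) Z \<subseteq> reach (set ?es) (- Y)"
  proof (rule reach_least)
    show "Z \<subseteq> reach (set ?es) (- Y)" using assms(2) reach_refl by blast
    fix x y assume xy: "(x, y) \<in> set es"
    show "x \<in> reach (set ?es) (- Y) \<longleftrightarrow> y \<in> reach (set ?es) (- Y)"
    proof (cases "touch Y (x, y)")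
      case True
      then show ?thesis using xy by (intro reach_closed) auto
    next
      case False
      then have "x \<in> - Y" "y \<in> - Y" by (auto simp: touch_def)
      then show ?thesis by (simp add: reach_start)
    qed
  qed
  then have "reach (set ?es) (- Y) - (- Y) = Y" using assms(1) by auto
  then show ?thesis using card_reach_le[of ?es "- Y"] by simp
qed

text \<open>Reachability is an equivalence relation, so paths from a single root are enough.\<close>

lemma connI:
  assumes "x \<in> S" "S \<subseteq> reach {p \<in> A. inside S p} {x}"
  shows "conn A S"
  unfolding conn_def
proof
  let ?B = "{p \<in> A. inside S p}"
  fix y assume "y \<in> S"
  then have "reach ?B {y} = reach ?B {x}" using assms(2) by (intro reach_eq) auto
  then show "S \<subseteq> reach ?B {y}" using assms(2) by simp
qed

lemma conn_singleton: "conn A {x}"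
  by (rule connI[of x]) (auto intro: reach_start)

lemma conn_reach: "conn A (reach A {x})"
proof (rule connI[of x])
  show "x \<in> reach A {x}" by (simp add: reach_start)
  let ?B = "{p \<in> A. inside (reach A {x}) p}"
  have "reach A {x} \<subseteq> reach ?B {x} \<inter> reach A {x}"
  proof (rule reach_least)
    show "{x} \<subseteq> reach ?B {x} \<inter> reach A {x}" by (simp add: reach_start)
    fix u v assume uv: "(u, v) \<in> A"
    have c: "u \<in> reach A {x} \<longleftrightarrow> v \<in> reach A {x}" by (rule reach_closed[OF uv])
    have "u \<in> reach ?B {x} \<longleftrightarrow> v \<in> reach ?B {x}" if "u \<in> reach A {x}"
      by (rule reach_closed) (use uv c that in \<open>simp add: inside_def\<close>)
    with c show "u \<in> reach ?B {x} \<inter> reach A {x} \<longleftrightarrow> v \<in> reach ?B {x} \<inter> reach A {x}" by blast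
  qed
  then show "reach A {x} \<subseteq> reach ?B {x}" by blast
qed

lemma conn_subset_reach: "conn A S \<Longrightarrow> x \<in> S \<Longrightarrow> S \<subseteq> reach A {x}"
  unfolding conn_def using reach_mono[of "{p \<in> A. inside S p}" A "{x}" "{x}"] by blast

lemma conn_reach_super:
  assumes "conn A S" "x \<in> S" "{p \<in> A. inside S p} \<subseteq> B"
  shows "S \<subseteq> reach B {x}"
proof -
  have "S \<subseteq> reach {p \<in> A. inside S p} {x}" using assms(1,2) by (simp add: conn_def)
  also have "\<dots> \<subseteq> reach B {x}" using assms(3) by (intro reach_mono) auto
  finally show ?thesis .
qed

text \<open>Connectivity of \<open>S\<close> sees only the edges inside \<open>S\<close>; changes
  elsewhere in the graph do not affect it.\<close>

lemma conn_mono: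
  assumes "conn A S" "{p \<in> A. inside S p} \<subseteq> B"
  shows "conn B S"
  unfolding conn_def
proof
  fix x assume "x \<in> S"
  then show "S \<subseteq> reach {p \<in> B. inside S p} {x}"
    using assms by (intro conn_reach_super[of A]) auto
qed

lemma conn_Un:
  assumes "conn A S" "conn A T" "x \<in> S" "y \<in> T" "x = y \<or> (x, y) \<in> A \<or> (y, x) \<in> A"
  shows "conn A (S \<union> T)"
proof (rule connI[of x])
  let ?B = "{p \<in> A. inside (S \<union> T) p}"
  have S: "S \<subseteq> reach ?B {x}"
    by (rule conn_reach_super[OF assms(1,3)]) (auto simp: inside_def)
  have T: "T \<subseteq> reach ?B {y}"
    by (rule conn_reach_super[OF assms(2,4)]) (auto simp: inside_def)
  have "y \<in> reach ?B {x}"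
  proof (cases "x = y")
    case False
    then have "(x, y) \<in> ?B \<or> (y, x) \<in> ?B" using assms(3-5) by (auto simp: inside_def)
    with reach_start[of x "{x}" ?B] show ?thesis by (intro reach_step[of x ?B "{x}" y]) auto
  qed (simp add: reach_start)
  then show "S \<union> T \<subseteq> reach ?B {x}" using S T reach_eq[of y ?B x] by blast
qed (use assms in auto)

lemma conn_star:
  assumes "conn A S" "x \<in> S" "\<And>i. i \<in> I \<Longrightarrow> conn A (S \<union> T i)"
  shows "conn A (S \<union> (\<Union>i\<in>I. T i))"
proof (rule connI[of x])
  let ?B = "{p \<in> A. inside (S \<union> (\<Union>i\<in>I. T i)) p}"
  have 1: "S \<subseteq> reach ?B {x}"
    by (rule conn_reach_super[OF assms(1,2)]) (auto simp: inside_def)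
  have "S \<union> T i \<subseteq> reach ?B {x}" if "i \<in> I" for i
    by (rule conn_reach_super[OF assms(3)[OF that]]) (use assms(2) that in \<open>auto simp: inside_def\<close>)
  with 1 show "S \<union> (\<Union>i\<in>I. T i) \<subseteq> reach ?B {x}" by blast
qed (use assms in auto)

text \<open>The vertices of \<open>T - S\<close> are reached from \<open>S\<close> inside
  \<open>T\<close>, so there are at least as many edges of \<open>T\<close> touching
  \<open>T - S\<close> as vertices in it. Thus the excess of a connected set is at least that of
  each nonempty subset.\<close>

lemma conn_cnt_mono:
  assumes "conn (set es) T" "S \<subseteq> T" "S \<noteq> {}" "finite T"
  shows "cnt S es + card (T - S) \<le> cnt T es"
proof -
  let ?es = "filter (inside T) es"
  obtain x where x: "x \<in> S" using assms(3) by blast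
  have "T \<subseteq> reach (set ?es) {x}" using assms(1,2) x by (auto simp: conn_def)
  then have "T - S \<subseteq> reach (set ?es) S"
    using reach_mono[of "set ?es" "set ?es" "{x}" S] x by auto
  then have "card (T - S) \<le> length (filter (touch (T - S)) ?es)"
    using card_le_touch[of "T - S" ?es S] by auto
  moreover have "length (filter (inside S) es) + length (filter (touch (T - S)) ?es) \<le> length (filter (inside T) es)"
    unfolding filter_filter by (rule length_filter_disj) (use assms(2) in \<open>auto simp: inside_def touch_def\<close>)
  ultimately show ?thesis by (simp add: cnt_def)
qed

text \<open>By monotonicity of the excess, the condition of \<open>sol\<close> has to be checked for
  maximal connected sets only.\<close>

lemma conn_sol_subset:
  assumes "conn (set es) T" "finite T" "cnt T es + 1 \<le> card T + r" "S \<subseteq> T" "S \<noteq> {}"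
  shows "cnt S es + 1 \<le> card S + r"
  using conn_cnt_mono[OF assms(1,4,5,2)] assms(2-4) card_Diff_subset[of S T]
    card_mono[of T S] finite_subset[of S T] by simp

lemma conn_cnt_ge:
  assumes "conn (set es) T" "finite T" "T \<noteq> {}"
  shows "card T \<le> cnt T es + 1"
proof -
  obtain x where x: "x \<in> T" using assms(3) by blast
  show ?thesis using conn_cnt_mono[OF assms(1), of "{x}"] assms(2) x by simp
qed

lemma sol_mono: "sol r W es \<Longrightarrow> U \<subseteq> W \<Longrightarrow> sol r U es"
  by (auto simp: sol_def)

lemma simple_path:
  assumes "y \<in> reach A {x}"
  obtains ps where "ps \<noteq> []" "hd ps = x" "last ps = y" "distinct ps"
    "\<And>i. Suc i < length ps \<Longrightarrow> (ps ! i, ps ! Suc i) \<in> A \<union> A\<inverse>"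
proof -
  have "(x, y) \<in> (A \<union> A\<inverse>)\<^sup>*" using assms by (auto simp: reach_def)
  then have "\<exists>ps. ps \<noteq> [] \<and> hd ps = x \<and> last ps = y \<and> distinct ps \<and>
    (\<forall>i. Suc i < length ps \<longrightarrow> (ps ! i, ps ! Suc i) \<in> A \<union> A\<inverse>)"
  proof (induction rule: rtrancl_induct)
    case base
    show ?case by (rule exI[of _ "[x]"]) auto
  next
    case (step y z)
    then obtain ps where ps: "ps \<noteq> []" "hd ps = x" "last ps = y" "distinct ps"
      "\<forall>i. Suc i < length ps \<longrightarrow> (ps ! i, ps ! Suc i) \<in> A \<union> A\<inverse>" by blast
    show ?case
    proof (cases "z \<in> set ps")
      case True
      then obtain j where j: "j < length ps" "ps ! j = z" by (auto simp: in_set_conv_nth)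
      \<comment> \<open>A step back to a vertex already visited truncates the path there, which
        keeps it simple.\<close>
      have "last (take (Suc j) ps) = z" using j by (simp add: take_Suc_conv_app_nth)
      then show ?thesis
        using ps j by (intro exI[of _ "take (Suc j) ps"]) (auto simp: hd_take)
    next
      case False
      have "(ps @ [z]) ! i = ps ! i" if "i < length ps" for i using that by (simp add: nth_append)
      moreover have "ps ! i = y" if "Suc i = length ps" for i
        using ps(1,3) that by (metis diff_Suc_1 last_conv_nth)
      ultimately have "\<forall>i. Suc i < length (ps @ [z]) \<longrightarrow> ((ps @ [z]) ! i, (ps @ [z]) ! Suc i) \<in> A \<union> A\<inverse>"
        using ps(5) step.hyps(2) by (auto simp: less_Suc_eq nth_append)
      then show ?thesis
        using ps False by (intro exI[of _ "ps @ [z]"]) auto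
    qed
  qed
  then show ?thesis using that by blast
qed

section \<open>Pseudoforests and edge counts\<close>

text \<open>In this section \<open>en\<close> maps the edges to the pairs of their ends.\<close>

definition redundant :: "('e \<Rightarrow> nat \<times> nat) \<Rightarrow> 'e set \<Rightarrow> 'e \<Rightarrow> bool" where
  "redundant en Q i \<longleftrightarrow> snd (en i) \<in> reach (en ` (Q - {i})) {fst (en i)}"

text \<open>A redundant edge is one that lies on a cycle; a loop is always redundant. Removing an
  irredundant edge separates its two ends, and the remaining edges fall into one set on each side,
  to which induction applies.\<close>

lemma irredundant_card:
  assumes "finite S" "S \<noteq> {}" "finite Q" "\<And>i. i \<in> Q \<Longrightarrow> inside S (en i)" "\<And>i. i \<in> Q \<Longrightarrow> \<not> redundant en Q i"
  shows "card Q + 1 \<le> card S"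
  using assms
proof (induction "card Q" arbitrary: Q S rule: less_induct)
  case less
  show ?case
  proof (cases "Q = {}")
    case True
    then show ?thesis using less.prems(1,2) by (simp add: Suc_leI card_gt_0_iff)
  next
    case False
    then obtain i where i: "i \<in> Q" by blast
    let ?R = "reach (en ` (Q - {i})) {fst (en i)}"
    let ?Q1 = "{j \<in> Q - {i}. fst (en j) \<in> ?R}" and ?Q2 = "{j \<in> Q - {i}. fst (en j) \<notin> ?R}"
    have cl: "fst (en j) \<in> ?R \<longleftrightarrow> snd (en j) \<in> ?R" if "j \<in> Q - {i}" for j
      using that by (intro reach_closed) (metis image_eqI prod.collapse)
    have irr: "\<not> redundant en Q' j" if "Q' \<subseteq> Q" "j \<in> Q'" for Q' j
    proof
      assume "redundant en Q' j"
      moreover have "reach (en ` (Q' - {j})) {fst (en j)} \<subseteq> reach (en ` (Q - {j})) {fst (en j)}"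
        using that by (intro reach_mono) blast+
      ultimately have "redundant en Q j" by (auto simp: redundant_def)
      then show False using less.prems(5) that by blast
    qed
    have lt: "card ?Q1 < card Q" "card ?Q2 < card Q"
      using i less.prems(3) by (auto intro!: psubset_card_mono)
    have "fst (en i) \<in> ?R" "snd (en i) \<notin> ?R"
      using less.prems(5)[OF i] by (auto simp: redundant_def reach_start)
    moreover have "fst (en i) \<in> S" "snd (en i) \<in> S" using less.prems(4)[OF i] by (auto simp: inside_def)
    ultimately have ne: "S \<inter> ?R \<noteq> {}" "S - ?R \<noteq> {}" by auto
    have 1: "card ?Q1 + 1 \<le> card (S \<inter> ?R)"
      by (rule less.hyps[OF lt(1)])
        (use less.prems(1,3,4) ne cl irr[of ?Q1] in \<open>auto simp: inside_def\<close>)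
    have 2: "card ?Q2 + 1 \<le> card (S - ?R)"
      by (rule less.hyps[OF lt(2)])
        (use less.prems(1,3,4) ne cl irr[of ?Q2] in \<open>auto simp: inside_def\<close>)
    have "card Q = card ?Q1 + card ?Q2 + 1"
    proof -
      have "Q = insert i (?Q1 \<union> ?Q2)" using i by auto
      moreover have "card (insert i (?Q1 \<union> ?Q2)) = Suc (card (?Q1 \<union> ?Q2))"
        using less.prems(3) by (intro card_insert_disjoint) auto
      moreover have "card (?Q1 \<union> ?Q2) = card ?Q1 + card ?Q2"
        using less.prems(3) by (intro card_Un_disjoint) auto
      ultimately show ?thesis by simp
    qed
    moreover have "card S = card (S \<inter> ?R) + card (S - ?R)"
      using less.prems(1) by (metis card_Int_Diff)
    ultimately show ?thesis using 1 2 by simp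
  qed
qed

text \<open>A simple path between the ends of the edge that avoids the edge is closed by it to a
  cycle. For a loop the path is a single vertex, and a parallel edge gives a cycle of length
  two.\<close>

lemma redundant_imp_cycle:
  assumes G: "edges G = Q" "\<And>i. i \<in> Q \<Longrightarrow> ends G i = {fst (en i), snd (en i)} \<and> inside (verts G) (en i)"
    and i: "i \<in> Q" "redundant en Q i"
  shows "\<exists>vs es. is_cycle G vs es"
proof -
  obtain ps where ps: "ps \<noteq> []" "hd ps = fst (en i)" "last ps = snd (en i)" "distinct ps"
    "\<And>j. Suc j < length ps \<Longrightarrow> (ps ! j, ps ! Suc j) \<in> en ` (Q - {i}) \<union> (en ` (Q - {i}))\<inverse>"
    using i(2) simple_path unfolding redundant_def by blast
  define l where "l = length ps - 1"
  have lps: "length ps = Suc l" using ps(1) by (cases ps) (auto simp: l_def)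
  have "\<exists>e. e \<in> Q - {i} \<and> {fst (en e), snd (en e)} = {ps ! j, ps ! Suc j}" if j: "j < l" for j
    using ps(5)[of j] j lps by (auto simp: image_iff) (metis fst_conv snd_conv insert_commute)+
  then obtain f where f: "\<And>j. j < l \<Longrightarrow> f j \<in> Q - {i} \<and> {fst (en (f j)), snd (en (f j))} = {ps ! j, ps ! Suc j}"
    by metis
  define es where "es = map f [0..<l] @ [i]"
  have les: "length es = Suc l" by (simp add: es_def)
  have dist: "distinct es"
  proof -
    \<comment> \<open>The edges along the path are distinct because their pairs of ends are: the
      vertices of the path do not repeat.\<close>
    have "inj_on f {0..<l}"
    proof (rule inj_onI)
      fix j k assume jk: "j \<in> {0..<l}" "k \<in> {0..<l}" "f j = f k"
      then have "{ps ! j, ps ! Suc j} = {ps ! k, ps ! Suc k}" using f[of j] f[of k] by auto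
      then have "ps ! j = ps ! k \<or> (ps ! j = ps ! Suc k \<and> ps ! Suc j = ps ! k)" by (auto simp: doubleton_eq_iff)
      then show "j = k" using jk(1,2) ps(4) lps by (auto simp: nth_eq_iff_index_eq)
    qed
    moreover have "i \<notin> f ` {0..<l}" using f by fastforce
    ultimately show ?thesis by (auto simp: es_def distinct_map)
  qed
  have ends_j: "ends G (es ! j) = {ps ! j, ps ! ((j + 1) mod length es)}" if "j < length es" for j
  proof (cases "j = l")
    case True
    have "ps ! l = snd (en i)" "ps ! 0 = fst (en i)"
      using ps(1-3) lps by (auto simp: last_conv_nth hd_conv_nth)
    then show ?thesis using True les G(2)[OF i(1)] by (auto simp: es_def nth_append)
  next
    case False
    then have "j < l" using that les by simp
    then show ?thesis using f[of j] G(2)[of "f j"] les by (auto simp: es_def nth_append)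
  qed
  have "set ps \<subseteq> verts G"
  proof
    fix v assume "v \<in> set ps"
    then obtain j where j: "j < length ps" "ps ! j = v" by (auto simp: in_set_conv_nth)
    have "es ! j \<in> Q" using j lps i(1) f[of j] by (auto simp: es_def nth_append less_Suc_eq)
    then show "v \<in> verts G" using ends_j[of j] j lps les G(2)[of "es ! j"] by (auto simp: inside_def doubleton_eq_iff)
  qed
  moreover have "set es \<subseteq> edges G" using f i(1) G(1) by (auto simp: es_def)
  ultimately have "is_cycle G ps es"
    using dist ps(4) lps les ends_j by (auto simp: is_cycle_def)
  then show ?thesis by blast
qed

text \<open>The other edges of the cycle connect the two ends of its last edge.\<close>

lemma cycle_imp_redundant:
  assumes G: "edges G = Q" "\<And>i. i \<in> Q \<Longrightarrow> ends G i = {fst (en i), snd (en i)}"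
    and cyc: "is_cycle G vs es"
  shows "\<exists>i \<in> Q. redundant en Q i"
proof -
  define n where "n = length es - 1"
  have n: "length es = Suc n" "length vs = Suc n" using cyc by (auto simp: is_cycle_def n_def)
  let ?i = "es ! n"
  have ends: "ends G (es ! j) = {vs ! j, vs ! ((j + 1) mod Suc n)}" if "j \<le> n" for j
    using cyc that n by (auto simp: is_cycle_def)
  have inQ: "es ! j \<in> Q" if "j \<le> n" for j
    using cyc that n G(1) by (auto simp: is_cycle_def)
  have dist: "es ! j \<noteq> es ! n" if "j < n" for j
    using cyc that n by (auto simp: is_cycle_def nth_eq_iff_index_eq)
  have "vs ! j \<in> reach (en ` (Q - {?i})) {vs ! 0}" if "j \<le> n" for j
    using that
  proof (induction j)
    case 0
    show ?case by (simp add: reach_start)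
  next
    case (Suc j)
    have "{fst (en (es ! j)), snd (en (es ! j))} = {vs ! j, vs ! Suc j}"
      using ends[of j] Suc.prems G(2)[OF inQ[of j]] by simp
    then have "(vs ! j, vs ! Suc j) = en (es ! j) \<or> (vs ! Suc j, vs ! j) = en (es ! j)"
      by (auto simp: doubleton_eq_iff prod_eq_iff)
    moreover have "en (es ! j) \<in> en ` (Q - {?i})" using inQ[of j] dist[of j] Suc.prems by auto
    ultimately have "(vs ! j, vs ! Suc j) \<in> en ` (Q - {?i}) \<or> (vs ! Suc j, vs ! j) \<in> en ` (Q - {?i})" by metis
    then show ?case using reach_step[OF Suc.IH] Suc.prems by (meson Suc_leD)
  qed
  then have r: "vs ! n \<in> reach (en ` (Q - {?i})) {vs ! 0}" by simp
  have "{fst (en ?i), snd (en ?i)} = {vs ! n, vs ! 0}"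
    using ends[of n] G(2)[OF inQ[of n]] by simp
  then have "redundant en Q ?i"
    unfolding redundant_def using r reach_sym[OF r] by (auto simp: doubleton_eq_iff)
  then show ?thesis using inQ by blast
qed

lemma forest_iff:
  assumes G: "edges G = Q" "\<And>i. i \<in> Q \<Longrightarrow> ends G i = {fst (en i), snd (en i)} \<and> inside (verts G) (en i)"
  shows "forest G \<longleftrightarrow> (\<forall>i\<in>Q. \<not> redundant en Q i)"
  using redundant_imp_cycle[of G Q en] cycle_imp_redundant[of G Q en] assms
  unfolding forest_def by blast

lemma cnt_card: "cnt S es = card {i. i < length es \<and> inside S (es ! i)}"
  by (simp add: cnt_def length_filter_conv_card)

text \<open>If deleting at most \<open>r\<close> edges of a component leaves a forest, then at most
  \<open>card S - 1\<close> of the remaining edges lie inside \<open>S\<close>. Conversely, a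
  smallest edge set \<open>T\<close> that still connects a component \<open>C\<close> is a forest
  with at least \<open>card C - 1\<close> edges; all other edges are deleted, and the bound for
  \<open>C\<close> itself says that they are at most \<open>r\<close>.\<close>

lemma forest_delete_iff_sol:
  assumes "finite W"
    and G: "G = \<lparr>verts = W, edges = {i. i < length es \<and> inside W (es ! i)}, ends = \<lambda>i. {fst (es ! i), snd (es ! i)}\<rparr>"
  shows "pseudoforest r G \<longleftrightarrow> sol r W es"
proof -
  let ?A = "{p \<in> set es. inside W p}"
  have adj: "adjacency G = ?A \<union> ?A\<inverse>"
  proof -
    have "(u, v) \<in> adjacency G \<longleftrightarrow> (u, v) \<in> ?A \<union> ?A\<inverse>" for u v
      by (auto simp: adjacency_def G doubleton_eq_iff in_set_conv_nth inside_def prod_eq_iff)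
    then show ?thesis by auto
  qed
  have R: "reach ?A {x} \<subseteq> W" if "x \<in> W" for x
    by (rule reach_least) (use that in \<open>auto simp: inside_def\<close>)
  have vG: "verts G = W" by (simp add: G)
  have "connectedness G `` {x} = reach ?A {x}" if "x \<in> W" for x
    using R[OF that] that unfolding connectedness_def adj vG reach_def by blast
  then have comps: "components G = (\<lambda>x. induced_subgraph G (reach ?A {x})) ` W"
    by (auto simp: components_def quotient_def vG)
  define J where "J x = {i. i < length es \<and> inside (reach ?A {x}) (es ! i)}" for x
  have finJ: "finite (J x)" for x by (simp add: J_def)
  have ind: "induced_subgraph G (reach ?A {x}) =
     \<lparr>verts = reach ?A {x}, edges = J x, ends = \<lambda>i. {fst (es ! i), snd (es ! i)}\<rparr>" if "x \<in> W" for x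
    using R[OF that] by (auto simp: induced_subgraph_def G J_def inside_def)
  have forest: "forest (delete_edges (induced_subgraph G (reach ?A {x})) F) \<longleftrightarrow>
    (\<forall>i\<in>J x - F. \<not> redundant ((!) es) (J x - F) i)" if "x \<in> W" for x F
    unfolding ind[OF that] by (rule forest_iff) (auto simp: delete_edges_def J_def inside_def)
  have "(\<exists>F\<subseteq>J x. finite F \<and> card F \<le> r \<and> (\<forall>i\<in>J x - F. \<not> redundant ((!) es) (J x - F) i)) \<longleftrightarrow>
     (\<forall>S. S \<noteq> {} \<and> S \<subseteq> reach ?A {x} \<and> conn (set es) S \<longrightarrow> cnt S es + 1 \<le> card S + r)" (is "?L \<longleftrightarrow> ?R")
    if x: "x \<in> W" for x
  proof
    assume ?L
    then obtain F where F: "F \<subseteq> J x" "finite F" "card F \<le> r" "\<And>i. i \<in> J x - F \<Longrightarrow> \<not> redundant ((!) es) (J x - F) i"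
      by blast
    show ?R
    proof (intro allI impI)
      fix S assume S: "S \<noteq> {} \<and> S \<subseteq> reach ?A {x} \<and> conn (set es) S"
      then have SC: "S \<subseteq> reach ?A {x}" by blast
      have finS: "finite S" by (rule finite_subset[OF order_trans[OF SC R[OF x]] assms(1)])
      let ?I = "{i. i < length es \<and> inside S (es ! i)}"
      have sub: "?I - F \<subseteq> J x - F" unfolding J_def by (blast intro: inside_mono[OF _ SC])
      have "card (?I - F) + 1 \<le> card S"
      proof (rule irredundant_card[OF finS])
        fix i assume i: "i \<in> ?I - F"
        have "reach ((!) es ` ((?I - F) - {i})) {fst (es ! i)} \<subseteq> reach ((!) es ` ((J x - F) - {i})) {fst (es ! i)}"
          by (rule reach_mono) (use sub in blast)+
        moreover have "\<not> redundant ((!) es) (J x - F) i" using F(4) i sub by blast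
        ultimately show "\<not> redundant ((!) es) (?I - F) i"
          unfolding redundant_def by blast
      qed (use S in \<open>simp_all\<close>)
      moreover have "card ?I - card F \<le> card (?I - F)" by (rule diff_card_le_card_Diff[OF F(2)])
      ultimately show "cnt S es + 1 \<le> card S + r" using F(3) by (simp add: cnt_card)
    qed
  next
    assume R': ?R
    let ?C = "reach ?A {x}"
    have finC: "finite ?C" by (rule finite_subset[OF R[OF x] assms(1)])
    have xC: "x \<in> ?C" by (simp add: reach_start)
    have "conn (set es) ?C" by (rule conn_mono[OF conn_reach[of ?A x]]) blast
    then have cntC: "cnt ?C es + 1 \<le> card ?C + r" using R' xC by blast
    have "{p \<in> set es. inside ?C p} \<subseteq> (!) es ` J x"
      unfolding J_def in_set_conv_nth by blast
    then have JC: "?C \<subseteq> reach ((!) es ` J x) {x}"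
      by (rule conn_reach_super[OF \<open>conn (set es) ?C\<close> xC])
    \<comment> \<open>The edge sets of the component that connect all of it; a smallest one plays
      the part of a spanning tree.\<close>
    define P where "P T \<longleftrightarrow> T \<subseteq> J x \<and> ?C \<subseteq> reach ((!) es ` T) {x}" for T
    have "P (J x)" using JC by (simp add: P_def)
    then have "\<exists>T. P T \<and> (\<forall>T'. P T' \<longrightarrow> card T \<le> card T')" by (rule ex_has_least_nat)
    then obtain T where T: "P T" "\<And>T'. P T' \<Longrightarrow> card T \<le> card T'" by blast
    have finT: "finite T" using T(1) finJ finite_subset by (auto simp: P_def)
    have "card (?C - {x}) \<le> card (reach ((!) es ` T) {x} - {x})"
    proof (rule card_mono)
      have "finite ({x} \<union> fst ` (!) es ` T \<union> snd ` (!) es ` T)" using finT by simp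
      then show "finite (reach ((!) es ` T) {x} - {x})"
        using reach_ends[of "(!) es ` T" "{x}"] finite_subset by blast
      show "?C - {x} \<subseteq> reach ((!) es ` T) {x} - {x}" using T(1) by (auto simp: P_def)
    qed
    also have "\<dots> \<le> card T" by (rule card_reach_image_le[OF finT])
    finally have cT: "card ?C \<le> card T + 1" using xC finC by (simp add: card_Diff_singleton)
    \<comment> \<open>A redundant edge could be dropped without losing connectivity, against the
      choice of \<open>T\<close> as smallest.\<close>
    have red: "\<not> redundant ((!) es) T i" if i: "i \<in> T" for i
    proof
      assume red: "redundant ((!) es) T i"
      let ?T = "(!) es ` (T - {i})"
      have "reach ((!) es ` T) {x} \<subseteq> reach ?T {x}"
      proof (rule reach_least)
        show "{x} \<subseteq> reach ?T {x}" by (simp add: reach_start)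
        fix u v assume "(u, v) \<in> (!) es ` T"
        then consider "(u, v) \<in> ?T" | "(u, v) = es ! i" by auto
        then show "u \<in> reach ?T {x} \<longleftrightarrow> v \<in> reach ?T {x}"
        proof cases
          case 1
          then show ?thesis by (rule reach_closed)
        next
          case 2
          then have "v \<in> reach ?T {u}" using red by (auto simp: redundant_def dest: sym)
          then have "reach ?T {v} = reach ?T {u}" by (rule reach_eq)
          moreover have "w \<in> reach ?T {x} \<longleftrightarrow> x \<in> reach ?T {w}" for w
            using reach_sym[of w ?T x] reach_sym[of x ?T w] by blast
          ultimately show ?thesis by simp
        qed
      qed
      then have "P (T - {i})" using T(1) by (auto simp: P_def)
      from T(2)[OF this] show False using card_Diff1_less[OF finT i] by linarith
    qed
    show ?L
    proof (intro exI[of _ "J x - T"] conjI)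
      have TJ: "T \<subseteq> J x" using T(1) by (simp add: P_def)
      have "J x - (J x - T) = T" using TJ by auto
      then show "\<forall>i\<in>J x - (J x - T). \<not> redundant ((!) es) (J x - (J x - T)) i" using red by simp
      have "card (J x) = cnt ?C es" by (simp add: J_def cnt_card)
      then show "card (J x - T) \<le> r"
        using cntC cT TJ finT card_Diff_subset[OF finT TJ] by simp
    qed (use finJ in auto)
  qed
  note eq = this
  let ?H = "\<lambda>x. induced_subgraph G (reach ?A {x})"
  have edges_H: "edges (?H x) = J x" if "x \<in> W" for x by (simp add: ind[OF that])
  have "pseudoforest r G \<longleftrightarrow> (\<forall>x\<in>W. \<exists>F\<subseteq>edges (?H x). finite F \<and> card F \<le> r \<and> forest (delete_edges (?H x) F))"
    by (simp add: pseudoforest_def comps)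
  also have "\<dots> \<longleftrightarrow> (\<forall>x\<in>W. \<exists>F\<subseteq>J x. finite F \<and> card F \<le> r \<and> (\<forall>i\<in>J x - F. \<not> redundant ((!) es) (J x - F) i))"
    by (intro ball_cong refl) (simp only: edges_H forest)
  also have "\<dots> \<longleftrightarrow> (\<forall>x\<in>W. \<forall>S. S \<noteq> {} \<and> S \<subseteq> reach ?A {x} \<and> conn (set es) S \<longrightarrow> cnt S es + 1 \<le> card S + r)"
    by (intro ball_cong refl eq)
  also have "\<dots> \<longleftrightarrow> sol r W es"
  proof
    assume *: "\<forall>x\<in>W. \<forall>S. S \<noteq> {} \<and> S \<subseteq> reach ?A {x} \<and> conn (set es) S \<longrightarrow> cnt S es + 1 \<le> card S + r"
    show "sol r W es"
      unfolding sol_def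
    proof (intro allI impI)
      fix S assume "S \<noteq> {} \<and> S \<subseteq> W \<and> conn (set es) S"
      then have S: "S \<noteq> {}" "S \<subseteq> W" "conn (set es) S" by simp_all
      from S(1) obtain x where x: "x \<in> S" by blast
      have "{p \<in> set es. inside S p} \<subseteq> ?A" by (blast intro: inside_mono[OF _ S(2)])
      with S(3) have "conn ?A S" by (rule conn_mono)
      then have "S \<subseteq> reach ?A {x}" using x by (rule conn_subset_reach)
      moreover have "x \<in> W" using S(2) x by (rule subsetD)
      ultimately show "cnt S es + 1 \<le> card S + r" using *[rule_format, of x S] S by simp
    qed
  next
    assume "sol r W es"
    then have *: "cnt S es + 1 \<le> card S + r" if "S \<noteq> {}" "S \<subseteq> W" "conn (set es) S" for S
      using that by (simp add: sol_def)
    show "\<forall>x\<in>W. \<forall>S. S \<noteq> {} \<and> S \<subseteq> reach ?A {x} \<and> conn (set es) S \<longrightarrow> cnt S es + 1 \<le> card S + r"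
    proof (intro ballI allI impI)
      fix x S assume "x \<in> W" "S \<noteq> {} \<and> S \<subseteq> reach ?A {x} \<and> conn (set es) S"
      then show "cnt S es + 1 \<le> card S + r" using order_trans[OF _ R[of x], of S] by (intro *) simp_all
    qed
  qed
  finally show ?thesis .
qed

definition ok :: "nat \<Rightarrow> nat set \<Rightarrow> (nat \<times> nat) list \<Rightarrow> nat \<Rightarrow> bool" where
  "ok r V es k \<longleftrightarrow> (\<exists>X\<subseteq>V. card X \<le> k \<and> sol r (V - X) es)"

lemma pseudoforest_deletion_iff_ok:
  "pseudoforest_deletion r (graph_of (vs, es, k)) k' \<longleftrightarrow> k' \<ge> 0 \<and> ok r (set vs) es (nat k')"
proof -
  have "pseudoforest r (delete_verts (graph_of (vs, es, k)) X) \<longleftrightarrow> sol r (set vs - X) es" for X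
    by (rule forest_delete_iff_sol)
      (auto simp: delete_verts_def induced_subgraph_def inside_def)
  note iff = this
  have fin: "finite X" if "X \<subseteq> set vs" for X by (rule finite_subset[OF that]) simp
  show ?thesis
  proof (cases "k' \<ge> 0")
    case True
    have V: "verts (graph_of (vs, es, k)) = set vs" by simp
    have c: "int n \<le> k' \<longleftrightarrow> n \<le> nat k'" for n using True by linarith
    show ?thesis
      unfolding pseudoforest_deletion_def ok_def iff V c using True fin by blast
  next
    case False
    then show ?thesis by (auto simp: pseudoforest_deletion_def)
  qed
qed

section \<open>Correctness of the reduction rules\<close>

definition avoid :: "nat set \<Rightarrow> (nat \<times> nat) list \<Rightarrow> (nat \<times> nat) list" where
  "avoid U es = filter (\<lambda>p. \<not> touch U p) es"

section \<open>Solutions under deletion of vertices and edges\<close>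

lemma solD: "sol r W es \<Longrightarrow> S \<noteq> {} \<Longrightarrow> S \<subseteq> W \<Longrightarrow> conn (set es) S \<Longrightarrow> cnt S es + 1 \<le> card S + r"
  by (simp add: sol_def)

lemma solI:
  assumes "\<And>S. S \<noteq> {} \<Longrightarrow> S \<subseteq> W \<Longrightarrow> conn (set es) S \<Longrightarrow> cnt S es + 1 \<le> card S + r"
  shows "sol r W es"
  using assms by (simp add: sol_def)

lemma okI: "X \<subseteq> V \<Longrightarrow> card X \<le> k \<Longrightarrow> sol r (V - X) es \<Longrightarrow> ok r V es k"
  by (auto simp: ok_def)

lemma okE:
  assumes "ok r V es k"
  obtains X where "X \<subseteq> V" "card X \<le> k" "sol r (V - X) es"
  using assms by (auto simp: ok_def)

lemma cnt_filter: "S \<subseteq> W \<Longrightarrow> cnt S (filter (inside W) es) = cnt S es"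
  unfolding cnt_def filter_filter by (rule arg_cong[of _ _ length], rule filter_cong) (auto intro: inside_mono)

lemma conn_filter: "S \<subseteq> W \<Longrightarrow> conn (set (filter (inside W) es)) S \<longleftrightarrow> conn (set es) S"
  by (auto intro!: conn_mono intro: inside_mono elim!: conn_mono)

text \<open>Both the connectivity of a subset of \<open>W\<close> and its edge count depend only on
  the edges inside \<open>W\<close>. Rules that alter edges meeting the deleted vertices are
  therefore justified by comparing two filtered lists.\<close>

lemma sol_filter_eq:
  assumes "filter (inside W) es = filter (inside W) es'"
  shows "sol r W es \<longleftrightarrow> sol r W es'"
proof -
  have "cnt S es = cnt S es'" "conn (set es) S \<longleftrightarrow> conn (set es') S" if "S \<subseteq> W" for S
    using that assms cnt_filter[of S W] conn_filter[of S W] by metis+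
  then show ?thesis unfolding sol_def by metis
qed

lemma filter_inside_avoid: "W \<inter> U = {} \<Longrightarrow> filter (inside W) (avoid U es) = filter (inside W) es"
  unfolding avoid_def filter_filter by (rule filter_cong) (auto simp: inside_def touch_def)

lemma sol_avoid: "W \<inter> U = {} \<Longrightarrow> sol r W (avoid U es) \<longleftrightarrow> sol r W es"
  by (rule sol_filter_eq) (rule filter_inside_avoid)

lemma sol_sub_edges:
  assumes "sol r W es" "filter (inside W) es' = filter P (filter (inside W) es)"
  shows "sol r W es'"
proof (rule solI)
  fix S assume S: "S \<noteq> {}" "S \<subseteq> W" "conn (set es') S"
  have "set (filter (inside W) es') \<subseteq> set es" unfolding assms(2) by auto
  moreover have "conn (set (filter (inside W) es')) S" using S(3) conn_filter[OF S(2)] by simp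
  ultimately have "conn (set es) S" by (elim conn_mono) auto
  then have "cnt S es + 1 \<le> card S + r" using solD[OF assms(1)] S by simp
  moreover have "cnt S es' \<le> cnt S es"
  proof -
    have "cnt S es' = cnt S (filter P (filter (inside W) es))" using cnt_filter[OF S(2), of es'] assms(2) by simp
    also have "\<dots> \<le> cnt S (filter (inside W) es)"
      unfolding cnt_def filter_filter by (rule length_filter_mono) auto
    finally show ?thesis using cnt_filter[OF S(2), of es] by simp
  qed
  ultimately show "cnt S es' + 1 \<le> card S + r" by simp
qed

lemma ok_delete_forced:
  assumes "v \<in> V" "finite V" "\<And>X. X \<subseteq> V \<Longrightarrow> card X \<le> Suc k \<Longrightarrow> sol r (V - X) es \<Longrightarrow> v \<in> X"
  shows "ok r (V - {v}) (avoid {v} es) k \<longleftrightarrow> ok r V es (Suc k)"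
proof
  assume "ok r (V - {v}) (avoid {v} es) k"
  then obtain X where X: "X \<subseteq> V - {v}" "card X \<le> k" "sol r (V - {v} - X) (avoid {v} es)" by (rule okE)
  have "sol r (V - {v} - X) es" using X(3) by (subst (asm) sol_avoid) auto
  moreover have "V - {v} - X = V - insert v X" by auto
  moreover have "card (insert v X) \<le> Suc k"
    using X(1,2) assms(2) by (metis card_insert_if finite_Diff finite_subset le_SucI not_less_eq_eq)
  ultimately show "ok r V es (Suc k)" using X(1) assms(1) by (intro okI[of "insert v X"]) auto
next
  assume "ok r V es (Suc k)"
  then obtain X where X: "X \<subseteq> V" "card X \<le> Suc k" "sol r (V - X) es" by (rule okE)
  have v: "v \<in> X" by (rule assms(3)[OF X])
  have "V - {v} - (X - {v}) = V - X" using v by auto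
  moreover have "sol r (V - X) (avoid {v} es)" using X(3) v by (subst sol_avoid) auto
  moreover have "card (X - {v}) \<le> k" using X v by (simp add: card_Diff_singleton)
  ultimately show "ok r (V - {v}) (avoid {v} es) k" using X(1) by (intro okI[of "X - {v}"]) auto
qed

lemma ok_avoidI:
  assumes "ok r V es k" "finite V"
  shows "ok r (V - U) (avoid U es) k"
proof -
  obtain X where X: "X \<subseteq> V" "card X \<le> k" "sol r (V - X) es" using assms(1) by (rule okE)
  have "sol r (V - U - (X - U)) es" by (rule sol_mono[OF X(3)]) auto
  then have "sol r (V - U - (X - U)) (avoid U es)" by (subst sol_avoid) auto
  moreover have "card (X - U) \<le> k" using card_mono[of X "X - U"] X(1,2) finite_subset[OF X(1) assms(2)] by auto
  ultimately show ?thesis using X(1) by (intro okI[of "X - U"]) auto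
qed

text \<open>A connected set that meets the component lies inside it, where the bound follows from
  that of the whole component. Hence nothing in the component ever has to be deleted.\<close>

lemma ok_delete_component:
  assumes "finite V" "set es \<subseteq> V \<times> V" "x \<in> V" "C = reach (set es) {x}" "cnt C es + 1 \<le> card C + r"
  shows "ok r (V - C) (avoid C es) k \<longleftrightarrow> ok r V es k"
proof
  assume "ok r (V - C) (avoid C es) k"
  then obtain X where X: "X \<subseteq> V - C" "card X \<le> k" "sol r (V - C - X) (avoid C es)" by (rule okE)
  have C: "C \<subseteq> V" unfolding assms(4) by (rule reach_least) (use assms(2,3) in auto)
  have finC: "finite C" using C assms(1) finite_subset by blast
  have connC: "conn (set es) C" unfolding assms(4) by (rule conn_reach)
  have sol: "sol r (V - C - X) es" using X(3) by (subst (asm) sol_avoid) auto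
  have "sol r (V - X) es"
  proof (rule solI)
    fix S assume S: "S \<noteq> {}" "S \<subseteq> V - X" "conn (set es) S"
    show "cnt S es + 1 \<le> card S + r"
    proof (cases "S \<inter> C = {}")
      case True
      then show ?thesis using S by (intro solD[OF sol]) auto
    next
      case False
      then obtain y where y: "y \<in> S" "y \<in> C" by blast
      have "S \<subseteq> reach (set es) {y}" by (rule conn_subset_reach[OF S(3) y(1)])
      also have "\<dots> = C" using y(2) reach_eq assms(4) by simp
      finally show ?thesis using conn_sol_subset[OF connC finC assms(5)] S(1) by blast
    qed
  qed
  then show "ok r V es k" using X by (intro okI[of X]) auto
qed (rule ok_avoidI[OF _ assms(1)])

text \<open>A set \<open>U\<close> is pendant at \<open>v\<close> if it induces a forest every component of which is attached
  to the rest of \<open>W\<close> by at most one edge, which leads to \<open>v\<close>.\<close>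

definition pendant :: "nat set \<Rightarrow> nat set \<Rightarrow> nat \<Rightarrow> (nat \<times> nat) list \<Rightarrow> bool" where
  "pendant W U v es \<longleftrightarrow> v \<notin> U \<and>
     (\<forall>p \<in> set es. inside W p \<and> touch U p \<longrightarrow> inside (insert v U) p) \<and>
     (\<forall>S \<subseteq> U. length (filter (\<lambda>p. touch S p \<and> inside (insert v S) p) es) \<le> card S) \<and>
     (\<forall>S \<subseteq> U. S \<noteq> {} \<and> conn (set es) S \<longrightarrow> cnt S es + 1 \<le> card S)"

text \<open>Inside \<open>S\<close>, paths enter and leave \<open>U\<close> only through
  \<open>v\<close>. So detours into \<open>U\<close> can be cut out, and without \<open>v\<close> no
  connected set has vertices both in \<open>U\<close> and outside it.\<close>

lemma conn_diff_pendant: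
  assumes S: "conn A S" and U: "\<And>p. p \<in> A \<Longrightarrow> inside S p \<Longrightarrow> touch U p \<Longrightarrow> inside (insert v U) p"
  shows "v \<in> S - U \<Longrightarrow> conn A (S - U)" and "v \<notin> S \<Longrightarrow> S \<inter> U = {} \<or> S \<subseteq> U"
proof -
  assume v: "v \<in> S - U"
  let ?B = "{p \<in> A. inside (S - U) p}"
  have "S \<subseteq> reach {p \<in> A. inside S p} {v}" using S v by (auto simp: conn_def)
  also have "\<dots> \<subseteq> reach ?B {v} \<union> U"
  proof (rule reach_least)
    show "{v} \<subseteq> reach ?B {v} \<union> U" by (simp add: reach_start)
    fix x y assume xy: "(x, y) \<in> {p \<in> A. inside S p}"
    show "x \<in> reach ?B {v} \<union> U \<longleftrightarrow> y \<in> reach ?B {v} \<union> U"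
    proof (cases "touch U (x, y)")
      case True
      then have "inside (insert v U) (x, y)" using U xy by blast
      then show ?thesis by (auto simp: inside_def reach_start)
    next
      case False
      then have "(x, y) \<in> ?B" using xy by (auto simp: inside_def touch_def)
      then have "x \<in> reach ?B {v} \<longleftrightarrow> y \<in> reach ?B {v}" by (rule reach_closed)
      with False show ?thesis by (auto simp: touch_def)
    qed
  qed
  finally show "conn A (S - U)" using v by (intro connI[of v]) auto
next
  assume v: "v \<notin> S"
  show "S \<inter> U = {} \<or> S \<subseteq> U"
  proof (cases "S \<inter> U = {}")
    case False
    then obtain x where x: "x \<in> S" "x \<in> U" by blast
    have "S \<subseteq> reach {p \<in> A. inside S p} {x}" using S x by (auto simp: conn_def)
    also have "\<dots> \<subseteq> U"
    proof (rule reach_least)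
      show "{x} \<subseteq> U" using x by simp
      fix a b assume "(a, b) \<in> {p \<in> A. inside S p}"
      then have ab: "(a, b) \<in> A" "inside S (a, b)" by auto
      then show "a \<in> U \<longleftrightarrow> b \<in> U" using U[OF ab] v by (auto simp: inside_def touch_def)
    qed
    finally show ?thesis by simp
  qed simp
qed

text \<open>A connected set \<open>S\<close> that contains \<open>v\<close> consists of
  \<open>S - U\<close>, which is still connected, and \<open>S Int U\<close>, which contributes at
  most one edge per vertex and thus no excess. Without \<open>v\<close> the set lies on one side,
  and inside \<open>U\<close> it is a tree.\<close>

lemma sol_pendant:
  assumes p: "pendant W U v es" and s: "sol r (W - U) es" and fin: "finite W"
  shows "sol r W es"
proof (rule solI)
  fix S assume S: "S \<noteq> {}" "S \<subseteq> W" "conn (set es) S"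
  have U: "inside (insert v U) p" if "p \<in> set es" "inside S p" "touch U p" for p
    using p that inside_mono[OF that(2) S(2)] unfolding pendant_def by blast
  have finS: "finite S" using S(2) fin finite_subset by blast
  show "cnt S es + 1 \<le> card S + r"
  proof (cases "v \<in> S")
    case False
    from conn_diff_pendant(2)[OF S(3) U False] consider "S \<inter> U = {}" | "S \<subseteq> U" by blast
    then show ?thesis
    proof cases
      case 1
      then show ?thesis using S by (intro solD[OF s]) auto
    next
      case 2
      then have "cnt S es + 1 \<le> card S" using p S unfolding pendant_def by blast
      then show ?thesis by simp
    qed
  next
    case True
    then have v: "v \<in> S - U" using p by (simp add: pendant_def)
    have "conn (set es) (S - U)" by (rule conn_diff_pendant(1)[OF S(3) U v])
    then have 1: "cnt (S - U) es + 1 \<le> card (S - U) + r" using S v by (intro solD[OF s]) auto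
    have "cnt S es \<le> cnt (S - U) es + length (filter (\<lambda>p. touch (S \<inter> U) p \<and> inside (insert v (S \<inter> U)) p) es)"
      unfolding cnt_def
    proof (rule length_filter_le_add)
      fix p assume p: "p \<in> set es" "inside S p"
      show "inside (S - U) p \<or> touch (S \<inter> U) p \<and> inside (insert v (S \<inter> U)) p"
      proof (cases "touch U p")
        case True
        then show ?thesis using U[OF p True] p(2) by (auto simp: inside_def touch_def)
      next
        case False
        then show ?thesis using p(2) by (auto simp: inside_def touch_def)
      qed
    qed
    moreover have "length (filter (\<lambda>p. touch (S \<inter> U) p \<and> inside (insert v (S \<inter> U)) p) es) \<le> card (S \<inter> U)"
      using p unfolding pendant_def by blast
    moreover have "card S = card (S \<inter> U) + card (S - U)" using finS by (rule card_Int_Diff)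
    ultimately show ?thesis using 1 by simp
  qed
qed

section \<open>Vertices of degree one and two\<close>

definition other :: "nat \<Rightarrow> nat \<times> nat \<Rightarrow> nat" where
  "other u p = (if fst p = u then snd p else fst p)"

lemma touch_singleton: "touch {u} p \<longleftrightarrow> fst p = u \<or> snd p = u"
  by (simp add: touch_def)

lemma inside_singleton: "inside {u} p \<longleftrightarrow> fst p = u \<and> snd p = u"
  by (simp add: inside_def)

text \<open>The vertex is pendant at its only neighbour.\<close>

lemma ok_delete_leaf:
  assumes "finite V" "length (filter (touch {u}) es) \<le> 1" "filter (inside {u}) es = []"
  shows "ok r (V - {u}) (avoid {u} es) k \<longleftrightarrow> ok r V es k"
proof
  assume "ok r (V - {u}) (avoid {u} es) k"
  then obtain X where X: "X \<subseteq> V - {u}" "card X \<le> k" "sol r (V - {u} - X) (avoid {u} es)" by (rule okE)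
  have nl: "\<not> inside {u} p" if "p \<in> set es" for p using assms(3) that by (simp add: filter_empty_conv)
  have sol: "sol r (V - X - {u}) es"
  proof -
    have "V - {u} - X = V - X - {u}" by auto
    then show ?thesis using X(3) sol_avoid[of "V - X - {u}" "{u}" r es] by simp
  qed
  obtain v where v: "v \<noteq> u" "\<And>p. p \<in> set es \<Longrightarrow> touch {u} p \<Longrightarrow> inside {v, u} p"
  proof (cases "filter (touch {u}) es")
    case Nil
    \<comment> \<open>An isolated vertex is pendant at any other number, whether or not that number
      is a vertex.\<close>
    then show ?thesis using that[of "Suc u"] by (simp add: filter_empty_conv)
  next
    case (Cons p ps)
    then have "ps = []" using assms(2) by simp
    then have *: "{q \<in> set es. touch {u} q} = {p}" using Cons by (metis list.set(1) list.simps(15) set_filter)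
    then have p: "p \<in> set es" "touch {u} p" by auto
    show ?thesis
    proof (rule that[of "other u p"])
      show "other u p \<noteq> u" using p nl[of p] by (auto simp: other_def touch_def inside_def)
      fix q assume "q \<in> set es" "touch {u} q"
      then have "q = p" using * by blast
      then show "inside {other u p, u} q" using p(2) by (auto simp: other_def touch_def inside_def)
    qed
  qed
  have "pendant (V - X) {u} v es"
    unfolding pendant_def
  proof (intro conjI ballI allI impI)
    show "v \<notin> {u}" using v(1) by simp
    show "inside {v, u} p" if "p \<in> set es" "inside (V - X) p \<and> touch {u} p" for p using v(2) that by blast
    fix S assume "S \<subseteq> {u}"
    then have S: "S = {} \<or> S = {u}" by blast
    have "length (filter (\<lambda>p. touch {u} p \<and> inside (insert v {u}) p) es) \<le> length (filter (touch {u}) es)"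
      by (rule length_filter_mono) simp
    then show "length (filter (\<lambda>p. touch S p \<and> inside (insert v S) p) es) \<le> card S"
      using S assms(2) by (auto simp: touch_def)
    assume "S \<noteq> {} \<and> conn (set es) S"
    then show "cnt S es + 1 \<le> card S" using S assms(3) by (auto simp: cnt_def)
  qed
  then have "sol r (V - X) es" by (rule sol_pendant) (use sol assms(1) in auto)
  then show "ok r V es k" using X by (intro okI[of X]) auto
qed (rule ok_avoidI[OF _ assms(1)])

lemma length_filter_eq_add:
  assumes "\<And>x. x \<in> set xs \<Longrightarrow> R x \<longleftrightarrow> P x \<or> Q x" "\<And>x. x \<in> set xs \<Longrightarrow> P x \<Longrightarrow> \<not> Q x"
  shows "length (filter R xs) = length (filter P xs) + length (filter Q xs)"
  by (rule antisym; (rule length_filter_le_add | rule length_filter_disj)) (use assms in blast)+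

text \<open>Suppressing \<open>u\<close> removes one vertex and one edge, so a connected set through
  \<open>u\<close> keeps its excess when it contains \<open>a\<close> or \<open>b\<close>. A
  solution that deletes \<open>u\<close> is repaired by deleting \<open>a\<close> instead. If
  \<open>a = b\<close>, the new edge is a loop.\<close>

lemma ok_contract:
  assumes fin: "finite V" and es: "set es \<subseteq> V \<times> V" and pq: "filter (touch {u}) es = [p, q]"
    and nl: "filter (inside {u}) es = []" and ab: "a = other u p" "b = other u q"
  shows "ok r (V - {u}) ((a, b) # avoid {u} es) k \<longleftrightarrow> ok r V es k"
proof -
  let ?es = "(a, b) # avoid {u} es"
  have set_pq: "{x \<in> set es. touch {u} x} = {p, q}" using arg_cong[OF pq, of set] by simp
  then have p: "p \<in> set es" "touch {u} p" and q: "q \<in> set es" "touch {u} q" by blast+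
  have nl': "\<not> inside {u} x" if "x \<in> set es" for x using nl that by (simp add: filter_empty_conv)
  have au: "a \<noteq> u" "b \<noteq> u" using nl'[OF p(1)] nl'[OF q(1)] p q ab by (auto simp: other_def touch_def inside_def)
  have p_ends: "inside T p \<longleftrightarrow> u \<in> T \<and> a \<in> T" and q_ends: "inside T q \<longleftrightarrow> u \<in> T \<and> b \<in> T" for T
    using p(2) q(2) ab by (auto simp: other_def touch_def inside_def)
  have p_cases: "p = (u, a) \<or> p = (a, u)" and q_cases: "q = (u, b) \<or> q = (b, u)"
    using p(2) q(2) ab by (auto simp: other_def touch_def prod_eq_iff)
  have aV: "a \<in> V" using es p(1) p_cases by blast
  have av: "x \<in> set (avoid {u} es) \<longleftrightarrow> x \<in> set es \<and> x \<noteq> p \<and> x \<noteq> q" for x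
    using set_pq p q by (auto simp: avoid_def)
  have in_av: "x \<in> set es \<Longrightarrow> u \<notin> T \<Longrightarrow> inside T x \<Longrightarrow> x \<in> set (avoid {u} es)" for x T
    by (auto simp: avoid_def inside_def touch_def)
  have cnt_av: "cnt T (avoid {u} es) = cnt T es" if "u \<notin> T" for T
  proof -
    have "filter (inside T) (avoid {u} es) = filter (inside T) es" by (rule filter_inside_avoid) (use that in auto)
    then show ?thesis by (simp add: cnt_def)
  qed
  have cnt_es: "cnt T ?es = cnt T es + of_bool (a \<in> T \<and> b \<in> T)" if "u \<notin> T" for T
    using cnt_av[OF that] by (simp add: cnt_def inside_def)
  have cnt_u: "cnt (insert u T) es = cnt T es + of_bool (a \<in> T) + of_bool (b \<in> T)" if "u \<notin> T" for T
  proof -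
    have "cnt (insert u T) es = length (filter (inside T) es) + length (filter (\<lambda>x. touch {u} x \<and> inside (insert u T) x) es)"
      unfolding cnt_def by (rule length_filter_eq_add) (use that in \<open>auto simp: inside_def touch_def\<close>)
    also have "filter (\<lambda>x. touch {u} x \<and> inside (insert u T) x) es = filter (inside (insert u T)) [p, q]"
      unfolding pq[symmetric] filter_filter ..
    finally show ?thesis using au by (simp add: cnt_def p_ends q_ends)
  qed
  show ?thesis
  proof
    assume "ok r (V - {u}) ?es k"
    then obtain X where X: "X \<subseteq> V - {u}" "card X \<le> k" "sol r (V - {u} - X) ?es" by (rule okE)
    have "sol r (V - X) es"
    proof (rule solI)
      fix S assume S: "S \<noteq> {}" "S \<subseteq> V - X" "conn (set es) S"
      have finS: "finite S" using S(2) fin by (meson finite_Diff finite_subset)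
      show "cnt S es + 1 \<le> card S + r"
      proof (cases "u \<in> S")
        case False
        have "{x \<in> set es. inside S x} \<subseteq> set ?es" using in_av[OF _ False] by auto
        with S(3) have "conn (set ?es) S" by (rule conn_mono)
        then have "cnt S ?es + 1 \<le> card S + r" using S False by (intro solD[OF X(3)]) auto
        then show ?thesis using cnt_es[OF False] by simp
      next
        case True
        define T where "T = S - {u}"
        have T: "u \<notin> T" "S = insert u T" using True by (auto simp: T_def)
        have cS: "card S = card T + 1" using T finS by simp
        show ?thesis
        proof (cases "a \<in> T \<or> b \<in> T")
          \<comment> \<open>Without \<open>a\<close> and \<open>b\<close> no edge leads from
            \<open>u\<close> into the rest of \<open>S\<close>, so \<open>S\<close> is just
            \<open>u\<close>. The vertex \<open>Suc (Max S)\<close> serves as a point of attachment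
            that is certainly outside \<open>S\<close>.\<close>
          case False
          have "S \<inter> {u} = {} \<or> S \<subseteq> {u}"
          proof (rule conn_diff_pendant(2)[OF S(3), of "{u}" "Suc (Max S)"])
            fix x assume x: "x \<in> set es" "inside S x" "touch {u} x"
            then have "x = p \<or> x = q" using set_pq by blast
            then have "a \<in> S \<or> b \<in> S" using x(2) p_ends[of S] q_ends[of S] by blast
            then show "inside {Suc (Max S), u} x" unfolding T(2) using au False by simp
          next
            show "Suc (Max S) \<notin> S" using finS Max_ge Suc_n_not_le_n by blast
          qed
          then have "T = {}" using True T_def by blast
          then show ?thesis using cnt_u[OF T(1)] T(2) cS by (simp add: cnt_def inside_def)
        next
          case ab': True
          \<comment> \<open>Connectivity of \<open>T\<close> is shown from a neighbour of
            \<open>u\<close> in \<open>T\<close>. A passage through \<open>u\<close> runs between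
            \<open>a\<close> and \<open>b\<close>, and the new edge replaces it.\<close>
          define c where "c = (if a \<in> T then a else b)"
          have c: "c \<in> T" "c = a \<or> c = b" using ab' by (auto simp: c_def)
          let ?B = "{x \<in> set ?es. inside T x}"
          have "S \<subseteq> reach {x \<in> set es. inside S x} {c}" using S(3) c(1) T(2) by (auto simp: conn_def)
          also have "\<dots> \<subseteq> reach ?B {c} \<union> {u}"
          proof (rule reach_least)
            show "{c} \<subseteq> reach ?B {c} \<union> {u}" by (simp add: reach_start)
            have d: "d \<in> reach ?B {c}" if "d \<in> T" "d = a \<or> d = b" for d
            proof (cases "d = c")
              case False
              then have "(c, d) = (a, b) \<or> (d, c) = (a, b)" using c(2) that(2) by auto
              then have "(c, d) \<in> ?B \<or> (d, c) \<in> ?B" using c(1) that(1) by (auto simp: inside_def)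
              with reach_start[of c "{c}" ?B] show ?thesis by (intro reach_step[of c ?B "{c}" d]) auto
            qed (simp add: reach_start)
            fix x y assume "(x, y) \<in> {x \<in> set es. inside S x}"
            then have xy: "(x, y) \<in> set es" "inside S (x, y)" by auto
            show "x \<in> reach ?B {c} \<union> {u} \<longleftrightarrow> y \<in> reach ?B {c} \<union> {u}"
            proof (cases "touch {u} (x, y)")
              case True
              then have "(x, y) \<in> {p, q}" using set_pq xy(1) by blast
              then have "(x, y) = (u, a) \<or> (x, y) = (a, u) \<or> (x, y) = (u, b) \<or> (x, y) = (b, u)"
                using p_cases q_cases by auto
              then show ?thesis using xy(2) d T au by (auto simp: inside_def)
            next
              case False
              then have "inside T (x, y)" using xy(2) T(2) by (auto simp: inside_def touch_def)
              then have "(x, y) \<in> ?B" using in_av[OF xy(1) T(1)] by auto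
              then have "x \<in> reach ?B {c} \<longleftrightarrow> y \<in> reach ?B {c}" by (rule reach_closed)
              with False show ?thesis by (auto simp: touch_def)
            qed
          qed
          finally have "conn (set ?es) T" using c(1) T by (intro connI[of c]) auto
          then have "cnt T ?es + 1 \<le> card T + r" using c(1) T S(2) by (intro solD[OF X(3)]) auto
          then show ?thesis using cnt_es[OF T(1)] cnt_u[OF T(1)] T(2) cS by (auto simp: of_bool_def split: if_splits)
        qed
      qed
    qed
    then show "ok r V es k" using X by (intro okI[of X]) auto
  next
    assume "ok r V es k"
    then obtain X where X: "X \<subseteq> V" "card X \<le> k" "sol r (V - X) es" by (rule okE)
    have finX: "finite X" using X(1) fin finite_subset by blast
    have no_ab: "cnt S ?es + 1 \<le> card S + r"
      if S: "S \<noteq> {}" "S \<subseteq> V - X" "u \<notin> S" "conn (set ?es) S" "\<not> (a \<in> S \<and> b \<in> S)" for S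
    proof -
      have "{x \<in> set ?es. inside S x} \<subseteq> set es" using S(5) by (auto simp: av inside_def)
      with S(4) have "conn (set es) S" by (rule conn_mono)
      then have "cnt S es + 1 \<le> card S + r" using S by (intro solD[OF X(3)]) auto
      then show ?thesis using cnt_es[OF S(3)] S(5) by simp
    qed
    show "ok r (V - {u}) ?es k"
    proof (cases "u \<in> X")
      case True
      \<comment> \<open>The new edge must be hit once \<open>u\<close> is gone; \<open>a\<close>
        takes the place of \<open>u\<close> in the solution.\<close>
      have "sol r (V - {u} - insert a (X - {u})) ?es"
        by (rule solI, rule no_ab) auto
      moreover have "card (insert a (X - {u})) \<le> k"
        using X(2) True finX card_insert_le_m1[of "card X" "X - {u}" a]
        by (metis card_Diff_singleton card_gt_0_iff card_insert_le_m1 empty_iff le_refl le_trans)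
      ultimately show ?thesis using X(1) aV au by (intro okI[of "insert a (X - {u})"]) auto
    next
      case False
      have "sol r (V - {u} - X) ?es"
      proof (rule solI)
        fix S assume S: "S \<noteq> {}" "S \<subseteq> V - {u} - X" "conn (set ?es) S"
        have uS: "u \<notin> S" using S(2) by auto
        have finS: "finite S" using S(2) fin by (meson finite_Diff finite_subset)
        show "cnt S ?es + 1 \<le> card S + r"
        proof (cases "a \<in> S \<and> b \<in> S")
          case False
          then show ?thesis using S uS by (intro no_ab) auto
        next
          case True
          \<comment> \<open>Subdividing the new edge again by \<open>u\<close> gives a connected set
            of the old graph with the same excess.\<close>
          let ?T = "insert u S"
          let ?B = "{x \<in> set es. inside ?T x}"
          have pB: "p \<in> ?B" "q \<in> ?B" using p q True p_ends q_ends by auto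
          have uR: "u \<in> reach ?B {a}"
            using pB(1) p_cases reach_start[of a "{a}" ?B] reach_step[of a ?B "{a}" u] by auto
          have bR: "b \<in> reach ?B {a}"
            using pB(2) q_cases uR reach_step[of u ?B "{a}" b] by auto
          have "S \<subseteq> reach {x \<in> set ?es. inside S x} {a}" using S(3) True by (auto simp: conn_def)
          also have "\<dots> \<subseteq> reach ?B {a}"
          proof (rule reach_least)
            show "{a} \<subseteq> reach ?B {a}" by (simp add: reach_start)
            fix x y assume "(x, y) \<in> {x \<in> set ?es. inside S x}"
            then have xy: "(x, y) \<in> set ?es" "inside S (x, y)" by auto
            show "x \<in> reach ?B {a} \<longleftrightarrow> y \<in> reach ?B {a}"
            proof (cases "(x, y) = (a, b)")
              case True
              then show ?thesis using bR reach_start[of a "{a}" ?B] by auto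
            next
              case False
              then have "(x, y) \<in> ?B" using xy av[of "(x, y)"] by (auto simp: inside_def)
              then show ?thesis by (rule reach_closed)
            qed
          qed
          finally have "conn (set es) ?T" using uR True by (intro connI[of a]) auto
          then have "cnt ?T es + 1 \<le> card ?T + r" using S(1,2) False X(1) p(1) es p_cases by (intro solD[OF X(3)]) auto
          then show ?thesis using cnt_es[OF uS] cnt_u[OF uS] True finS uS by simp
        qed
      qed
      then show ?thesis using X False by (intro okI[of X]) auto
    qed
  qed
qed

section \<open>Parallel edges, loops and petals\<close>

definition parallel :: "nat \<times> nat \<Rightarrow> nat \<times> nat \<Rightarrow> bool" where
  "parallel p q \<longleftrightarrow> {fst p, snd p} = {fst q, snd q}"

text \<open>Two vertices may span at most \<open>2 + r - 1 = r + 1\<close> edges, so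
  \<open>r + 2\<close> parallel ones are the smallest bundle that forces one of its ends to be
  deleted.\<close>

lemma parallel_bundle_hit:
  assumes "sol r (V - X) es" "a \<in> V" "b \<in> V" "a \<noteq> b" "length (filter (parallel (a, b)) es) \<ge> r + 2"
  shows "a \<in> X \<or> b \<in> X"
proof (rule ccontr)
  assume *: "\<not> (a \<in> X \<or> b \<in> X)"
  let ?S = "{a, b}"
  obtain p where p: "p \<in> set es" "parallel (a, b) p"
  proof -
    have "filter (parallel (a, b)) es \<noteq> []" using assms(5) by auto
    then show thesis using that unfolding filter_empty_conv by blast
  qed
  have "conn (set es) ({a} \<union> {b})"
  proof (rule conn_Un[of _ _ _ a b])
    show "a = b \<or> (a, b) \<in> set es \<or> (b, a) \<in> set es"
      using p by (cases p) (auto simp: parallel_def doubleton_eq_iff)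
  qed (auto intro: conn_singleton)
  then have "cnt ?S es + 1 \<le> card ?S + r"
    using * assms(2,3) by (intro solD[OF assms(1)]) (auto simp: insert_commute)
  moreover have "length (filter (parallel (a, b)) es) \<le> cnt ?S es"
    unfolding cnt_def by (rule length_filter_mono) (auto simp: parallel_def inside_def)
  ultimately show False using assms(4,5) by simp
qed

text \<open>Before and after thinning every solution deletes \<open>a\<close> or \<open>b\<close>,
  and then none of the parallel edges survives.\<close>

lemma ok_thin_parallel:
  assumes "a \<noteq> b" "a \<in> V" "b \<in> V" "length (filter (parallel (a, b)) es) \<ge> r + 2"
  shows "ok r V (filter (\<lambda>p. \<not> parallel (a, b) p) es @ replicate (r + 2) (a, b)) k \<longleftrightarrow> ok r V es k"
proof -
  let ?es = "filter (\<lambda>p. \<not> parallel (a, b) p) es @ replicate (r + 2) (a, b)"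
  have inside_par: "inside W p \<longleftrightarrow> a \<in> W \<and> b \<in> W" if "parallel (a, b) p" for p W
    using that by (auto simp: parallel_def inside_def doubleton_eq_iff)
  have eq: "sol r (V - X) ?es \<longleftrightarrow> sol r (V - X) es" if "a \<in> X \<or> b \<in> X" for X
  proof (rule sol_filter_eq)
    have "filter (inside (V - X)) (filter (\<lambda>p. \<not> parallel (a, b) p) es) = filter (inside (V - X)) es"
      unfolding filter_filter by (rule filter_cong) (use that inside_par in auto)
    moreover have "\<not> inside (V - X) (a, b)" using that by (auto simp: inside_def)
    ultimately show "filter (inside (V - X)) ?es = filter (inside (V - X)) es" by simp
  qed
  have "length (filter (parallel (a, b)) ?es) \<ge> r + 2" by (simp add: parallel_def)
  then have hit: "a \<in> X \<or> b \<in> X" if "sol r (V - X) ?es" for X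
    using parallel_bundle_hit[OF that assms(2,3,1)] by simp
  have hit': "a \<in> X \<or> b \<in> X" if "sol r (V - X) es" for X
    using parallel_bundle_hit[OF that assms(2,3,1,4)] .
  show ?thesis
    unfolding ok_def using eq hit hit' by metis
qed

lemma loops_hit:
  assumes "sol r (V - X) es" "v \<in> V" "length (filter (inside {v}) es) \<ge> r + 1"
  shows "v \<in> X"
proof (rule ccontr)
  assume "v \<notin> X"
  then have "cnt {v} es + 1 \<le> card {v} + r" using assms(2) by (intro solD[OF assms(1)] conn_singleton) auto
  then show False using assms(3) by (simp add: cnt_def)
qed

lemma disjoint_hits:
  assumes "finite X" "\<And>i j. i \<in> I \<Longrightarrow> j \<in> I \<Longrightarrow> i \<noteq> j \<Longrightarrow> D i \<inter> D j = {}"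
  shows "card {i \<in> I. D i \<inter> X \<noteq> {}} \<le> card X"
proof -
  define h where "h i = (SOME x. x \<in> D i \<inter> X)" for i
  have h: "h i \<in> D i \<inter> X" if "i \<in> {i \<in> I. D i \<inter> X \<noteq> {}}" for i
    unfolding h_def by (rule someI_ex) (use that in auto)
  have "inj_on h {i \<in> I. D i \<inter> X \<noteq> {}}"
  proof (rule inj_onI)
    fix i j assume ij: "i \<in> {i \<in> I. D i \<inter> X \<noteq> {}}" "j \<in> {i \<in> I. D i \<inter> X \<noteq> {}}" "h i = h j"
    then show "i = j" using h[OF ij(1)] h[OF ij(2)] assms(2)[of i j] by auto
  qed
  then show ?thesis by (rule card_inj_on_le) (use h assms(1) in auto)
qed

lemma petals_cnt:
  assumes "finite I" "\<And>i j. i \<in> I \<Longrightarrow> j \<in> I \<Longrightarrow> i \<noteq> j \<Longrightarrow> D i \<inter> D j = {}"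
    and "\<And>i. i \<in> I \<Longrightarrow> D i \<inter> B = {}"
    and "\<And>i. i \<in> I \<Longrightarrow> card (D i) + 1 \<le> length (filter (\<lambda>p. touch (D i) p \<and> inside (B \<union> D i) p) es)"
  shows "(\<Sum>i\<in>I. card (D i)) + card I
    \<le> length (filter (\<lambda>p. touch (\<Union>i\<in>I. D i) p \<and> inside (B \<union> (\<Union>i\<in>I. D i)) p) es)"
  using assms
proof (induction I rule: finite_induct)
  case empty
  then show ?case by simp
next
  case (insert i I)
  let ?U = "\<Union>i\<in>I. D i"
  have IH: "(\<Sum>i\<in>I. card (D i)) + card I \<le> length (filter (\<lambda>p. touch ?U p \<and> inside (B \<union> ?U) p) es)"
    using insert.prems by (intro insert.IH) auto
  have disj: "D i \<inter> (B \<union> ?U) = {}" using insert.prems(1)[of i] insert.prems(2)[of i] insert.hyps(2) by fastforce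
  have "length (filter (\<lambda>p. touch ?U p \<and> inside (B \<union> ?U) p) es) + length (filter (\<lambda>p. touch (D i) p \<and> inside (B \<union> D i) p) es)
    \<le> length (filter (\<lambda>p. touch (\<Union>i\<in>insert i I. D i) p \<and> inside (B \<union> (\<Union>i\<in>insert i I. D i)) p) es)"
    by (rule length_filter_disj) (use disj in \<open>auto simp: touch_def inside_def\<close>)
  then show ?case using IH insert.prems(3)[of i] insert.hyps by simp
qed

text \<open>Each petal brings one edge more than it has vertices, so the petals together with the
  base \<open>B\<close> have excess at least \<open>card I - card B\<close>, which must stay below
  \<open>r\<close>. The base is \<open>{v}\<close> for lobes with a cycle and \<open>{v, a}\<close>
  for lobes attached to a hub \<open>a\<close>.\<close>

lemma petals_violate:
  assumes sol: "sol r W es" and I: "finite I" "\<And>i j. i \<in> I \<Longrightarrow> j \<in> I \<Longrightarrow> i \<noteq> j \<Longrightarrow> D i \<inter> D j = {}"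
    and D: "\<And>i. i \<in> I \<Longrightarrow> D i \<inter> B = {}" "\<And>i. i \<in> I \<Longrightarrow> D i \<subseteq> W"
      "\<And>i. i \<in> I \<Longrightarrow> card (D i) + 1 \<le> length (filter (\<lambda>p. touch (D i) p \<and> inside (B \<union> D i) p) es)"
    and B: "B \<subseteq> W" "B \<noteq> {}" "finite W" "conn (set es) (B \<union> (\<Union>i\<in>I. D i))"
  shows "card I < r + card B"
proof -
  let ?S = "B \<union> (\<Union>i\<in>I. D i)"
  have fin: "finite B" by (rule finite_subset[OF B(1,3)])
  have finD: "finite (D i)" if "i \<in> I" for i by (rule finite_subset[OF D(2)[OF that] B(3)])
  have "cnt ?S es + 1 \<le> card ?S + r"
    using B D(2) by (intro solD[OF sol]) auto
  moreover have "card ?S = card B + (\<Sum>i\<in>I. card (D i))"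
  proof -
    have "card ?S = card B + card (\<Union>i\<in>I. D i)"
      using fin finD I(1) D(1) by (intro card_Un_disjoint) auto
    moreover have "card (\<Union>i\<in>I. D i) = (\<Sum>i\<in>I. card (D i))"
      using finD I by (intro card_UN_disjoint) auto
    ultimately show ?thesis by simp
  qed
  moreover have "(\<Sum>i\<in>I. card (D i)) + card I \<le> cnt ?S es"
    unfolding cnt_def
    by (rule order_trans[OF petals_cnt[OF I D(1) D(3)]]) (auto intro: length_filter_mono)
  ultimately show ?thesis by simp
qed

text \<open>A lobe of \<open>v\<close> with respect to \<open>A\<close> is a component of the graph without \<open>v\<close> and \<open>A\<close>
  that is joined to \<open>v\<close> by exactly one edge.\<close>

definition lobe :: "(nat \<times> nat) list \<Rightarrow> nat \<Rightarrow> nat set \<Rightarrow> nat set \<Rightarrow> bool" where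
  "lobe es v A C \<longleftrightarrow> C \<noteq> {} \<and> v \<notin> C \<and> C \<inter> A = {} \<and> conn (set es) C \<and>
     (\<forall>p \<in> set es. touch C p \<longrightarrow> inside (insert v (A \<union> C)) p) \<and>
     length (filter (\<lambda>p. touch C p \<and> touch {v} p) es) = 1"

lemma lobe_edge:
  assumes "lobe es v A C"
  obtains p u where "p \<in> set es" "u \<in> C" "p = (v, u) \<or> p = (u, v)"
proof -
  have 1: "filter (\<lambda>p. touch C p \<and> touch {v} p) es \<noteq> []" and v: "v \<notin> C" using assms by (auto simp: lobe_def)
  from 1 obtain p where p: "p \<in> set es" "touch C p" "touch {v} p" unfolding filter_empty_conv by blast
  have "p = (v, other v p) \<or> p = (other v p, v)" "other v p \<in> C"
    using p(2,3) v by (auto simp: touch_def other_def prod_eq_iff)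
  then show thesis using that p(1) by blast
qed

lemma lobe_conn:
  assumes "lobe es v A C"
  shows "conn (set es) ({v} \<union> C)"
proof -
  obtain p u where p: "p \<in> set es" "u \<in> C" "p = (v, u) \<or> p = (u, v)" using assms by (rule lobe_edge)
  show ?thesis
    by (rule conn_Un[OF conn_singleton _ _ p(2), of _ v]) (use assms p in \<open>auto simp: lobe_def\<close>)
qed

lemma lobe_cnt:
  assumes "lobe es v A C"
  shows "length (filter (\<lambda>p. touch C p \<and> inside (insert v C) p) es) = cnt C es + 1"
proof -
  have v: "v \<notin> C" "C \<inter> A = {}" using assms by (auto simp: lobe_def)
  have cl: "inside (insert v (A \<union> C)) p" if "p \<in> set es" "touch C p" for p using assms that by (simp add: lobe_def)
  have "length (filter (\<lambda>p. touch C p \<and> inside (insert v C) p) es)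
    = length (filter (inside C) es) + length (filter (\<lambda>p. touch C p \<and> touch {v} p) es)"
  proof (rule length_filter_eq_add)
    fix p assume "p \<in> set es"
    then show "touch C p \<and> inside (insert v C) p \<longleftrightarrow> inside C p \<or> (touch C p \<and> touch {v} p)"
      using cl[of p] v by (auto simp: inside_def touch_def)
    show "inside C p \<Longrightarrow> \<not> (touch C p \<and> touch {v} p)" using v by (auto simp: inside_def touch_def)
  qed
  then show ?thesis using assms by (simp add: lobe_def cnt_def)
qed

text \<open>If \<open>v\<close> survives, the solution meets at most \<open>k\<close> of the
  disjoint lobes. At least \<open>r + 1\<close> lobes remain, each with a cycle and an edge to
  \<open>v\<close>, and these are petals at \<open>v\<close>.\<close>

lemma forced_by_lobes:
  assumes lobe: "\<And>i. i \<in> I \<Longrightarrow> lobe es v A (D i)" and D: "\<And>i. i \<in> I \<Longrightarrow> D i \<subseteq> V" "\<And>i. i \<in> I \<Longrightarrow> card (D i) \<le> cnt (D i) es"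
    and disj: "\<And>i j. i \<in> I \<Longrightarrow> j \<in> I \<Longrightarrow> i \<noteq> j \<Longrightarrow> D i \<inter> D j = {}"
    and card: "finite I" "k + r + 1 \<le> card I" and v: "v \<in> V" "finite V"
    and X: "X \<subseteq> V" "card X \<le> k" "sol r (V - X) es"
  shows "v \<in> X"
proof (rule ccontr)
  assume vX: "v \<notin> X"
  let ?I = "{i \<in> I. D i \<inter> X = {}}"
  have finX: "finite X" using X(1) v(2) by (rule finite_subset)
  have "card {i \<in> I. D i \<inter> X \<noteq> {}} \<le> card X" by (rule disjoint_hits[OF finX disj])
  moreover have "card I = card ?I + card {i \<in> I. D i \<inter> X \<noteq> {}}"
  proof -
    have "I = ?I \<union> {i \<in> I. D i \<inter> X \<noteq> {}}" by auto
    moreover have "card (?I \<union> {i \<in> I. D i \<inter> X \<noteq> {}}) = card ?I + card {i \<in> I. D i \<inter> X \<noteq> {}}"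
      using card(1) by (intro card_Un_disjoint) auto
    ultimately show ?thesis by simp
  qed
  moreover have "card ?I < r + card {v}"
  proof (rule petals_violate[OF X(3)])
    fix i assume i: "i \<in> ?I"
    then have l: "lobe es v A (D i)" using lobe by simp
    show "D i \<inter> {v} = {}" using l by (simp add: lobe_def)
    show "D i \<subseteq> V - X" using i D(1) by auto
    show "card (D i) + 1 \<le> length (filter (\<lambda>p. touch (D i) p \<and> inside ({v} \<union> D i) p) es)"
      using lobe_cnt[OF l] D(2)[of i] i by simp
    show "D i \<inter> D j = {}" if "j \<in> ?I" "i \<noteq> j" for j using i that disj by simp
  next
    show "conn (set es) ({v} \<union> (\<Union>i\<in>?I. D i))"
    proof (rule conn_star[OF conn_singleton])
      fix i assume "i \<in> ?I"
      then show "conn (set es) ({v} \<union> D i)" using lobe_conn lobe by blast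
    qed simp
  qed (use card v vX in auto)
  ultimately show False using card(2) X(2) by simp
qed

text \<open>A tree lobe together with its edge to \<open>v\<close> has exactly \<open>card C\<close>
  edges. Each vertex of \<open>C - S\<close> is reached from \<open>v\<close> and uses up one of
  those that touch \<open>C - S\<close>; what is left for \<open>S\<close> is at most
  \<open>card S\<close>.\<close>

lemma tree_lobe_touch_le:
  assumes l: "lobe es v A C" and tree: "cnt C es + 1 = card C" and S: "S \<subseteq> C"
  shows "length (filter (\<lambda>p. touch S p \<and> inside (insert v S) p) es) \<le> card S"
proof -
  let ?F = "filter (\<lambda>p. touch C p \<and> inside (insert v C) p) es"
  have finC: "finite C" using tree card.infinite by fastforce
  have vC: "v \<notin> C" using l by (simp add: lobe_def)
  have "{v} \<union> C \<subseteq> reach {p \<in> set es. inside ({v} \<union> C) p} {v}"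
    using lobe_conn[OF l] by (simp add: conn_def)
  also have "\<dots> \<subseteq> reach (set ?F) {v}"
  proof (rule reach_least)
    show "{v} \<subseteq> reach (set ?F) {v}" by (rule reach_refl)
    fix x y assume "(x, y) \<in> {p \<in> set es. inside ({v} \<union> C) p}"
    then have xy: "(x, y) \<in> set es" "inside ({v} \<union> C) (x, y)" by auto
    show "x \<in> reach (set ?F) {v} \<longleftrightarrow> y \<in> reach (set ?F) {v}"
    proof (cases "touch C (x, y)")
      case True
      then have "(x, y) \<in> set ?F" using xy by simp
      then show ?thesis by (rule reach_closed)
    next
      case False
      then have "x = v" "y = v" using xy(2) by (auto simp: inside_def touch_def)
      then show ?thesis by simp
    qed
  qed
  finally have "C - S \<subseteq> reach (set ?F) {v}" by blast
  then have "card (C - S) \<le> length (filter (touch (C - S)) ?F)"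
    using card_le_touch[of "C - S" ?F "{v}"] vC by auto
  moreover have "length (filter (\<lambda>p. touch S p \<and> inside (insert v S) p) es) + length (filter (touch (C - S)) ?F) \<le> length ?F"
    unfolding filter_filter by (rule length_filter_disj) (use S vC in \<open>auto simp: inside_def touch_def\<close>)
  moreover have "length ?F = card C" using lobe_cnt[OF l] tree by simp
  moreover have "card C = card S + card (C - S)"
    using S finC by (metis card_Int_Diff inf.absorb_iff2)
  ultimately show ?thesis by linarith
qed

text \<open>Once the hubs are deleted, the single edge to \<open>v\<close> is the only connection of
  a tree lobe to the rest, so the lobes can be ignored by \<open>sol_pendant\<close>.\<close>

lemma tree_lobes_pendant:
  assumes l: "\<And>i. i \<in> I \<Longrightarrow> lobe es v A (D i)" and tree: "\<And>i. i \<in> I \<Longrightarrow> cnt (D i) es + 1 = card (D i)"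
    and W: "W \<inter> A = {}" and I: "finite I"
  shows "pendant W (\<Union>i\<in>I. D i) v es"
proof -
  let ?U = "\<Union>i\<in>I. D i"
  have vD: "v \<notin> D i" if "i \<in> I" for i using l[OF that] by (simp add: lobe_def)
  have cl: "inside (insert v (A \<union> D i)) p" if "i \<in> I" "p \<in> set es" "touch (D i) p" for p i
    using l[OF that(1)] that(2,3) by (simp add: lobe_def)
  have DA: "D i \<inter> A = {}" if "i \<in> I" for i using l[OF that] by (simp add: lobe_def)
  have finD: "finite (D i)" if "i \<in> I" for i using tree[OF that] card.infinite by fastforce
  show ?thesis
    unfolding pendant_def
  proof (intro conjI ballI allI impI)
    show "v \<notin> ?U" using vD by blast
    fix p assume p: "p \<in> set es" "inside W p \<and> touch ?U p"
    then obtain i where i: "i \<in> I" "touch (D i) p" by (auto simp: touch_def)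
    then show "inside (insert v ?U) p" using cl[OF i(1) p(1) i(2)] p(2) W by (auto simp: inside_def)
  next
    fix S assume S: "S \<subseteq> ?U"
    let ?F = "\<lambda>T. length (filter (\<lambda>p. touch T p \<and> inside (insert v T) p) es)"
    have AU: "?U \<inter> insert v A = {}" using DA vD by blast
    have part: "?F (S \<inter> (\<Union>i\<in>J. D i)) \<le> card (S \<inter> (\<Union>i\<in>J. D i))" if "finite J" "J \<subseteq> I" for J
      using that
    proof (induction J rule: finite_induct)
      case empty
      then show ?case by (simp add: touch_def)
    next
      case (insert i J)
      \<comment> \<open>The counts are added lobe by lobe; \<open>?N\<close> is the part of
        \<open>S\<close> that the new lobe contributes.\<close>
      let ?T = "S \<inter> (\<Union>i\<in>J. D i)" and ?N = "(S \<inter> D i) - (\<Union>i\<in>J. D i)"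
      have i: "i \<in> I" using insert.prems by simp
      have fin: "finite ?T" "finite ?N" using finD insert.hyps(1) insert.prems i by auto
      have "?F (S \<inter> (\<Union>i\<in>insert i J. D i)) \<le> ?F ?T + ?F ?N"
      proof (rule length_filter_le_add)
        fix p assume p: "p \<in> set es" "touch (S \<inter> (\<Union>i\<in>insert i J. D i)) p \<and> inside (insert v (S \<inter> (\<Union>i\<in>insert i J. D i))) p"
        show "(touch ?T p \<and> inside (insert v ?T) p) \<or> (touch ?N p \<and> inside (insert v ?N) p)"
        proof (cases "touch (\<Union>i\<in>J. D i) p")
          case True
          then obtain j where j: "j \<in> J" "touch (D j) p" by (auto simp: touch_def)
          then have "inside (insert v (A \<union> D j)) p" using cl[of j p] p(1) insert.prems by blast
          then have "inside (insert v ?T) p" using p(2) AU S j(1) by (auto simp: inside_def)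
          moreover have "touch ?T p" using True p(2) vD insert.prems j by (auto simp: touch_def inside_def)
          ultimately show ?thesis by simp
        next
          case False
          then show ?thesis using p(2) by (auto simp: touch_def inside_def)
        qed
      qed
      moreover have "?F ?N \<le> card ?N" by (rule tree_lobe_touch_le[OF l[OF i] tree[OF i]]) auto
      moreover have "?F ?T \<le> card ?T" using insert.IH insert.prems by simp
      moreover have "card (S \<inter> (\<Union>i\<in>insert i J. D i)) = card ?T + card ?N"
      proof -
        have "S \<inter> (\<Union>i\<in>insert i J. D i) = ?T \<union> ?N" by auto
        moreover have "card (?T \<union> ?N) = card ?T + card ?N" using fin by (intro card_Un_disjoint) auto
        ultimately show ?thesis by simp
      qed
      ultimately show ?case by linarith
    qed
    have "S \<inter> ?U = S" using S by blast
    then show "?F S \<le> card S" using part[OF I] by simp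
    assume "S \<noteq> {} \<and> conn (set es) S"
    then have S': "S \<noteq> {}" "conn (set es) S" by simp_all
    from S'(1) S obtain i where i: "i \<in> I" "S \<inter> D i \<noteq> {}" by blast
    have "S \<inter> D i = {} \<or> S \<subseteq> D i"
    proof (rule conn_diff_pendant(2)[OF S'(2), where v = v])
      fix p assume p: "p \<in> set es" "inside S p" "touch (D i) p"
      have "inside (insert v (A \<union> D i)) p" by (rule cl[OF i(1) p(1,3)])
      then show "inside (insert v (D i)) p" using p(2) S AU by (auto simp: inside_def)
    next
      show "v \<notin> S" using S vD by blast
    qed
    then have SD: "S \<subseteq> D i" using i(2) by simp
    have "cnt S es + 1 \<le> card S + 0"
    proof (rule conn_sol_subset[OF _ finD[OF i(1)] _ SD S'(1)])
      show "conn (set es) (D i)" using l[OF i(1)] by (simp add: lobe_def)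
    qed (use tree[OF i(1)] in simp)
    then show "cnt S es + 1 \<le> card S" by simp
  qed
qed

definition expand :: "nat \<Rightarrow> nat \<Rightarrow> nat list \<Rightarrow> nat set \<Rightarrow> (nat \<times> nat) list \<Rightarrow> (nat \<times> nat) list" where
  "expand q v as U es = concat (map (\<lambda>a. replicate q (v, a)) as) @ filter (\<lambda>p. \<not> (touch {v} p \<and> touch U p)) es"

text \<open>Nothing changes for solutions containing \<open>v\<close>. Otherwise the new bundles
  force all hubs into the solution, after which the lobes are pendant in the old graph too.
  Conversely, a surviving hub \<open>a\<close> and \<open>v\<close> admit fewer than
  \<open>r + 2\<close> untouched lobes assigned to \<open>a\<close>, so the old solution meets one
  of these lobes. Different hubs give different, disjoint lobes, so the vertices deleted inside
  lobes can be exchanged for the missing hubs at no cost.\<close>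

lemma ok_expand:
  assumes fin: "finite V" "finite I" and v: "v \<in> V" and A: "set as \<subseteq> V - {v}"
    and lobe: "\<And>i. i \<in> I \<Longrightarrow> lobe es v (set as) (D i)" and tree: "\<And>i. i \<in> I \<Longrightarrow> cnt (D i) es + 1 = card (D i)"
    and D: "\<And>i. i \<in> I \<Longrightarrow> D i \<subseteq> V" "\<And>i j. i \<in> I \<Longrightarrow> j \<in> I \<Longrightarrow> i \<noteq> j \<Longrightarrow> D i \<inter> D j = {}"
    and adj: "\<And>i. i \<in> I \<Longrightarrow> \<exists>p \<in> set es. touch (D i) p \<and> touch {s i} p"
    and load: "\<And>a. a \<in> set as \<Longrightarrow> r + 2 \<le> card {i \<in> I. s i = a}"
  shows "ok r V (expand (r + 2) v as (\<Union>i\<in>I. D i) es) k \<longleftrightarrow> ok r V es k"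
proof -
  let ?U = "\<Union>i\<in>I. D i" and ?A = "set as"
  let ?es = "expand (r + 2) v as ?U es"
  have "D i \<inter> ?A = {} \<and> v \<notin> D i" if "i \<in> I" for i using lobe[OF that] by (simp add: lobe_def)
  then have UA: "?U \<inter> ?A = {}" and vU: "v \<notin> ?U" by blast+
  have new: "fst p = v \<and> snd p \<in> ?A" if "p \<in> set (concat (map (\<lambda>a. replicate (r + 2) (v, a)) as))" for p
    using that by (auto split: if_splits)
  have new0: "filter (inside W) (concat (map (\<lambda>a. replicate (r + 2) (v, a)) as)) = []" if "v \<notin> W \<or> W \<inter> ?A = {}" for W
  proof -
    have "\<not> inside W p" if "p \<in> set (concat (map (\<lambda>a. replicate (r + 2) (v, a)) as))" for p
      using new[OF that] \<open>v \<notin> W \<or> W \<inter> ?A = {}\<close> unfolding inside_def by blast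
    then show ?thesis unfolding filter_empty_conv by blast
  qed
  have eq_v: "sol r W ?es \<longleftrightarrow> sol r W es" if "v \<notin> W" for W
  proof (rule sol_filter_eq)
    show "filter (inside W) ?es = filter (inside W) es"
      unfolding expand_def filter_append new0[OF disjI1[OF that]] filter_filter append_Nil
      by (rule filter_cong) (use that in \<open>auto simp: inside_def touch_def\<close>)
  qed
  have eq_A: "sol r W ?es \<longleftrightarrow> sol r W es" if "W \<inter> ?A = {}" "W \<inter> ?U = {}" for W
  proof (rule sol_filter_eq)
    show "filter (inside W) ?es = filter (inside W) es"
      unfolding expand_def filter_append new0[OF disjI2[OF that(1)]] filter_filter append_Nil
      by (rule filter_cong) (use that in \<open>auto simp: inside_def touch_def\<close>)
  qed
  show ?thesis
  proof
    assume "ok r V ?es k"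
    then obtain X where X: "X \<subseteq> V" "card X \<le> k" "sol r (V - X) ?es" by (rule okE)
    have "sol r (V - X) es"
    proof (cases "v \<in> X")
      case True
      then show ?thesis using X(3) eq_v[of "V - X"] by simp
    next
      case False
      \<comment> \<open>The \<open>r + 2\<close> new edges between \<open>v\<close> and a hub force
        one of the two into the solution, and \<open>v\<close> is not in it.\<close>
      have "?A \<subseteq> X"
      proof
        fix a assume a: "a \<in> ?A"
        have "r + 2 \<le> length (filter (parallel (v, a)) ?es)"
        proof -
          obtain bs cs where "as = bs @ a # cs" using a by (meson split_list)
          then show ?thesis by (simp add: expand_def parallel_def)
        qed
        then have "v \<in> X \<or> a \<in> X" using a A v by (intro parallel_bundle_hit[OF X(3)]) auto
        then show "a \<in> X" using False by simp
      qed
      then have W: "(V - X) \<inter> ?A = {}" by blast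
      have "sol r (V - X - ?U) ?es" using X(3) by (rule sol_mono) blast
      then have "sol r (V - X - ?U) es" using eq_A[of "V - X - ?U"] W by blast
      moreover have "pendant (V - X) ?U v es" by (rule tree_lobes_pendant[OF lobe tree W fin(2)])
      ultimately show ?thesis using sol_pendant fin(1) by blast
    qed
    then show "ok r V es k" using X by (intro okI)
  next
    assume "ok r V es k"
    then obtain X where X: "X \<subseteq> V" "card X \<le> k" "sol r (V - X) es" by (rule okE)
    show "ok r V ?es k"
    proof (cases "v \<in> X")
      case True
      then have "sol r (V - X) ?es" using X(3) eq_v[of "V - X"] by simp
      then show ?thesis using X by (intro okI)
    next
      case False
      have finX: "finite X" using X(1) fin(1) by (rule finite_subset)
      \<comment> \<open>The exchanged solution: deletions inside the lobes are given up in favour of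
        all hubs.\<close>
      let ?Y = "(X - ?U) \<union> ?A"
      have hit: "\<exists>i. i \<in> I \<and> s i = a \<and> D i \<inter> X \<noteq> {}" if a: "a \<in> ?A - X" for a
      proof (rule ccontr)
        assume *: "\<not> ?thesis"
        let ?I = "{i \<in> I. s i = a}"
        have av: "a \<noteq> v" "a \<in> V" using a A by auto
        have "card ?I < r + card {v, a}"
        proof (rule petals_violate[OF X(3)])
          fix i assume i: "i \<in> ?I"
          then have iI: "i \<in> I" and si: "s i = a" by auto
          have l: "lobe es v ?A (D i)" by (rule lobe[OF iI])
          show disj: "D i \<inter> {v, a} = {}" using l a by (auto simp: lobe_def)
          show "D i \<subseteq> V - X" using iI D(1) * si by blast
          obtain p where p: "p \<in> set es" "touch (D i) p" "touch {a} p" using adj[OF iI] si by blast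
          \<comment> \<open>A tree has one edge less than vertices. The edge to \<open>v\<close>
            makes up for this, and an edge to \<open>a\<close> gives the surplus that makes the lobe
            a petal at \<open>{v, a}\<close>.\<close>
          have "length (filter (\<lambda>p. touch (D i) p \<and> inside (insert v (D i)) p) es)
             + length (filter (\<lambda>p. touch (D i) p \<and> touch {a} p) es)
             \<le> length (filter (\<lambda>p. touch (D i) p \<and> inside ({v, a} \<union> D i) p) es)"
            by (rule length_filter_disj) (use disj av in \<open>auto simp: inside_def touch_def\<close>)
          moreover have "filter (\<lambda>p. touch (D i) p \<and> touch {a} p) es \<noteq> []"
            unfolding filter_empty_conv using p by blast
          then have "0 < length (filter (\<lambda>p. touch (D i) p \<and> touch {a} p) es)" by simp
          ultimately show "card (D i) + 1 \<le> length (filter (\<lambda>p. touch (D i) p \<and> inside ({v, a} \<union> D i) p) es)"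
            using lobe_cnt[OF l] tree[OF iI] by linarith
          show "D i \<inter> D j = {}" if "j \<in> ?I" "i \<noteq> j" for j using iI that D(2) by simp
        next
          have ne: "?I \<noteq> {}" using load[of a] a by fastforce
          then obtain i0 where i0: "i0 \<in> ?I" by blast
          have c1: "conn (set es) ({v} \<union> (\<Union>i\<in>?I. D i))"
          proof (rule conn_star[OF conn_singleton])
            fix i assume "i \<in> ?I"
            then show "conn (set es) ({v} \<union> D i)" using lobe_conn lobe by blast
          qed simp
          obtain p where p: "p \<in> set es" "touch (D i0) p" "touch {a} p" using adj[of i0] i0 by blast
          have "D i0 \<inter> {a} = {}" using lobe[of i0] i0 a by (auto simp: lobe_def)
          then have "p = (a, other a p) \<or> p = (other a p, a)" "other a p \<in> D i0"
            using p(2,3) by (auto simp: touch_def other_def prod_eq_iff)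
          then have "conn (set es) ({a} \<union> ({v} \<union> (\<Union>i\<in>?I. D i)))"
            using i0 p(1) by (intro conn_Un[of "set es" "{a}" _ a "other a p", OF conn_singleton c1]) auto
          moreover have "{a} \<union> ({v} \<union> (\<Union>i\<in>?I. D i)) = {v, a} \<union> (\<Union>i\<in>?I. D i)" by blast
          ultimately show "conn (set es) ({v, a} \<union> (\<Union>i\<in>?I. D i))" by simp
        qed (use fin v av a False in auto)
        then show False using load[of a] a av by simp
      qed
      then obtain h where h: "\<And>a. a \<in> ?A - X \<Longrightarrow> h a \<in> I \<and> s (h a) = a \<and> D (h a) \<inter> X \<noteq> {}" by metis
      have "card (?A - X) \<le> card {i \<in> I. D i \<inter> (X \<inter> ?U) \<noteq> {}}"
      proof (rule card_inj_on_le[of h])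
        show "inj_on h (?A - X)" by (rule inj_on_inverseI[of _ s]) (use h in blast)
        show "h ` (?A - X) \<subseteq> {i \<in> I. D i \<inter> (X \<inter> ?U) \<noteq> {}}"
        proof
          fix i assume "i \<in> h ` (?A - X)"
          then have "i \<in> I" "D i \<inter> X \<noteq> {}" using h by auto
          then show "i \<in> {i \<in> I. D i \<inter> (X \<inter> ?U) \<noteq> {}}" by blast
        qed
        show "finite {i \<in> I. D i \<inter> (X \<inter> ?U) \<noteq> {}}" using fin(2) by simp
      qed
      also have "\<dots> \<le> card (X \<inter> ?U)" by (rule disjoint_hits[OF _ D(2)]) (use finX in auto)
      finally have le: "card (?A - X) \<le> card (X \<inter> ?U)" .
      have "card ?Y \<le> card (X - ?U) + card (?A - X)"
      proof -
        have "?Y \<subseteq> (X - ?U) \<union> (?A - X)" using UA by blast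
        then have "card ?Y \<le> card ((X - ?U) \<union> (?A - X))" using finX by (intro card_mono) auto
        also have "\<dots> \<le> card (X - ?U) + card (?A - X)" by (rule card_Un_le)
        finally show ?thesis .
      qed
      also have "\<dots> \<le> card X" using le card_Int_Diff[OF finX, of ?U] by simp
      finally have cY: "card ?Y \<le> k" using X(2) by simp
      have W: "(V - ?Y) \<inter> ?A = {}" by blast
      have "sol r (V - ?Y - ?U) es" using X(3) by (rule sol_mono) blast
      moreover have "pendant (V - ?Y) ?U v es" by (rule tree_lobes_pendant[OF lobe tree W fin(2)])
      ultimately have s: "sol r (V - ?Y) es" using sol_pendant fin(1) by blast
      have "sol r (V - ?Y) ?es"
      proof (rule sol_sub_edges[OF s])
        show "filter (inside (V - ?Y)) ?es = filter (\<lambda>p. \<not> (touch {v} p \<and> touch ?U p)) (filter (inside (V - ?Y)) es)"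
          unfolding expand_def filter_append new0[OF disjI2[OF W]] filter_filter append_Nil by (rule filter_cong) auto
      qed
      then show ?thesis using X(1) A cY by (intro okI[of ?Y]) auto
    qed
  qed
qed

section \<open>Ears at a vertex\<close>

text \<open>The edges are labelled by their positions here, so that sets of edges can be used although
  there may be parallel edges.\<close>

type_synonym ledge = "nat \<times> nat \<times> nat"

lemma set_enumerate_snd: "snd ` set (List.enumerate n es) = set es"
  by (metis list.set_map map_snd_enumerate)

text \<open>Translates multiplicities in the edge list into cardinalities of sets of labelled edges,
  where unions and injections are available.\<close>

lemma length_filter_enumerate:
  "length (filter P es) = card {e \<in> set (List.enumerate 0 es). P (snd e)}"
proof -
  let ?L = "filter (\<lambda>e. P (snd e)) (List.enumerate 0 es)"
  have "length (filter P es) = length (filter (\<lambda>e. P (snd e)) (List.enumerate n es))" for n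
    by (induction es arbitrary: n) auto
  moreover have "distinct ?L" by simp
  then have "card (set ?L) = length ?L" by (rule distinct_card)
  ultimately show ?thesis by simp
qed

definition minim :: "('a list \<Rightarrow> bool) \<Rightarrow> 'a list \<Rightarrow> 'a list" where
  "minim P xs = fold (\<lambda>e cur. if P (filter (\<lambda>x. x \<noteq> e) cur) then filter (\<lambda>x. x \<noteq> e) cur else cur) xs xs"

text \<open>All intermediate lists are sublists of the given one; this bounds their size in the
  running time.\<close>

lemma minim_filter: "\<exists>R. fold (\<lambda>e cur. if P (filter (\<lambda>x. x \<noteq> e) cur) then filter (\<lambda>x. x \<noteq> e) cur else cur) ys xs = filter R xs"
proof (induction ys arbitrary: xs)
  case Nil
  then show ?case by (intro exI[of _ "\<lambda>_. True"]) simp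
next
  case (Cons y ys)
  have *: "\<exists>R. fold (\<lambda>e cur. if P (filter (\<lambda>x. x \<noteq> e) cur) then filter (\<lambda>x. x \<noteq> e) cur else cur) ys (filter Q xs) = filter R xs" for Q
    using Cons[of "filter Q xs"] by (auto simp: filter_filter)
  show ?case using *[of "\<lambda>x. x \<noteq> y"] *[of "\<lambda>_. True"] by simp
qed

text \<open>One pass is enough for a monotone property: an element that could not be dropped from
  the list at its turn cannot be dropped from the smaller final list either.\<close>

lemma minim:
  assumes mono: "\<And>xs ys. set xs \<subseteq> set ys \<Longrightarrow> P xs \<Longrightarrow> P ys" and P: "P xs"
  shows "set (minim P xs) \<subseteq> set xs" "P (minim P xs)"
    "\<And>e. e \<in> set (minim P xs) \<Longrightarrow> \<not> P (filter (\<lambda>x. x \<noteq> e) (minim P xs))"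
proof -
  let ?f = "\<lambda>e cur. if P (filter (\<lambda>x. x \<noteq> e) cur) then filter (\<lambda>x. x \<noteq> e) cur else cur"
  have gen: "set (fold ?f ys cur) \<subseteq> set cur \<and> P (fold ?f ys cur) \<and>
    (\<forall>e \<in> set ys. e \<in> set (fold ?f ys cur) \<longrightarrow> \<not> P (filter (\<lambda>x. x \<noteq> e) (fold ?f ys cur)))" if "P cur" for ys cur
    using that
  proof (induction ys arbitrary: cur)
    case (Cons y ys)
    define cur' where "cur' = ?f y cur"
    have P': "P cur'" using Cons.prems by (simp add: cur'_def)
    have sub: "set cur' \<subseteq> set cur" by (auto simp: cur'_def)
    let ?r = "fold ?f ys cur'"
    have IH: "set ?r \<subseteq> set cur'" "P ?r" "\<forall>e \<in> set ys. e \<in> set ?r \<longrightarrow> \<not> P (filter (\<lambda>x. x \<noteq> e) ?r)"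
      using Cons.IH[OF P'] by auto
    have "\<not> P (filter (\<lambda>x. x \<noteq> y) ?r)" if y: "y \<in> set ?r"
    proof
      assume r: "P (filter (\<lambda>x. x \<noteq> y) ?r)"
      have "set (filter (\<lambda>x. x \<noteq> y) ?r) \<subseteq> set (filter (\<lambda>x. x \<noteq> y) cur)" using IH(1) sub by auto
      then have "P (filter (\<lambda>x. x \<noteq> y) cur)" using r by (rule mono)
      then have "cur' = filter (\<lambda>x. x \<noteq> y) cur" by (simp add: cur'_def)
      then show False using y IH(1) by auto
    qed
    then show ?case using IH sub by (simp add: cur'_def[symmetric])
  qed simp
  note * = gen[OF P, of xs, folded minim_def]
  show "set (minim P xs) \<subseteq> set xs" "P (minim P xs)" using * by simp_all
  fix e assume e: "e \<in> set (minim P xs)"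
  then have "e \<in> set xs" using * by blast
  then show "\<not> P (filter (\<lambda>x. x \<noteq> e) (minim P xs))" using * e by blast
qed

text \<open>A simple path to a target, cut at the first target on it, already does all that
  \<open>E\<close> is required to do. So by minimality \<open>E\<close> has no other edges, and the
  path meets \<open>T\<close> only at its end.\<close>

lemma minimal_path:
  fixes E :: "('l \<times> nat \<times> nat) set"
  assumes T: "\<exists>t\<in>T. t \<in> reach (snd ` E) {u}"
    and minimal: "\<And>e. e \<in> E \<Longrightarrow> \<not> (\<exists>t\<in>T. t \<in> reach (snd ` (E - {e})) {u})"
  obtains ps g where "ps \<noteq> []" "hd ps = u" "last ps \<in> T" "distinct ps" "set (butlast ps) \<inter> T = {}"
    "E = g ` {..<length ps - 1}" "inj_on g {..<length ps - 1}"
    "\<And>j. Suc j < length ps \<Longrightarrow> snd (g j) = (ps ! j, ps ! Suc j) \<or> snd (g j) = (ps ! Suc j, ps ! j)"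
    "reach (snd ` E) {u} = set ps"
proof -
  obtain t where t: "t \<in> T" "t \<in> reach (snd ` E) {u}" using T by blast
  obtain qs where qs: "qs \<noteq> []" "hd qs = u" "last qs = t" "distinct qs"
    "\<And>i. Suc i < length qs \<Longrightarrow> (qs ! i, qs ! Suc i) \<in> snd ` E \<union> (snd ` E)\<inverse>"
    using simple_path[OF t(2)] by blast
  define n where "n = (LEAST i. i < length qs \<and> qs ! i \<in> T)"
  have "length qs - 1 < length qs \<and> qs ! (length qs - 1) \<in> T" using qs(1,3) t(1) by (simp add: last_conv_nth)
  then have n: "n < length qs" "qs ! n \<in> T" unfolding n_def by (metis (mono_tags, lifting) LeastI)+
  have below: "qs ! i \<notin> T" if "i < n" for i
    using not_less_Least[of i "\<lambda>i. i < length qs \<and> qs ! i \<in> T"] that n(1) unfolding n_def by auto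
  define ps where "ps = take (Suc n) qs"
  have len: "length ps = Suc n" using n(1) by (simp add: ps_def)
  have nth: "ps ! i = qs ! i" if "i \<le> n" for i using that by (simp add: ps_def)
  have ne: "ps \<noteq> []" using len by auto
  have hd: "hd ps = u" using qs(1,2) by (simp add: ps_def hd_take)
  have last: "last ps = qs ! n" using len nth[of n] ne by (simp add: last_conv_nth)
  have dist: "distinct ps" using qs(4) by (simp add: ps_def)
  have "\<exists>e \<in> E. snd e = (ps ! j, ps ! Suc j) \<or> snd e = (ps ! Suc j, ps ! j)" if j: "j < n" for j
    using qs(5)[of j] n(1) j nth[of j] nth[of "Suc j"] by force
  then obtain g where g: "\<And>j. j < n \<Longrightarrow> g j \<in> E \<and> (snd (g j) = (ps ! j, ps ! Suc j) \<or> snd (g j) = (ps ! Suc j, ps ! j))"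
    by metis
  have inj: "inj_on g {..<n}"
  proof (rule inj_onI)
    fix j k assume jk: "j \<in> {..<n}" "k \<in> {..<n}" "g j = g k"
    then have "{ps ! j, ps ! Suc j} = {ps ! k, ps ! Suc k}" using g[of j] g[of k] by auto
    then have "ps ! j = ps ! k \<or> (ps ! j = ps ! Suc k \<and> ps ! Suc j = ps ! k)" by (auto simp: doubleton_eq_iff)
    then show "j = k" using jk(1,2) dist len by (auto simp: nth_eq_iff_index_eq)
  qed
  have reach_ps: "ps ! j \<in> reach (snd ` (g ` {..<n})) {u}" if "j \<le> n" for j
    using that
  proof (induction j)
    case 0
    then show ?case using hd ne by (simp add: reach_start hd_conv_nth[symmetric])
  next
    case (Suc j)
    have "(ps ! j, ps ! Suc j) \<in> snd ` g ` {..<n} \<or> (ps ! Suc j, ps ! j) \<in> snd ` g ` {..<n}"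
    proof -
      have "snd (g j) \<in> snd ` g ` {..<n}" using Suc.prems by simp
      moreover have "snd (g j) = (ps ! j, ps ! Suc j) \<or> snd (g j) = (ps ! Suc j, ps ! j)" using g[of j] Suc.prems by simp
      ultimately show ?thesis by metis
    qed
    moreover have "ps ! j \<in> reach (snd ` g ` {..<n}) {u}" using Suc by simp
    ultimately show ?case by (rule reach_step[rotated])
  qed
  have E: "E = g ` {..<n}"
  proof (rule ccontr)
    assume "E \<noteq> g ` {..<n}"
    moreover have sub: "g ` {..<n} \<subseteq> E"
    proof (rule image_subsetI)
      show "g j \<in> E" if "j \<in> {..<n}" for j using g[of j] that by simp
    qed
    ultimately obtain e where e: "e \<in> E" "e \<notin> g ` {..<n}" by blast
    then have "snd ` g ` {..<n} \<subseteq> snd ` (E - {e})" using sub by blast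
    from reach_mono[OF this order_refl] reach_ps[of n] have "ps ! n \<in> reach (snd ` (E - {e})) {u}" by blast
    then show False using minimal[OF e(1)] n(2) nth[of n] by auto
  qed
  have bl: "set (butlast ps) \<inter> T = {}"
  proof -
    have "x \<notin> T" if "x \<in> set (butlast ps)" for x
    proof -
      obtain i where "i < length (butlast ps)" "butlast ps ! i = x"
        using \<open>x \<in> set (butlast ps)\<close> unfolding in_set_conv_nth by blast
      then show ?thesis using below[of i] nth[of i] len by (auto simp: nth_butlast)
    qed
    then show ?thesis by blast
  qed
  have reach_eq: "reach (snd ` E) {u} = set ps"
  proof
    show "set ps \<subseteq> reach (snd ` E) {u}"
    proof
      fix x assume "x \<in> set ps"
      then obtain i where "i < length ps" "ps ! i = x" by (auto simp: in_set_conv_nth)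
      then show "x \<in> reach (snd ` E) {u}" using reach_ps[of i] len E by auto
    qed
    show "reach (snd ` E) {u} \<subseteq> set ps"
    proof (rule reach_least)
      show "{u} \<subseteq> set ps" using hd ne by auto
      fix x y assume "(x, y) \<in> snd ` E"
      then obtain j where j: "j < n" "snd (g j) = (x, y)" unfolding E by auto
      then have "x \<in> set ps \<and> y \<in> set ps" using g[OF j(1)] len nth_mem[of j ps] nth_mem[of "Suc j" ps] by auto
      then show "x \<in> set ps \<longleftrightarrow> y \<in> set ps" by simp
    qed
  qed
  show thesis
  proof (rule that[of ps g])
    show "last ps \<in> T" using last n(2) by simp
  qed (use ne hd dist bl E inj g len reach_eq in auto)
qed

text \<open>\<open>M\<close> is a union of \<open>m\<close> ears, each of which starts at \<open>v\<close>.  Its vertices other than \<open>v\<close>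
  are \<open>Z\<close> and \<open>S\<close>, where \<open>S\<close> contains the neighbours of \<open>v\<close> and the vertices of degree three.\<close>

definition ears_inv :: "nat \<Rightarrow> ledge set \<Rightarrow> nat set \<Rightarrow> nat set \<Rightarrow> nat \<Rightarrow> bool" where
  "ears_inv v M Z S m \<longleftrightarrow> finite M \<and> finite Z \<and> finite S \<and> Z \<inter> S = {} \<and> v \<notin> Z \<and> v \<notin> S \<and>
     (\<forall>e \<in> M. inside (insert v (Z \<union> S)) (snd e)) \<and>
     (\<forall>e \<in> M. touch {v} (snd e) \<longrightarrow> other v (snd e) \<in> S) \<and>
     card M = card (Z \<union> S) + m \<and>
     (\<forall>x \<in> Z. card {e \<in> M. touch {x} (snd e)} \<le> 2) \<and>
     (\<forall>x \<in> S. card {e \<in> M. touch {x} (snd e)} \<le> 3) \<and>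
     (\<forall>W \<subseteq> Z \<union> S. card {e \<in> M. inside W (snd e)} \<le> card W) \<and>
     card S \<le> 2 * m"

lemma ears_inv_init: "ears_inv v {} {} {} 0"
  by (simp add: ears_inv_def)

text \<open>If \<open>v\<close> survives, at most \<open>3 * card ?X\<close> edges of
  \<open>M\<close> are lost along with \<open>card ?X\<close> vertices, so at least
  \<open>m - 2k\<close> more edges than vertices other than \<open>v\<close> remain. The parts cut
  off from \<open>v\<close> cannot contain the surplus, so the connected set around \<open>v\<close>
  has at least \<open>card ?R + r\<close> edges, one too many.\<close>

lemma ears_inv_forced:
  assumes inv: "ears_inv v M Z S m" and M: "M \<subseteq> set (List.enumerate 0 es)" and V: "Z \<union> S \<subseteq> V" "v \<in> V" "finite V"
    and m: "2 * k + r + 1 \<le> m" and X: "X \<subseteq> V" "card X \<le> k" "sol r (V - X) es"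
  shows "v \<in> X"
proof (rule ccontr)
  assume vX: "v \<notin> X"
  let ?VM = "Z \<union> S"
  have finM: "finite M" and finVM: "finite ?VM" and vVM: "v \<notin> ?VM"
    and ends: "\<And>e. e \<in> M \<Longrightarrow> inside (insert v ?VM) (snd e)"
    and cardM: "card M = card ?VM + m"
    and degZ: "\<And>x. x \<in> Z \<Longrightarrow> card {e \<in> M. touch {x} (snd e)} \<le> 2"
    and degS: "\<And>x. x \<in> S \<Longrightarrow> card {e \<in> M. touch {x} (snd e)} \<le> 3"
    and forest: "\<And>W. W \<subseteq> ?VM \<Longrightarrow> card {e \<in> M. inside W (snd e)} \<le> card W"
    using inv by (simp_all add: ears_inv_def)
  have deg: "card {e \<in> M. touch {x} (snd e)} \<le> 3" if "x \<in> ?VM" for x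
    using that degZ[of x] degS[of x] by fastforce
  let ?X = "X \<inter> ?VM"
  let ?M = "{e \<in> M. \<not> touch X (snd e)}"
  let ?R = "reach (snd ` ?M) {v}"
  have finX: "finite X" using X(1) V(3) by (rule finite_subset)
  have hitM: "card {e \<in> M. touch X (snd e)} \<le> 3 * card ?X"
  proof -
    have "{e \<in> M. touch X (snd e)} \<subseteq> (\<Union>x\<in>?X. {e \<in> M. touch {x} (snd e)})"
    proof
      fix e assume e: "e \<in> {e \<in> M. touch X (snd e)}"
      then have "inside (insert v ?VM) (snd e)" using ends by simp
      then show "e \<in> (\<Union>x\<in>?X. {e \<in> M. touch {x} (snd e)})" using e vX by (auto simp: touch_def inside_def)
    qed
    then have "card {e \<in> M. touch X (snd e)} \<le> card (\<Union>x\<in>?X. {e \<in> M. touch {x} (snd e)})"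
      using finM finX by (intro card_mono) auto
    also have "\<dots> \<le> (\<Sum>x\<in>?X. card {e \<in> M. touch {x} (snd e)})"
      using finX by (intro card_UN_le) auto
    also have "\<dots> \<le> of_nat (card ?X) * 3" by (rule sum_bounded_above) (use deg in auto)
    finally show ?thesis by simp
  qed
  have RV: "?R \<subseteq> insert v ?VM - X"
  proof (rule reach_least)
    show "{v} \<subseteq> insert v ?VM - X" using vX by simp
    fix x y assume "(x, y) \<in> snd ` ?M"
    then obtain e where e: "e \<in> M" "\<not> touch X (snd e)" "snd e = (x, y)" by auto
    have "inside (insert v ?VM) (x, y)" using ends[OF e(1)] e(3) by simp
    moreover have "\<not> touch X (x, y)" using e by simp
    ultimately show "x \<in> insert v ?VM - X \<longleftrightarrow> y \<in> insert v ?VM - X" by (auto simp: inside_def touch_def)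
  qed
  have vR: "v \<in> ?R" by (simp add: reach_start)
  \<comment> \<open>The vertices that survive but are separated from \<open>v\<close>. The
    last-but-one clause of \<open>ears_inv\<close> says that they carry no more edges than
    vertices.\<close>
  let ?W = "?VM - X - ?R"
  have "snd ` ?M \<subseteq> set es" using M set_enumerate_snd[of 0 es] by blast
  then have "conn (set es) ?R" using conn_reach[of "snd ` ?M" v] by (elim conn_mono) blast
  moreover have "?R \<subseteq> V - X" using RV V by blast
  ultimately have s: "cnt ?R es + 1 \<le> card ?R + r" using vR by (intro solD[OF X(3)]) auto
  have finR: "finite ?R" using RV finVM finite_subset by blast
  have "card ?M \<le> card {e \<in> M. inside ?R (snd e)} + card {e \<in> M. inside ?W (snd e)}"
  proof -
    have "?M \<subseteq> {e \<in> M. inside ?R (snd e)} \<union> {e \<in> M. inside ?W (snd e)}"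
    proof
      fix e assume e: "e \<in> ?M"
      obtain x y where xy: "snd e = (x, y)" by (cases "snd e")
      have "(x, y) \<in> snd ` ?M" using e xy by force
      then have "x \<in> ?R \<longleftrightarrow> y \<in> ?R" by (rule reach_closed)
      moreover have "inside (insert v ?VM) (x, y)" "\<not> touch X (x, y)" using e ends[of e] xy by auto
      ultimately show "e \<in> {e \<in> M. inside ?R (snd e)} \<union> {e \<in> M. inside ?W (snd e)}"
        using e xy vR by (auto simp: inside_def touch_def)
    qed
    then have "card ?M \<le> card ({e \<in> M. inside ?R (snd e)} \<union> {e \<in> M. inside ?W (snd e)})"
      using finM by (intro card_mono) auto
    also have "\<dots> \<le> card {e \<in> M. inside ?R (snd e)} + card {e \<in> M. inside ?W (snd e)}" by (rule card_Un_le)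
    finally show ?thesis .
  qed
  moreover have "card {e \<in> M. inside ?W (snd e)} \<le> card ?W" by (rule forest) blast
  moreover have "card {e \<in> M. inside ?R (snd e)} \<le> cnt ?R es"
    unfolding cnt_def length_filter_enumerate using M by (intro card_mono) auto
  moreover have "card M = card ?M + card {e \<in> M. touch X (snd e)}"
  proof -
    have "M = ?M \<union> {e \<in> M. touch X (snd e)}" by blast
    moreover have "card (?M \<union> {e \<in> M. touch X (snd e)}) = card ?M + card {e \<in> M. touch X (snd e)}"
      using finM by (intro card_Un_disjoint) auto
    ultimately show ?thesis by simp
  qed
  moreover have "card ?VM = card ?X + card (?R - {v}) + card ?W"
  proof -
    have "?VM = ?X \<union> ((?R - {v}) \<union> ?W)" using RV vVM by blast
    also have "card \<dots> = card ?X + card ((?R - {v}) \<union> ?W)"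
      using finVM finX finR RV by (intro card_Un_disjoint) auto
    also have "card ((?R - {v}) \<union> ?W) = card (?R - {v}) + card ?W"
      using finVM finR by (intro card_Un_disjoint) auto
    finally show ?thesis by simp
  qed
  moreover have "card ?R = card (?R - {v}) + 1" using card.remove[OF finR vR] by linarith
  moreover have "card ?X \<le> card X" using finX by (intro card_mono) auto
  ultimately show False using s hitM cardM m X(2) by linarith
qed

text \<open>The ear starts with \<open>e\<close>, follows \<open>ps\<close> from \<open>u\<close> to
  \<open>t\<close>, and either stops at a vertex \<open>t\<close> of earlier ears or returns to
  \<open>v\<close> by one more edge in \<open>Fs\<close>. In both cases it has one edge more than
  new vertices. Inner vertices get degree two and join \<open>Z\<close>; \<open>u\<close> is a
  neighbour of \<open>v\<close>, and \<open>t\<close> is one or has its degree raised to at most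
  three, so both join \<open>S\<close>. This adds at most two vertices to \<open>S\<close> per
  ear.\<close>

lemma ears_inv_step:
  assumes inv: "ears_inv v M Z S m"
    and e: "e \<notin> M" "snd e = (v, u) \<or> snd e = (u, v)" "u \<noteq> v" "u \<notin> S"
    and ps: "ps \<noteq> []" "hd ps = u" "last ps = t" "distinct ps" "set (butlast ps) \<inter> Z = {}" "set ps \<inter> S = {}" "v \<notin> set ps"
    and g: "inj_on g {..<length ps - 1}" "g ` {..<length ps - 1} \<inter> M = {}"
      "\<And>j. Suc j < length ps \<Longrightarrow> snd (g j) = (ps ! j, ps ! Suc j) \<or> snd (g j) = (ps ! Suc j, ps ! j)"
    and fs: "t \<in> Z \<and> Fs = {} \<or> t \<notin> Z \<and> (\<exists>f. Fs = {f} \<and> f \<notin> M \<and> f \<noteq> e \<and> (snd f = (v, t) \<or> snd f = (t, v)))"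
  shows "ears_inv v (M \<union> (insert e (g ` {..<length ps - 1}) \<union> Fs)) ((Z \<union> set ps) - {u, t}) (S \<union> {u, t}) (Suc m)"
proof -
  let ?VM = "Z \<union> S"
  have finM: "finite M" and finZ: "finite Z" and finS: "finite S" and ZS: "Z \<inter> S = {}" and vVM: "v \<notin> Z" "v \<notin> S"
    and ends: "\<And>e. e \<in> M \<Longrightarrow> inside (insert v ?VM) (snd e)"
    and vends: "\<And>e. e \<in> M \<Longrightarrow> touch {v} (snd e) \<Longrightarrow> other v (snd e) \<in> S"
    and cardM: "card M = card ?VM + m"
    and degZ: "\<And>x. x \<in> Z \<Longrightarrow> card {e \<in> M. touch {x} (snd e)} \<le> 2"
    and degS: "\<And>x. x \<in> S \<Longrightarrow> card {e \<in> M. touch {x} (snd e)} \<le> 3"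
    and forest: "\<And>W. W \<subseteq> ?VM \<Longrightarrow> card {e \<in> M. inside W (snd e)} \<le> card W"
    and cardS: "card S \<le> 2 * m"
    using inv by (simp_all add: ears_inv_def)
  define l where "l = length ps - 1"
  have len: "length ps = Suc l" using ps(1) by (cases ps) (auto simp: l_def)
  let ?Q = "g ` {..<l}"
  let ?P = "insert e ?Q \<union> Fs"
  have u0: "ps ! 0 = u" using ps(1,2) by (simp add: hd_conv_nth)
  have tl: "ps ! l = t" using ps(1,3) len by (simp add: last_conv_nth)
  have g': "snd (g j) = (ps ! j, ps ! Suc j) \<or> snd (g j) = (ps ! Suc j, ps ! j)" if "j < l" for j
    using g(3)[of j] that len by simp
  have ps_in: "ps ! j \<in> set ps" if "j \<le> l" for j using that len by simp
  have u_in: "u \<in> set ps" and t_in: "t \<in> set ps" using ps_in[of 0] ps_in[of l] u0 tl by auto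
  have notZ: "ps ! j \<notin> Z" if "j < l" for j
  proof -
    have "butlast ps ! j = ps ! j" "j < length (butlast ps)" using that len by (simp_all add: nth_butlast)
    then have "ps ! j \<in> set (butlast ps)" by (metis nth_mem)
    then show ?thesis using ps(5) by blast
  qed
  have Qv: "\<not> touch {v} (snd f)" if "f \<in> ?Q" for f
    using that g' ps(7) ps_in by (fastforce simp: touch_def)
  have Qin: "inside (set ps) (snd f)" if "f \<in> ?Q" for f
    using that g' ps_in by (fastforce simp: inside_def)
  have eQ: "e \<notin> ?Q" using Qv[of e] e(2) by (auto simp: touch_def)
  have finFs: "finite Fs" using fs by auto
  have Fs_v: "snd f = (v, t) \<or> snd f = (t, v)" if "f \<in> Fs" for f using fs that by auto
  have Fs_Q: "Fs \<inter> insert e ?Q = {}"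
  proof -
    have "f \<notin> ?Q" if "f \<in> Fs" for f
      using Fs_v[OF that] Qv[of f] by (auto simp: touch_def)
    moreover have "e \<notin> Fs" using fs by blast
    ultimately show ?thesis by blast
  qed
  have tS: "t \<notin> S" "t \<noteq> v" using t_in ps(6,7) by auto
  have PM: "?P \<inter> M = {}" using e(1) g(2) fs by (auto simp: l_def)
  have cardQ: "card ?Q = l" using g(1) by (simp add: card_image l_def)
  have cardP: "card ?P = l + 1 + card Fs"
  proof -
    have "card ?P = card (insert e ?Q) + card Fs" using finFs Fs_Q by (intro card_Un_disjoint) auto
    also have "card (insert e ?Q) = l + 1" using eQ cardQ by simp
    finally show ?thesis .
  qed
  let ?N = "set ps - Z"
  \<comment> \<open>All vertices of the path are new except possibly the last, which is old exactly
    when there is no closing edge.\<close>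
  have cardN: "card ?N + 1 = l + 1 + card Fs"
  proof (cases "t \<in> Z")
    case True
    have "set (butlast ps @ [last ps]) = insert t (set (butlast ps))" using ps(3) by simp
    then have set_ps: "set ps = insert t (set (butlast ps))" unfolding append_butlast_last_id[OF ps(1)] .
    have "?N = set (butlast ps)" unfolding set_ps using True ps(5) by blast
    moreover have "card (set (butlast ps)) = l" using distinct_card[OF distinct_butlast[OF ps(4)]] len by simp
    moreover have "Fs = {}" using fs True by blast
    ultimately show ?thesis by simp
  next
    case False
    have "x \<notin> Z" if "x \<in> set ps" for x
    proof -
      obtain j where "j \<le> l" "ps ! j = x" using \<open>x \<in> set ps\<close> len by (auto simp: in_set_conv_nth less_Suc_eq_le)
      then show ?thesis using notZ[of j] tl False by (cases "j = l") auto
    qed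
    then have "?N = set ps" by blast
    moreover have "card (set ps) = l + 1" using ps(4) len by (simp add: distinct_card)
    moreover have "card Fs = 1" using fs False by auto
    ultimately show ?thesis by simp
  qed
  have VM': "((Z \<union> set ps) - {u, t}) \<union> (S \<union> {u, t}) = ?VM \<union> ?N" using u_in t_in by blast
  have NVM: "?N \<inter> ?VM = {}" using ps(6) by blast
  have degP: "card {f \<in> ?P. touch {x} (snd f)} \<le> (if x \<in> set ps then if x \<in> Z then 1 else 2 else 0)" if x: "x \<noteq> v" for x
  proof (cases "x \<in> set ps")
    case False
    have "\<not> touch {x} (snd f)" if f: "f \<in> ?P" for f
    proof -
      consider "f = e" | "f \<in> ?Q" | "f \<in> Fs" using f by blast
      then show ?thesis
      proof cases
        case 1
        then show ?thesis using e(2) u_in False x by (auto simp: touch_def)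
      next
        case 2
        then show ?thesis using Qin[of f] False by (auto simp: touch_def inside_def)
      next
        case 3
        then show ?thesis using Fs_v[of f] t_in False x by (auto simp: touch_def)
      qed
    qed
    then have "{f \<in> ?P. touch {x} (snd f)} = {}" by blast
    then show ?thesis by (simp only: card.empty)
  next
    case True
    then obtain i where i: "i \<le> l" "ps ! i = x" using len by (auto simp: in_set_conv_nth less_Suc_eq_le)
    have idx: "j = i" if "j \<le> l" "ps ! j = x" for j
      using that i ps(4) len by (metis le_imp_less_Suc nth_eq_iff_index_eq)
    \<comment> \<open>The at most two edges of the ear at the \<open>i\<close>-th vertex of the
      path: the one before it, which is \<open>e\<close> at the start, and the one after it, which
      belongs to \<open>Fs\<close> at the end.\<close>
    let ?B = "(if i = 0 then {e} else {g (i - 1)}) \<union> (if i < l then {g i} else Fs)"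
    have "{f \<in> ?P. touch {x} (snd f)} \<subseteq> ?B"
    proof
      fix f assume f: "f \<in> {f \<in> ?P. touch {x} (snd f)}"
      then have ft: "touch {x} (snd f)" by blast
      consider "f = e" | "f \<in> ?Q" | "f \<in> Fs" using f by blast
      then show "f \<in> ?B"
      proof cases
        case 1
        then have "x = u" using ft e(2) x by (auto simp: touch_def)
        then have "i = 0" using idx[of 0] u0 by simp
        then show ?thesis using 1 by simp
      next
        case 2
        then obtain j where j: "j < l" "f = g j" by auto
        then have "ps ! j = x \<or> ps ! Suc j = x" using g'[OF j(1)] ft by (auto simp: touch_def)
        then have "j = i \<or> Suc j = i" using idx[of j] idx[of "Suc j"] j(1) by auto
        then show ?thesis using j by auto
      next
        case 3
        then have "x = t" using Fs_v[OF 3] ft x by (auto simp: touch_def)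
        then have "i = l" using idx[of l] tl by simp
        then show ?thesis using 3 by simp
      qed
    qed
    moreover have finB: "finite ?B" using finFs by simp
    ultimately have le: "card {f \<in> ?P. touch {x} (snd f)} \<le> card ?B" by (intro card_mono)
    have B2: "card ?B \<le> 1 + card (if i < l then {g i} else Fs)"
      by (rule order_trans[OF card_Un_le]) (simp split: if_splits)
    show ?thesis
    proof (cases "x \<in> Z")
      case True
      then have il: "i = l" using notZ[of i] i by (cases "i < l") auto
      then have "Fs = {}" using fs tl i(2) True by blast
      then have "card ?B \<le> 1" using B2 il by simp
      then show ?thesis using le True \<open>x \<in> set ps\<close> by simp
    next
      case False
      have "card Fs \<le> 1" using fs by auto
      then have "card ?B \<le> 2" using B2 by (simp split: if_splits)
      then show ?thesis using le False \<open>x \<in> set ps\<close> by simp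
    qed
  qed
  have deg': "card {f \<in> M \<union> ?P. touch {x} (snd f)} \<le> card {f \<in> M. touch {x} (snd f)} + card {f \<in> ?P. touch {x} (snd f)}" for x
  proof -
    have eq: "{f \<in> M \<union> ?P. touch {x} (snd f)} = {f \<in> M. touch {x} (snd f)} \<union> {f \<in> ?P. touch {x} (snd f)}" by blast
    show ?thesis unfolding eq by (rule card_Un_le)
  qed
  have deg0: "card {f \<in> M. touch {x} (snd f)} = 0" if "x \<notin> insert v ?VM" for x
  proof -
    have "{f \<in> M. touch {x} (snd f)} = {}" using ends that by (fastforce simp: inside_def touch_def)
    then show ?thesis by (simp only: card.empty)
  qed
  show ?thesis
    unfolding ears_inv_def l_def[symmetric] VM'
  proof (intro conjI ballI allI impI)
    show "finite (M \<union> ?P)" using finM finFs by simp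
    show "finite ((Z \<union> set ps) - {u, t})" using finZ by simp
    show "finite (S \<union> {u, t})" using finS by simp
    show "((Z \<union> set ps) - {u, t}) \<inter> (S \<union> {u, t}) = {}" using ZS ps(6) by blast
    show "v \<notin> (Z \<union> set ps) - {u, t}" using vVM ps(7) by blast
    show "v \<notin> S \<union> {u, t}" using vVM e(3) tS by blast
    show "card (M \<union> ?P) = card (?VM \<union> ?N) + Suc m"
    proof -
      have "card (M \<union> ?P) = card M + card ?P" using finM finFs PM by (intro card_Un_disjoint) auto
      moreover have "card (?VM \<union> ?N) = card ?VM + card ?N" using finZ finS NVM by (intro card_Un_disjoint) auto
      ultimately show ?thesis using cardM cardP cardN by linarith
    qed
    show "card (S \<union> {u, t}) \<le> 2 * Suc m"
    proof -
      have "card (S \<union> {u, t}) \<le> card S + card {u, t}" by (rule card_Un_le)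
      moreover have "card {u, t} \<le> 2" by (simp add: card_insert_if)
      ultimately show ?thesis using cardS by simp
    qed
  next
    fix f assume f: "f \<in> M \<union> ?P"
    then consider "f \<in> M" | "f = e" | "f \<in> ?Q" | "f \<in> Fs" by blast
    then show "inside (insert v (?VM \<union> ?N)) (snd f)"
    proof cases
      case 1
      then show ?thesis using ends[of f] by (auto simp: inside_def)
    next
      case 2
      then show ?thesis using e(2) u_in by (auto simp: inside_def)
    next
      case 3
      then show ?thesis using Qin[OF 3] by (auto simp: inside_def)
    next
      case 4
      then show ?thesis using Fs_v[OF 4] t_in by (auto simp: inside_def)
    qed
  next
    fix f assume f: "f \<in> M \<union> ?P" and fv: "touch {v} (snd f)"
    from f consider "f \<in> M" | "f = e" | "f \<in> ?Q" | "f \<in> Fs" by blast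
    then show "other v (snd f) \<in> S \<union> {u, t}"
    proof cases
      case 1
      then show ?thesis using vends[of f] fv by blast
    next
      case 2
      have "other v (snd e) = u" using e(2) by (elim disjE) (simp_all add: other_def)
      with 2 show ?thesis by simp
    next
      case 3
      then show ?thesis using Qv fv by blast
    next
      case 4
      have "other v (snd f) = t" using Fs_v[OF 4] by (elim disjE) (simp_all add: other_def)
      then show ?thesis by simp
    qed
  next
    fix x assume x: "x \<in> (Z \<union> set ps) - {u, t}"
    then have xv: "x \<noteq> v" using vVM ps(7) by blast
    show "card {f \<in> M \<union> ?P. touch {x} (snd f)} \<le> 2"
    proof (cases "x \<in> Z")
      case True
      have "x \<notin> set ps"
      proof
        assume "x \<in> set ps"
        then obtain j where j: "j \<le> l" "ps ! j = x" using len by (auto simp: in_set_conv_nth less_Suc_eq_le)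
        then have "j = l" using notZ[of j] True by (cases "j < l") auto
        then show False using j tl x by blast
      qed
      then show ?thesis using deg'[of x] degP[OF xv] degZ[OF True] by simp
    next
      case False
      then have xp: "x \<in> set ps" using x by blast
      then have "x \<notin> insert v ?VM" using False xv ps(6) by blast
      then show ?thesis using deg'[of x] degP[OF xv] deg0[of x] xp False by simp
    qed
  next
    fix x assume x: "x \<in> S \<union> {u, t}"
    then have xv: "x \<noteq> v" using vVM e(3) tS by blast
    show "card {f \<in> M \<union> ?P. touch {x} (snd f)} \<le> 3"
    proof (cases "x \<in> S")
      case True
      then have "x \<notin> set ps" using ps(6) by blast
      then show ?thesis using deg'[of x] degP[OF xv] degS[OF True] by simp
    next
      case False
      then have xp: "x \<in> set ps" using x u_in t_in by blast
      show ?thesis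
      proof (cases "x \<in> Z")
        case True
        then show ?thesis using deg'[of x] degP[OF xv] degZ[OF True] xp by simp
      next
        case xZ: False
        then have "x \<notin> insert v ?VM" using False xv by blast
        then show ?thesis using deg'[of x] degP[OF xv] deg0[of x] xp xZ by simp
      qed
    qed
  next
    fix W assume W: "W \<subseteq> ?VM \<union> ?N"
    have finW: "finite W" by (rule finite_subset[OF W]) (use finZ finS in simp)
    have vW: "v \<notin> W" using W vVM ps(7) by blast
    have sub: "{f \<in> M \<union> ?P. inside W (snd f)} \<subseteq> {f \<in> M. inside (W \<inter> ?VM) (snd f)} \<union> {f \<in> ?Q. inside W (snd f)}"
    proof
      fix f assume f: "f \<in> {f \<in> M \<union> ?P. inside W (snd f)}"
      then have fW: "inside W (snd f)" by blast
      from f consider "f \<in> M" | "f = e" | "f \<in> ?Q" | "f \<in> Fs" by blast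
      then show "f \<in> {f \<in> M. inside (W \<inter> ?VM) (snd f)} \<union> {f \<in> ?Q. inside W (snd f)}"
      proof cases
        case 1
        then show ?thesis using ends[OF 1] fW vW by (auto simp: inside_def)
      next
        case 2
        then show ?thesis using e(2) fW vW by (auto simp: inside_def)
      next
        case 3
        then show ?thesis using fW by blast
      next
        case 4
        then show ?thesis using Fs_v[OF 4] fW vW by (auto simp: inside_def)
      qed
    qed
    have "card {f \<in> M \<union> ?P. inside W (snd f)} \<le> card ({f \<in> M. inside (W \<inter> ?VM) (snd f)} \<union> {f \<in> ?Q. inside W (snd f)})"
      by (rule card_mono[OF _ sub]) (use finM in simp)
    also have "\<dots> \<le> card {f \<in> M. inside (W \<inter> ?VM) (snd f)} + card {f \<in> ?Q. inside W (snd f)}" by (rule card_Un_le)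
    also have "card {f \<in> M. inside (W \<inter> ?VM) (snd f)} \<le> card (W \<inter> ?VM)" by (rule forest) blast
    also have "card {f \<in> ?Q. inside W (snd f)} \<le> card (W - ?VM)"
    proof -
      \<comment> \<open>A path edge inside \<open>W\<close> is charged to its end nearer to
        \<open>u\<close>. That vertex is new, so the old edges and the path edges are charged to
        disjoint parts of \<open>W\<close>. The first edge and a closing edge contain
        \<open>v\<close> and do not count.\<close>
      let ?J = "{j. j < l \<and> inside W (snd (g j))}"
      have finJ: "finite ?J" by simp
      have "{f \<in> ?Q. inside W (snd f)} \<subseteq> g ` ?J" by blast
      then have "card {f \<in> ?Q. inside W (snd f)} \<le> card (g ` ?J)" by (rule card_mono[OF finite_imageI[OF finJ]])
      also have "card (g ` ?J) \<le> card ?J" by (rule card_image_le[OF finJ])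
      finally have "card {f \<in> ?Q. inside W (snd f)} \<le> card ?J" .
      also have "card ?J \<le> card (W - ?VM)"
      proof (rule card_inj_on_le[of "(!) ps"])
        show "inj_on ((!) ps) ?J"
          by (rule inj_onI) (use ps(4) len in \<open>auto simp: nth_eq_iff_index_eq\<close>)
        show "(!) ps ` ?J \<subseteq> W - ?VM"
        proof
          fix x assume "x \<in> (!) ps ` ?J"
          then obtain j where j: "j < l" "inside W (snd (g j))" "x = ps ! j" by blast
          have "x \<in> W" using g'[OF j(1)] j(2,3) by (auto simp: inside_def)
          moreover have "x \<in> set ps" using ps_in[of j] j by simp
          ultimately show "x \<in> W - ?VM" using notZ[OF j(1)] j(3) ps(6) by blast
        qed
        show "finite (W - ?VM)" using finW by simp
      qed
      finally show ?thesis .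
    qed
    finally show "card {f \<in> M \<union> ?P. inside W (snd f)} \<le> card W"
      using card_Int_Diff[OF finW, of ?VM] by simp
  qed
qed

section \<open>The algorithms\<close>

lemma fold_const_funpow: "fold (\<lambda>_. f) xs s = (f ^^ length xs) s"
  by (induction xs arbitrary: s) (simp_all add: funpow_swap1)

text \<open>The measure drops with every genuine change, so as many rounds as its initial value lead
  to a fixed point. This turns an exhaustive iteration into a fold with a number of rounds known in
  advance.\<close>

lemma iterate_stable:
  fixes \<mu> :: "'s \<Rightarrow> nat"
  assumes I: "\<And>s. I s \<Longrightarrow> I (f s)" and dec: "\<And>s. I s \<Longrightarrow> f s \<noteq> s \<Longrightarrow> \<mu> (f s) < \<mu> s"
  shows "I s \<Longrightarrow> \<mu> s \<le> n \<Longrightarrow> I ((f ^^ n) s) \<and> f ((f ^^ n) s) = (f ^^ n) s"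
proof (induction n arbitrary: s)
  case 0
  then show ?case using dec[of s] by auto
next
  case (Suc n)
  show ?case
  proof (cases "f s = s")
    case True
    then have "(f ^^ m) s = s" for m by (induction m) auto
    then show ?thesis using Suc.prems True by simp
  next
    case False
    then have "\<mu> (f s) \<le> n" using dec[of s] Suc.prems by simp
    then show ?thesis using Suc.IH[of "f s"] I Suc.prems by (simp add: funpow_swap1)
  qed
qed

text \<open>Every round filters the same list of candidates instead of appending new vertices, so
  the accumulator never outgrows that list.\<close>

definition reachl :: "(nat \<times> nat) list \<Rightarrow> nat list \<Rightarrow> nat list" where
  "reachl E Z = fold (\<lambda>_ R. filter (\<lambda>y. y \<in> set R \<or> (\<exists>p \<in> set E. fst p \<in> set R \<and> snd p = y \<or> snd p \<in> set R \<and> fst p = y))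
     (Z @ map fst E @ map snd E)) (Z @ map fst E @ map snd E) Z"

lemma set_reachl: "set (reachl E Z) = reach (set E) (set Z)"
proof -
  let ?c = "Z @ map fst E @ map snd E"
  let ?P = "\<lambda>R y. y \<in> R \<or> (\<exists>p \<in> set E. fst p \<in> R \<and> snd p = y \<or> snd p \<in> R \<and> fst p = y)"
  define f where "f R = filter (?P (set R)) ?c" for R
  define F where "F R = {y \<in> set ?c. ?P R y}" for R
  have "set ((f ^^ n) Z) = (F ^^ n) (set Z)" for n
    by (induction n) (auto simp: f_def F_def)
  then have eq: "set (reachl E Z) = (F ^^ length ?c) (set Z)"
    unfolding reachl_def fold_const_funpow f_def by simp
  let ?I = "\<lambda>R. set Z \<subseteq> R \<and> R \<subseteq> reach (set E) (set Z) \<and> R \<subseteq> set ?c"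
  have IF: "?I (F R)" "R \<subseteq> F R" if "?I R" for R
  proof -
    have "y \<in> reach (set E) (set Z)" if "?P R y" for y
    proof -
      from that consider "y \<in> R" | p where "p \<in> set E" "fst p \<in> R" "snd p = y" | p where "p \<in> set E" "snd p \<in> R" "fst p = y"
        by blast
      then show ?thesis
      proof cases
        case 1
        then show ?thesis using \<open>?I R\<close> by blast
      next
        case 2
        then have "(fst p, y) \<in> set E" by auto
        then show ?thesis using reach_step[of "fst p"] 2 \<open>?I R\<close> by blast
      next
        case 3
        then have "(y, snd p) \<in> set E" by auto
        then show ?thesis using reach_step[of "snd p"] 3 \<open>?I R\<close> by blast
      qed
    qed
    then show "?I (F R)" "R \<subseteq> F R" using that unfolding F_def by auto
  qed
  have "?I ((F ^^ length ?c) (set Z)) \<and> F ((F ^^ length ?c) (set Z)) = (F ^^ length ?c) (set Z)"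
  proof (rule iterate_stable[where \<mu> = "\<lambda>R. card (set ?c - R)"])
    show "?I (F R)" if "?I R" for R using IF(1)[OF that] .
    show "card (set ?c - F R) < card (set ?c - R)" if R: "?I R" "F R \<noteq> R" for R
    proof (rule psubset_card_mono)
      have "F R \<subseteq> set ?c" "R \<subset> F R" using IF[OF R(1)] R(2) by auto
      then show "set ?c - F R \<subset> set ?c - R" by blast
    qed simp
    show "?I (set Z)" using reach_refl by auto
    show "card (set ?c - set Z) \<le> length ?c"
      by (rule order_trans[OF card_mono card_length[of ?c]]) auto
  qed
  then have I: "?I (set (reachl E Z))" and fixp: "F (set (reachl E Z)) = set (reachl E Z)" unfolding eq by blast+
  have "reach (set E) (set Z) \<subseteq> set (reachl E Z)"
  proof (rule reach_least)
    show "set Z \<subseteq> set (reachl E Z)" using I by blast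
    fix x y assume xy: "(x, y) \<in> set E"
    then have c: "x \<in> set ?c" "y \<in> set ?c" by force+
    have "y \<in> F (set (reachl E Z))" if "x \<in> set (reachl E Z)"
    proof -
      have "\<exists>p \<in> set E. fst p \<in> set (reachl E Z) \<and> snd p = y \<or> snd p \<in> set (reachl E Z) \<and> fst p = y"
        by (rule bexI[OF _ xy]) (use that in simp)
      with c(2) show ?thesis unfolding F_def by blast
    qed
    moreover have "x \<in> F (set (reachl E Z))" if "y \<in> set (reachl E Z)"
    proof -
      have "\<exists>p \<in> set E. fst p \<in> set (reachl E Z) \<and> snd p = x \<or> snd p \<in> set (reachl E Z) \<and> fst p = x"
        by (rule bexI[OF _ xy]) (use that in simp)
      with c(1) show ?thesis unfolding F_def by blast
    qed
    ultimately show "x \<in> set (reachl E Z) \<longleftrightarrow> y \<in> set (reachl E Z)" unfolding fixp by blast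
  qed
  with I show ?thesis by blast
qed

subsection \<open>Ears\<close>

definition freshv :: "nat \<Rightarrow> ledge list \<Rightarrow> nat list \<Rightarrow> ledge list" where
  "freshv v F S = filter (\<lambda>e. (fst (snd e) = v \<or> snd (snd e) = v) \<and> other v (snd e) \<noteq> v \<and> other v (snd e) \<notin> set S) F"

definition coreE :: "nat \<Rightarrow> ledge list \<Rightarrow> nat list \<Rightarrow> ledge list" where
  "coreE v F S = filter (\<lambda>e. fst (snd e) \<noteq> v \<and> snd (snd e) \<noteq> v \<and> fst (snd e) \<notin> set S \<and> snd (snd e) \<notin> set S) F"

text \<open>Points where an ear beginning with \<open>e\<close> may end: a vertex of
  \<open>Z\<close>, which still has degree at most two, or the far end of another fresh edge, by
  which the ear returns to \<open>v\<close>.\<close>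

definition targets :: "nat \<Rightarrow> ledge list \<Rightarrow> nat list \<Rightarrow> nat list \<Rightarrow> ledge \<Rightarrow> nat list" where
  "targets v F Z S e = Z @ map (\<lambda>f. other v (snd f)) (filter (\<lambda>f. f \<noteq> e) (freshv v F S))"

definition hits :: "nat list \<Rightarrow> nat \<Rightarrow> ledge list \<Rightarrow> bool" where
  "hits T u Q \<longleftrightarrow> (\<exists>t \<in> set T. t \<in> set (reachl (map snd Q) [u]))"

type_synonym estate = "ledge list \<times> nat list \<times> nat list \<times> unit list"

definition earcands :: "nat \<Rightarrow> estate \<Rightarrow> ledge list" where
  "earcands v st = (case st of (F, Z, S, ms) \<Rightarrow>
     filter (\<lambda>e. hits (targets v F Z S e) (other v (snd e)) (coreE v F S)) (freshv v F S))"

definition take1 :: "'a list \<Rightarrow> 'a list" where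
  "take1 xs = (case xs of [] \<Rightarrow> [] | x # ys \<Rightarrow> [x])"

definition add_ear :: "nat \<Rightarrow> nat list \<Rightarrow> estate \<Rightarrow> ledge \<Rightarrow> nat \<Rightarrow> ledge list \<Rightarrow> ledge list \<Rightarrow> estate" where
  "add_ear v V st e t Q fs = (case st of (F, Z, S, ms) \<Rightarrow>
     (filter (\<lambda>f. f \<noteq> e \<and> f \<notin> set Q \<and> f \<notin> set fs) F,
      filter (\<lambda>x. (x \<in> set Z \<or> (\<exists>f \<in> set Q. fst (snd f) = x \<or> snd (snd f) = x)) \<and> x \<noteq> other v (snd e) \<and> x \<noteq> t) V,
      filter (\<lambda>x. x \<in> set S \<or> x = other v (snd e) \<or> x = t) V,
      () # ms))"

text \<open>The minimal edge set \<open>Q\<close> is a path that meets the targets only at its end,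
  so the filter singles out that end. The default \<open>0\<close> does not arise when
  \<open>e\<close> is taken from \<open>earcands\<close>.\<close>

definition find_ear :: "nat \<Rightarrow> nat list \<Rightarrow> estate \<Rightarrow> ledge \<Rightarrow> estate" where
  "find_ear v V st e = (case st of (F, Z, S, ms) \<Rightarrow>
     let Q = minim (hits (targets v F Z S e) (other v (snd e))) (coreE v F S);
         t = (case filter (\<lambda>t. t \<in> set (reachl (map snd Q) [other v (snd e)])) (targets v F Z S e) of
               [] \<Rightarrow> 0 | t # ts \<Rightarrow> t);
         fs = (if t \<in> set Z then [] else take1 (filter (\<lambda>f. f \<noteq> e \<and> other v (snd f) = t) (freshv v F S)))
     in add_ear v V st e t Q fs)"

definition earstep :: "nat \<Rightarrow> nat list \<Rightarrow> estate \<Rightarrow> estate" where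
  "earstep v V st = (case earcands v st of [] \<Rightarrow> st | e # es \<Rightarrow> find_ear v V st e)"

definition ears :: "nat \<Rightarrow> nat list \<Rightarrow> ledge list \<Rightarrow> estate" where
  "ears v V L = fold (\<lambda>_. earstep v V) L (L, [], [], [])"

section \<open>Correctness of the ear search\<close>

lemma hits_iff: "hits T u Q \<longleftrightarrow> (\<exists>t \<in> set T. t \<in> reach (snd ` set Q) {u})"
  by (simp add: hits_def set_reachl)

lemma hits_mono: "set Q \<subseteq> set Q' \<Longrightarrow> hits T u Q \<Longrightarrow> hits T u Q'"
  unfolding hits_iff using reach_mono[of "snd ` set Q" "snd ` set Q'" "{u}" "{u}"] by blast

lemma other_cases:
  assumes "fst p = v \<or> snd p = v"
  shows "p = (v, other v p) \<or> p = (other v p, v)"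
  using assms by (auto simp: other_def prod_eq_iff)

lemma freshvD:
  assumes "e \<in> set (freshv v F S)"
  shows "e \<in> set F" "snd e = (v, other v (snd e)) \<or> snd e = (other v (snd e), v)"
    "other v (snd e) \<noteq> v" "other v (snd e) \<notin> set S"
proof -
  have "fst (snd e) = v \<or> snd (snd e) = v" using assms unfolding freshv_def by simp
  then show "snd e = (v, other v (snd e)) \<or> snd e = (other v (snd e), v)" by (rule other_cases)
qed (use assms in \<open>simp_all add: freshv_def\<close>)

definition ears_state :: "nat \<Rightarrow> nat list \<Rightarrow> ledge list \<Rightarrow> estate \<Rightarrow> bool" where
  "ears_state v V L st \<longleftrightarrow> (case st of (F, Z, S, ms) \<Rightarrow>
     set F \<subseteq> set L \<and> ears_inv v (set L - set F) (set Z) (set S) (length ms) \<and> set Z \<union> set S \<subseteq> set V \<and> distinct S \<and>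
     (distinct L \<longrightarrow> distinct F))"

lemma find_ear_state:
  assumes V: "distinct V" "\<And>e. e \<in> set L \<Longrightarrow> inside (set V) (snd e)"
    and st: "ears_state v V L st" and e: "e \<in> set (earcands v st)"
  shows "ears_state v V L (find_ear v V st e)" "length (fst (find_ear v V st e)) < length (fst st)"
proof -
  obtain F Z S ms where st_eq: "st = (F, Z, S, ms)" by (metis prod_cases4)
  have FL: "set F \<subseteq> set L" and inv: "ears_inv v (set L - set F) (set Z) (set S) (length ms)"
    and ZSV: "set Z \<union> set S \<subseteq> set V" "distinct S" and distF: "distinct L \<longrightarrow> distinct F" using st by (simp_all add: ears_state_def st_eq)
  define u where "u = other v (snd e)"
  define T where "T = targets v F Z S e"
  define Q where "Q = minim (hits T u) (coreE v F S)"
  define t where "t = (case filter (\<lambda>t. t \<in> set (reachl (map snd Q) [u])) T of [] \<Rightarrow> 0 | t # ts \<Rightarrow> t)"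
  define fs where "fs = (if t \<in> set Z then [] else take1 (filter (\<lambda>f. f \<noteq> e \<and> other v (snd f) = t) (freshv v F S)))"
  have fe: "find_ear v V st e = add_ear v V st e t Q fs"
    unfolding find_ear_def st_eq prod.case Let_def fs_def t_def Q_def T_def u_def by (rule refl)
  have ef: "e \<in> set (freshv v F S)" and hit: "hits T u (coreE v F S)"
    using e by (simp_all add: earcands_def st_eq T_def u_def)
  note efD = freshvD[OF ef, folded u_def]
  have Q: "set Q \<subseteq> set (coreE v F S)" "hits T u Q" "\<And>f. f \<in> set Q \<Longrightarrow> \<not> hits T u (filter (\<lambda>x. x \<noteq> f) Q)"
    unfolding Q_def using minim[of "hits T u" "coreE v F S"] hits_mono hit by blast+
  have core: "f \<in> set F" "\<not> touch (insert v (set S)) (snd f)" if "f \<in> set Q" for f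
    using Q(1) that by (auto simp: coreE_def touch_def)
  have "\<exists>t\<in>set T. t \<in> reach (snd ` set Q) {u}" using Q(2) by (simp add: hits_iff)
  moreover have "\<not> (\<exists>t\<in>set T. t \<in> reach (snd ` (set Q - {f})) {u})" if "f \<in> set Q" for f
  proof -
    have "set (filter (\<lambda>x. x \<noteq> f) Q) = set Q - {f}" by auto
    then show ?thesis using Q(3)[OF that] by (simp add: hits_iff)
  qed
  ultimately obtain ps g where ps: "ps \<noteq> []" "hd ps = u" "last ps \<in> set T" "distinct ps" "set (butlast ps) \<inter> set T = {}"
    "set Q = g ` {..<length ps - 1}" "inj_on g {..<length ps - 1}"
    "\<And>j. Suc j < length ps \<Longrightarrow> snd (g j) = (ps ! j, ps ! Suc j) \<or> snd (g j) = (ps ! Suc j, ps ! j)"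
    "reach (snd ` set Q) {u} = set ps"
    using minimal_path[of "set T" "set Q" u] by blast
  have t_last: "t = last ps"
  proof -
    have set_f: "set (filter (\<lambda>t. t \<in> set (reachl (map snd Q) [u])) T) = set T \<inter> set ps"
      using ps(9) by (auto simp: set_reachl)
    have "set ps = insert (last ps) (set (butlast ps))"
      using arg_cong[OF append_butlast_last_id[OF ps(1)], of set] by simp
    then have "set T \<inter> set ps = {last ps}" using ps(3,5) by auto
    then have s1: "set (filter (\<lambda>t. t \<in> set (reachl (map snd Q) [u])) T) = {last ps}" using set_f by simp
    show ?thesis
    proof (cases "filter (\<lambda>t. t \<in> set (reachl (map snd Q) [u])) T")
      case Nil
      then show ?thesis using s1 by simp
    next
      case (Cons a list)
      then have "a = last ps" using s1 by auto
      then show ?thesis using Cons by (simp add: t_def)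
    qed
  qed
  have tT: "t \<in> set T" using ps(3) t_last by simp
  have ps_sub: "set ps \<subseteq> insert u (\<Union>f\<in>set Q. {fst (snd f), snd (snd f)})"
    using reach_ends[of "snd ` set Q" "{u}"] ps(9) by auto
  have psS: "set ps \<inter> set S = {}" "v \<notin> set ps"
    using ps_sub core(2) efD(3,4) unfolding touch_def by blast+
  have ZT: "set Z \<subseteq> set T" by (auto simp: T_def targets_def)
  have Fs: "t \<in> set Z \<and> set fs = {} \<or> t \<notin> set Z \<and> (\<exists>f. set fs = {f} \<and> f \<notin> set L - set F \<and> f \<noteq> e \<and> (snd f = (v, t) \<or> snd f = (t, v)) \<and> f \<in> set F)"
  proof (cases "t \<in> set Z")
    case True
    then show ?thesis by (simp add: fs_def)
  next
    case False
    then obtain f0 where "f0 \<in> set (freshv v F S)" "f0 \<noteq> e" "other v (snd f0) = t"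
      using tT by (auto simp: T_def targets_def)
    then have ne: "filter (\<lambda>f. f \<noteq> e \<and> other v (snd f) = t) (freshv v F S) \<noteq> []"
      unfolding filter_empty_conv by blast
    then obtain f rest where f: "filter (\<lambda>f. f \<noteq> e \<and> other v (snd f) = t) (freshv v F S) = f # rest"
      by (meson list.exhaust)
    then have "f \<in> set (filter (\<lambda>f. f \<noteq> e \<and> other v (snd f) = t) (freshv v F S))" by simp
    then have f': "f \<in> set (freshv v F S)" "f \<noteq> e" "other v (snd f) = t" by simp_all
    have "set fs = {f}" using False f by (simp add: fs_def take1_def)
    then show ?thesis using False f'(2) freshvD(1,2)[OF f'(1)] f'(3) by blast
  qed
  have inv': "ears_inv v ((set L - set F) \<union> (insert e (g ` {..<length ps - 1}) \<union> set fs)) ((set Z \<union> set ps) - {u, t}) (set S \<union> {u, t}) (Suc (length ms))"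
  proof (rule ears_inv_step[OF inv])
    show "e \<notin> set L - set F" using efD(1) by blast
    show "snd e = (v, u) \<or> snd e = (u, v)" by (rule efD(2))
    show "u \<noteq> v" "u \<notin> set S" by (rule efD)+
    show "set (butlast ps) \<inter> set Z = {}" using ps(5) ZT by blast
    show "g ` {..<length ps - 1} \<inter> (set L - set F) = {}" using core(1) unfolding ps(6)[symmetric] by blast
    show "t \<in> set Z \<and> set fs = {} \<or> t \<notin> set Z \<and> (\<exists>f. set fs = {f} \<and> f \<notin> set L - set F \<and> f \<noteq> e \<and> (snd f = (v, t) \<or> snd f = (t, v)))"
      using Fs by blast
  qed (use ps psS t_last in simp_all)
  define F' Z' S' where "F' = filter (\<lambda>f. f \<noteq> e \<and> f \<notin> set Q \<and> f \<notin> set fs) F"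
    and "Z' = filter (\<lambda>x. (x \<in> set Z \<or> (\<exists>f \<in> set Q. fst (snd f) = x \<or> snd (snd f) = x)) \<and> x \<noteq> u \<and> x \<noteq> t) V"
    and "S' = filter (\<lambda>x. x \<in> set S \<or> x = u \<or> x = t) V"
  have add: "find_ear v V st e = (F', Z', S', () # ms)"
    unfolding fe unfolding add_ear_def st_eq prod.case F'_def Z'_def S'_def u_def by (rule refl)
  have fsF: "set fs \<subseteq> set F" using Fs by auto
  have M': "set L - set F' = (set L - set F) \<union> (insert e (g ` {..<length ps - 1}) \<union> set fs)"
  proof -
    have "set F' = set F - (insert e (set Q) \<union> set fs)" by (auto simp: F'_def)
    moreover have "insert e (set Q) \<union> set fs \<subseteq> set L" using efD(1) core(1) fsF FL by blast
    ultimately show ?thesis unfolding ps(6)[symmetric] by blast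
  qed
  have inV: "fst (snd f) \<in> set V \<and> snd (snd f) \<in> set V" if "f \<in> set F" for f
    using V(2)[of f] FL that by (auto simp: inside_def)
  have uV: "u \<in> set V"
  proof -
    have "fst (snd e) = u \<or> snd (snd e) = u" using efD(2) by (metis fst_conv snd_conv)
    then show ?thesis using inV[OF efD(1)] by blast
  qed
  have psV: "set ps \<subseteq> set V" using ps_sub uV inV core(1) by blast
  have tV: "t \<in> set V" unfolding t_last using psV last_in_set[OF ps(1)] by blast
  have Z': "set Z' = (set Z \<union> set ps) - {u, t}"
  proof -
    have "f \<in> set Q \<Longrightarrow> fst (snd f) \<in> set ps \<and> snd (snd f) \<in> set ps" for f
    proof -
      assume "f \<in> set Q"
      then obtain j where j: "j < length ps - 1" "f = g j" using ps(6) by auto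
      then have "Suc j < length ps" by simp
      then show "fst (snd f) \<in> set ps \<and> snd (snd f) \<in> set ps"
        using ps(8)[of j] j(2) nth_mem[of j ps] nth_mem[of "Suc j" ps] by auto
    qed
    then show ?thesis using ps_sub psV ZSV unfolding Z'_def by auto
  qed
  have S': "set S' = set S \<union> {u, t}" using ZSV uV tV by (auto simp: S'_def)
  show "ears_state v V L (find_ear v V st e)"
    unfolding add ears_state_def prod.case M' Z' S'
    using inv' FL V(1) ZSV psV uV tV distF by (auto simp: F'_def S'_def)
  show "length (fst (find_ear v V st e)) < length (fst st)"
    unfolding add unfolding st_eq fst_conv F'_def using efD(1) by (intro length_filter_less[of e]) auto
qed

lemma ears_correct:
  assumes V: "distinct V" "\<And>e. e \<in> set L \<Longrightarrow> inside (set V) (snd e)"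
  shows "ears_state v V L (ears v V L)" "earcands v (ears v V L) = []"
proof -
  have "ears_state v V L ((earstep v V ^^ length L) (L, [], [], [])) \<and>
    earstep v V ((earstep v V ^^ length L) (L, [], [], [])) = (earstep v V ^^ length L) (L, [], [], [])"
  proof (rule iterate_stable[where \<mu> = "\<lambda>st. length (fst st)"])
    fix st assume st: "ears_state v V L st"
    show "ears_state v V L (earstep v V st)"
      using st find_ear_state(1)[OF V st] by (auto simp: earstep_def split: list.split)
    show "length (fst (earstep v V st)) < length (fst st)" if "earstep v V st \<noteq> st"
      using that find_ear_state(2)[OF V st] by (auto simp: earstep_def split: list.splits)
  next
    show "ears_state v V L (L, [], [], [])" by (simp add: ears_state_def ears_inv_init)
  qed simp
  then have st: "ears_state v V L (ears v V L)" and fixp: "earstep v V (ears v V L) = ears v V L"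
    unfolding ears_def fold_const_funpow by blast+
  show "ears_state v V L (ears v V L)" by (rule st)
  show "earcands v (ears v V L) = []"
  proof (cases "earcands v (ears v V L)")
    case (Cons e es)
    then have "earstep v V (ears v V L) = find_ear v V (ears v V L) e" by (simp add: earstep_def)
    moreover have "e \<in> set (earcands v (ears v V L))" unfolding Cons by (rule list.set_intros(1))
    then have "length (fst (find_ear v V (ears v V L) e)) < length (fst (ears v V L))"
      using find_ear_state(2)[of V L v "ears v V L" e] V st by blast
    ultimately show ?thesis using fixp by simp
  qed simp
qed

definition lobel :: "nat \<Rightarrow> nat list \<Rightarrow> ledge list \<Rightarrow> nat list \<Rightarrow> ledge \<Rightarrow> nat list" where
  "lobel v V F S e = (let R = reachl (map snd (coreE v F S)) [other v (snd e)] in filter (\<lambda>x. x \<in> set R) V)"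

text \<open>When no ear is left, what can be reached from a fresh edge \<open>e\<close> outside
  \<open>v\<close> and the hubs avoids \<open>Z\<close> and the far ends of all other fresh edges.
  Hence \<open>e\<close> is the only edge between this component and \<open>v\<close>, all its other
  outer neighbours are hubs, and different fresh edges have disjoint components.\<close>

lemma lobes_correct:
  assumes V: "distinct V" and es: "set es \<subseteq> set V \<times> set V"
    and ears: "ears v V (List.enumerate 0 es) = (F, Z, S, ms)"
  shows "e \<in> set (freshv v F S) \<Longrightarrow> lobe es v (set S) (set (lobel v V F S e))"
    and "e \<in> set (freshv v F S) \<Longrightarrow> f \<in> set (freshv v F S) \<Longrightarrow> e \<noteq> f \<Longrightarrow>
      set (lobel v V F S e) \<inter> set (lobel v V F S f) = {}"
    and "e \<in> set (freshv v F S) \<Longrightarrow> other v (snd e) \<in> set (lobel v V F S e)"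
proof -
  let ?L = "List.enumerate 0 es"
  have inV: "inside (set V) (snd e)" if "e \<in> set ?L" for e
  proof -
    have "snd e \<in> set es" using that set_enumerate_snd[of 0 es] by blast
    then show ?thesis using es by (auto simp: inside_def)
  qed
  have st: "ears_state v V ?L (F, Z, S, ms)" and nc: "earcands v (F, Z, S, ms) = []"
    using ears_correct[OF V inV, of ?L v] ears by simp_all
  have FL: "set F \<subseteq> set ?L" and inv: "ears_inv v (set ?L - set F) (set Z) (set S) (length ms)"
    using st by (simp_all add: ears_state_def)
  let ?Q = "snd ` set (coreE v F S)"
  let ?C = "\<lambda>e. reach ?Q {other v (snd e)}"
  have Q_sub: "?Q \<subseteq> set es" using FL set_enumerate_snd[of 0 es] by (auto simp: coreE_def)
  have fD: "e \<in> set ?L" "other v (snd e) \<in> set V" if "e \<in> set (freshv v F S)" for e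
  proof -
    show eL: "e \<in> set ?L" using freshvD(1)[OF that] FL by blast
    have "fst (snd e) = other v (snd e) \<or> snd (snd e) = other v (snd e)"
      using freshvD(2)[OF that] by (metis fst_conv snd_conv)
    then show "other v (snd e) \<in> set V" using inV[OF eL] by (auto simp: inside_def)
  qed
  have C_sub: "?C e \<subseteq> set V - insert v (set S)" if "e \<in> set (freshv v F S)" for e
  proof (rule reach_least)
    show "{other v (snd e)} \<subseteq> set V - insert v (set S)" using freshvD(3,4)[OF that] fD(2)[OF that] by simp
    fix x y assume "(x, y) \<in> ?Q"
    then obtain f where f: "f \<in> set (coreE v F S)" "snd f = (x, y)" by auto
    then have "inside (set V) (x, y)" using inV[of f] FL by (auto simp: coreE_def)
    then show "x \<in> set V - insert v (set S) \<longleftrightarrow> y \<in> set V - insert v (set S)"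
      using f by (auto simp: coreE_def inside_def)
  qed
  have lob: "set (lobel v V F S e) = ?C e" if "e \<in> set (freshv v F S)" for e
  proof -
    have "set (lobel v V F S e) = {x \<in> set V. x \<in> ?C e}"
      unfolding lobel_def Let_def by (simp add: set_reachl)
    then show ?thesis using C_sub[OF that] by blast
  qed
  have noT: "?C e \<inter> set (targets v F Z S e) = {}" if "e \<in> set (freshv v F S)" for e
  proof -
    have "\<not> hits (targets v F Z S e) (other v (snd e)) (coreE v F S)"
      using nc that by (simp add: earcands_def filter_empty_conv)
    then show ?thesis unfolding hits_iff by blast
  qed
  have CZ: "?C e \<inter> set Z = {}" if "e \<in> set (freshv v F S)" for e
    using noT[OF that] by (auto simp: targets_def)
  have Cf: "other v (snd f) \<notin> ?C e" if "e \<in> set (freshv v F S)" "f \<in> set (freshv v F S)" "f \<noteq> e" for e f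
    using noT[OF that(1)] that(2,3) by (auto simp: targets_def)
  have touchF: "f \<in> set F" if e: "e \<in> set (freshv v F S)" and f: "f \<in> set ?L" "touch (?C e) (snd f)" for e f
  proof (rule ccontr)
    assume "f \<notin> set F"
    then have "inside (insert v (set Z \<union> set S)) (snd f)" using inv f(1) by (simp add: ears_inv_def)
    then show False using f(2) CZ[OF e] C_sub[OF e] by (auto simp: inside_def touch_def)
  qed
  have closed: "inside (?C e) (snd f)" if e: "e \<in> set (freshv v F S)" and f: "f \<in> set ?L" "touch (?C e) (snd f)"
     "\<not> touch (insert v (set S)) (snd f)" for e f
  proof -
    have "f \<in> set (coreE v F S)" using touchF[OF e f(1,2)] f(3) by (auto simp: coreE_def touch_def)
    then have "(fst (snd f), snd (snd f)) \<in> ?Q" by auto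
    then have "fst (snd f) \<in> ?C e \<longleftrightarrow> snd (snd f) \<in> ?C e" by (rule reach_closed)
    then show ?thesis using f(2) by (auto simp: inside_def touch_def)
  qed
  show "lobe es v (set S) (set (lobel v V F S e))" if e: "e \<in> set (freshv v F S)"
    unfolding lob[OF e] lobe_def
  proof (intro conjI ballI impI)
    have uC: "other v (snd e) \<in> ?C e" by (simp add: reach_start)
    show "?C e \<noteq> {}" using uC by blast
    show "v \<notin> ?C e" "?C e \<inter> set S = {}" using C_sub[OF e] by blast+
    show "conn (set es) (?C e)" using conn_reach[of ?Q] by (rule conn_mono) (use Q_sub in blast)
    fix p assume p: "p \<in> set es" "touch (?C e) p"
    obtain f where f: "f \<in> set ?L" "snd f = p" using p(1) set_enumerate_snd[of 0 es] by (metis imageE)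
    show "inside (insert v (set S \<union> ?C e)) p"
    proof (cases "touch (insert v (set S)) p")
      case True
      then show ?thesis using p(2) C_sub[OF e] unfolding inside_def touch_def by blast
    next
      case False
      then have "inside (?C e) p" using closed[OF e f(1)] p(2) f(2) by simp
      then show ?thesis by (rule inside_mono) blast
    qed
  next
    have "{f \<in> set ?L. touch (?C e) (snd f) \<and> touch {v} (snd f)} = {e}"
    proof (intro equalityI subsetI)
      fix f assume "f \<in> {f \<in> set ?L. touch (?C e) (snd f) \<and> touch {v} (snd f)}"
      then have f: "f \<in> set ?L" "touch (?C e) (snd f)" "touch {v} (snd f)" by auto
      have fF: "f \<in> set F" by (rule touchF[OF e f(1,2)])
      have fv: "fst (snd f) = v \<or> snd (snd f) = v" using f(3) by (simp add: touch_def)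
      have o: "other v (snd f) \<in> ?C e" using f(2) fv C_sub[OF e] by (auto simp: touch_def other_def)
      then have "f \<in> set (freshv v F S)" using fF fv C_sub[OF e] by (auto simp: freshv_def)
      then show "f \<in> {e}" using Cf[OF e] o by blast
    next
      fix f assume "f \<in> {e}"
      moreover have "touch (?C e) (snd e)"
      proof -
        have "fst (snd e) = other v (snd e) \<or> snd (snd e) = other v (snd e)"
          using freshvD(2)[OF e] by (metis fst_conv snd_conv)
        then show ?thesis using reach_start[of "other v (snd e)" "{other v (snd e)}" ?Q] unfolding touch_def by force
      qed
      moreover have "touch {v} (snd e)" using e by (simp add: freshv_def touch_def)
      ultimately show "f \<in> {f \<in> set ?L. touch (?C e) (snd f) \<and> touch {v} (snd f)}" using fD(1)[OF e] by blast
    qed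
    then show "length (filter (\<lambda>p. touch (?C e) p \<and> touch {v} p) es) = 1"
      unfolding length_filter_enumerate by simp
  qed
  show "set (lobel v V F S e) \<inter> set (lobel v V F S f) = {}"
    if e: "e \<in> set (freshv v F S)" and f: "f \<in> set (freshv v F S)" and ne: "e \<noteq> f"
  proof (rule ccontr)
    assume "set (lobel v V F S e) \<inter> set (lobel v V F S f) \<noteq> {}"
    then obtain x where "x \<in> ?C e" "x \<in> ?C f" using lob e f by blast
    then have "?C e = ?C f" by (metis reach_eq)
    then have "other v (snd f) \<in> ?C e" by (simp add: reach_start)
    then show False using Cf[OF e f] ne by blast
  qed
  show "other v (snd e) \<in> set (lobel v V F S e)" if "e \<in> set (freshv v F S)"
    unfolding lob[OF that] by (simp add: reach_start)
qed

subsection \<open>Assigning lobes to hubs\<close>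

text \<open>A push-relabel scheme: \<open>asg\<close> assigns every key to one of its neighbours in \<open>S\<close>, and
  overloaded elements of \<open>S\<close> pass keys on to neighbours with smaller labels.  If some label
  exceeds the size of \<open>S\<close>, then there is a gap between the labels, and the elements above the
  gap violate Hall's condition.\<close>

definition lab :: "nat list \<Rightarrow> nat \<Rightarrow> nat" where
  "lab labs s = length (filter (\<lambda>x. x = s) labs)"

definition load :: "('a \<times> nat) list \<Rightarrow> nat \<Rightarrow> nat" where
  "load asg s = length (filter (\<lambda>p. snd p = s) asg)"

definition prmoves :: "nat \<Rightarrow> ('a \<times> nat) list \<Rightarrow> ('a \<times> nat) list \<times> nat list \<Rightarrow> ('a \<times> nat) list" where
  "prmoves q Adj st = filter (\<lambda>a. \<exists>p \<in> set (fst st). fst p = fst a \<and> q < load (fst st) (snd p) \<and>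
     lab (snd st) (snd a) < lab (snd st) (snd p)) Adj"

text \<open>A label is raised only if no overloaded element can pass a key on. The first test
  freezes the state once a label exceeds \<open>length S\<close>, which keeps the number of steps
  bounded.\<close>

definition prstep :: "nat \<Rightarrow> nat list \<Rightarrow> ('a \<times> nat) list \<Rightarrow> ('a \<times> nat) list \<times> nat list \<Rightarrow> ('a \<times> nat) list \<times> nat list" where
  "prstep q S Adj st = (if \<exists>s \<in> set S. length S < lab (snd st) s then st
     else case prmoves q Adj st of
       [] \<Rightarrow> (case filter (\<lambda>s. q < load (fst st) s) S of [] \<Rightarrow> st | s # ss \<Rightarrow> (fst st, s # snd st))
     | a # as \<Rightarrow> (map (\<lambda>p. if fst p = fst a then a else p) (fst st), snd st))"

text \<open>The third clause is the validity of labels in push-relabel algorithms: a possible move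
  never descends more than one level. The last clause says that an element whose label was ever
  raised keeps load at least \<open>q\<close>.\<close>

definition pr_inv :: "nat \<Rightarrow> ('a \<times> nat) list \<Rightarrow> 'a list \<Rightarrow> ('a \<times> nat) list \<times> nat list \<Rightarrow> bool" where
  "pr_inv q Adj keys st \<longleftrightarrow> map fst (fst st) = keys \<and> set (fst st) \<subseteq> set Adj \<and>
     (\<forall>p \<in> set (fst st). \<forall>a \<in> set Adj. fst a = fst p \<longrightarrow> lab (snd st) (snd p) \<le> lab (snd st) (snd a) + 1) \<and>
     (\<forall>s. 1 \<le> lab (snd st) s \<longrightarrow> q \<le> load (fst st) s)"

text \<open>The elements with at least the label of \<open>s1\<close> form the Hall violator: each
  of them is fully loaded, and the keys assigned to them have no neighbours below that
  level.\<close>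

definition good_level :: "nat \<Rightarrow> nat list \<Rightarrow> ('a \<times> nat) list \<Rightarrow> ('a \<times> nat) list \<times> nat list \<Rightarrow> nat \<Rightarrow> bool" where
  "good_level q S Adj st s1 \<longleftrightarrow>
     (\<forall>s \<in> set S. lab (snd st) s1 \<le> lab (snd st) s \<longrightarrow> q \<le> load (fst st) s) \<and>
     (\<forall>p \<in> set (fst st). \<forall>a \<in> set Adj. lab (snd st) s1 \<le> lab (snd st) (snd p) \<and> fst a = fst p \<longrightarrow>
        lab (snd st) s1 \<le> lab (snd st) (snd a))"

text \<open>The label of an element is its number of occurrences in a list. Raising a label is a
  \<open>Cons\<close>, and labels remain unary.\<close>

lemma lab_Cons: "lab (s # labs) x = lab labs x + of_bool (x = s)"
  by (simp add: lab_def)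

lemma length_filter_key_le:
  "distinct (map fst xs) \<Longrightarrow> length (filter (\<lambda>p. fst p = k) xs) \<le> 1"
  by (induction xs) (auto simp: filter_empty_conv image_iff)

lemma distinct_keyD: "distinct (map fst xs) \<Longrightarrow> p \<in> set xs \<Longrightarrow> p' \<in> set xs \<Longrightarrow> fst p = fst p' \<Longrightarrow> p = p'"
  by (metis eq_key_imp_eq_value prod.collapse)

lemma sum_list_less:
  fixes f g :: "'a \<Rightarrow> nat"
  assumes "\<And>x. x \<in> set xs \<Longrightarrow> f x \<le> g x" "x \<in> set xs" "f x < g x"
  shows "sum_list (map f xs) < sum_list (map g xs)"
  using assms
proof (induction xs)
  case (Cons y ys)
  have le: "sum_list (map f ys) \<le> sum_list (map g ys)"
    by (rule sum_list_mono) (use Cons.prems(1) in simp)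
  show ?case
  proof (cases "x = y")
    case True
    then show ?thesis using le Cons.prems(3) by simp
  next
    case False
    then have "sum_list (map f ys) < sum_list (map g ys)" using Cons by simp
    moreover have "f y \<le> g y" using Cons.prems(1) by simp
    ultimately show ?thesis by simp
  qed
qed simp

text \<open>A lexicographic order as one number. A push lowers the second summand only. Raising a
  label adds at most \<open>length asg\<close> to the second summand and lowers the first by at
  least \<open>length asg + 1\<close>.\<close>

definition prpot :: "nat list \<Rightarrow> ('a \<times> nat) list \<times> nat list \<Rightarrow> nat" where
  "prpot S st = (\<Sum>s\<in>set S. length S + 1 - lab (snd st) s) * (length (fst st) + 1) +
     sum_list (map (\<lambda>p. lab (snd st) (snd p)) (fst st))"

lemma sum_list_lab_Cons: "sum_list (map (\<lambda>p. lab (s # labs) (snd p)) asg) = sum_list (map (\<lambda>p. lab labs (snd p)) asg) + load asg s"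
  by (induction asg) (auto simp: lab_Cons load_def)

lemma prstep_correct:
  assumes inv: "pr_inv q Adj keys st" and keys: "distinct keys"
  shows "pr_inv q Adj keys (prstep q S Adj st)" "prstep q S Adj st \<noteq> st \<Longrightarrow> prpot S (prstep q S Adj st) < prpot S st"
proof -
  obtain asg labs where st: "st = (asg, labs)" by (cases st)
  have fst_asg: "map fst asg = keys" and sub: "set asg \<subseteq> set Adj"
    and V1: "\<And>p a. p \<in> set asg \<Longrightarrow> a \<in> set Adj \<Longrightarrow> fst a = fst p \<Longrightarrow> lab labs (snd p) \<le> lab labs (snd a) + 1"
    and V2: "\<And>s. 1 \<le> lab labs s \<Longrightarrow> q \<le> load asg s"
    using inv by (simp_all add: pr_inv_def st)
  have dist: "distinct (map fst asg)" using fst_asg keys by simp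
  have "pr_inv q Adj keys (prstep q S Adj st) \<and> (prstep q S Adj st \<noteq> st \<longrightarrow> prpot S (prstep q S Adj st) < prpot S st)"
  proof (cases "\<exists>s \<in> set S. length S < lab labs s")
    case True
    then have "prstep q S Adj st = st" by (simp add: prstep_def st)
    then show ?thesis using inv by simp
  next
    case small: False
    show ?thesis
    proof (cases "prmoves q Adj st")
      case (Cons a as)
      then have "a \<in> set (prmoves q Adj st)" by simp
      then obtain p0 where a: "a \<in> set Adj" and p0: "p0 \<in> set asg" "fst p0 = fst a" "q < load asg (snd p0)"
        "lab labs (snd a) < lab labs (snd p0)" by (auto simp: prmoves_def st)
      let ?f = "\<lambda>p. if fst p = fst a then a else p"
      have step: "prstep q S Adj st = (map ?f asg, labs)"
        using small Cons by (simp add: prstep_def st)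
      have uniq: "p = p0" if "p \<in> set asg" "fst p = fst a" for p
        using distinct_keyD[OF dist that(1) p0(1)] that(2) p0(2) by simp
      \<comment> \<open>Keys are distinct, so a push moves one key. Its former owner had load above
        \<open>q\<close> and therefore keeps at least \<open>q\<close>, as the last clause of the
        invariant demands.\<close>
      have load': "load (map ?f asg) x \<ge> (if x = snd p0 then load asg x - 1 else load asg x)" for x
      proof -
        have eq: "load (map ?f asg) x = length (filter (\<lambda>p. snd (?f p) = x) asg)"
          by (simp add: load_def filter_map comp_def)
        show ?thesis
        proof (cases "x = snd p0")
          case True
          have "load asg x \<le> length (filter (\<lambda>p. snd (?f p) = x) asg) + length (filter (\<lambda>p. fst p = fst a) asg)"
            unfolding load_def by (rule length_filter_le_add) auto
          then show ?thesis using length_filter_key_le[OF dist, of "fst a"] True eq by simp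
        next
          case False
          have "load asg x \<le> length (filter (\<lambda>p. snd (?f p) = x) asg)"
            unfolding load_def by (rule length_filter_mono) (use uniq False in auto)
          then show ?thesis using False eq by simp
        qed
      qed
      have "pr_inv q Adj keys (map ?f asg, labs)"
        unfolding pr_inv_def fst_conv snd_conv
      proof (intro conjI ballI allI impI)
        have "map fst (map ?f asg) = map fst asg" by auto
        then show "map fst (map ?f asg) = keys" using fst_asg by simp
        show "set (map ?f asg) \<subseteq> set Adj" using sub a by auto
        show "q \<le> load (map ?f asg) s" if "1 \<le> lab labs s" for s
          using load'[of s] V2[OF that] p0(3) by (auto split: if_splits)
        fix p b assume p: "p \<in> set (map ?f asg)" and b: "b \<in> set Adj" "fst b = fst p"
        from p have "p \<in> ?f ` set asg" by (simp only: set_map)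
        then obtain p1 where p1: "p1 \<in> set asg" "p = ?f p1" by (elim imageE)
        show "lab labs (snd p) \<le> lab labs (snd b) + 1"
        proof (cases "fst p1 = fst a")
          case True
          then have "lab labs (snd p0) \<le> lab labs (snd b) + 1" using V1[OF p0(1) b(1)] b(2) p0(2) p1(2) by simp
          then show ?thesis using p0(4) True p1(2) by simp
        next
          case False
          then show ?thesis using V1[OF p1(1) b(1)] b(2) p1(2) by simp
        qed
      qed
      moreover have "sum_list (map (\<lambda>p. lab labs (snd (?f p))) asg) < sum_list (map (\<lambda>p. lab labs (snd p)) asg)"
      proof (rule sum_list_less[OF _ p0(1)])
        show "lab labs (snd (?f p)) \<le> lab labs (snd p)" if "p \<in> set asg" for p
          using uniq[OF that] p0(4) by auto
      qed (use p0 in simp)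
      then have "prpot S (map ?f asg, labs) < prpot S st"
        unfolding prpot_def st by (simp add: comp_def)
      ultimately show ?thesis using step by simp
    next
      case Nil
      show ?thesis
      proof (cases "filter (\<lambda>s. q < load asg s) S")
        case Nil': Nil
        then have "prstep q S Adj st = st" using Nil by (simp add: prstep_def st)
        then show ?thesis using inv by simp
      next
        case (Cons s ss)
        then have "s \<in> set (filter (\<lambda>s. q < load asg s) S)" by simp
        then have s: "s \<in> set S" "q < load asg s" by simp_all
        have step: "prstep q S Adj st = (asg, s # labs)"
          using small Nil Cons by (simp add: prstep_def st)
        \<comment> \<open>No push from the overloaded \<open>s\<close> is possible, so all
          alternatives for its keys have labels no smaller than that of \<open>s\<close>. Raising
          the label by one keeps the labels valid.\<close>
        have nomove: "lab labs (snd p) \<le> lab labs (snd a)"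
          if "p \<in> set asg" "a \<in> set Adj" "fst a = fst p" "snd p = s" for p a
          using Nil that s(2) by (force simp: prmoves_def st filter_empty_conv)
        have "pr_inv q Adj keys (asg, s # labs)"
          unfolding pr_inv_def fst_conv snd_conv
        proof (intro conjI ballI allI impI)
          show "map fst asg = keys" "set asg \<subseteq> set Adj" by (rule fst_asg sub)+
          show "q \<le> load asg x" if "1 \<le> lab (s # labs) x" for x
            using V2[of x] that s(2) by (cases "x = s") (auto simp: lab_Cons)
          fix p a assume pa: "p \<in> set asg" "a \<in> set Adj" "fst a = fst p"
          show "lab (s # labs) (snd p) \<le> lab (s # labs) (snd a) + 1"
            using V1[OF pa] nomove[OF pa] by (cases "snd p = s") (auto simp: lab_Cons)
        qed
        moreover have "(\<Sum>x\<in>set S. length S + 1 - lab (s # labs) x) + 1 \<le> (\<Sum>x\<in>set S. length S + 1 - lab labs x)"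
        proof -
          have "(\<Sum>x\<in>set S. length S + 1 - lab (s # labs) x) < (\<Sum>x\<in>set S. length S + 1 - lab labs x)"
          proof (rule sum_strict_mono_ex1)
            show "\<forall>x\<in>set S. length S + 1 - lab (s # labs) x \<le> length S + 1 - lab labs x"
              by (intro ballI diff_le_mono2) (simp add: lab_Cons)
            have "lab labs s \<le> length S" using small s(1) by (meson not_le_imp_less)
            then show "\<exists>x\<in>set S. length S + 1 - lab (s # labs) x < length S + 1 - lab labs x"
              by (intro bexI[OF _ s(1)]) (simp add: lab_Cons)
          qed simp
          then show ?thesis by simp
        qed
        then have "((\<Sum>x\<in>set S. length S + 1 - lab (s # labs) x) + 1) * (length asg + 1)
            \<le> (\<Sum>x\<in>set S. length S + 1 - lab labs x) * (length asg + 1)" by (rule mult_le_mono1)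
        then have "prpot S (asg, s # labs) < prpot S st"
        proof -
          assume A: "((\<Sum>x\<in>set S. length S + 1 - lab (s # labs) x) + 1) * (length asg + 1)
            \<le> (\<Sum>x\<in>set S. length S + 1 - lab labs x) * (length asg + 1)"
          have "load asg s \<le> length asg" unfolding load_def by (rule length_filter_le)
          then show ?thesis using A unfolding prpot_def st fst_conv snd_conv sum_list_lab_Cons
            by (simp only: add_mult_distrib mult_1)
        qed
        ultimately show ?thesis using step by simp
      qed
    qed
  qed
  then show "pr_inv q Adj keys (prstep q S Adj st)" "prstep q S Adj st \<noteq> st \<Longrightarrow> prpot S (prstep q S Adj st) < prpot S st"
    by blast+
qed

text \<open>The number of rounds is an upper bound for the initial potential.\<close>

definition assign :: "nat \<Rightarrow> nat list \<Rightarrow> ('a \<times> nat) list \<Rightarrow> ('a \<times> nat) list \<Rightarrow> ('a \<times> nat) list \<times> nat list" where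
  "assign q S Adj asg = fold (\<lambda>_. prstep q S Adj) (replicate (length S * (length S + 1) * (length asg + 1)) ()) (asg, [])"

lemma assign_correct:
  assumes asg: "set asg \<subseteq> set Adj" "distinct (map fst asg)"
  shows "pr_inv q Adj (map fst asg) (assign q S Adj asg)" "prstep q S Adj (assign q S Adj asg) = assign q S Adj asg"
proof -
  let ?n = "length S * (length S + 1) * (length asg + 1)"
  have "pr_inv q Adj (map fst asg) ((prstep q S Adj ^^ ?n) (asg, [])) \<and>
    prstep q S Adj ((prstep q S Adj ^^ ?n) (asg, [])) = (prstep q S Adj ^^ ?n) (asg, [])"
  proof (rule iterate_stable[where \<mu> = "prpot S"])
    show "pr_inv q Adj (map fst asg) (asg, [])" using asg(1) by (simp add: pr_inv_def lab_def)
    have "(\<Sum>s\<in>set S. length S + 1) \<le> length S * (length S + 1)"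
      unfolding sum_constant of_nat_id by (rule mult_le_mono1) (rule card_length)
    then have "(\<Sum>s\<in>set S. length S + 1) * (length asg + 1) \<le> ?n" by (rule mult_le_mono1)
    moreover have "prpot S (asg, []) = (\<Sum>s\<in>set S. length S + 1) * (length asg + 1)"
      by (simp add: prpot_def lab_def)
    ultimately show "prpot S (asg, []) \<le> ?n" by simp
  qed (use prstep_correct asg(2) in blast)+
  then show "pr_inv q Adj (map fst asg) (assign q S Adj asg)" "prstep q S Adj (assign q S Adj asg) = assign q S Adj asg"
    unfolding assign_def fold_const_funpow by simp_all
qed

lemma length_le_sum_load:
  assumes "finite T" "snd ` set asg \<subseteq> T"
  shows "length asg \<le> (\<Sum>s\<in>T. load asg s)"
  using assms(2)
proof (induction asg)
  case (Cons p asg)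
  have "(\<Sum>s\<in>T. load (p # asg) s) = (\<Sum>s\<in>T. load asg s + (if snd p = s then 1 else 0))"
    by (rule sum.cong) (auto simp: load_def)
  also have "\<dots> = (\<Sum>s\<in>T. load asg s) + 1"
    using Cons.prems assms(1) by (simp add: sum.distrib)
  finally show ?case using Cons by simp
qed simp

text \<open>A label above \<open>length S\<close> would leave a gap among the lower labels, and
  everything above a gap is a good level. Without good levels all labels are therefore small, so
  stability means that no element is overloaded, and adding up the loads bounds the number of
  keys.\<close>

lemma assign_stable:
  assumes inv: "pr_inv q Adj keys st" and stable: "prstep q S Adj st = st"
    and S: "snd ` set Adj \<subseteq> set S" "distinct S" and none: "\<And>s. s \<in> set S \<Longrightarrow> \<not> good_level q S Adj st s"
  shows "length keys \<le> q * length S"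
proof -
  obtain asg labs where st: "st = (asg, labs)" by (cases st)
  have fst_asg: "map fst asg = keys" and sub: "set asg \<subseteq> set Adj"
    and V1: "\<And>p a. p \<in> set asg \<Longrightarrow> a \<in> set Adj \<Longrightarrow> fst a = fst p \<Longrightarrow> lab labs (snd p) \<le> lab labs (snd a) + 1"
    and V2: "\<And>s. 1 \<le> lab labs s \<Longrightarrow> q \<le> load asg s"
    using inv by (simp_all add: pr_inv_def st)
  have small: "\<not> (\<exists>s \<in> set S. length S < lab labs s)"
  proof
    assume "\<exists>s \<in> set S. length S < lab labs s"
    then obtain s0 where s0: "s0 \<in> set S" "length S < lab labs s0" by blast
    \<comment> \<open>Pigeonhole: the elements other than \<open>s0\<close> are too few to take all
      values from \<open>1\<close> to \<open>length S\<close>, and the label of \<open>s0\<close>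
      lies above this range. Some value \<open>g\<close> is therefore no label at all.\<close>
    have "card (lab labs ` (set S - {s0})) \<le> card (set S - {s0})" by (rule card_image_le) simp
    also have "\<dots> < card {1..length S}"
      using card_Diff1_less[of "set S" s0] s0(1) distinct_card[OF S(2)] by simp
    finally have "\<not> {1..length S} \<subseteq> lab labs ` (set S - {s0})"
      by (meson card_mono finite_Diff finite_imageI finite_set not_le)
    then obtain g where g0: "g \<in> {1..length S}" "g \<notin> lab labs ` (set S - {s0})" by blast
    then have g: "1 \<le> g" "g \<le> length S" "g \<notin> lab labs ` (set S - {s0})" by simp_all
    have gap: "lab labs s \<noteq> g" if "s \<in> set S" for s
      using g s0(2) that by (cases "s = s0") auto
    \<comment> \<open>The lowest label above the gap. Moves descend by at most one level, so from
      above the gap they reach level \<open>g\<close> at the lowest; since this level is empty, they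
      stay above the gap.\<close>
    obtain s1 where s1: "s1 \<in> set S \<and> g < lab labs s1" "\<And>s. s \<in> set S \<and> g < lab labs s \<Longrightarrow> lab labs s1 \<le> lab labs s"
      using ex_has_least_nat[of "\<lambda>s. s \<in> set S \<and> g < lab labs s" s0 "lab labs"] s0 g(2) by auto
    have up: "lab labs s1 \<le> lab labs s" if "s \<in> set S" "g \<le> lab labs s" for s
      using s1(2)[of s] gap[of s] that by simp
    have "good_level q S Adj st s1"
      unfolding good_level_def st fst_conv snd_conv
    proof (intro conjI ballI impI)
      show "q \<le> load asg s" if "lab labs s1 \<le> lab labs s" for s
        using V2[of s] s1(1) g(1) that by simp
      fix p a assume pa: "p \<in> set asg" "a \<in> set Adj" "lab labs s1 \<le> lab labs (snd p) \<and> fst a = fst p"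
      then have "lab labs (snd p) \<le> lab labs (snd a) + 1" using V1 by blast
      then have "g \<le> lab labs (snd a)" using pa(3) s1(1) by simp
      moreover have "snd a \<in> set S" using S(1) pa(2) by blast
      ultimately show "lab labs s1 \<le> lab labs (snd a)" using up by blast
    qed
    then show False using none s1(1) by blast
  qed
  have le: "load asg s \<le> q" if "s \<in> set S" for s
  proof (rule ccontr)
    assume "\<not> load asg s \<le> q"
    then have ne: "filter (\<lambda>s. q < load asg s) S \<noteq> []"
      unfolding filter_empty_conv not_le[symmetric] using that by blast
    show False
    proof (cases "prmoves q Adj st")
      case Nil
      then have "snd (prstep q S Adj st) \<noteq> labs"
        using ne small by (auto simp: prstep_def st split: list.split)
      then show False using stable st by simp
    next
      case (Cons a as)
      then have "a \<in> set (prmoves q Adj st)" by simp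
      then obtain p0 where p0: "p0 \<in> set asg" "fst p0 = fst a" "lab labs (snd a) < lab labs (snd p0)"
        by (auto simp: prmoves_def st)
      have "map (\<lambda>p. if fst p = fst a then a else p) asg = asg"
        using stable small Cons by (simp add: prstep_def st)
      then have "map (\<lambda>p. if fst p = fst a then a else p) asg = map (\<lambda>p. p) asg" by simp
      then have "\<forall>p \<in> set asg. (if fst p = fst a then a else p) = p" by (simp only: map_eq_conv)
      then have "(if fst p0 = fst a then a else p0) = p0" using p0(1) by blast
      then show False using p0(2,3) by simp
    qed
  qed
  have "length asg \<le> (\<Sum>s\<in>set S. load asg s)"
    by (rule length_le_sum_load) (use sub S(1) in auto)
  also have "\<dots> \<le> of_nat (card (set S)) * q" by (rule sum_bounded_above) (rule le)
  finally show ?thesis using fst_asg distinct_card[OF S(2)] by (metis length_map mult.commute of_nat_id)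
qed

subsection \<open>The reduction step\<close>

text \<open>The third component of a state is the budget in unary.\<close>

type_synonym rstate = "nat list \<times> (nat \<times> nat) list \<times> unit list"

definition compl :: "nat list \<Rightarrow> (nat \<times> nat) list \<Rightarrow> nat \<Rightarrow> nat list" where
  "compl V es x = filter (\<lambda>y. y \<in> set (reachl es [x])) V"

definition loops :: "nat \<Rightarrow> (nat \<times> nat) list \<Rightarrow> nat" where
  "loops x es = length (filter (inside {x}) es)"

definition deg :: "nat \<Rightarrow> (nat \<times> nat) list \<Rightarrow> nat" where
  "deg x es = length (filter (touch {x}) es) + loops x es"

definition cand_comp :: "nat \<Rightarrow> rstate \<Rightarrow> rstate list" where
  "cand_comp r st = (case st of (V, es, ks) \<Rightarrow>
     map (\<lambda>x. (filter (\<lambda>y. y \<notin> set (compl V es x)) V, avoid (set (compl V es x)) es, ks))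
       (filter (\<lambda>x. cnt (set (compl V es x)) es + 1 \<le> length (compl V es x) + r) V))"

definition cand_leaf :: "rstate \<Rightarrow> rstate list" where
  "cand_leaf st = (case st of (V, es, ks) \<Rightarrow>
     map (\<lambda>x. (filter (\<lambda>y. y \<noteq> x) V, avoid {x} es, ks)) (filter (\<lambda>x. deg x es \<le> 1) V))"

definition cand_contract :: "rstate \<Rightarrow> rstate list" where
  "cand_contract st = (case st of (V, es, ks) \<Rightarrow>
     concat (map (\<lambda>x. case filter (touch {x}) es of [] \<Rightarrow> [] | p # ps \<Rightarrow>
         (case ps of [] \<Rightarrow> [] | q # qs \<Rightarrow>
            [(filter (\<lambda>y. y \<noteq> x) V, (other x p, other x q) # avoid {x} es, ks)]))
       (filter (\<lambda>x. deg x es \<le> 2 \<and> loops x es \<le> 0) V)))"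

text \<open>The threshold is \<open>r + 3\<close> because \<open>r + 2\<close> copies are kept; a
  smaller bundle would not shrink.\<close>

definition cand_parallel :: "nat \<Rightarrow> rstate \<Rightarrow> rstate list" where
  "cand_parallel r st = (case st of (V, es, ks) \<Rightarrow>
     map (\<lambda>p. (V, filter (\<lambda>q. \<not> parallel p q) es @ map (\<lambda>_. p) (replicate (r + 2) ()), ks))
       (filter (\<lambda>p. fst p \<noteq> snd p \<and> r + 3 \<le> length (filter (parallel p) es)) es))"

definition treel :: "nat \<Rightarrow> nat list \<Rightarrow> (nat \<times> nat) list \<Rightarrow> estate \<Rightarrow> ledge \<Rightarrow> bool" where
  "treel v V es st e \<longleftrightarrow> cnt (set (lobel v V (fst st) (fst (snd (snd st))) e)) es < length (lobel v V (fst st) (fst (snd (snd st))) e)"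

definition lobes :: "nat \<Rightarrow> estate \<Rightarrow> ledge list" where
  "lobes v st = freshv v (fst st) (fst (snd (snd st)))"

definition hubs :: "estate \<Rightarrow> nat list" where
  "hubs st = fst (snd (snd st))"

definition ear_count :: "estate \<Rightarrow> nat" where
  "ear_count st = length (snd (snd (snd st)))"

definition forced :: "nat \<Rightarrow> rstate \<Rightarrow> nat \<Rightarrow> bool" where
  "forced r st v = (case st of (V, es, ks) \<Rightarrow>
     r + 1 \<le> loops v es \<or>
     (let est = ears v V (List.enumerate 0 es) in
        2 * length ks + r + 1 \<le> ear_count est \<or>
        length ks + r + 1 \<le> length (filter (\<lambda>e. \<not> treel v V es est e) (lobes v est))))"

definition cand_forced :: "nat \<Rightarrow> rstate \<Rightarrow> rstate list" where
  "cand_forced r st = (case st of (V, es, ks) \<Rightarrow>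
     (if ks = [] then [] else map (\<lambda>x. (filter (\<lambda>y. y \<noteq> x) V, avoid {x} es, tl ks)) (filter (forced r st) V)))"

definition adjl :: "nat \<Rightarrow> nat list \<Rightarrow> (nat \<times> nat) list \<Rightarrow> estate \<Rightarrow> (ledge \<times> nat) list" where
  "adjl v V es est = concat (map (\<lambda>e. map (\<lambda>s. (e, s))
      (filter (\<lambda>s. \<exists>p \<in> set es. touch (set (lobel v V (fst est) (hubs est) e)) p \<and> touch {s} p) (hubs est)))
    (filter (treel v V es est) (lobes v est)))"

definition asg0 :: "nat \<Rightarrow> nat list \<Rightarrow> (nat \<times> nat) list \<Rightarrow> estate \<Rightarrow> (ledge \<times> nat) list" where
  "asg0 v V es est = concat (map (\<lambda>e. take1 (filter (\<lambda>a. fst a = e) (adjl v V es est)))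
    (filter (treel v V es est) (lobes v est)))"

definition assigned :: "nat \<Rightarrow> nat \<Rightarrow> nat list \<Rightarrow> (nat \<times> nat) list \<Rightarrow> estate \<Rightarrow> (ledge \<times> nat) list \<times> nat list" where
  "assigned r v V es est = assign (r + 3) (hubs est) (adjl v V es est) (asg0 v V es est)"

definition expand_at :: "nat \<Rightarrow> nat \<Rightarrow> rstate \<Rightarrow> estate \<Rightarrow> (ledge \<times> nat) list \<times> nat list \<Rightarrow> nat \<Rightarrow> rstate" where
  "expand_at r v st est pst s1 = (case st of (V, es, ks) \<Rightarrow>
     (V, expand (r + 2) v (filter (\<lambda>s. lab (snd pst) s1 \<le> lab (snd pst) s) (hubs est))
        (set (concat (map (\<lambda>p. lobel v V (fst est) (hubs est) (fst p))
           (filter (\<lambda>p. lab (snd pst) s1 \<le> lab (snd pst) (snd p)) (fst pst))))) es, ks))"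

definition cand_expand :: "nat \<Rightarrow> rstate \<Rightarrow> rstate list" where
  "cand_expand r st = (case st of (V, es, ks) \<Rightarrow>
     concat (map (\<lambda>v. let est = ears v V (List.enumerate 0 es); pst = assigned r v V es est in
         map (expand_at r v st est pst) (filter (good_level (r + 3) (hubs est) (adjl v V es est) pst) (hubs est))) V))"

definition cands :: "nat \<Rightarrow> rstate \<Rightarrow> rstate list" where
  "cands r st = cand_comp r st @ cand_leaf st @ cand_contract st @ cand_parallel r st @ cand_forced r st @ cand_expand r st"

definition valid :: "rstate \<Rightarrow> bool" where
  "valid st \<longleftrightarrow> (case st of (V, es, ks) \<Rightarrow> distinct V \<and> set es \<subseteq> set V \<times> set V)"

definition rsize :: "rstate \<Rightarrow> nat" where
  "rsize st = length (fst st) + length (fst (snd st))"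

text \<open>The first two conditions are those of \<open>valid\<close> in executable form. Excluding
  new vertices matters for the encoding: fresh names could have longer and longer binary
  representations.\<close>

definition smaller :: "rstate \<Rightarrow> rstate \<Rightarrow> bool" where
  "smaller st st' \<longleftrightarrow> (distinct (fst st') \<and> (\<forall>p \<in> set (fst (snd st')). fst p \<in> set (fst st') \<and> snd p \<in> set (fst st'))) \<and>
     (\<forall>x \<in> set (fst st'). x \<in> set (fst st)) \<and> rsize st' < rsize st \<and> length (snd (snd st')) \<le> length (snd (snd st))"

definition rstep :: "nat \<Rightarrow> rstate \<Rightarrow> rstate" where
  "rstep r st = (case filter (smaller st) (cands r st) of [] \<Rightarrow> st | c # cs \<Rightarrow> c)"

definition okst :: "nat \<Rightarrow> rstate \<Rightarrow> bool" where
  "okst r st = ok r (set (fst st)) (fst (snd st)) (length (snd (snd st)))"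

section \<open>Every candidate is an equivalent instance\<close>

lemma set_compl:
  assumes "set es \<subseteq> set V \<times> set V" "x \<in> set V"
  shows "set (compl V es x) = reach (set es) {x}"
proof -
  have "reach (set es) {x} \<subseteq> set V" by (rule reach_least) (use assms in auto)
  then show ?thesis by (auto simp: compl_def set_reachl)
qed

lemma ok_cand_comp:
  assumes "valid (V, es, ks)" "c \<in> set (cand_comp r (V, es, ks))"
  shows "okst r c \<longleftrightarrow> okst r (V, es, ks)"
proof -
  have V: "distinct V" "set es \<subseteq> set V \<times> set V" using assms(1) by (simp_all add: valid_def)
  obtain x where x: "x \<in> set V" "cnt (set (compl V es x)) es + 1 \<le> length (compl V es x) + r"
    and c: "c = (filter (\<lambda>y. y \<notin> set (compl V es x)) V, avoid (set (compl V es x)) es, ks)"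
    using assms(2) by (auto simp: cand_comp_def)
  let ?C = "set (compl V es x)"
  have "distinct (compl V es x)" using V(1) by (simp add: compl_def)
  then have "cnt ?C es + 1 \<le> card ?C + r" using x(2) by (simp add: distinct_card)
  then have "ok r (set V - ?C) (avoid ?C es) (length ks) \<longleftrightarrow> ok r (set V) es (length ks)"
    by (intro ok_delete_component[OF _ V(2) x(1)]) (simp_all add: set_compl[OF V(2) x(1)])
  moreover have "set (filter (\<lambda>y. y \<notin> ?C) V) = set V - ?C" by auto
  ultimately show ?thesis by (simp add: okst_def c)
qed

lemma set_filter_neq: "set (filter (\<lambda>y. y \<noteq> x) V) = set V - {x}"
  by auto

lemma loops_le_touch: "loops x es \<le> length (filter (touch {x}) es)"
  unfolding loops_def by (rule length_filter_mono) (simp add: inside_def touch_def)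

lemma ok_cand_leaf:
  assumes "c \<in> set (cand_leaf (V, es, ks))"
  shows "okst r c \<longleftrightarrow> okst r (V, es, ks)"
proof -
  obtain x where x: "deg x es \<le> 1" and c: "c = (filter (\<lambda>y. y \<noteq> x) V, avoid {x} es, ks)"
    using assms by (auto simp: cand_leaf_def)
  have "loops x es = 0" "length (filter (touch {x}) es) \<le> 1" using x loops_le_touch[of x es] by (simp_all add: deg_def)
  then have "ok r (set V - {x}) (avoid {x} es) (length ks) \<longleftrightarrow> ok r (set V) es (length ks)"
    by (intro ok_delete_leaf) (simp_all add: loops_def)
  then show ?thesis by (simp only: okst_def c fst_conv snd_conv set_filter_neq)
qed

lemma ok_cand_contract:
  assumes "valid (V, es, ks)" "c \<in> set (cand_contract (V, es, ks))"
  shows "okst r c \<longleftrightarrow> okst r (V, es, ks)"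
proof -
  have V: "set es \<subseteq> set V \<times> set V" using assms(1) by (simp add: valid_def)
  let ?c = "\<lambda>x p q. (filter (\<lambda>y. y \<noteq> x) V, (other x p, other x q) # avoid {x} es, ks)"
  let ?f = "\<lambda>x. case filter (touch {x}) es of [] \<Rightarrow> [] | p # ps \<Rightarrow> (case ps of [] \<Rightarrow> [] | q # qs \<Rightarrow> [?c x p q])"
  have "c \<in> \<Union> (set ` (?f ` set (filter (\<lambda>x. deg x es \<le> 2 \<and> loops x es \<le> 0) V)))"
    using assms(2) unfolding cand_contract_def prod.case set_concat set_map .
  then obtain x where "x \<in> set (filter (\<lambda>x. deg x es \<le> 2 \<and> loops x es \<le> 0) V)" and cx: "c \<in> set (?f x)"
    by blast
  then have x: "deg x es \<le> 2" "loops x es \<le> 0" by simp_all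
  obtain p q qs where pq: "filter (touch {x}) es = p # q # qs" and c: "c = ?c x p q"
  proof (cases "filter (touch {x}) es")
    case Nil
    then show thesis using cx by simp
  next
    case (Cons p ps)
    then show thesis using cx that by (cases ps) simp_all
  qed
  have "qs = []" using x pq by (simp add: deg_def)
  then have "ok r (set V - {x}) ((other x p, other x q) # avoid {x} es) (length ks) \<longleftrightarrow> ok r (set V) es (length ks)"
    using x(2) pq by (intro ok_contract[OF _ V]) (simp_all add: loops_def)
  then show ?thesis by (simp only: okst_def c fst_conv snd_conv set_filter_neq)
qed

lemma ok_cand_parallel:
  assumes "valid (V, es, ks)" "c \<in> set (cand_parallel r (V, es, ks))"
  shows "okst r c \<longleftrightarrow> okst r (V, es, ks)"
proof -
  have V: "set es \<subseteq> set V \<times> set V" using assms(1) by (simp add: valid_def)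
  obtain a b where p: "(a, b) \<in> set es" "a \<noteq> b" "r + 3 \<le> length (filter (parallel (a, b)) es)"
    and c: "c = (V, filter (\<lambda>q. \<not> parallel (a, b) q) es @ map (\<lambda>_. (a, b)) (replicate (r + 2) ()), ks)"
    using assms(2) by (auto simp: cand_parallel_def)
  have "ok r (set V) (filter (\<lambda>q. \<not> parallel (a, b) q) es @ replicate (r + 2) (a, b)) (length ks) \<longleftrightarrow> ok r (set V) es (length ks)"
    using p V by (intro ok_thin_parallel) auto
  moreover have "map (\<lambda>_. (a, b)) (replicate (r + 2) ()) = replicate (r + 2) (a, b)" by (simp add: map_replicate)
  ultimately show ?thesis unfolding okst_def c by simp
qed

locale at_vertex =
  fixes V :: "nat list" and es :: "(nat \<times> nat) list" and v :: nat and F Z S ms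
  assumes V: "distinct V" "set es \<subseteq> set V \<times> set V" and v: "v \<in> set V"
    and ears: "ears v V (List.enumerate 0 es) = (F, Z, S, ms)"
begin

abbreviation "est \<equiv> (F, Z, S, ms)"
abbreviation "D e \<equiv> set (lobel v V F S e)"

lemma inV: "e \<in> set (List.enumerate 0 es) \<Longrightarrow> inside (set V) (snd e)"
proof -
  assume "e \<in> set (List.enumerate 0 es)"
  then have "snd e \<in> set es" using set_enumerate_snd[of 0 es] by blast
  then show "inside (set V) (snd e)" using V(2) by (auto simp: inside_def)
qed

lemma state: "ears_state v V (List.enumerate 0 es) (F, Z, S, ms)"
  using ears_correct(1)[OF V(1) inV, of "List.enumerate 0 es" v] ears by simp

lemma state_facts:
  "set F \<subseteq> set (List.enumerate 0 es)"
  "ears_inv v (set (List.enumerate 0 es) - set F) (set Z) (set S) (length ms)"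
  "set Z \<union> set S \<subseteq> set V" "distinct S" "distinct F"
  using state by (simp_all add: ears_state_def)

lemma v_notin_S: "v \<notin> set S"
  using state_facts(2) by (simp add: ears_inv_def)

lemma card_D: "card (D e) = length (lobel v V F S e)"
  by (rule distinct_card) (simp add: lobel_def Let_def V(1))

lemma D_sub: "D e \<subseteq> set V"
  by (auto simp: lobel_def Let_def)

lemmas D_lobe = lobes_correct(1)[OF V ears]
lemmas D_disj = lobes_correct(2)[OF V ears]

lemma lobes_est: "lobes v est = freshv v F S"
  by (simp add: lobes_def)

lemma distinct_lobes: "distinct (lobes v est)"
  using state_facts(5) by (simp add: lobes_est freshv_def)

lemma treel_iff: "treel v V es est e \<longleftrightarrow> cnt (D e) es < card (D e)"
  by (simp add: treel_def card_D)

lemma forced_hit: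
  assumes "forced r (V, es, ks) v" "X \<subseteq> set V" "card X \<le> length ks" "sol r (set V - X) es"
  shows "v \<in> X"
proof -
  from assms(1) consider "r + 1 \<le> loops v es" | "2 * length ks + r + 1 \<le> length ms"
    | "length ks + r + 1 \<le> length (filter (\<lambda>e. \<not> treel v V es est e) (lobes v est))"
    by (auto simp: forced_def Let_def ears ear_count_def)
  then show ?thesis
  proof cases
    case 1
    then show ?thesis by (intro loops_hit[OF assms(4) v]) (simp add: loops_def)
  next
    case 2
    then show ?thesis
      by (intro ears_inv_forced[OF state_facts(2) _ state_facts(3) v _ _ assms(2-4)]) auto
  next
    case 3
    let ?I = "set (filter (\<lambda>e. \<not> treel v V es est e) (lobes v est))"
    show ?thesis
    proof (rule forced_by_lobes[where I = ?I and A = "set S" and D = D, OF _ _ _ _ _ _ v _ assms(2-4)])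
      show "lobe es v (set S) (D e)" if "e \<in> ?I" for e using that D_lobe by (simp add: lobes_est)
      show "D e \<subseteq> set V" for e by (rule D_sub)
      show "card (D e) \<le> cnt (D e) es" if "e \<in> ?I" for e using that by (simp add: treel_iff)
      show "D e \<inter> D f = {}" if "e \<in> ?I" "f \<in> ?I" "e \<noteq> f" for e f
        using that by (intro D_disj) (simp_all add: lobes_est)
      have "card ?I = length (filter (\<lambda>e. \<not> treel v V es est e) (lobes v est))"
        by (rule distinct_card) (simp add: distinct_lobes)
      then show "length ks + r + 1 \<le> card ?I" using 3 by simp
    qed simp_all
  qed
qed

lemma keys_asg0: "map fst (asg0 v V es est) =
    filter (\<lambda>e. \<exists>a \<in> set (adjl v V es est). fst a = e) (filter (treel v V es est) (lobes v est))"
proof -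
  have "map fst (concat (map (\<lambda>e. take1 (filter (\<lambda>a. fst a = e) as)) ts)) = filter (\<lambda>e. \<exists>a \<in> set as. fst a = e) ts"
    for ts :: "ledge list" and as :: "(ledge \<times> nat) list"
  proof (induction ts)
    case (Cons t ts)
    have "map fst (take1 (filter (\<lambda>a. fst a = t) as)) = (if \<exists>a \<in> set as. fst a = t then [t] else [])"
    proof (cases "filter (\<lambda>a. fst a = t) as")
      case Nil
      then show ?thesis by (simp add: take1_def filter_empty_conv)
    next
      case (Cons a list)
      then have "a \<in> set (filter (\<lambda>a. fst a = t) as)" by simp
      then have "a \<in> set as" "fst a = t" by simp_all
      then show ?thesis using Cons by (auto simp: take1_def)
    qed
    then show ?case using Cons by simp
  qed simp
  then show ?thesis unfolding asg0_def .
qed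

lemma asg0_facts: "set (asg0 v V es est) \<subseteq> set (adjl v V es est)" "distinct (map fst (asg0 v V es est))"
proof -
  have "set (take1 xs) \<subseteq> set xs" for xs :: "(ledge \<times> nat) list" by (cases xs) (auto simp: take1_def)
  then show "set (asg0 v V es est) \<subseteq> set (adjl v V es est)" unfolding asg0_def by fastforce
  show "distinct (map fst (asg0 v V es est))" unfolding keys_asg0 using distinct_lobes by simp
qed

lemma adjl_iff: "(e, s) \<in> set (adjl v V es est) \<longleftrightarrow> e \<in> set (lobes v est) \<and> treel v V es est e \<and> s \<in> set S \<and>
    (\<exists>p \<in> set es. touch (D e) p \<and> touch {s} p)"
  unfolding adjl_def hubs_def set_concat set_map image_image set_filter fst_conv snd_conv by blast

lemma assigned_facts:
  "pr_inv (r + 3) (adjl v V es est) (map fst (asg0 v V es est)) (assigned r v V es est)"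
  "prstep (r + 3) S (adjl v V es est) (assigned r v V es est) = assigned r v V es est"
  using assign_correct[OF asg0_facts, of "r + 3" S] by (simp_all add: assigned_def hubs_def)

lemma lobe_shrink:
  assumes "lobe es v T C" "A \<subseteq> T" "\<And>p s. p \<in> set es \<Longrightarrow> s \<in> T \<Longrightarrow> touch C p \<Longrightarrow> touch {s} p \<Longrightarrow> s \<in> A"
  shows "lobe es v A C"
  unfolding lobe_def
proof (intro conjI ballI impI)
  have cl: "inside (insert v (T \<union> C)) p" if "p \<in> set es" "touch C p" for p using assms(1) that by (simp add: lobe_def)
  show "C \<noteq> {}" "v \<notin> C" "conn (set es) C" "length (filter (\<lambda>p. touch C p \<and> touch {v} p) es) = 1"
    using assms(1) by (simp_all add: lobe_def)
  show "C \<inter> A = {}" using assms(1,2) unfolding lobe_def by blast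
  fix p assume p: "p \<in> set es" "touch C p"
  have "x \<in> A" if "x \<in> T" "fst p = x \<or> snd p = x" for x
    using assms(3)[OF p(1) that(1) p(2)] that(2) by (simp add: touch_def)
  then show "inside (insert v (A \<union> C)) p" using cl[OF p] by (auto simp: inside_def)
qed

context
  fixes r s1 asg labs
  assumes pst: "assigned r v V es est = (asg, labs)"
    and s1: "s1 \<in> set S" "good_level (r + 3) S (adjl v V es est) (asg, labs) s1"
begin

definition "hubs1 = filter (\<lambda>s. lab labs s1 \<le> lab labs s) S"
definition "asg1 = filter (\<lambda>p. lab labs s1 \<le> lab labs (snd p)) asg"

lemma asg_facts: "set asg \<subseteq> set (adjl v V es est)" "distinct (map fst asg)"
  using assigned_facts(1)[of r] asg0_facts(2) by (simp_all add: pst pr_inv_def)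

lemma asg1_D:
  assumes "p \<in> set asg1"
  shows "p \<in> set asg" "fst p \<in> set (lobes v est)" "treel v V es est (fst p)" "snd p \<in> set hubs1"
    "\<exists>q \<in> set es. touch (D (fst p)) q \<and> touch {snd p} q"
proof -
  show p: "p \<in> set asg" using assms by (simp add: asg1_def)
  then have "(fst p, snd p) \<in> set (adjl v V es est)" using asg_facts(1) by auto
  then show "fst p \<in> set (lobes v est)" "treel v V es est (fst p)" "snd p \<in> set hubs1"
    "\<exists>q \<in> set es. touch (D (fst p)) q \<and> touch {snd p} q"
    using assms unfolding adjl_iff asg1_def hubs1_def by simp_all
qed

text \<open>By the closure property of a good level, all hubs adjacent to a lobe assigned at or
  above the level are themselves at or above it. So the lobe is bounded by \<open>hubs1\<close>
  alone, which is what the expansion rule requires.\<close>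

lemma asg1_lobe:
  assumes p: "p \<in> set asg1"
  shows "lobe es v (set hubs1) (D (fst p))"
proof (rule lobe_shrink)
  show "lobe es v (set S) (D (fst p))" using asg1_D(2)[OF p] by (intro D_lobe) (simp add: lobes_est)
  show "set hubs1 \<subseteq> set S" by (auto simp: hubs1_def)
  fix q s assume q: "q \<in> set es" "s \<in> set S" "touch (D (fst p)) q" "touch {s} q"
  have "(fst p, s) \<in> set (adjl v V es est)" unfolding adjl_iff using asg1_D[OF p] q by blast
  moreover have "lab labs s1 \<le> lab labs (snd p)" using p by (simp add: asg1_def)
  ultimately have "lab labs s1 \<le> lab labs s"
    using s1(2) asg1_D(1)[OF p] unfolding good_level_def by fastforce
  then show "s \<in> set hubs1" using q(2) by (simp add: hubs1_def)
qed

lemma load_asg1: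
  assumes "a \<in> set hubs1"
  shows "r + 3 \<le> card {p \<in> set asg1. snd p = a}"
proof -
  have a: "a \<in> set S" "lab labs s1 \<le> lab labs a" using assms by (simp_all add: hubs1_def)
  then have "r + 3 \<le> load asg a" using s1(2) by (simp add: good_level_def)
  also have "load asg a = card (set (filter (\<lambda>p. snd p = a) asg))"
    unfolding load_def using asg_facts(2) by (intro distinct_card[symmetric] distinct_filter) (simp add: distinct_map)
  also have "set (filter (\<lambda>p. snd p = a) asg) = {p \<in> set asg1. snd p = a}"
    using a(2) by (auto simp: asg1_def)
  finally show ?thesis .
qed

lemma asg1_disj: "p \<in> set asg1 \<Longrightarrow> q \<in> set asg1 \<Longrightarrow> p \<noteq> q \<Longrightarrow> D (fst p) \<inter> D (fst q) = {}"
  using distinct_keyD[OF asg_facts(2), of p q] asg1_D(1,2)[of p] asg1_D(1,2)[of q]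
  by (intro D_disj) (auto simp: lobes_est)

lemma ok_expand_level:
  "ok r (set V) (expand (r + 2) v hubs1 (\<Union>p\<in>set asg1. D (fst p)) es) k \<longleftrightarrow> ok r (set V) es k"
proof (rule ok_expand[where s = snd])
  show "set hubs1 \<subseteq> set V - {v}" using state_facts(3) v_notin_S by (auto simp: hubs1_def)
  show "r + 2 \<le> card {p \<in> set asg1. snd p = a}" if "a \<in> set hubs1" for a
    using load_asg1[OF that] by simp
  fix p assume p: "p \<in> set asg1"
  show "lobe es v (set hubs1) (D (fst p))" by (rule asg1_lobe[OF p])
  show "cnt (D (fst p)) es + 1 = card (D (fst p))"
  proof -
    have l: "lobe es v (set S) (D (fst p))" using asg1_D(2)[OF p] by (intro D_lobe) (simp add: lobes_est)
    have "card (D (fst p)) \<le> cnt (D (fst p)) es + 1"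
      using l by (intro conn_cnt_ge) (simp_all add: lobe_def)
    then show ?thesis using asg1_D(3)[OF p] by (simp add: treel_iff)
  qed
  show "D (fst p) \<subseteq> set V" by (rule D_sub)
  show "\<exists>q\<in>set es. touch (D (fst p)) q \<and> touch {snd p} q" by (rule asg1_D(5)[OF p])
  show "D (fst p) \<inter> D (fst q) = {}" if "q \<in> set asg1" "p \<noteq> q" for q
    by (rule asg1_disj[OF p that])
qed (use v in simp_all)

text \<open>Every hub receives \<open>r + 2\<close> new edges, and the edges of at least \<open>r + 3\<close> lobes vanish for it.\<close>

lemma length_expand_level:
  "length (expand (r + 2) v hubs1 (\<Union>p\<in>set asg1. D (fst p)) es) < length es"
proof -
  let ?U = "\<Union>p\<in>set asg1. D (fst p)"
  let ?del = "\<lambda>q. touch {v} q \<and> touch ?U q"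
  have distS: "distinct hubs1" using state_facts(4) by (simp add: hubs1_def)
  have dist1: "distinct (map fst asg1)" using asg_facts(2) by (simp add: asg1_def distinct_map_filter)
  have "(\<Sum>a\<in>set hubs1. r + 3) \<le> (\<Sum>a\<in>set hubs1. card {p \<in> set asg1. snd p = a})"
    by (rule sum_mono) (rule load_asg1)
  also have "\<dots> = card (\<Union>a\<in>set hubs1. {p \<in> set asg1. snd p = a})"
    by (rule card_UN_disjoint[symmetric]) auto
  also have "\<dots> \<le> card (set asg1)" by (rule card_mono) auto
  also have "\<dots> = card (fst ` set asg1)"
    using dist1 by (intro card_image[symmetric]) (simp add: distinct_map)
  \<comment> \<open>The key of a lobe is its own edge to \<open>v\<close>, so distinct keys are
    distinct edges that disappear.\<close>
  also have "\<dots> \<le> card {e \<in> set (List.enumerate 0 es). ?del (snd e)}"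
  proof (rule card_mono)
    show "fst ` set asg1 \<subseteq> {e \<in> set (List.enumerate 0 es). ?del (snd e)}"
    proof
      fix e assume "e \<in> fst ` set asg1"
      then obtain p where p: "p \<in> set asg1" "e = fst p" by blast
      then have ef: "e \<in> set (freshv v F S)" using asg1_D(2) by (simp add: lobes_est)
      have oD: "other v (snd e) \<in> D e" by (rule lobes_correct(3)[OF V ears ef])
      have "fst (snd e) = other v (snd e) \<or> snd (snd e) = other v (snd e)"
        using freshvD(2)[OF ef] by (metis fst_conv snd_conv)
      then have "touch (D e) (snd e)" using oD unfolding touch_def by metis
      then have "touch ?U (snd e)" using p unfolding touch_def by blast
      moreover have "touch {v} (snd e)" using ef by (simp add: freshv_def touch_def)
      ultimately show "e \<in> {e \<in> set (List.enumerate 0 es). ?del (snd e)}"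
        using freshvD(1)[OF ef] state_facts(1) by blast
    qed
  qed simp
  also have "\<dots> = length (filter ?del es)" by (rule length_filter_enumerate[symmetric])
  finally have le: "length hubs1 * (r + 3) \<le> length (filter ?del es)"
    using distinct_card[OF distS] by simp
  have "length (expand (r + 2) v hubs1 ?U es) = length hubs1 * (r + 2) + length (filter (\<lambda>q. \<not> ?del q) es)"
    by (simp add: expand_def length_concat comp_def sum_list_triv)
  also have "\<dots> + length (filter ?del es) = length hubs1 * (r + 2) + length es"
    using sum_length_filter_compl[of ?del es] by simp
  finally have "length (expand (r + 2) v hubs1 ?U es) + length (filter ?del es) = length hubs1 * (r + 2) + length es" .
  moreover have "s1 \<in> set hubs1" using s1(1) by (simp add: hubs1_def)
  then have "0 < length hubs1" by (rule length_pos_if_in_set)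
  moreover have "length hubs1 * (r + 2) + length hubs1 = length hubs1 * (r + 3)" by (simp add: algebra_simps)
  ultimately show ?thesis using le by linarith
qed

lemma expand_at_eq:
  "expand_at r v (V, es, ks) est (asg, labs) s1 = (V, expand (r + 2) v hubs1 (\<Union>p\<in>set asg1. D (fst p)) es, ks)"
proof -
  have "set (concat (map (\<lambda>p. lobel v V F S (fst p)) asg1)) = (\<Union>p\<in>set asg1. D (fst p))" by simp
  then show ?thesis by (simp add: expand_at_def hubs_def hubs1_def asg1_def)
qed

end

end

lemma ok_cand_forced:
  assumes "valid (V, es, ks)" "c \<in> set (cand_forced r (V, es, ks))"
  shows "okst r c \<longleftrightarrow> okst r (V, es, ks)"
proof -
  obtain v where vf: "v \<in> set V" "forced r (V, es, ks) v" and ks: "ks \<noteq> []"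
    and c: "c = (filter (\<lambda>y. y \<noteq> v) V, avoid {v} es, tl ks)"
    using assms(2) by (auto simp: cand_forced_def split: if_splits)
  obtain F Z S ms where ears: "ears v V (List.enumerate 0 es) = (F, Z, S, ms)" by (metis prod_cases4)
  interpret at_vertex V es v F Z S ms
    by standard (use assms(1) vf ears in \<open>simp_all add: valid_def\<close>)
  have len: "length ks = Suc (length (tl ks))" using ks by simp
  have "ok r (set V - {v}) (avoid {v} es) (length (tl ks)) \<longleftrightarrow> ok r (set V) es (Suc (length (tl ks)))"
  proof (rule ok_delete_forced[OF vf(1)])
    fix X assume "X \<subseteq> set V" "card X \<le> Suc (length (tl ks))" "sol r (set V - X) es"
    then show "v \<in> X" by (intro forced_hit[OF vf(2)]) (simp_all only: len)
  qed simp
  then show ?thesis unfolding okst_def c fst_conv snd_conv set_filter_neq len .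
qed

lemma ok_cand_expand:
  assumes "valid (V, es, ks)" "c \<in> set (cand_expand r (V, es, ks))"
  shows "okst r c \<longleftrightarrow> okst r (V, es, ks)"
proof -
  obtain v s1 where v: "v \<in> set V"
    and s1: "s1 \<in> set (hubs (ears v V (List.enumerate 0 es)))"
      "good_level (r + 3) (hubs (ears v V (List.enumerate 0 es))) (adjl v V es (ears v V (List.enumerate 0 es)))
         (assigned r v V es (ears v V (List.enumerate 0 es))) s1"
    and c: "c = expand_at r v (V, es, ks) (ears v V (List.enumerate 0 es)) (assigned r v V es (ears v V (List.enumerate 0 es))) s1"
    using assms(2) unfolding cand_expand_def Let_def by auto
  obtain F Z S ms where ears: "ears v V (List.enumerate 0 es) = (F, Z, S, ms)" by (metis prod_cases4)
  interpret at_vertex V es v F Z S ms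
    by standard (use assms(1) v ears in \<open>simp_all add: valid_def\<close>)
  obtain asg labs where pst: "assigned r v V es (F, Z, S, ms) = (asg, labs)" by (cases "assigned r v V es (F, Z, S, ms)")
  have s1': "s1 \<in> set S" "good_level (r + 3) S (adjl v V es (F, Z, S, ms)) (asg, labs) s1"
    using s1 unfolding ears pst by (simp_all add: hubs_def)
  show ?thesis
    unfolding c ears pst expand_at_eq[OF pst s1'] okst_def fst_conv snd_conv by (rule ok_expand_level[OF pst s1'])
qed

lemma ok_cands:
  assumes "valid st" "c \<in> set (cands r st)"
  shows "okst r c \<longleftrightarrow> okst r st"
proof -
  obtain V es ks where st: "st = (V, es, ks)" by (metis prod_cases3)
  have v: "valid (V, es, ks)" using assms(1) by (simp add: st)
  show ?thesis
    using assms(2) unfolding st cands_def set_append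
    by (elim UnE) (rule ok_cand_comp[OF v] ok_cand_leaf ok_cand_contract[OF v] ok_cand_parallel[OF v]
      ok_cand_forced[OF v] ok_cand_expand[OF v], assumption)+
qed

lemma rstep_correct:
  assumes "valid st"
  shows "valid (rstep r st) \<and> (okst r (rstep r st) \<longleftrightarrow> okst r st) \<and> length (snd (snd (rstep r st))) \<le> length (snd (snd st))"
    "rstep r st \<noteq> st \<Longrightarrow> rsize (rstep r st) < rsize st"
proof -
  have *: "(valid (rstep r st) \<and> (okst r (rstep r st) \<longleftrightarrow> okst r st) \<and> length (snd (snd (rstep r st))) \<le> length (snd (snd st))) \<and>
    (rstep r st \<noteq> st \<longrightarrow> rsize (rstep r st) < rsize st)"
  proof (cases "filter (smaller st) (cands r st)")
    case Nil
    then show ?thesis using assms by (simp add: rstep_def)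
  next
    case (Cons c cs)
    then have "c \<in> set (filter (smaller st) (cands r st))" by simp
    then have c: "c \<in> set (cands r st)" "smaller st c" by simp_all
    have "valid c" using c(2) unfolding smaller_def valid_def by (cases c) auto
    moreover have "rstep r st = c" using Cons by (simp add: rstep_def)
    ultimately show ?thesis using ok_cands[OF assms c(1)] c(2) by (simp add: smaller_def)
  qed
  then show "valid (rstep r st) \<and> (okst r (rstep r st) \<longleftrightarrow> okst r st) \<and> length (snd (snd (rstep r st))) \<le> length (snd (snd st))"
    "rstep r st \<noteq> st \<Longrightarrow> rsize (rstep r st) < rsize st" by blast+
qed

lemma rstep_stable:
  assumes "rstep r st = st" "c \<in> set (cands r st)"
  shows "\<not> smaller st c"
proof
  assume "smaller st c"
  then have "filter (smaller st) (cands r st) \<noteq> []" using assms(2) unfolding filter_empty_conv by blast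
  then obtain d ds where d: "filter (smaller st) (cands r st) = d # ds" by (meson list.exhaust)
  then have "d \<in> set (filter (smaller st) (cands r st))" by simp
  then have "smaller st d" by simp
  moreover have "rstep r st = d" using d by (simp add: rstep_def)
  ultimately show False using assms(1) by (simp add: smaller_def)
qed

section \<open>Irreducible yes-instances are small\<close>

lemma sum_deg:
  assumes "finite A"
  shows "(\<Sum>x\<in>A. deg x es) = 2 * cnt A es + length (filter (\<lambda>p. touch A p \<and> \<not> inside A p) es)"
proof (induction es)
  case Nil
  then show ?case by (simp add: deg_def loops_def cnt_def)
next
  case (Cons p es)
  have "deg x (p # es) = deg x es + ((if fst p = x then 1 else 0) + (if snd p = x then 1 else 0))" for x
    by (auto simp: deg_def loops_def touch_def inside_def)
  then have "(\<Sum>x\<in>A. deg x (p # es)) = (\<Sum>x\<in>A. deg x es)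
      + ((\<Sum>x\<in>A. if fst p = x then 1 else 0) + (\<Sum>x\<in>A. if snd p = x then 1 else 0))"
    by (simp add: sum.distrib)
  also have "(\<Sum>x\<in>A. if fst p = x then 1 else 0) = (if fst p \<in> A then 1 else (0::nat))"
    using assms by (simp add: sum.delta')
  also have "(\<Sum>x\<in>A. if snd p = x then 1 else 0) = (if snd p \<in> A then 1 else (0::nat))"
    using assms by (simp add: sum.delta')
  finally show ?case using Cons by (simp add: cnt_def touch_def inside_def)
qed

lemma other_ends: "fst p = v \<or> snd p = v \<Longrightarrow> {v, other v p} = {fst p, snd p}"
  by (auto simp: other_def)

locale irreducible =
  fixes r :: nat and V :: "nat list" and es :: "(nat \<times> nat) list" and ks :: "unit list"
  assumes val: "valid (V, es, ks)" and stable: "rstep r (V, es, ks) = (V, es, ks)" and rk: "r < length ks"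
begin

abbreviation "st \<equiv> (V, es, ks)"
abbreviation "k \<equiv> length ks"

lemma distV: "distinct V" and esV: "set es \<subseteq> set V \<times> set V"
  using val by (simp_all add: valid_def)

lemma ends_in: "p \<in> set es \<Longrightarrow> fst p \<in> set V \<and> snd p \<in> set V"
  using esV by auto

lemma not_smaller: "c \<in> set (cands r st) \<Longrightarrow> \<not> smaller st c"
  using rstep_stable[OF stable] by blast

lemma smaller_delete:
  assumes "x \<in> set V" "x \<in> U" "length ks' \<le> k"
  shows "smaller st (filter (\<lambda>y. y \<notin> U) V, avoid U es, ks')"
proof -
  have "length (filter (\<lambda>y. y \<notin> U) V) < length V" by (rule length_filter_less[OF assms(1)]) (use assms(2) in simp)
  moreover have "length (avoid U es) \<le> length es" by (simp add: avoid_def)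
  moreover have "fst p \<in> set V - U \<and> snd p \<in> set V - U" if "p \<in> set (avoid U es)" for p
    using that ends_in[of p] by (simp add: avoid_def touch_def)
  ultimately show ?thesis using distV assms(3) by (simp add: smaller_def rsize_def)
qed

lemma smaller_delete1:
  assumes "x \<in> set V" "length ks' \<le> k"
  shows "smaller st (filter (\<lambda>y. y \<noteq> x) V, avoid {x} es, ks')"
  using smaller_delete[OF assms(1) _ assms(2), of "{x}"] by simp

lemma comp_large:
  assumes "x \<in> set V"
  shows "card (reach (set es) {x}) + r \<le> cnt (reach (set es) {x}) es"
proof (rule ccontr)
  assume *: "\<not> ?thesis"
  let ?C = "compl V es x"
  have C: "set ?C = reach (set es) {x}" by (rule set_compl[OF esV assms])
  have "distinct ?C" using distV by (simp add: compl_def)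
  then have "cnt (set ?C) es + 1 \<le> length ?C + r" using * C distinct_card[of ?C] by simp
  then have "(filter (\<lambda>y. y \<notin> set ?C) V, avoid (set ?C) es, ks) \<in> set (cand_comp r st)"
    using assms unfolding cand_comp_def prod.case by simp
  then have "(filter (\<lambda>y. y \<notin> set ?C) V, avoid (set ?C) es, ks) \<in> set (cands r st)" by (simp add: cands_def)
  moreover have "x \<in> set ?C" unfolding C by (simp add: reach_start)
  ultimately show False using not_smaller smaller_delete[OF assms, of "set ?C" ks] by blast
qed

lemma deg_ge2:
  assumes "x \<in> set V"
  shows "2 \<le> deg x es"
proof (rule ccontr)
  assume "\<not> 2 \<le> deg x es"
  then have "(filter (\<lambda>y. y \<noteq> x) V, avoid {x} es, ks) \<in> set (cand_leaf st)"
    using assms by (simp add: cand_leaf_def)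
  then have "(filter (\<lambda>y. y \<noteq> x) V, avoid {x} es, ks) \<in> set (cands r st)" by (simp add: cands_def)
  then show False using not_smaller smaller_delete1[OF assms, of ks] by simp
qed

lemma not_contract:
  assumes "x \<in> set V" "deg x es \<le> 2"
  shows "0 < loops x es"
proof (rule ccontr)
  assume l: "\<not> 0 < loops x es"
  then have "length (filter (touch {x}) es) = 2" using deg_ge2[OF assms(1)] assms(2) by (simp add: deg_def)
  then obtain p q where pq: "filter (touch {x}) es = [p, q]"
    by (auto simp: numeral_2_eq_2 length_Suc_conv)
  let ?c = "(filter (\<lambda>y. y \<noteq> x) V, (other x p, other x q) # avoid {x} es, ks)"
  let ?f = "\<lambda>x. case filter (touch {x}) es of [] \<Rightarrow> [] | p # ps \<Rightarrow> (case ps of [] \<Rightarrow> [] | q # qs \<Rightarrow>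
      [(filter (\<lambda>y. y \<noteq> x) V, (other x p, other x q) # avoid {x} es, ks)])"
  have "?c \<in> set (?f x)" unfolding pq by simp
  moreover have "x \<in> set (filter (\<lambda>x. deg x es \<le> 2 \<and> loops x es \<le> 0) V)" using assms l by simp
  ultimately have "?c \<in> \<Union> (set ` (?f ` set (filter (\<lambda>x. deg x es \<le> 2 \<and> loops x es \<le> 0) V)))" by blast
  then have "?c \<in> set (cand_contract st)" unfolding cand_contract_def prod.case set_concat set_map .
  then have c: "?c \<in> set (cands r st)" by (simp add: cands_def)
  have nl: "\<not> inside {x} e" if "e \<in> set es" for e
    using l that by (simp add: loops_def filter_empty_conv)
  have other_in: "other x e \<in> set V - {x}" if "e \<in> set (filter (touch {x}) es)" for e
  proof -
    have e: "e \<in> set es" "touch {x} e" using that by simp_all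
    then show ?thesis using ends_in[OF e(1)] nl[OF e(1)] by (auto simp: other_def touch_def inside_def)
  qed
  have "length (filter (touch {x}) es) + length (avoid {x} es) = length es"
    unfolding avoid_def by (rule sum_length_filter_compl)
  then have "length (avoid {x} es) + 2 = length es" using pq by simp
  moreover have "other x p \<in> set V - {x}" "other x q \<in> set V - {x}" using other_in pq by simp_all
  moreover have "length (filter (\<lambda>y. y \<noteq> x) V) < length V" by (rule length_filter_less[OF assms(1)]) simp
  ultimately have "smaller st ?c"
    using smaller_delete1[OF assms(1), of ks] by (simp add: smaller_def rsize_def)
  then show False using not_smaller[OF c] by simp
qed

text \<open>The rules leave open only a vertex with one loop and no other edge. It is a component of
  its own with as many edges as vertices, which survives the component rule only for
  \<open>r = 0\<close>; but then one loop already forces the vertex.\<close>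

lemma deg_ge3:
  assumes "x \<in> set V"
  shows "3 \<le> deg x es"
proof (rule ccontr)
  assume "\<not> 3 \<le> deg x es"
  then have "deg x es \<le> 2" by simp
  then have l: "0 < loops x es" by (rule not_contract[OF assms])
  have lt: "loops x es \<le> length (filter (touch {x}) es)" by (rule loops_le_touch)
  have one: "loops x es = 1" "length (filter (touch {x}) es) = 1"
    using l lt \<open>deg x es \<le> 2\<close> by (simp_all add: deg_def)
  have "length (filter (inside {x}) es) + length (filter (\<lambda>p. touch {x} p \<and> \<not> inside {x} p) es) \<le> length (filter (touch {x}) es)"
    by (rule length_filter_disj) (auto simp: inside_def touch_def)
  then have "filter (\<lambda>p. touch {x} p \<and> \<not> inside {x} p) es = []" using one by (simp add: loops_def)
  then have in_x: "inside {x} p" if "p \<in> set es" "touch {x} p" for p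
    using that unfolding filter_empty_conv by blast
  have "reach (set es) {x} \<subseteq> {x}"
  proof (rule reach_least)
    fix a b assume "(a, b) \<in> set es"
    then have "touch {x} (a, b) \<Longrightarrow> inside {x} (a, b)" by (rule in_x)
    then show "a \<in> {x} \<longleftrightarrow> b \<in> {x}" unfolding inside_def touch_def fst_conv snd_conv by blast
  qed simp
  then have C: "reach (set es) {x} = {x}" using reach_start[of x "{x}"] by blast
  have "r = 0" using comp_large[OF assms] one unfolding C by (simp add: cnt_def loops_def)
  moreover have "\<not> forced r st x"
  proof
    assume "forced r st x"
    then have "(filter (\<lambda>y. y \<noteq> x) V, avoid {x} es, tl ks) \<in> set (cand_forced r st)"
      using assms rk unfolding cand_forced_def prod.case by auto
    then have "(filter (\<lambda>y. y \<noteq> x) V, avoid {x} es, tl ks) \<in> set (cands r st)" by (simp add: cands_def)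
    then show False using not_smaller smaller_delete1[OF assms, of "tl ks"] by simp
  qed
  ultimately show False using l by (simp add: forced_def)
qed

lemma not_forced:
  assumes "x \<in> set V"
  shows "\<not> forced r st x"
proof
  assume "forced r st x"
  then have "(filter (\<lambda>y. y \<noteq> x) V, avoid {x} es, tl ks) \<in> set (cand_forced r st)"
    using assms rk unfolding cand_forced_def prod.case by auto
  then have "(filter (\<lambda>y. y \<noteq> x) V, avoid {x} es, tl ks) \<in> set (cands r st)" by (simp add: cands_def)
  then show False using not_smaller smaller_delete1[OF assms, of "tl ks"] by simp
qed

lemma parallel_le:
  assumes "a \<noteq> b"
  shows "length (filter (parallel (a, b)) es) \<le> r + 2"
proof (rule ccontr)
  assume *: "\<not> ?thesis"
  then have "filter (parallel (a, b)) es \<noteq> []" by auto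
  then obtain p where p: "p \<in> set es" "parallel (a, b) p" unfolding filter_empty_conv by blast
  have eq: "parallel p = parallel (a, b)" using p(2) by (auto simp: parallel_def fun_eq_iff)
  have ne: "fst p \<noteq> snd p" using p(2) assms by (auto simp: parallel_def doubleton_eq_iff)
  let ?c = "(V, filter (\<lambda>q. \<not> parallel p q) es @ map (\<lambda>_. p) (replicate (r + 2) ()), ks)"
  have "p \<in> set (filter (\<lambda>p. fst p \<noteq> snd p \<and> r + 3 \<le> length (filter (parallel p) es)) es)"
    using p(1) ne * by (simp add: eq)
  then have "?c \<in> set (cand_parallel r st)" unfolding cand_parallel_def prod.case set_map by (rule imageI)
  then have c: "?c \<in> set (cands r st)" by (simp add: cands_def)
  have "length (filter (parallel p) es) + length (filter (\<lambda>q. \<not> parallel p q) es) = length es"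
    by (rule sum_length_filter_compl)
  then have "length (filter (\<lambda>q. \<not> parallel p q) es) + (r + 2) < length es" using * by (simp add: eq)
  then have "smaller st ?c" using distV ends_in p(1) by (auto simp: smaller_def rsize_def)
  then show False using not_smaller[OF c] by simp
qed

text \<open>Loops contribute \<open>2r\<close>. There are at most \<open>2 * (2k + r)\<close>, hence
  at most \<open>6k\<close>, hubs with at most \<open>r + 2\<close> parallel edges each. The lobes
  are at most \<open>k + r\<close> with a cycle and \<open>r + 3\<close> trees per hub. Altogether
  this is \<open>3r + k + length S * (2r + 5)\<close>, at most \<open>4k + 6k * 7 * max 1 r\<close>,
  whence 46.\<close>

lemma deg_le:
  assumes v: "v \<in> set V"
  shows "deg v es \<le> 46 * k * max 1 r"
proof -
  obtain F Z S ms where ears: "ears v V (List.enumerate 0 es) = (F, Z, S, ms)" by (metis prod_cases4)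
  interpret at_vertex V es v F Z S ms
    by standard (use distV esV v ears in simp_all)
  have nf: "loops v es \<le> r" "length ms \<le> 2 * k + r"
    "length (filter (\<lambda>e. \<not> treel v V es est e) (lobes v est)) \<le> k + r"
    using not_forced[OF v] by (simp_all add: forced_def Let_def ears ear_count_def)
  have "card (set S) \<le> 2 * length ms" using state_facts(2) by (simp add: ears_inv_def)
  then have S: "length S \<le> 6 * k" using distinct_card[OF state_facts(4)] nf(2) rk by simp
  obtain asg labs where pst: "assigned r v V es est = (asg, labs)" by (cases "assigned r v V es est")
  have none: "\<not> good_level (r + 3) S (adjl v V es est) (asg, labs) s" if s: "s \<in> set S" for s
  proof
    assume g: "good_level (r + 3) S (adjl v V es est) (asg, labs) s"
    let ?c = "expand_at r v st est (asg, labs) s"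
    let ?g = "\<lambda>v. let est = ears v V (List.enumerate 0 es); pst = assigned r v V es est in
         map (expand_at r v st est pst) (filter (good_level (r + 3) (hubs est) (adjl v V es est) pst) (hubs est))"
    have "?c \<in> set (?g v)" using s g by (simp add: ears pst Let_def hubs_def)
    then have "?c \<in> \<Union> (set ` (?g ` set V))" using v by blast
    then have "?c \<in> set (cand_expand r st)" unfolding cand_expand_def prod.case set_concat set_map .
    then have c: "?c \<in> set (cands r st)" by (simp add: cands_def)
    have "smaller st ?c"
      unfolding expand_at_eq[OF pst s g] smaller_def rsize_def fst_conv snd_conv
    proof (intro conjI ballI)
      show "length V + length (expand (r + 2) v (hubs1 s labs) (\<Union>p\<in>set (asg1 s asg labs). D (fst p)) es) < length V + length es"
        using length_expand_level[OF pst s g] by simp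
      fix p assume "p \<in> set (expand (r + 2) v (hubs1 s labs) (\<Union>p\<in>set (asg1 s asg labs). D (fst p)) es)"
      then consider "p \<in> set es" | a where "a \<in> set (hubs1 s labs)" "p = (v, a)"
        unfolding expand_def by (auto split: if_splits)
      then have "fst p \<in> set V \<and> snd p \<in> set V"
      proof cases
        case 1
        then show ?thesis by (rule ends_in)
      next
        case 2
        then have "a \<in> set S" by (simp add: hubs1_def[OF pst s g])
        then show ?thesis using 2(2) v state_facts(3) by auto
      qed
      then show "fst p \<in> set V" "snd p \<in> set V" by blast+
    qed (use distV in simp_all)
    then show False using not_smaller[OF c] by simp
  qed
  have trees: "length (filter (treel v V es est) (lobes v est)) \<le> (r + 3) * length S"
  proof -
    \<comment> \<open>A tree lobe that touches no hub has a single edge leaving it, so its degrees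
      add up to at most \<open>2 * (card - 1) + 1\<close>; but all degrees are at least two.\<close>
    have adjacent: "\<exists>a \<in> set (adjl v V es est). fst a = e" if e: "e \<in> set (lobes v est)" "treel v V es est e" for e
    proof (rule ccontr)
      assume no: "\<not> ?thesis"
      have l: "lobe es v (set S) (D e)" using e(1) by (intro D_lobe) (simp add: lobes_est)
      have noS: "\<not> touch (set S) p" if p: "p \<in> set es" "touch (D e) p" for p
      proof
        assume "touch (set S) p"
        then obtain s where s: "s \<in> set S" "touch {s} p" by (auto simp: touch_def)
        have "(e, s) \<in> set (adjl v V es est)" unfolding adjl_iff using e s p by blast
        then show False using no by force
      qed
      have "length (filter (\<lambda>p. touch (D e) p \<and> \<not> inside (D e) p) es) \<le> length (filter (\<lambda>p. touch (D e) p \<and> touch {v} p) es)"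
      proof (rule length_filter_mono)
        fix p assume p: "p \<in> set es" "touch (D e) p \<and> \<not> inside (D e) p"
        then have "inside (insert v (set S \<union> D e)) p" using l by (simp add: lobe_def)
        then show "touch (D e) p \<and> touch {v} p" using p noS[OF p(1)] by (auto simp: inside_def touch_def)
      qed
      also have "\<dots> = 1" using l by (simp add: lobe_def)
      finally have "(\<Sum>x\<in>D e. deg x es) \<le> 2 * cnt (D e) es + 1" by (simp add: sum_deg)
      moreover have "(\<Sum>x\<in>D e. 2) \<le> (\<Sum>x\<in>D e. deg x es)"
        by (rule sum_mono) (use D_sub deg_ge2 in blast)
      moreover have "cnt (D e) es < card (D e)" using e(2) by (simp add: treel_iff)
      ultimately show False by simp
    qed
    have "map fst (asg0 v V es est) = filter (treel v V es est) (lobes v est)"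
      unfolding keys_asg0 by (rule filter_True) (use adjacent in simp)
    moreover have "length (map fst (asg0 v V es est)) \<le> (r + 3) * length S"
    proof (rule assign_stable)
      show "pr_inv (r + 3) (adjl v V es est) (map fst (asg0 v V es est)) (asg, labs)"
        using assigned_facts(1)[of r] by (simp add: pst)
      show "prstep (r + 3) S (adjl v V es est) (asg, labs) = (asg, labs)"
        using assigned_facts(2)[of r] by (simp add: pst)
      show "snd ` set (adjl v V es est) \<subseteq> set S" using adjl_iff by fastforce
      show "distinct S" by (rule state_facts(4))
      show "\<not> good_level (r + 3) S (adjl v V es est) (asg, labs) s" if "s \<in> set S" for s by (rule none[OF that])
    qed
    ultimately show ?thesis by simp
  qed
  have lob: "length (lobes v est) \<le> (r + 3) * length S + (k + r)"
    using trees nf(3) sum_length_filter_compl[of "treel v V es est" "lobes v est"] by simp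
  let ?L = "set (List.enumerate 0 es)"
  have "{e \<in> ?L. touch {v} (snd e)} \<subseteq>
     {e \<in> ?L. inside {v} (snd e)} \<union> (\<Union>s\<in>set S. {e \<in> ?L. parallel (v, s) (snd e)}) \<union> set (lobes v est)"
  proof
    fix e assume "e \<in> {e \<in> ?L. touch {v} (snd e)}"
    then have e: "e \<in> ?L" "fst (snd e) = v \<or> snd (snd e) = v" by (auto simp: touch_def)
    note oc = other_cases[OF e(2)]
    consider "other v (snd e) = v" | "other v (snd e) \<in> set S" | "other v (snd e) \<noteq> v" "other v (snd e) \<notin> set S" by blast
    then show "e \<in> {e \<in> ?L. inside {v} (snd e)} \<union> (\<Union>s\<in>set S. {e \<in> ?L. parallel (v, s) (snd e)}) \<union> set (lobes v est)"
    proof cases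
      case 1
      then have "inside {v} (snd e)" using oc by (auto simp: inside_def)
      then show ?thesis using e(1) by blast
    next
      case 2
      have "parallel (v, other v (snd e)) (snd e)" using other_ends[OF e(2)] by (simp add: parallel_def)
      then show ?thesis using e(1) 2 by blast
    next
      case 3
      have "e \<in> set F"
      proof (rule ccontr)
        assume "e \<notin> set F"
        then have "e \<in> ?L - set F" using e(1) by blast
        moreover have "\<forall>e \<in> ?L - set F. touch {v} (snd e) \<longrightarrow> other v (snd e) \<in> set S"
          using state_facts(2) unfolding ears_inv_def by blast
        ultimately have "other v (snd e) \<in> set S" using e(2) unfolding touch_singleton by blast
        then show False using 3 by simp
      qed
      then have "e \<in> set (lobes v est)" using e 3 by (simp add: lobes_est freshv_def)
      then show ?thesis by blast
    qed
  qed
  then have "card {e \<in> ?L. touch {v} (snd e)} \<le> card ({e \<in> ?L. inside {v} (snd e)} \<union> (\<Union>s\<in>set S. {e \<in> ?L. parallel (v, s) (snd e)}) \<union> set (lobes v est))"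
    by (intro card_mono) auto
  also have "\<dots> \<le> card {e \<in> ?L. inside {v} (snd e)} + card (\<Union>s\<in>set S. {e \<in> ?L. parallel (v, s) (snd e)}) + card (set (lobes v est))"
    by (intro order_trans[OF card_Un_le] add_mono card_Un_le order_refl)
  also have "card {e \<in> ?L. inside {v} (snd e)} = loops v es"
    unfolding loops_def length_filter_enumerate ..
  also have "card (\<Union>s\<in>set S. {e \<in> ?L. parallel (v, s) (snd e)}) \<le> (\<Sum>s\<in>set S. card {e \<in> ?L. parallel (v, s) (snd e)})"
    by (rule card_UN_le) simp
  also have "\<dots> \<le> of_nat (card (set S)) * (r + 2)"
  proof (rule sum_bounded_above)
    fix s assume "s \<in> set S"
    then have "v \<noteq> s" using v_notin_S by blast
    from parallel_le[OF this] show "card {e \<in> ?L. parallel (v, s) (snd e)} \<le> r + 2"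
      unfolding length_filter_enumerate .
  qed
  also have "card (set (lobes v est)) \<le> length (lobes v est)" by (rule card_length)
  finally have "length (filter (touch {v}) es) \<le> loops v es + length S * (r + 2) + length (lobes v est)"
    unfolding length_filter_enumerate using distinct_card[OF state_facts(4)] by simp
  then have "deg v es \<le> 2 * r + length S * (r + 2) + ((r + 3) * length S + (k + r))"
    using nf(1) lob by (simp add: deg_def)
  also have "\<dots> = 3 * r + k + length S * (2 * r + 5)" by (simp add: algebra_simps)
  also have "\<dots> \<le> 4 * k + 6 * k * (2 * r + 5)"
    using S rk by (intro add_mono mult_le_mono1) auto
  also have "\<dots> \<le> 4 * k * max 1 r + 6 * k * (7 * max 1 r)"
    by (intro add_mono mult_le_mono2) auto
  also have "\<dots> = 46 * k * max 1 r" by (simp add: algebra_simps)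
  finally show ?thesis .
qed

text \<open>Write \<open>R = max 1 r\<close>, and let \<open>e1\<close> count the edges at
  \<open>X\<close>, so \<open>e1\<close> is at most \<open>46 * k^2 * R\<close>. There are at most
  \<open>e1\<close> components outside \<open>X\<close>, and minimum degree three bounds their
  vertices by \<open>2 * r * e1 + e1\<close>. The edges are then at most
  \<open>2 * e1 + 3 * r * e1\<close>, at most \<open>5 * R * e1\<close>, and
  \<open>5 * 46 = 230\<close>.\<close>

lemma size_bounds:
  assumes X: "X \<subseteq> set V" "card X \<le> k" "sol r (set V - X) es"
  shows "length V \<le> 230 * k\<^sup>2 * (max 1 r)\<^sup>2" "length es \<le> 230 * k\<^sup>2 * (max 1 r)\<^sup>2"
proof -
  let ?W = "set V - X" and ?L = "set (List.enumerate 0 es)"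
  let ?A = "{p \<in> set es. inside ?W p}"
  define R where "R = max 1 r"
  have finX: "finite X" using X(1) finite_subset by blast
  define e1 where "e1 = card {e \<in> ?L. touch X (snd e)}"
  have e1_le: "e1 \<le> 46 * k\<^sup>2 * R"
  proof -
    have "{e \<in> ?L. touch X (snd e)} \<subseteq> (\<Union>x\<in>X. {e \<in> ?L. touch {x} (snd e)})" by (auto simp: touch_def)
    then have "e1 \<le> card (\<Union>x\<in>X. {e \<in> ?L. touch {x} (snd e)})"
      unfolding e1_def using finX by (intro card_mono) auto
    also have "\<dots> \<le> (\<Sum>x\<in>X. card {e \<in> ?L. touch {x} (snd e)})" by (rule card_UN_le[OF finX])
    also have "\<dots> \<le> of_nat (card X) * (46 * k * R)"
    proof (rule sum_bounded_above)
      fix x assume "x \<in> X"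
      then have "deg x es \<le> 46 * k * R" unfolding R_def using X(1) by (intro deg_le) auto
      then show "card {e \<in> ?L. touch {x} (snd e)} \<le> 46 * k * R"
        unfolding deg_def length_filter_enumerate by simp
    qed
    also have "\<dots> \<le> k * (46 * k * R)" using X(2) by (simp add: mult_le_mono1)
    also have "\<dots> = 46 * k\<^sup>2 * R" by (simp add: power2_eq_square)
    finally show ?thesis .
  qed
  define Cs where "Cs = (\<lambda>x. reach ?A {x}) ` ?W"
  have finCs: "finite Cs" by (simp add: Cs_def)
  have C_sub: "C \<subseteq> ?W" if "C \<in> Cs" for C
  proof -
    obtain x where x: "x \<in> ?W" "C = reach ?A {x}" using \<open>C \<in> Cs\<close> unfolding Cs_def by blast
    show ?thesis unfolding x(2) by (rule reach_least) (use x(1) in \<open>auto simp: inside_def\<close>)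
  qed
  have C_disj: "C \<inter> C' = {}" if "C \<in> Cs" "C' \<in> Cs" "C \<noteq> C'" for C C'
  proof (rule ccontr)
    assume "C \<inter> C' \<noteq> {}"
    then obtain y where y: "y \<in> C" "y \<in> C'" by blast
    obtain x x' where "C = reach ?A {x}" "C' = reach ?A {x'}" using \<open>C \<in> Cs\<close> \<open>C' \<in> Cs\<close> unfolding Cs_def by blast
    then have "reach ?A {y} = C" "reach ?A {y} = C'" using y by (metis reach_eq)+
    then show False using that(3) by simp
  qed
  have C_cnt: "cnt C es + 1 \<le> card C + r" if "C \<in> Cs" for C
  proof (rule solD[OF X(3) _ C_sub[OF that]])
    obtain x where x: "x \<in> ?W" "C = reach ?A {x}" using \<open>C \<in> Cs\<close> unfolding Cs_def by blast
    show "C \<noteq> {}" using x(2) reach_start[of x "{x}" ?A] by blast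
    show "conn (set es) C" unfolding x(2) by (rule conn_mono[OF conn_reach]) blast
  qed
  \<comment> \<open>Without an edge to \<open>X\<close> this would be a component of the whole graph
    within the bound, and the component rule would have removed it.\<close>
  have C_edge: "\<exists>e. e \<in> ?L \<and> touch C (snd e) \<and> touch X (snd e)" if C: "C \<in> Cs" for C
  proof (rule ccontr)
    assume no: "\<not> ?thesis"
    obtain x where x: "x \<in> ?W" "C = reach ?A {x}" using \<open>C \<in> Cs\<close> unfolding Cs_def by blast
    have noX: "\<not> touch X p" if "p \<in> set es" "touch C p" for p
    proof -
      obtain e where "e \<in> ?L" "snd e = p" using \<open>p \<in> set es\<close> set_enumerate_snd[of 0 es] by (metis imageE)
      then show ?thesis using no \<open>touch C p\<close> by blast
    qed
    have "reach (set es) {x} \<subseteq> C"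
    proof (rule reach_least)
      show "{x} \<subseteq> C" unfolding x(2) by (rule reach_refl)
      fix a b assume ab: "(a, b) \<in> set es"
      show "a \<in> C \<longleftrightarrow> b \<in> C"
      proof (cases "touch C (a, b)")
        case True
        then have "(a, b) \<in> ?A" using noX[OF ab] ends_in[OF ab] ab by (auto simp: inside_def touch_def)
        then show ?thesis unfolding x(2) by (rule reach_closed)
      next
        case False
        then show ?thesis by (auto simp: touch_def)
      qed
    qed
    moreover have "C \<subseteq> reach (set es) {x}" unfolding x(2) by (rule reach_mono) auto
    ultimately have "C = reach (set es) {x}" by blast
    then have "card C + r \<le> cnt C es" using comp_large[of x] x(1) by simp
    then show False using C_cnt[OF C] by simp
  qed
  \<comment> \<open>An edge at \<open>X\<close> has at most one end outside \<open>X\<close>, so it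
    serves only one component.\<close>
  have card_Cs: "card Cs \<le> e1"
  proof -
    obtain h where h: "\<And>C. C \<in> Cs \<Longrightarrow> h C \<in> ?L \<and> touch C (snd (h C)) \<and> touch X (snd (h C))"
      using C_edge by metis
    show ?thesis
      unfolding e1_def
    proof (rule card_inj_on_le[of h])
      show "inj_on h Cs"
      proof (rule inj_onI, rule ccontr)
        fix C C' assume C: "C \<in> Cs" "C' \<in> Cs" "h C = h C'" "C \<noteq> C'"
        have "touch C (snd (h C))" "touch C' (snd (h C))" "touch X (snd (h C))" using h C by metis+
        then show False using C_disj[OF C(1,2,4)] C_sub[OF C(1)] C_sub[OF C(2)] unfolding touch_def by blast
      qed
      show "h ` Cs \<subseteq> {e \<in> ?L. touch X (snd e)}" using h by blast
    qed simp
  qed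
  have cntW: "cnt ?W es \<le> card ?W + r * e1"
  proof -
    have "{e \<in> ?L. inside ?W (snd e)} \<subseteq> (\<Union>C\<in>Cs. {e \<in> ?L. inside C (snd e)})"
    proof
      fix e assume "e \<in> {e \<in> ?L. inside ?W (snd e)}"
      then have e: "e \<in> ?L" "inside ?W (snd e)" by blast+
      then have "snd e \<in> ?A" using set_enumerate_snd[of 0 es] by blast
      then have "(fst (snd e), snd (snd e)) \<in> ?A" by simp
      then have "snd (snd e) \<in> reach ?A {fst (snd e)}"
        using reach_closed[of "fst (snd e)" "snd (snd e)" ?A "{fst (snd e)}"] reach_start[of "fst (snd e)" "{fst (snd e)}" ?A] by blast
      then have "inside (reach ?A {fst (snd e)}) (snd e)" by (simp add: inside_def reach_start)
      moreover have "reach ?A {fst (snd e)} \<in> Cs" using e(2) unfolding Cs_def inside_def by blast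
      ultimately show "e \<in> (\<Union>C\<in>Cs. {e \<in> ?L. inside C (snd e)})" using e(1) by blast
    qed
    then have "cnt ?W es \<le> card (\<Union>C\<in>Cs. {e \<in> ?L. inside C (snd e)})"
      unfolding cnt_def length_filter_enumerate using finCs by (intro card_mono) auto
    also have "\<dots> \<le> (\<Sum>C\<in>Cs. card {e \<in> ?L. inside C (snd e)})" by (rule card_UN_le[OF finCs])
    also have "\<dots> = (\<Sum>C\<in>Cs. cnt C es)" unfolding cnt_def length_filter_enumerate ..
    also have "\<dots> \<le> (\<Sum>C\<in>Cs. card C + r)" by (rule sum_mono) (use C_cnt in fastforce)
    also have "\<dots> = (\<Sum>C\<in>Cs. card C) + card Cs * r" by (simp add: sum.distrib)
    also have "(\<Sum>C\<in>Cs. card C) = card (\<Union>C\<in>Cs. C)"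
    proof (rule card_UN_disjoint[symmetric, OF finCs])
      show "\<forall>C\<in>Cs. finite C"
      proof
        show "finite C" if "C \<in> Cs" for C by (rule finite_subset[OF C_sub[OF that]]) simp
      qed
      show "\<forall>C\<in>Cs. \<forall>C'\<in>Cs. C \<noteq> C' \<longrightarrow> C \<inter> C' = {}" using C_disj by simp
    qed
    also have "\<dots> \<le> card ?W" by (rule card_mono) (use C_sub in auto)
    finally have "cnt ?W es \<le> card ?W + card Cs * r" by simp
    also have "card Cs * r \<le> r * e1" using card_Cs by (simp add: mult.commute)
    finally show ?thesis by simp
  qed
  have split_es: "length es = e1 + cnt ?W es"
  proof -
    have "length (filter (touch X) es) + length (filter (\<lambda>p. \<not> touch X p) es) = length es"
      by (rule sum_length_filter_compl)
    moreover have "filter (\<lambda>p. \<not> touch X p) es = filter (inside ?W) es"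
      by (rule filter_cong) (use ends_in in \<open>auto simp: inside_def touch_def\<close>)
    moreover have "length (filter (touch X) es) = e1" unfolding e1_def length_filter_enumerate ..
    ultimately show ?thesis by (simp add: cnt_def)
  qed
  \<comment> \<open>Three times the number of vertices is at most the degree sum
    \<open>2 * cnt + e1\<close>, while \<open>cnt\<close> exceeds the number of vertices by at most
    \<open>r * e1\<close>. The difference bounds the number of vertices.\<close>
  have "(\<Sum>x\<in>?W. 3) \<le> (\<Sum>x\<in>?W. deg x es)" by (rule sum_mono) (use deg_ge3 in blast)
  also have "\<dots> = 2 * cnt ?W es + length (filter (\<lambda>p. touch ?W p \<and> \<not> inside ?W p) es)" by (rule sum_deg) simp
  also have "length (filter (\<lambda>p. touch ?W p \<and> \<not> inside ?W p) es) \<le> length (filter (touch X) es)"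
    by (rule length_filter_mono) (use ends_in in \<open>auto simp: inside_def touch_def\<close>)
  also have "length (filter (touch X) es) = e1" unfolding e1_def length_filter_enumerate ..
  finally have "3 * card ?W \<le> 2 * (card ?W + r * e1) + e1" using cntW by simp
  then have W: "card ?W \<le> 2 * (r * e1) + e1" by simp
  have rR: "r * e1 \<le> R * e1" "e1 \<le> R * e1" by (simp_all add: R_def)
  have k1: "1 \<le> k" using rk by simp
  have bound: "5 * (R * e1) \<le> 230 * k\<^sup>2 * R\<^sup>2"
  proof -
    have "5 * (R * e1) \<le> 5 * (R * (46 * k\<^sup>2 * R))" by (intro mult_le_mono2 e1_le)
    also have "\<dots> = 230 * k\<^sup>2 * R\<^sup>2" by (simp add: power2_eq_square)
    finally show ?thesis .
  qed
  have "length es \<le> 5 * (R * e1)" using split_es cntW W rR by linarith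
  then show "length es \<le> 230 * k\<^sup>2 * (max 1 r)\<^sup>2" using bound unfolding R_def by (rule le_trans)
  have "length V = card (set V)" using distinct_card[OF distV] by simp
  also have "\<dots> \<le> card X + card ?W"
  proof -
    have "set V = X \<union> ?W" using X(1) by blast
    then have "card (set V) = card (X \<union> ?W)" by simp
    also have "\<dots> \<le> card X + card ?W" by (rule card_Un_le)
    finally show ?thesis .
  qed
  finally have "length V \<le> k + 3 * (R * e1)" using X(2) W rR by linarith
  \<comment> \<open>The vertices alone would need only \<open>1 + 138\<close>; the constant of the
    edges is used for both.\<close>
  also have "\<dots> \<le> k\<^sup>2 * R\<^sup>2 + 138 * k\<^sup>2 * R\<^sup>2"
  proof (rule add_mono)
    have "1 \<le> R" by (simp add: R_def)
    then have "1 \<le> k * R\<^sup>2" using k1 by simp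
    then have "k * 1 \<le> k * (k * R\<^sup>2)" by (rule mult_le_mono2)
    then show "k \<le> k\<^sup>2 * R\<^sup>2" by (simp add: power2_eq_square mult.assoc)
    have "3 * (R * e1) \<le> 3 * (R * (46 * k\<^sup>2 * R))" by (intro mult_le_mono2 e1_le)
    also have "\<dots> = 138 * k\<^sup>2 * R\<^sup>2" by (simp add: power2_eq_square)
    finally show "3 * (R * e1) \<le> 138 * k\<^sup>2 * R\<^sup>2" .
  qed
  also have "\<dots> \<le> 230 * k\<^sup>2 * R\<^sup>2" by simp
  finally show "length V \<le> 230 * k\<^sup>2 * (max 1 r)\<^sup>2" unfolding R_def .
qed

end

section \<open>Running times\<close>

text \<open>Each function is analysed once, on a tuple of variables; its applications to arbitrary
  arguments then follow by composition, so definitions need not be unfolded again.\<close>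

lemma pt_lift2: "pt (\<lambda>z. f (fst z) (snd z)) \<Longrightarrow> pt a \<Longrightarrow> pt b \<Longrightarrow> pt (\<lambda>x. f (a x) (b x))"
  using pt_comp[of "\<lambda>z. f (fst z) (snd z)" "\<lambda>x. (a x, b x)"] by (simp add: pt_pair)

lemma pt_lift3: "pt (\<lambda>z. f (fst z) (fst (snd z)) (snd (snd z))) \<Longrightarrow> pt a \<Longrightarrow> pt b \<Longrightarrow> pt c \<Longrightarrow> pt (\<lambda>x. f (a x) (b x) (c x))"
  using pt_comp[of "\<lambda>z. f (fst z) (fst (snd z)) (snd (snd z))" "\<lambda>x. (a x, b x, c x)"] by (simp add: pt_pair)

lemma pt_lift4: "pt (\<lambda>z. f (fst z) (fst (snd z)) (fst (snd (snd z))) (snd (snd (snd z)))) \<Longrightarrow> pt a \<Longrightarrow> pt b \<Longrightarrow> pt c \<Longrightarrow> pt d \<Longrightarrow>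
    pt (\<lambda>x. f (a x) (b x) (c x) (d x))"
  using pt_comp[of "\<lambda>z. f (fst z) (fst (snd z)) (fst (snd (snd z))) (snd (snd (snd z)))" "\<lambda>x. (a x, b x, c x, d x)"]
  by (simp add: pt_pair)

lemma pt_lift5: "pt (\<lambda>z. f (fst z) (fst (snd z)) (fst (snd (snd z))) (fst (snd (snd (snd z)))) (snd (snd (snd (snd z))))) \<Longrightarrow>
    pt a \<Longrightarrow> pt b \<Longrightarrow> pt c \<Longrightarrow> pt d \<Longrightarrow> pt e \<Longrightarrow> pt (\<lambda>x. f (a x) (b x) (c x) (d x) (e x))"
  using pt_comp[of "\<lambda>z. f (fst z) (fst (snd z)) (fst (snd (snd z))) (fst (snd (snd (snd z)))) (snd (snd (snd (snd z))))"
    "\<lambda>x. (a x, b x, c x, d x, e x)"]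
  by (simp add: pt_pair)

lemma pt_Let [pt_intros]: "pt a \<Longrightarrow> pt (\<lambda>z. f (fst z) (snd z)) \<Longrightarrow> pt (\<lambda>x. let y = a x in f x y)"
  unfolding Let_def by (rule pt_lift2[of f "\<lambda>x. x" a]) (auto intro: pt_id)

lemma pt_replicate: "upt a \<Longrightarrow> pt (\<lambda>x. replicate (a x) ())"
  by (simp add: upt_def)

lemma pt_inside [pt_intros]: "pt C \<Longrightarrow> pt p \<Longrightarrow> pt (\<lambda>x. inside (set (C x)) (p x))"
  unfolding inside_def by (intro pt_intros)

lemma pt_touch [pt_intros]: "pt C \<Longrightarrow> pt p \<Longrightarrow> pt (\<lambda>x. touch (set (C x)) (p x))"
  unfolding touch_def by (intro pt_intros)

lemma pt_inside1 [pt_intros]: "pt v \<Longrightarrow> pt p \<Longrightarrow> pt (\<lambda>x. inside {v x} (p x))"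
  unfolding inside_singleton by (intro pt_intros)

lemma pt_touch1 [pt_intros]: "pt v \<Longrightarrow> pt p \<Longrightarrow> pt (\<lambda>x. touch {v x} (p x))"
  unfolding touch_singleton by (intro pt_intros)

lemma pt_parallel [pt_intros]: "pt p \<Longrightarrow> pt q \<Longrightarrow> pt (\<lambda>x. parallel (p x) (q x))"
  unfolding parallel_def doubleton_eq_iff by (intro pt_intros)

lemma pt_other [pt_intros]: "pt v \<Longrightarrow> pt p \<Longrightarrow> pt (\<lambda>x. other (v x) (p x))"
  unfolding other_def by (intro pt_intros)

text \<open>In the body of a \<open>filter\<close> or \<open>map\<close> the input is paired with
  the current element, and outer arguments are reached through \<open>fst\<close>.\<close>

lemma pt_shift: "pt f \<Longrightarrow> pt (\<lambda>z. f (fst z))"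
  by (rule pt_comp[of f fst]) (auto intro: pt_intros)

lemma upt_cnt [pt_intros]: "pt C \<Longrightarrow> pt es \<Longrightarrow> upt (\<lambda>x. cnt (set (C x)) (es x))"
  unfolding cnt_def by (intro pt_intros pt_shift[of C])

lemma pt_avoid [pt_intros]: "pt C \<Longrightarrow> pt es \<Longrightarrow> pt (\<lambda>x. avoid (set (C x)) (es x))"
  unfolding avoid_def by (intro pt_intros pt_shift[of C])

lemma pt_avoid1 [pt_intros]: "pt v \<Longrightarrow> pt es \<Longrightarrow> pt (\<lambda>x. avoid {v x} (es x))"
  unfolding avoid_def by (intro pt_intros pt_shift[of v])

lemma upt_loops [pt_intros]: "pt v \<Longrightarrow> pt es \<Longrightarrow> upt (\<lambda>x. loops (v x) (es x))"
  unfolding loops_def by (intro pt_intros pt_shift[of v])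

lemma upt_deg [pt_intros]: "pt v \<Longrightarrow> pt es \<Longrightarrow> upt (\<lambda>x. deg (v x) (es x))"
  unfolding deg_def by (intro pt_intros pt_shift[of v])

lemma pt_reachl [pt_intros]:
  assumes "pt E" "pt Z"
  shows "pt (\<lambda>x. reachl (E x) (Z x))"
proof -
  let ?c = "\<lambda>z :: (nat \<times> nat) list \<times> nat list. snd z @ map fst (fst z) @ map snd (fst z)"
  have c: "pt ?c" by (intro pt_intros)
  obtain p where p: "\<And>z. esize (?c z) \<le> poly p (esize z)" using pt_bound[OF c] by blast
  have "pt (\<lambda>z. reachl (fst z) (snd z))"
    unfolding reachl_def
  proof (rule pt_fold_inv[where I = "\<lambda>z i R. esize R \<le> esize (?c z)" and b = "poly p"])
    show "esize (filter (P z i s) (?c z)) \<le> esize (?c z)" for P :: "(nat \<times> nat) list \<times> nat list \<Rightarrow> nat \<Rightarrow> nat list \<Rightarrow> nat \<Rightarrow> bool" and z i s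
      by (rule esize_filter)
    show "esize R \<le> poly p (esize z)" if "esize R \<le> esize (?c z)" for z R using p[of z] that by linarith
  qed (auto intro!: pt_intros)
  then show ?thesis by (rule pt_lift2) (rule assms)+
qed

lemma pt_compl [pt_intros]: "pt V \<Longrightarrow> pt es \<Longrightarrow> pt v \<Longrightarrow> pt (\<lambda>x. compl (V x) (es x) (v x))"
  by (rule pt_lift3[of compl]) (unfold compl_def, intro pt_intros)

lemma pt_take1 [pt_intros]: "pt xs \<Longrightarrow> pt (\<lambda>x. take1 (xs x))"
  unfolding take1_def by (intro pt_intros)

lemma pt_minim [pt_intros]:
  fixes xs :: "'a::enc \<Rightarrow> 'b::enc list"
  assumes xs: "pt xs" and P: "pt (\<lambda>z. P (fst z) (snd z))"
  shows "pt (\<lambda>x. minim (P x) (xs x))"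
proof -
  obtain p where p: "\<And>x. esize (xs x) \<le> poly p (esize x)" using pt_bound[OF xs] by blast
  have f: "pt (\<lambda>z. filter (\<lambda>x. x \<noteq> fst (snd z)) (snd (snd z)))" for z :: "'a \<times> 'b \<times> 'b list"
    by (intro pt_intros)
  have "pt (\<lambda>z :: 'a \<times> 'b \<times> 'b list. P (fst z) (filter (\<lambda>x. x \<noteq> fst (snd z)) (snd (snd z))))"
    by (rule pt_lift2[OF P]) (intro pt_intros)+
  then show ?thesis
    unfolding minim_def
    by (intro pt_fold[where b = "poly p", OF xs xs] pt_intros)
      (auto simp: minim_filter intro: order_trans[OF _ p], metis esize_filter le_trans minim_filter p)
qed

lemma pt_freshv [pt_intros]: "pt v \<Longrightarrow> pt F \<Longrightarrow> pt S \<Longrightarrow> pt (\<lambda>x. freshv (v x) (F x) (S x))"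
  by (rule pt_lift3[of freshv]) (unfold freshv_def, intro pt_intros)

lemma pt_coreE [pt_intros]: "pt v \<Longrightarrow> pt F \<Longrightarrow> pt S \<Longrightarrow> pt (\<lambda>x. coreE (v x) (F x) (S x))"
  by (rule pt_lift3[of coreE]) (unfold coreE_def, intro pt_intros)

lemma pt_targets [pt_intros]: "pt v \<Longrightarrow> pt F \<Longrightarrow> pt Z \<Longrightarrow> pt S \<Longrightarrow> pt e \<Longrightarrow> pt (\<lambda>x. targets (v x) (F x) (Z x) (S x) (e x))"
  by (rule pt_lift5[of targets]) (unfold targets_def, intro pt_intros)

lemma pt_hits [pt_intros]: "pt T \<Longrightarrow> pt u \<Longrightarrow> pt Q \<Longrightarrow> pt (\<lambda>x. hits (T x) (u x) (Q x))"
  by (rule pt_lift3[of hits]) (unfold hits_def, intro pt_intros)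

lemma pt_earcands [pt_intros]: "pt v \<Longrightarrow> pt st \<Longrightarrow> pt (\<lambda>x. earcands (v x) (st x))"
  by (rule pt_lift2[of earcands]) (unfold earcands_def, intro pt_intros)

lemma pt_add_ear:
  "pt (\<lambda>z. add_ear (fst z) (fst (snd z)) (fst (snd (snd z))) (fst (snd (snd (snd z)))) (fst (snd (snd (snd (snd z)))))
     (fst (snd (snd (snd (snd (snd z)))))) (snd (snd (snd (snd (snd (snd z)))))))"
  unfolding add_ear_def by (intro pt_intros)

lemma pt_add_ear' [pt_intros]:
  assumes "pt v" "pt V" "pt st" "pt e" "pt t" "pt Q" "pt fs"
  shows "pt (\<lambda>x. add_ear (v x) (V x) (st x) (e x) (t x) (Q x) (fs x))"
  using pt_comp[OF pt_add_ear, of "\<lambda>x. (v x, V x, st x, e x, t x, Q x, fs x)"] assms by (simp add: pt_pair)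

lemma pt_find_ear [pt_intros]: "pt v \<Longrightarrow> pt V \<Longrightarrow> pt st \<Longrightarrow> pt e \<Longrightarrow> pt (\<lambda>x. find_ear (v x) (V x) (st x) (e x))"
  by (rule pt_lift4[of find_ear]) (unfold find_ear_def, intro pt_intros)

lemma pt_earstep [pt_intros]: "pt v \<Longrightarrow> pt V \<Longrightarrow> pt st \<Longrightarrow> pt (\<lambda>x. earstep (v x) (V x) (st x))"
  by (rule pt_lift3[of earstep]) (unfold earstep_def, intro pt_intros)

text \<open>For the size bound it does not matter which ear is found: the lists are sublists of
  known ones, and the counter grows by one.\<close>

lemma earstep_shape:
  "earstep v V st = st \<or> (\<exists>P P' P''. earstep v V st = (filter P (fst st), filter P' V, filter P'' V, () # snd (snd (snd st))))"
proof (cases "earcands v st")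
  case Nil
  then show ?thesis by (simp add: earstep_def)
next
  case (Cons e es)
  then have "earstep v V st = find_ear v V st e" by (simp add: earstep_def)
  moreover have "\<exists>P P' P''. find_ear v V st e = (filter P (fst st), filter P' V, filter P'' V, () # snd (snd (snd st)))"
    unfolding find_ear_def add_ear_def case_prod_unfold Let_def by blast
  ultimately show ?thesis by simp
qed

lemma pt_ears [pt_intros]:
  assumes "pt v" "pt V" "pt L"
  shows "pt (\<lambda>x. ears (v x) (V x) (L x))"
proof -
  let ?I = "\<lambda>z :: nat \<times> nat list \<times> ledge list. \<lambda>i st :: estate. esize (fst st) \<le> esize (snd (snd z)) \<and> esize (fst (snd st)) \<le> esize (fst (snd z)) \<and>
      esize (fst (snd (snd st))) \<le> esize (fst (snd z)) \<and> length (snd (snd (snd st))) \<le> i"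
  have "pt (\<lambda>z. ears (fst z) (fst (snd z)) (snd (snd z)))"
    unfolding ears_def
  proof (rule pt_fold_inv[where I = ?I and b = "\<lambda>n. 3 + 4 * n"])
    show "?I z (Suc i) (earstep (fst z) (fst (snd z)) st)" if I: "?I z i st" for z i st
    proof -
      have "esize (filter P (fst st)) \<le> esize (snd (snd z))" for P
        using I esize_filter[of P "fst st"] by linarith
      then show ?thesis
        using earstep_shape[of "fst z" "fst (snd z)" st] I esize_filter[of _ "fst (snd z)"] by fastforce
    qed
    show "esize st \<le> 3 + 4 * esize z" if "i \<le> length (snd (snd z))" "?I z i st" for z i st
    proof -
      have "esize st = 3 + esize (fst st) + esize (fst (snd st)) + esize (fst (snd (snd st))) + length (snd (snd (snd st)))"
        by (simp add: encode_pair)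
      moreover have "esize z = 2 + esize (fst z) + esize (fst (snd z)) + esize (snd (snd z))" by (simp add: encode_pair)
      moreover have "length (snd (snd z)) \<le> esize (snd (snd z))" by (rule length_le_esize)
      ultimately show ?thesis using that by linarith
    qed
  qed (auto intro!: pt_intros)
  then show ?thesis by (rule pt_lift3) (rule assms)+
qed

lemma pt_lobel [pt_intros]: "pt v \<Longrightarrow> pt V \<Longrightarrow> pt F \<Longrightarrow> pt S \<Longrightarrow> pt e \<Longrightarrow> pt (\<lambda>x. lobel (v x) (V x) (F x) (S x) (e x))"
  by (rule pt_lift5[of lobel]) (unfold lobel_def, intro pt_intros)

lemma pt_treel [pt_intros]: "pt v \<Longrightarrow> pt V \<Longrightarrow> pt es \<Longrightarrow> pt st \<Longrightarrow> pt e \<Longrightarrow> pt (\<lambda>x. treel (v x) (V x) (es x) (st x) (e x))"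
  by (rule pt_lift5[of treel]) (unfold treel_def, intro pt_intros)

lemma pt_lobes [pt_intros]: "pt v \<Longrightarrow> pt st \<Longrightarrow> pt (\<lambda>x. lobes (v x) (st x))"
  by (rule pt_lift2[of lobes]) (unfold lobes_def, intro pt_intros)

lemma pt_hubs [pt_intros]: "pt st \<Longrightarrow> pt (\<lambda>x. hubs (st x))"
  unfolding hubs_def by (intro pt_intros)

lemma upt_ear_count [pt_intros]: "pt st \<Longrightarrow> upt (\<lambda>x. ear_count (st x))"
  unfolding ear_count_def by (intro pt_intros)

lemma pt_forced [pt_intros]: "pt st \<Longrightarrow> pt v \<Longrightarrow> pt (\<lambda>x. forced r (st x) (v x))"
  by (rule pt_lift2[of "forced r"]) (unfold forced_def, intro pt_intros)

lemma pt_adjl [pt_intros]: "pt v \<Longrightarrow> pt V \<Longrightarrow> pt es \<Longrightarrow> pt st \<Longrightarrow> pt (\<lambda>x. adjl (v x) (V x) (es x) (st x))"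
  by (rule pt_lift4[of adjl]) (unfold adjl_def, intro pt_intros)

lemma pt_asg0 [pt_intros]: "pt v \<Longrightarrow> pt V \<Longrightarrow> pt es \<Longrightarrow> pt st \<Longrightarrow> pt (\<lambda>x. asg0 (v x) (V x) (es x) (st x))"
  by (rule pt_lift4[of asg0]) (unfold asg0_def, intro pt_intros)

lemma upt_lab [pt_intros]: "pt labs \<Longrightarrow> pt s \<Longrightarrow> upt (\<lambda>x. lab (labs x) (s x))"
  unfolding lab_def by (intro pt_intros pt_shift[of s])

lemma upt_load [pt_intros]: "pt asg \<Longrightarrow> pt s \<Longrightarrow> upt (\<lambda>x. load (asg x) (s x))"
  unfolding load_def by (intro pt_intros pt_shift[of s])

lemma pt_prmoves [pt_intros]: "pt Adj \<Longrightarrow> pt st \<Longrightarrow> pt (\<lambda>x. prmoves q (Adj x) (st x))"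
  by (rule pt_lift2[of "prmoves q"]) (unfold prmoves_def, intro pt_intros)

lemma pt_prstep [pt_intros]: "pt S \<Longrightarrow> pt Adj \<Longrightarrow> pt st \<Longrightarrow> pt (\<lambda>x. prstep q (S x) (Adj x) (st x))"
  by (rule pt_lift3[of "prstep q"]) (unfold prstep_def, intro pt_intros)

lemma pt_good_level [pt_intros]: "pt S \<Longrightarrow> pt Adj \<Longrightarrow> pt st \<Longrightarrow> pt s \<Longrightarrow> pt (\<lambda>x. good_level q (S x) (Adj x) (st x) (s x))"
  by (rule pt_lift4[of "good_level q"]) (unfold good_level_def, intro pt_intros)

text \<open>Polynomial time is claimed for arbitrary arguments, so the sizes are bounded without the
  invariant of the assignment, from the shape of a step alone.\<close>

lemma prstep_shape:
  "length (fst (prstep q S Adj st)) = length (fst st)"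
  "set (fst (prstep q S Adj st)) \<subseteq> set (fst st) \<union> set Adj"
  "length (snd (prstep q S Adj st)) \<le> Suc (length (snd st))"
  "set (snd (prstep q S Adj st)) \<subseteq> set (snd st) \<union> set S"
proof -
  have m: "a \<in> set Adj" if "prmoves q Adj st = a # as" for a as
  proof -
    have "a \<in> set (prmoves q Adj st)" using that by simp
    then show ?thesis by (simp add: prmoves_def)
  qed
  have s: "s \<in> set S" if "filter (\<lambda>s. q < load (fst st) s) S = s # ss" for s ss
  proof -
    have "s \<in> set (filter (\<lambda>s. q < load (fst st) s) S)" using that by simp
    then show ?thesis by simp
  qed
  have "prstep q S Adj st = st \<or> (\<exists>f. prstep q S Adj st = (map f (fst st), snd st) \<and> f ` set (fst st) \<subseteq> set (fst st) \<union> set Adj)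
    \<or> (\<exists>s \<in> set S. prstep q S Adj st = (fst st, s # snd st))"
  proof (cases "\<exists>s \<in> set S. length S < lab (snd st) s")
    case True
    then show ?thesis by (simp add: prstep_def)
  next
    case False
    show ?thesis
    proof (cases "prmoves q Adj st")
      case (Cons a as)
      have "prstep q S Adj st = (map (\<lambda>p. if fst p = fst a then a else p) (fst st), snd st)"
        using False Cons by (simp only: prstep_def if_False list.case)
      moreover have "(\<lambda>p. if fst p = fst a then a else p) ` set (fst st) \<subseteq> set (fst st) \<union> set Adj"
        using m[OF Cons] by auto
      ultimately show ?thesis by blast
    next
      case Nil
      show ?thesis
      proof (cases "filter (\<lambda>s. q < load (fst st) s) S")
        case (Cons s ss)
        have "prstep q S Adj st = (fst st, s # snd st)"
          using False Nil Cons by (simp only: prstep_def if_False list.case)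
        then show ?thesis using s[OF Cons] by blast
      next
        case Nil': Nil
        show ?thesis using False Nil Nil' by (simp only: prstep_def if_False list.case simp_thms)
      qed
    qed
  qed
  then have "length (fst (prstep q S Adj st)) = length (fst st) \<and>
    set (fst (prstep q S Adj st)) \<subseteq> set (fst st) \<union> set Adj \<and>
    length (snd (prstep q S Adj st)) \<le> Suc (length (snd st)) \<and>
    set (snd (prstep q S Adj st)) \<subseteq> set (snd st) \<union> set S"
    by (elim disjE exE conjE bexE) auto
  then show "length (fst (prstep q S Adj st)) = length (fst st)"
    "set (fst (prstep q S Adj st)) \<subseteq> set (fst st) \<union> set Adj"
    "length (snd (prstep q S Adj st)) \<le> Suc (length (snd st))"
    "set (snd (prstep q S Adj st)) \<subseteq> set (snd st) \<union> set S" by blast+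
qed

lemma pt_assign [pt_intros]:
  fixes Adj asg :: "'a::enc \<Rightarrow> ('b::enc \<times> nat) list"
  assumes "pt S" "pt Adj" "pt asg"
  shows "pt (\<lambda>x. assign q (S x) (Adj x) (asg x))"
proof -
  let ?n = "\<lambda>z :: nat list \<times> ('b \<times> nat) list \<times> ('b \<times> nat) list. length (fst z) * (length (fst z) + 1) * (length (snd (snd z)) + 1)"
  have n: "pt (\<lambda>z. replicate (?n z) ())" by (intro pt_replicate pt_intros)
  obtain p where p: "\<And>z. ?n z \<le> poly p (esize z)" using pt_bound[OF n] by auto
  let ?I = "\<lambda>z :: nat list \<times> ('b \<times> nat) list \<times> ('b \<times> nat) list. \<lambda>i st. length (fst st) = length (snd (snd z)) \<and>
    set (fst st) \<subseteq> set (snd (snd z) @ fst (snd z)) \<and> length (snd st) \<le> i \<and> set (snd st) \<subseteq> set (fst z)"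
  have "pt (\<lambda>z :: nat list \<times> ('b \<times> nat) list \<times> ('b \<times> nat) list. assign q (fst z) (fst (snd z)) (snd (snd z)))"
    unfolding assign_def
  proof (rule pt_fold_inv[where f = "\<lambda>z _. prstep q (fst z) (fst (snd z))" and xs = "\<lambda>z. replicate (?n z) ()"
        and init = "\<lambda>z. (snd (snd z), [])" and I = ?I and b = "\<lambda>n. 1 + n * (n + n + 1) + poly p n * (n + 1)"])
    show "?I z (Suc i) (prstep q (fst z) (fst (snd z)) st)" if I: "?I z i st" for z i st
      using prstep_shape[of q "fst z" "fst (snd z)" st] I by fastforce
    show "esize st \<le> 1 + esize z * (esize z + esize z + 1) + poly p (esize z) * (esize z + 1)"
      if i: "i \<le> length (replicate (?n z) ())" and I: "?I z i st" for z i st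
    proof -
      have z: "esize z = 2 + esize (fst z) + esize (fst (snd z)) + esize (snd (snd z))" by (simp add: encode_pair)
      have "esize (fst st) \<le> length (fst st) * (esize (snd (snd z) @ fst (snd z)) + 1)"
        using I by (intro esize_subset) blast
      also have "\<dots> \<le> esize z * (esize z + esize z + 1)"
        using I length_le_esize[of "snd (snd z)"] z by (intro mult_le_mono) auto
      finally have 1: "esize (fst st) \<le> esize z * (esize z + esize z + 1)" .
      have "esize (snd st) \<le> length (snd st) * (esize (fst z) + 1)"
        using I by (intro esize_subset) blast
      also have "\<dots> \<le> poly p (esize z) * (esize z + 1)"
        using I i p[of z] z by (intro mult_le_mono) auto
      finally show ?thesis using 1 by (simp add: encode_pair)
    qed
  qed (rule n, auto intro!: pt_intros)
  then show ?thesis by (rule pt_lift3) (rule assms)+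
qed

lemma pt_assigned [pt_intros]: "pt v \<Longrightarrow> pt V \<Longrightarrow> pt es \<Longrightarrow> pt st \<Longrightarrow> pt (\<lambda>x. assigned r (v x) (V x) (es x) (st x))"
  by (rule pt_lift4[of "assigned r"]) (unfold assigned_def, intro pt_intros)

lemma pt_expand [pt_intros]:
  assumes "pt v" "pt as" "pt U" "pt es"
  shows "pt (\<lambda>x. expand q (v x) (as x) (set (U x)) (es x))"
proof -
  have "replicate q y = map (\<lambda>_. y) (replicate q ())" for y :: "nat \<times> nat" by (simp add: map_replicate)
  then have eq: "expand q v as U es = concat (map (\<lambda>a. map (\<lambda>_. (v, a)) (replicate q ())) as) @ filter (\<lambda>p. \<not> (touch {v} p \<and> touch U p)) es"
    for v as U es by (simp add: expand_def)
  show ?thesis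
    by (rule pt_lift4[of "\<lambda>v as U es. expand q v as (set U) es", OF _ assms]) (unfold eq, intro pt_intros)
qed

lemma pt_expand_at [pt_intros]:
  "pt v \<Longrightarrow> pt st \<Longrightarrow> pt est \<Longrightarrow> pt pst \<Longrightarrow> pt s \<Longrightarrow> pt (\<lambda>x. expand_at r (v x) (st x) (est x) (pst x) (s x))"
  by (rule pt_lift5[of "expand_at r"]) (unfold expand_at_def, intro pt_intros)

lemma pt_cands [pt_intros]:
  assumes "pt st"
  shows "pt (\<lambda>x. cands r (st x))"
proof (rule pt_comp[OF _ assms])
  have "pt (cand_comp r)" unfolding cand_comp_def by (intro pt_intros)
  moreover have "pt cand_leaf" unfolding cand_leaf_def by (intro pt_intros)
  moreover have "pt cand_contract" unfolding cand_contract_def by (intro pt_intros)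
  moreover have "pt (cand_parallel r)" unfolding cand_parallel_def by (intro pt_intros)
  moreover have "pt (cand_forced r)" unfolding cand_forced_def by (intro pt_intros)
  moreover have "pt (cand_expand r)" unfolding cand_expand_def by (intro pt_intros)
  ultimately show "pt (cands r)"
    unfolding cands_def by (intro pt_append)
qed

text \<open>Distinctness in terms of quantifiers over lists, filters and lengths, for which closure
  rules are available.\<close>

lemma distinct_iff_filter: "distinct xs \<longleftrightarrow> (\<forall>x \<in> set xs. length (filter (\<lambda>y. y = x) xs) \<le> 1)"
proof (induction xs)
  case (Cons a xs)
  have "(\<forall>x \<in> set (a # xs). length (filter (\<lambda>y. y = x) (a # xs)) \<le> 1) \<longleftrightarrow>
    a \<notin> set xs \<and> (\<forall>x \<in> set xs. length (filter (\<lambda>y. y = x) xs) \<le> 1)"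
    by (auto simp: filter_empty_conv)
  then show ?case using Cons by simp
qed simp

lemma pt_distinct [pt_intros]: "pt xs \<Longrightarrow> pt (\<lambda>x. distinct (xs x))"
  unfolding distinct_iff_filter by (intro pt_intros pt_shift[of xs])

lemma pt_smaller [pt_intros]: "pt st \<Longrightarrow> pt st' \<Longrightarrow> pt (\<lambda>x. smaller (st x) (st' x))"
  by (rule pt_lift2[of smaller]) (unfold smaller_def rsize_def, intro pt_intros)

lemma pt_rstep [pt_intros]: "pt st \<Longrightarrow> pt (\<lambda>x. rstep r (st x))"
proof (rule pt_comp[of "rstep r" st])
  show "pt (rstep r)" unfolding rstep_def by (intro pt_intros)
qed

section \<open>The kernel\<close>

definition reduce :: "nat \<Rightarrow> rstate \<Rightarrow> rstate" where
  "reduce r st = fold (\<lambda>_. rstep r) (replicate (rsize st) ()) st"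

lemma reduce_correct:
  assumes "valid st"
  shows "valid (reduce r st)" "okst r (reduce r st) \<longleftrightarrow> okst r st"
    "length (snd (snd (reduce r st))) \<le> length (snd (snd st))" "rstep r (reduce r st) = reduce r st"
proof -
  let ?I = "\<lambda>s. valid s \<and> (okst r s \<longleftrightarrow> okst r st) \<and> length (snd (snd s)) \<le> length (snd (snd st))"
  have "?I ((rstep r ^^ rsize st) st) \<and> rstep r ((rstep r ^^ rsize st) st) = (rstep r ^^ rsize st) st"
  proof (rule iterate_stable[where \<mu> = rsize])
    show "?I (rstep r s)" if "?I s" for s
      using rstep_correct(1)[of s r] that by (meson le_trans)
    show "rsize (rstep r s) < rsize s" if "?I s" "rstep r s \<noteq> s" for s
      using rstep_correct(2)[of s r] that by blast
  qed (use assms in simp_all)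
  then show "valid (reduce r st)" "okst r (reduce r st) \<longleftrightarrow> okst r st"
    "length (snd (snd (reduce r st))) \<le> length (snd (snd st))" "rstep r (reduce r st) = reduce r st"
    unfolding reduce_def fold_const_funpow by simp_all
qed

lemma rstep_cases: "rstep r st = st \<or> smaller st (rstep r st)"
proof (cases "filter (smaller st) (cands r st)")
  case (Cons c cs)
  then have "c \<in> set (filter (smaller st) (cands r st))" by simp
  then have "smaller st c" by simp
  then show ?thesis using Cons by (simp add: rstep_def)
qed (simp add: rstep_def)

lemma pt_reduce: "pt (reduce r)"
proof -
  \<comment> \<open>The input need not be valid here: its edges may mention numbers that are no
    vertices. The first disjunct covers the untouched input; after an accepted step all edges run
    between input vertices.\<close>
  let ?I = "\<lambda>st :: rstate. \<lambda>i :: nat. \<lambda>s :: rstate. s = st \<or> set (fst s) \<subseteq> set (fst st) \<and> set (fst (snd s)) \<subseteq> set (fst st) \<times> set (fst st) \<and>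
    rsize s \<le> rsize st \<and> length (snd (snd s)) \<le> length (snd (snd st))"
  have "pt (\<lambda>st. fold (\<lambda>_. rstep r) (replicate (rsize st) ()) st)"
  proof (rule pt_fold_inv[where f = "\<lambda>_ _. rstep r" and xs = "\<lambda>st. replicate (rsize st) ()" and init = "\<lambda>st. st"
        and I = ?I and b = "\<lambda>n. n + (2 + n * (n + 1) + n * (2 * n + 2) + n)"])
    show "?I st (Suc i) (rstep r s)" if I: "?I st i s" for st i s
    proof (cases "rstep r s = s")
      case False
      then have s: "smaller s (rstep r s)" using rstep_cases[of r s] by blast
      have V: "set (fst (rstep r s)) \<subseteq> set (fst s)" using s unfolding smaller_def by blast
      have E: "set (fst (snd (rstep r s))) \<subseteq> set (fst (rstep r s)) \<times> set (fst (rstep r s))"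
        using s unfolding smaller_def by (auto simp: mem_Times_iff)
      have n: "rsize (rstep r s) < rsize s" "length (snd (snd (rstep r s))) \<le> length (snd (snd s))"
        using s unfolding smaller_def by blast+
      have "set (fst s) \<subseteq> set (fst st) \<and> rsize s \<le> rsize st \<and> length (snd (snd s)) \<le> length (snd (snd st))"
        using I by (elim disjE) (simp, blast)
      then show ?thesis using V E n by (intro disjI2) (simp, blast)
    qed (use I in simp)
    show "esize s \<le> esize st + (2 + esize st * (esize st + 1) + esize st * (2 * esize st + 2) + esize st)"
      if I: "?I st i s" for st i s
    proof (cases "s = st")
      case False
      then have I: "set (fst s) \<subseteq> set (fst st)" "set (fst (snd s)) \<subseteq> set (fst st) \<times> set (fst st)"
        "rsize s \<le> rsize st" "length (snd (snd s)) \<le> length (snd (snd st))"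
        using I by blast+
      have st: "esize st = 2 + esize (fst st) + esize (fst (snd st)) + length (snd (snd st))" by (simp add: encode_pair)
      have n: "rsize s \<le> esize st"
        using I(3) length_le_esize[of "fst st"] length_le_esize[of "fst (snd st)"] st by (simp add: rsize_def)
      have "esize (fst s) \<le> length (fst s) * (esize (fst st) + 1)" by (rule esize_subset[OF I(1)])
      also have "\<dots> \<le> esize st * (esize st + 1)" using n st by (intro mult_le_mono) (simp_all add: rsize_def)
      finally have 1: "esize (fst s) \<le> esize st * (esize st + 1)" .
      have "esize (fst (snd s)) \<le> length (fst (snd s)) * ((2 * esize st + 1) + 1)"
      proof (rule esize_list_le)
        fix p assume "p \<in> set (fst (snd s))"
        then have "fst p \<in> set (fst st)" "snd p \<in> set (fst st)" using I(2) by (auto simp: mem_Times_iff)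
        then show "esize p \<le> 2 * esize st + 1"
          using esize_mem[of "fst p" "fst st"] esize_mem[of "snd p" "fst st"] st by (simp add: encode_pair)
      qed
      also have "\<dots> \<le> esize st * (2 * esize st + 2)" using n by (intro mult_le_mono) (simp_all add: rsize_def)
      finally have 2: "esize (fst (snd s)) \<le> esize st * (2 * esize st + 2)" .
      have "esize s = 2 + esize (fst s) + esize (fst (snd s)) + length (snd (snd s))" by (simp add: encode_pair)
      then show ?thesis using 1 2 I(4) st by linarith
    qed simp
    show "pt (\<lambda>st :: rstate. replicate (rsize st) ())" unfolding rsize_def by (intro pt_replicate pt_intros)
  qed (auto intro!: pt_intros)
  then show ?thesis unfolding reduce_def .
qed

section \<open>Brute force for small budgets\<close>

definition sparse :: "nat \<Rightarrow> rstate \<Rightarrow> bool" where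
  "sparse r st \<longleftrightarrow> (\<forall>x \<in> set (fst st). cnt (set (compl (fst st) (fst (snd st)) x)) (fst (snd st)) + 1
     \<le> length (compl (fst st) (fst (snd st)) x) + r)"

text \<open>Monotonicity of the excess again: the components suffice, which makes the condition
  decidable in polynomial time.\<close>

lemma sparse_iff_sol:
  assumes "valid (V, es, ks)"
  shows "sparse r (V, es, ks) \<longleftrightarrow> sol r (set V) es"
proof -
  have V: "distinct V" "set es \<subseteq> set V \<times> set V" using assms by (simp_all add: valid_def)
  have len: "length (compl V es x) = card (set (compl V es x))" for x
    using V(1) unfolding compl_def by (intro distinct_card[symmetric] distinct_filter)
  have reach: "reach (set es) {x} \<subseteq> set V" if "x \<in> set V" for x
    by (rule reach_least) (use V(2) that in auto)
  have "sparse r (V, es, ks) \<longleftrightarrow> (\<forall>x\<in>set V. cnt (reach (set es) {x}) es + 1 \<le> card (reach (set es) {x}) + r)"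
    unfolding sparse_def fst_conv snd_conv len by (rule ball_cong[OF refl]) (simp only: set_compl[OF V(2)])
  also have "\<dots> \<longleftrightarrow> sol r (set V) es"
  proof
    assume R: "\<forall>x\<in>set V. cnt (reach (set es) {x}) es + 1 \<le> card (reach (set es) {x}) + r"
    show "sol r (set V) es"
    proof (rule solI)
      fix S assume S: "S \<noteq> {}" "S \<subseteq> set V" "conn (set es) S"
      obtain x where x: "x \<in> S" using S(1) by blast
      then have xV: "x \<in> set V" using S(2) by blast
      show "cnt S es + 1 \<le> card S + r"
        by (rule conn_sol_subset[OF conn_reach[of _ x] _ _ conn_subset_reach[OF S(3) x] S(1)])
          (use R xV finite_subset[OF reach[OF xV]] in blast)+
    qed
  next
    assume "sol r (set V) es"
    then show "\<forall>x\<in>set V. cnt (reach (set es) {x}) es + 1 \<le> card (reach (set es) {x}) + r"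
      using solD[OF _ _ reach conn_reach] reach_start by blast
  qed
  finally show ?thesis .
qed

fun solve :: "nat \<Rightarrow> nat \<Rightarrow> rstate \<Rightarrow> bool" where
  "solve r 0 st = sparse r st"
| "solve r (Suc j) st = (sparse r st \<or> (snd (snd st) \<noteq> [] \<and>
     (\<exists>v \<in> set (fst st). solve r j (filter (\<lambda>y. y \<noteq> v) (fst st), avoid {v} (fst (snd st)), tl (snd (snd st))))))"

lemma ok_0: "finite V \<Longrightarrow> ok r V es 0 \<longleftrightarrow> sol r V es"
  unfolding ok_def using finite_subset by fastforce

lemma ok_branch:
  assumes "finite V"
  shows "ok r V es (Suc k) \<longleftrightarrow> sol r V es \<or> (\<exists>v\<in>V. ok r (V - {v}) (avoid {v} es) k)"
proof
  assume "ok r V es (Suc k)"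
  then obtain X where X: "X \<subseteq> V" "card X \<le> Suc k" "sol r (V - X) es" by (rule okE)
  show "sol r V es \<or> (\<exists>v\<in>V. ok r (V - {v}) (avoid {v} es) k)"
  proof (cases "X = {}")
    case False
    then obtain v where v: "v \<in> X" by blast
    have "finite X" by (rule finite_subset[OF X(1) assms])
    then have "card (X - {v}) \<le> k" using X(2) v by simp
    moreover have "V - {v} - (X - {v}) = V - X" using v by blast
    then have "sol r (V - {v} - (X - {v})) (avoid {v} es)" using X(3) v by (subst sol_avoid) auto
    ultimately have "ok r (V - {v}) (avoid {v} es) k" using X(1) by (intro okI[of "X - {v}"]) auto
    then show ?thesis using v X(1) by blast
  qed (use X in simp)
next
  assume "sol r V es \<or> (\<exists>v\<in>V. ok r (V - {v}) (avoid {v} es) k)"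
  then show "ok r V es (Suc k)"
  proof
    assume "sol r V es"
    then show ?thesis by (intro okI[of "{}"]) simp_all
  next
    assume "\<exists>v\<in>V. ok r (V - {v}) (avoid {v} es) k"
    then obtain v where v: "v \<in> V" "ok r (V - {v}) (avoid {v} es) k" by blast
    obtain X where X: "X \<subseteq> V - {v}" "card X \<le> k" "sol r (V - {v} - X) (avoid {v} es)" using v(2) by (rule okE)
    have "sol r (V - {v} - X) es" using X(3) by (subst (asm) sol_avoid) auto
    moreover have "V - {v} - X = V - insert v X" by blast
    moreover have "card (insert v X) \<le> Suc k" using card_insert_le_m1[of "Suc k" X v] X(2) by simp
    ultimately show ?thesis using X(1) v(1) by (intro okI[of "insert v X"]) auto
  qed
qed

lemma solve_correct: "valid st \<Longrightarrow> length (snd (snd st)) \<le> j \<Longrightarrow> solve r j st \<longleftrightarrow> okst r st"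
proof (induction j arbitrary: st)
  case 0
  obtain V es ks where st: "st = (V, es, ks)" by (metis prod_cases3)
  then show ?case using 0 sparse_iff_sol[of V es ks r] by (simp add: okst_def ok_0)
next
  case (Suc j)
  obtain V es ks where st: "st = (V, es, ks)" by (metis prod_cases3)
  have s: "sparse r (V, es, ks) \<longleftrightarrow> sol r (set V) es" using sparse_iff_sol Suc.prems(1) unfolding st .
  show ?case
  proof (cases ks)
    case Nil
    then show ?thesis using s unfolding st by (simp add: okst_def ok_0)
  next
    case (Cons u us)
    have "solve r j (filter (\<lambda>y. y \<noteq> v) V, avoid {v} es, us) \<longleftrightarrow> ok r (set V - {v}) (avoid {v} es) (length us)" for v
    proof -
      have "valid (filter (\<lambda>y. y \<noteq> v) V, avoid {v} es, us)"
        using Suc.prems(1) unfolding st valid_def avoid_def touch_def by auto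
      moreover have "length us \<le> j" using Suc.prems(2) Cons by (simp add: st)
      ultimately show ?thesis
        using Suc.IH[of "(filter (\<lambda>y. y \<noteq> v) V, avoid {v} es, us)"]
        unfolding okst_def fst_conv snd_conv set_filter_neq by blast
    qed
    then show ?thesis using s ok_branch[of "set V" r es "length us"] unfolding st Cons by (simp add: okst_def)
  qed
qed

lemma pt_sparse [pt_intros]: "pt st \<Longrightarrow> pt (\<lambda>x. sparse r (st x))"
  by (rule pt_comp[of "sparse r"]) (unfold sparse_def, intro pt_intros)

text \<open>The depth \<open>j\<close> is a parameter of the program and not part of the input. Each
  level adds one loop over the vertices, so the polynomial depends on \<open>j\<close>, which is
  \<open>r\<close> in the kernel.\<close>

lemma pt_solve: "pt (solve r j)"
proof (induction j)
  case 0
  show ?case unfolding solve.simps by (intro pt_intros)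
next
  case (Suc j)
  have "pt (\<lambda>z :: rstate \<times> nat. solve r j (filter (\<lambda>y. y \<noteq> snd z) (fst (fst z)), avoid {snd z} (fst (snd (fst z))), tl (snd (snd (fst z)))))"
    by (rule pt_comp[OF Suc]) (intro pt_intros)
  then show ?case unfolding solve.simps by (intro pt_intros)
qed

definition finish :: "nat \<Rightarrow> rstate \<Rightarrow> pd_instance" where
  "finish r st = (if length (snd (snd st)) \<le> r then (if solve r r st then ([], [], 0) else ([], [], - 1))
     else if length (fst st) \<le> 230 * (length (snd (snd st)))\<^sup>2 * (max 1 r)\<^sup>2 \<and>
       length (fst (snd st)) \<le> 230 * (length (snd (snd st)))\<^sup>2 * (max 1 r)\<^sup>2
     then (fst st, fst (snd st), int (length (snd (snd st)))) else ([], [], - 1))"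

text \<open>A budget of at least the number of vertices is handled at once, so the unary representation
  of the budget is short in the remaining case.\<close>

definition kernel :: "nat \<Rightarrow> pd_instance \<Rightarrow> pd_instance" where
  "kernel r I = (case I of (V, es, k) \<Rightarrow> if k < 0 then ([], [], k)
     else let ks = replicate (min (length V) (nat \<bar>k\<bar>)) () in
       if length V \<le> length ks then ([], [], 0) else finish r (reduce r (V, es, ks)))"

lemma pt_finish: "pt (finish r)"
proof -
  have i: "pt xs \<Longrightarrow> pt (\<lambda>x. int (length (xs x)))" for xs :: "rstate \<Rightarrow> unit list"
    by (intro pt_int_of_nat pt_of_unary upt_length)
  show ?thesis unfolding finish_def power2_eq_square by (intro pt_intros pt_solve i)
qed

lemma pt_kernel: "pt (kernel r)"
proof -
  have "pt (\<lambda>I :: pd_instance. if snd (snd I) < 0 then ([], [], snd (snd I))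
    else let ks = replicate (min (length (fst I)) (nat \<bar>snd (snd I)\<bar>)) () in
       if length (fst I) \<le> length ks then ([], [], 0) else finish r (reduce r (fst I, fst (snd I), ks)))"
    by (intro pt_intros pt_int_parts(1) pt_replicate upt_min_binary pt_int_parts(2) pt_comp[OF pt_finish] pt_comp[OF pt_reduce])
  then show ?thesis unfolding kernel_def case_prod_unfold .
qed

section \<open>The kernel on encoded instances, and its correctness\<close>

lemma encode_pd_instance: "encode = enc_instance"
  by (intro ext) (simp add: enc_instance_def encode_prod_def encode_list_def[abs_def] encode_nat_def[abs_def] encode_int_def[abs_def] enc_pair_def)

lemma poly_time_kernel: "poly_time enc_instance enc_instance pd_instances (kernel r)"
proof -
  obtain p :: "nat poly" and c where c: "\<And>x s. s 0 = encode x \<Longrightarrow>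
      \<exists>t s'. exec c s t s' \<and> t \<le> poly p (esize x) \<and> s' 0 = encode (kernel r x)"
    using pt_kernel[of r] unfolding pt_def by metis
  show ?thesis
    unfolding poly_time_def encode_pd_instance[symmetric]
  proof (rule exI[of _ c], rule exI[of _ p], rule ballI)
    fix x :: pd_instance
    obtain t s' where "exec c ((\<lambda>_. Leaf)(0 := encode x)) t s'" "t \<le> poly p (esize x)" "s' 0 = encode (kernel r x)"
      using c[of "(\<lambda>_. Leaf)(0 := encode x)" x] by auto
    then show "\<exists>t\<le>poly p (esize x). computes_in c (encode x) t (encode (kernel r x))"
      unfolding computes_in_def by blast
  qed
qed

lemma trivial_instances:
  "pseudoforest_deletion r (graph_of ([], [], k)) 0" "k < 0 \<Longrightarrow> \<not> pseudoforest_deletion r G k"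
  unfolding pseudoforest_deletion_iff_ok by (simp add: ok_0 sol_def) (simp add: pseudoforest_deletion_def)

lemma finish_correct:
  assumes "valid st" "rstep r st = st"
  shows "finish r st \<in> pd_instances" "pseudoforest_deletion r (graph_of (finish r st)) (budget (finish r st)) \<longleftrightarrow> okst r st"
    "budget (finish r st) \<le> int (length (snd (snd st)))"
    "int (card (verts (graph_of (finish r st)))) \<le> int 230 * (budget (finish r st))\<^sup>2 * (int (max 1 r))\<^sup>2"
    "int (card (edges (graph_of (finish r st)))) \<le> int 230 * (budget (finish r st))\<^sup>2 * (int (max 1 r))\<^sup>2"
proof -
  obtain V es ks where st: "st = (V, es, ks)" by (metis prod_cases3)
  have V: "distinct V" "set es \<subseteq> set V \<times> set V" using assms(1) by (simp_all add: valid_def st)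
  let ?b = "230 * (length ks)\<^sup>2 * (max 1 r)\<^sup>2"
  consider (brute) "length ks \<le> r" | (fit) "r < length ks" "length V \<le> ?b" "length es \<le> ?b" | (big) "r < length ks" "\<not> (length V \<le> ?b \<and> length es \<le> ?b)"
    by linarith
  then have "finish r st \<in> pd_instances \<and>
    (pseudoforest_deletion r (graph_of (finish r st)) (budget (finish r st)) \<longleftrightarrow> okst r st) \<and>
    budget (finish r st) \<le> int (length (snd (snd st))) \<and>
    int (card (verts (graph_of (finish r st)))) \<le> int 230 * (budget (finish r st))\<^sup>2 * (int (max 1 r))\<^sup>2 \<and>
    int (card (edges (graph_of (finish r st)))) \<le> int 230 * (budget (finish r st))\<^sup>2 * (int (max 1 r))\<^sup>2"
  proof cases
    case brute
    have s: "solve r r st \<longleftrightarrow> okst r st" by (rule solve_correct[OF assms(1)]) (use brute st in simp)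
    show ?thesis
    proof (cases "okst r st")
      case True
      then have "finish r st = ([], [], 0)" using brute s unfolding finish_def st by simp
      then show ?thesis using True trivial_instances(1) by (simp add: pd_instances_def)
    next
      case False
      then have "finish r st = ([], [], - 1)" using brute s unfolding finish_def st by simp
      then show ?thesis using False trivial_instances(2)[of "- 1" r] by (simp add: pd_instances_def)
    qed
  next
    case fit
    have f: "finish r st = (V, es, int (length ks))" using fit unfolding finish_def st by simp
    have le: "int n \<le> int 230 * (int (length ks))\<^sup>2 * (int (max 1 r))\<^sup>2" if "n \<le> ?b" for n
    proof -
      have "int n \<le> int ?b" using that by (rule zle_int[THEN iffD2])
      also have "int ?b = int 230 * (int (length ks))\<^sup>2 * (int (max 1 r))\<^sup>2" by (simp only: of_nat_mult of_nat_power)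
      finally show ?thesis .
    qed
    have "card (set V) = length V" by (rule distinct_card[OF V(1)])
    then show ?thesis
      using V le[OF fit(2)] le[OF fit(3)] unfolding f budget.simps pseudoforest_deletion_iff_ok
      by (simp add: pd_instances_def okst_def st)
  next
    case big
    have f: "finish r st = ([], [], - 1)" using big unfolding finish_def st by auto
    interpret irreducible r V es ks by standard (use assms st big(1) in simp_all)
    have "\<not> okst r st"
    proof
      assume "okst r st"
      then obtain X where X: "X \<subseteq> set V" "card X \<le> length ks" "sol r (set V - X) es"
        unfolding okst_def st fst_conv snd_conv by (rule okE)
      show False using size_bounds[OF X] big(2) by blast
    qed
    then show ?thesis unfolding f using trivial_instances(2)[of "- 1" r] by (simp add: pd_instances_def)
  qed
  then show "finish r st \<in> pd_instances" "pseudoforest_deletion r (graph_of (finish r st)) (budget (finish r st)) \<longleftrightarrow> okst r st"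
    "budget (finish r st) \<le> int (length (snd (snd st)))"
    "int (card (verts (graph_of (finish r st)))) \<le> int 230 * (budget (finish r st))\<^sup>2 * (int (max 1 r))\<^sup>2"
    "int (card (edges (graph_of (finish r st)))) \<le> int 230 * (budget (finish r st))\<^sup>2 * (int (max 1 r))\<^sup>2"
    by blast+
qed

theorem theorem2:
  "\<exists>C :: nat. \<forall>r :: nat. \<exists>kernel :: pd_instance \<Rightarrow> pd_instance.
     poly_time enc_instance enc_instance pd_instances kernel \<and>
     (\<forall>I \<in> pd_instances.
        kernel I \<in> pd_instances \<and>
        (pseudoforest_deletion r (graph_of (kernel I)) (budget (kernel I)) \<longleftrightarrow>
         pseudoforest_deletion r (graph_of I) (budget I)) \<and>
        budget (kernel I) \<le> budget I \<and>
        int (card (verts (graph_of (kernel I)))) \<le> int C * (budget I)\<^sup>2 * (int (max 1 r))\<^sup>2 \<and>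
        int (card (edges (graph_of (kernel I)))) \<le> int C * (budget I)\<^sup>2 * (int (max 1 r))\<^sup>2)"
proof (rule exI[of _ 230], rule allI)
  fix r :: nat
  show "\<exists>kernel :: pd_instance \<Rightarrow> pd_instance.
     poly_time enc_instance enc_instance pd_instances kernel \<and>
     (\<forall>I \<in> pd_instances.
        kernel I \<in> pd_instances \<and>
        (pseudoforest_deletion r (graph_of (kernel I)) (budget (kernel I)) \<longleftrightarrow>
         pseudoforest_deletion r (graph_of I) (budget I)) \<and>
        budget (kernel I) \<le> budget I \<and>
        int (card (verts (graph_of (kernel I)))) \<le> int 230 * (budget I)\<^sup>2 * (int (max 1 r))\<^sup>2 \<and>
        int (card (edges (graph_of (kernel I)))) \<le> int 230 * (budget I)\<^sup>2 * (int (max 1 r))\<^sup>2)"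
  proof (rule exI[of _ "kernel r"], rule conjI[OF poly_time_kernel], rule ballI)
    fix I assume I: "I \<in> pd_instances"
    obtain V es k where Idef: "I = (V, es, k)" by (metis prod_cases3)
    have V: "distinct V" "set es \<subseteq> set V \<times> set V" using I by (simp_all add: Idef pd_instances_def)
    let ?K = "kernel r I"
    consider (neg) "k < 0" | (all) "0 \<le> k" "length V \<le> nat k" | (red) "0 \<le> k" "nat k < length V" by linarith
    then show "?K \<in> pd_instances \<and>
        (pseudoforest_deletion r (graph_of ?K) (budget ?K) \<longleftrightarrow> pseudoforest_deletion r (graph_of I) (budget I)) \<and>
        budget ?K \<le> budget I \<and>
        int (card (verts (graph_of ?K))) \<le> int 230 * (budget I)\<^sup>2 * (int (max 1 r))\<^sup>2 \<and>
        int (card (edges (graph_of ?K))) \<le> int 230 * (budget I)\<^sup>2 * (int (max 1 r))\<^sup>2"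
    proof cases
      \<comment> \<open>The negative budget is returned as it is: replacing it by \<open>-1\<close>
        could raise it.\<close>
      case neg
      then have "?K = ([], [], k)" by (simp add: kernel_def Idef)
      then show ?thesis by (simp add: trivial_instances(2)[OF neg] Idef pd_instances_def)
    next
      case all
      then have K: "?K = ([], [], 0)" by (simp add: kernel_def Idef)
      have "ok r (set V) es (nat k)"
        by (rule okI[of "set V"]) (use all distinct_card[OF V(1)] in \<open>simp_all add: sol_def\<close>)
      then have "pseudoforest_deletion r (graph_of I) (budget I)"
        unfolding Idef budget.simps pseudoforest_deletion_iff_ok using all(1) by blast
      then show ?thesis using trivial_instances(1) all(1) K by (simp add: Idef pd_instances_def)
    next
      case red
      let ?st = "(V, es, replicate (nat k) ())"
      let ?S = "reduce r ?st"
      have K: "?K = finish r ?S" using red by (simp add: kernel_def Idef Let_def min_def)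
      have val: "valid ?st" using V by (simp add: valid_def)
      note R = reduce_correct[OF val, of r]
      note F = finish_correct[OF R(1,4)]
      have ok: "pseudoforest_deletion r (graph_of ?K) (budget ?K) \<longleftrightarrow> pseudoforest_deletion r (graph_of I) (budget I)"
        unfolding K F(2) R(2) unfolding Idef budget.simps pseudoforest_deletion_iff_ok
        using red(1) by (simp add: okst_def)
      have bud: "budget ?K \<le> budget I" using F(3) R(3) red(1) unfolding K by (simp add: Idef)
      show ?thesis
      \<comment> \<open>Squaring is monotone only for nonnegative budgets. A negative budget is
        produced only together with the empty graph, whose size needs no bound.\<close>
      proof (cases "0 \<le> budget ?K")
        case True
        have "int 230 * (budget ?K)\<^sup>2 * (int (max 1 r))\<^sup>2 \<le> int 230 * (budget I)\<^sup>2 * (int (max 1 r))\<^sup>2"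
          using power_mono[OF bud True, of 2] by (intro mult_right_mono mult_left_mono) simp_all
        then show ?thesis using F(1,4,5) ok bud unfolding K[symmetric] by (meson order_trans)
      next
        case False
        then have "?K = ([], [], - 1)" unfolding K finish_def by (auto split: if_splits)
        then show ?thesis using ok bud by (simp add: pd_instances_def)
      qed
    qed
  qed
qed

end
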